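(* Let $n\ge 3$, let $\Omega\subset\mathbb{R}^n$ be a bounded domain with smooth boundary containing the origin, and let $d>0$, $c\in\mathbb{R}$. Let $u$ be a solution to $$-\Delta u=d\,|\partial\Omega|\,\delta_0\ \text{ in }\Omega,\qquad u=c\ \text{ on }\partial\Omega,$$ satisfying $$\frac{H}{n-1}\ \ge\ \left(\frac{|\mathbb{S}^{n-1}|}{|\partial\Omega|}\right)^{\frac1{n-1}}\left[\frac{\left(\frac{1}{|\partial\Omega|}\int_{\partial\Omega}|Du|\,d\sigma\right)^2}{\frac{1}{|\partial\Omega|}\int_{\partial\Omega}|Du|^2\,d\sigma}\right]\left[\frac{\frac{1}{|\partial\Omega|}\int_{\partial\Omega}|Du|^3\,d\sigma}{\left(\frac{1}{|\partial\Omega|}\int_{\partial\Omega}|Du|\,d\sigma\right)^3}\right]^{\frac{n}{2(n-1)}}\qquad\text{on }\{u=c\}.$$ Then $\Omega$ is a ball and $u$ is rotationally symmetric.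
   Context: $D$ and $\Delta$ are the Euclidean gradient and Laplacian; $d\sigma$ is the $(n-1)$-dimensional Euclidean surface measure, $|\partial\Omega|$ the corresponding area of $\partial\Omega$, and $|\mathbb{S}^{n-1}|$ the area of the unit sphere in $\mathbb{R}^n$. $\delta_0$ is the Dirac distribution at the origin and the equation is understood in the sense of distributions; $u$ is smooth in $\overline\Omega\setminus\{0\}$. The set $\{u=c\}$ is $\partial\Omega$. $H$ is the mean curvature of $\partial\Omega$ with respect to the normal pointing towards the exterior of $\Omega$: the sum of the $n-1$ principal curvatures (not their average), with the sign convention that a round sphere with its outward normal has positive mean curvature. Rotationally symmetric means depending only on the distance to the center of the ball $\Omega$. *)

theory Defs
  imports "HOL-Analysis.Analysis"
begin

section \<open>Smooth functions and differential operators\<close>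

definition gradient :: "('a::euclidean_space \<Rightarrow> real) \<Rightarrow> 'a filter \<Rightarrow> 'a" where
  "gradient f F = (\<Sum>b\<in>Basis. frechet_derivative f F b *\<^sub>R b)"

definition laplacian :: "('a::euclidean_space \<Rightarrow> real) \<Rightarrow> 'a \<Rightarrow> real" where
  "laplacian f x =
    (\<Sum>b\<in>Basis. frechet_derivative (\<lambda>y. frechet_derivative f (at y) b) (at x) b)"

text \<open>Only meaningful for open sets, since the derivatives are unrestricted.\<close>
primrec Ck_on_open :: "nat \<Rightarrow> 'a::euclidean_space set \<Rightarrow> ('a \<Rightarrow> real) \<Rightarrow> bool" where
  "Ck_on_open 0 U f \<longleftrightarrow> continuous_on U f"
| "Ck_on_open (Suc k) U f \<longleftrightarrow>
    (\<forall>x\<in>U. f differentiable at x) \<and>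
    (\<forall>v. Ck_on_open k U (\<lambda>x. frechet_derivative f (at x) v))"

text \<open>Smoothness on an arbitrary set means having a smooth extension to an open
  neighbourhood. For an open set this is ordinary smoothness, and values of the function
  off the set play no role.\<close>
definition smooth_on :: "'a::euclidean_space set \<Rightarrow> ('a \<Rightarrow> real) \<Rightarrow> bool" where
  "smooth_on S f \<longleftrightarrow>
    (\<exists>V g. open V \<and> S \<subseteq> V \<and> (\<forall>k. Ck_on_open k V g) \<and> (\<forall>x\<in>S. g x = f x))"

section \<open>Surface measure\<close>

text \<open>The \<open>k\<close>-dimensional Hausdorff outer measure, normalised to agree with
  \<open>k\<close>-dimensional Lebesgue measure. The case distinction only matters for \<open>k = 0\<close>,
  where \<open>0 ^ 0 = 1\<close>; boundedness is required because \<open>diameter\<close> is unspecified on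
  unbounded sets.\<close>
definition hausdorff_outer :: "nat \<Rightarrow> 'a::euclidean_space set \<Rightarrow> ennreal" where
  "hausdorff_outer k A =
    (SUP \<delta>\<in>{0::real<..}.
      INF C\<in>{C :: nat \<Rightarrow> 'a set. A \<subseteq> (\<Union>i. C i) \<and> (\<forall>i. bounded (C i) \<and> diameter (C i) \<le> \<delta>)}.
        \<Sum>i. if C i = {} then 0
             else ennreal (unit_ball_vol (real k) * (diameter (C i) / 2) ^ k))"

definition hausdorff_measure :: "nat \<Rightarrow> 'a::euclidean_space measure" where
  "hausdorff_measure k = measure_of UNIV (sets borel) (hausdorff_outer k)"

definition surface_measure :: "'a::euclidean_space measure" where
  "surface_measure = hausdorff_measure (DIM('a) - 1)"

definition area :: "'a::euclidean_space set \<Rightarrow> real" where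
  "area S = measure surface_measure S"

definition surface_mean :: "'a::euclidean_space set \<Rightarrow> ('a \<Rightarrow> real) \<Rightarrow> real" where
  "surface_mean S f = 1 / area S * (LINT x:S|surface_measure. f x)"

section \<open>Smooth boundaries and mean curvature\<close>

definition local_defining_function ::
    "'a::euclidean_space set \<Rightarrow> 'a set \<Rightarrow> ('a \<Rightarrow> real) \<Rightarrow> bool" where
  "local_defining_function \<Omega> U \<phi> \<longleftrightarrow>
    open U \<and> smooth_on U \<phi> \<and> (\<forall>x\<in>U. gradient \<phi> (at x) \<noteq> 0) \<and>
    \<Omega> \<inter> U = {x\<in>U. \<phi> x < 0} \<and> frontier \<Omega> \<inter> U = {x\<in>U. \<phi> x = 0}"

definition smooth_boundary :: "'a::euclidean_space set \<Rightarrow> bool" where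
  "smooth_boundary \<Omega> \<longleftrightarrow>
    (\<forall>p\<in>frontier \<Omega>. \<exists>U \<phi>. p \<in> U \<and> local_defining_function \<Omega> U \<phi>)"

definition outer_unit_normal :: "'a::euclidean_space set \<Rightarrow> 'a \<Rightarrow> 'a" where
  "outer_unit_normal \<Omega> p =
    (THE \<nu>. \<exists>U \<phi>. p \<in> U \<and> local_defining_function \<Omega> U \<phi> \<and>
      \<nu> = gradient \<phi> (at p) /\<^sub>R norm (gradient \<phi> (at p)))"

text \<open>\<open>B\<close> is an orthonormal basis of the tangent space at \<open>p\<close> consisting of eigenvectors of
  the shape operator \<open>v \<mapsto> D\<^sub>v \<nu>\<close>, with the principal curvatures \<open>\<kappa>\<close> as eigenvalues.
  The normal is only defined on the boundary, so it is differentiated within the boundary; this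
  determines \<open>S\<close> on tangent vectors, which is all that is used. With this sign the sphere
  of radius \<open>r\<close> has principal curvatures \<open>1 / r\<close>.\<close>
definition principal_frame ::
    "'a::euclidean_space set \<Rightarrow> 'a \<Rightarrow> 'a set \<Rightarrow> ('a \<Rightarrow> real) \<Rightarrow> bool" where
  "principal_frame \<Omega> p B \<kappa> \<longleftrightarrow>
    pairwise orthogonal B \<and> (\<forall>e\<in>B. norm e = 1) \<and>
    span B = {v. v \<bullet> outer_unit_normal \<Omega> p = 0} \<and>
    (\<exists>S. (outer_unit_normal \<Omega> has_derivative S) (at p within frontier \<Omega>) \<and>
         (\<forall>e\<in>B. S e = \<kappa> e *\<^sub>R e))"

definition mean_curvature :: "'a::euclidean_space set \<Rightarrow> 'a \<Rightarrow> real" where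
  "mean_curvature \<Omega> p = (THE h. \<exists>B \<kappa>. principal_frame \<Omega> p B \<kappa> \<and> h = (\<Sum>e\<in>B. \<kappa> e))"

section \<open>The equation\<close>

definition test_function :: "'a::euclidean_space set \<Rightarrow> ('a \<Rightarrow> real) \<Rightarrow> bool" where
  "test_function \<Omega> \<phi> \<longleftrightarrow>
    smooth_on UNIV \<phi> \<and> (\<exists>K. compact K \<and> K \<subseteq> \<Omega> \<and> (\<forall>x. x \<notin> K \<longrightarrow> \<phi> x = 0))"

text \<open>\<open>-\<Delta>u = m \<delta>\<^sub>0\<close> in \<open>\<Omega>\<close> in the sense of distributions; local integrability is
  what makes \<open>u\<close> a distribution.\<close>
definition neg_laplacian_eq_dirac ::
    "'a::euclidean_space set \<Rightarrow> ('a \<Rightarrow> real) \<Rightarrow> real \<Rightarrow> bool" where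
  "neg_laplacian_eq_dirac \<Omega> u m \<longleftrightarrow>
    (\<forall>K. compact K \<and> K \<subseteq> \<Omega> \<longrightarrow> set_integrable lborel K u) \<and>
    (\<forall>\<phi>. test_function \<Omega> \<phi> \<longrightarrow>
      - (LINT x:\<Omega>|lborel. u x * laplacian \<phi> x) = m * \<phi> 0)"

end

theory Submission
  imports Defs
begin

text \<open>Write \<open>f = |Du|\<close> on the boundary and \<open>\<alpha> = n / (n - 2)\<close>. For every \<open>s\<close> for which
  \<open>w = u + s\<close> is positive, \<open>w\<close> is harmonic and \<open>\<Delta>(w\<^sup>-\<^sup>\<alpha> |Dw|\<^sup>2) = 2 w\<^sup>-\<^sup>\<alpha> |T|\<^sup>2 \<ge> 0\<close>, where \<open>T\<close> is
  a multiple of the trace-free Hessian of \<open>w\<^sup>-\<^sup>2\<^sup>/\<^sup>(\<^sup>n\<^sup>-\<^sup>2\<^sup>)\<close>. Near the pole \<open>u = A |x|\<^sup>2\<^sup>-\<^sup>n + O(1)\<close>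
  together with the first derivatives, so that for a suitable constant \<open>P\<close> the subharmonic function
  \<open>W = w\<^sup>-\<^sup>\<alpha> |Dw|\<^sup>2 - P w\<close> is \<open>o(|x|\<^sup>2\<^sup>-\<^sup>n)\<close> and has no flux into the pole. Where \<open>f > 0\<close>, the level
  set \<open>{u = c}\<close> satisfies \<open>H f = D\<^sup>2u(\<nu>, \<nu>)\<close>, which expresses the normal derivative of \<open>W\<close> through
  \<open>f\<close> and \<open>H\<close>. For one particular \<open>s\<close> the hypothesis on \<open>H\<close> implies that the flux of \<open>W\<close>
  through the boundary is at most \<open>0\<close>. Hence \<open>\<Delta>W = 0\<close> and \<open>T = 0\<close>, so \<open>w\<^sup>-\<^sup>2\<^sup>/\<^sup>(\<^sup>n\<^sup>-\<^sup>2\<^sup>)\<close> is a quadratic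
  polynomial which vanishes at the pole: a multiple of \<open>|x|\<^sup>2\<close>.

  The surface measure enters only through the divergence theorem. Its value on hyperplanes is a
  constant multiple of Lebesgue measure; the constant \<open>surface_const\<close> need not be known, because it
  cancels in the comparison of the flux of \<open>u\<close> with the area of the unit sphere.\<close>

section \<open>Smooth functions\<close>

text \<open>The shift \<open>s\<close> is free because it changes neither the equation nor
  \<open>Du\<close>. The factor \<open>P\<close> does not depend on it, being fixed by the leading
  coefficient \<open>A\<close> of \<open>u\<close> at the pole: as
  \<open>\<alpha> (n - 2) = n\<close>, both \<open>w^(-\<alpha>) |Dw|^2\<close> and \<open>w\<close>
  grow like \<open>|x|^(2 - n)\<close>, and \<open>P = (n - 2)^2 A^(1 - \<alpha>)\<close> cancels
  the leading terms. With \<open>M_k\<close> the integral of \<open>f^k\<close> and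
  \<open>c_0 = c + s\<close>, a lower bound \<open>H \<ge> (n - 1) K\<close> bounds the flux of
  \<open>W\<close> by \<open>\<alpha> c_0^(-\<alpha> - 1) M_3 - 2 (n - 1) K c_0^(-\<alpha>) M_2 + P
  M_1\<close>. This is smallest where \<open>(n - 2) K M_2 c_0 = M_3\<close>, and the right-hand
  side of the hypothesis is the value of \<open>K\<close> for which the minimum is zero. So its
  exponents come from optimising the shift. Two obstacles shape the rest. Nothing excludes in
  advance that \<open>f\<close> vanishes somewhere on the boundary, so the curvature enters the flux
  only through \<open>H f^2\<close>. And the surface measure is a Hausdorff measure, so the
  divergence theorem is obtained from Fubini along lines transversal to the boundary, over which the
  boundary is a graph.\<close>

abbreviation pd :: "'a::euclidean_space \<Rightarrow> ('a \<Rightarrow> real) \<Rightarrow> 'a \<Rightarrow> real" where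
  "pd v f x \<equiv> frechet_derivative f (at x) v"

definition Cinf :: "'a::euclidean_space set \<Rightarrow> ('a \<Rightarrow> real) \<Rightarrow> bool" where
  "Cinf U f \<longleftrightarrow> (\<forall>k. Ck_on_open k U f)"

lemma pd_has: "f differentiable at x \<Longrightarrow> (f has_derivative (\<lambda>v. pd v f x)) (at x)"
  by (simp add: frechet_derivative_works)

lemma pd_eqI: "(f has_derivative f') (at x) \<Longrightarrow> pd v f x = f' v"
  by (metis frechet_derivative_at)

lemma pd_cong:
  assumes "open U" "x \<in> U" "\<And>y. y \<in> U \<Longrightarrow> f y = g y"
  shows "pd v f x = pd v g x"
proof -
  have "(f has_derivative D) (at x) \<longleftrightarrow> (g has_derivative D) (at x)" for D
    using has_derivative_transform_within_open[of f D x UNIV U g]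
      has_derivative_transform_within_open[of g D x UNIV U f] assms by auto
  thus ?thesis unfolding frechet_derivative_def by presburger
qed

lemma differentiable_cong:
  assumes "open U" "x \<in> U" "\<And>y. y \<in> U \<Longrightarrow> f y = g y" "f differentiable at x"
  shows "g differentiable at x"
  using assms has_derivative_transform_within_open unfolding differentiable_def by blast

section \<open>Closure properties of the classes of k times and infinitely often differentiable
  functions\<close>

declare Ck_on_open.simps [simp del]

lemma Ck_0: "Ck_on_open 0 U f \<longleftrightarrow> continuous_on U f"
  by (simp add: Ck_on_open.simps)

lemma Ck_SucI:
  assumes "\<And>x. x \<in> U \<Longrightarrow> f differentiable at x" "\<And>v. Ck_on_open k U (\<lambda>x. pd v f x)"
  shows "Ck_on_open (Suc k) U f"
  using assms unfolding Ck_on_open.simps by blast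

lemma Ck_SucD:
  assumes "Ck_on_open (Suc k) U f"
  shows "x \<in> U \<Longrightarrow> f differentiable at x" "Ck_on_open k U (\<lambda>x. pd v f x)"
  using assms unfolding Ck_on_open.simps by blast+

lemma Ck_cong:
  assumes "open U" "\<And>y. y \<in> U \<Longrightarrow> f y = g y" "Ck_on_open k U f"
  shows "Ck_on_open k U g"
  using assms(2,3)
proof (induction k arbitrary: f g)
  case 0
  then show ?case using continuous_on_cong[of U U f g] by (simp add: Ck_0)
next
  case (Suc k)
  show ?case
  proof (rule Ck_SucI)
    show "g differentiable at x" if "x \<in> U" for x
      using differentiable_cong[OF assms(1) that Suc.prems(1) Ck_SucD(1)[OF Suc.prems(2) that]] .
    show "Ck_on_open k U (\<lambda>x. pd v g x)" for v
      by (rule Suc.IH[OF _ Ck_SucD(2)[OF Suc.prems(2), of v]])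
        (rule pd_cong[OF assms(1) _ Suc.prems(1)])
  qed
qed

lemma Ck_imp_continuous_on: "Ck_on_open k U f \<Longrightarrow> continuous_on U f"
proof (cases k)
  case (Suc l)
  moreover assume "Ck_on_open k U f"
  ultimately have "\<forall>x\<in>U. f differentiable at x" using Ck_SucD(1) by blast
  then show ?thesis
    by (meson continuous_at_imp_continuous_on differentiable_imp_continuous_within)
qed (simp add: Ck_0)

lemma Ck_Suc_imp_Ck: "Ck_on_open (Suc k) U f \<Longrightarrow> Ck_on_open k U f"
proof (induction k arbitrary: f)
  case 0
  then show ?case using Ck_imp_continuous_on Ck_0 by blast
next
  case (Suc k)
  show ?case
    by (rule Ck_SucI) (rule Ck_SucD(1)[OF Suc.prems], assumption, rule Suc.IH[OF Ck_SucD(2)[OF Suc.prems]])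
qed

lemma Ck_subset: "Ck_on_open k U f \<Longrightarrow> V \<subseteq> U \<Longrightarrow> Ck_on_open k V f"
proof (induction k arbitrary: f)
  case 0
  then show ?case using continuous_on_subset by (simp add: Ck_0)
next
  case (Suc k)
  show ?case
    by (rule Ck_SucI) (use Suc.prems(2) Ck_SucD(1)[OF Suc.prems(1)] in blast,
        rule Suc.IH[OF Ck_SucD(2)[OF Suc.prems(1)] Suc.prems(2)])
qed

lemma CinfD: "Cinf U f \<Longrightarrow> Ck_on_open k U f"
  by (simp add: Cinf_def)

lemma CinfI: "(\<And>k. Ck_on_open k U f) \<Longrightarrow> Cinf U f"
  by (simp add: Cinf_def)

lemma Cinf_subset: "Cinf U f \<Longrightarrow> V \<subseteq> U \<Longrightarrow> Cinf V f"
  by (rule CinfI, rule Ck_subset, erule CinfD)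

lemma Cinf_cong: "open U \<Longrightarrow> (\<And>y. y \<in> U \<Longrightarrow> f y = g y) \<Longrightarrow> Cinf U f \<Longrightarrow> Cinf U g"
  by (rule CinfI, rule Ck_cong[of U f g], assumption, blast, erule CinfD)

lemma Cinf_differentiable: "Cinf U f \<Longrightarrow> x \<in> U \<Longrightarrow> f differentiable at x"
  by (rule Ck_SucD(1)[OF CinfD])

lemma Cinf_pd: "Cinf U f \<Longrightarrow> Cinf U (\<lambda>x. pd v f x)"
  by (rule CinfI, rule Ck_SucD(2)[OF CinfD])

lemma Cinf_continuous_on: "Cinf U f \<Longrightarrow> continuous_on U f"
  by (rule Ck_imp_continuous_on[OF CinfD])

lemma Cinf_has_derivative: "Cinf U f \<Longrightarrow> x \<in> U \<Longrightarrow> (f has_derivative (\<lambda>v. pd v f x)) (at x)"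
  by (rule pd_has[OF Cinf_differentiable])

lemma Cinf_smooth_on: "open U \<Longrightarrow> Cinf U f \<Longrightarrow> smooth_on U f"
  unfolding smooth_on_def Cinf_def by blast

lemma smooth_onE:
  assumes "smooth_on S f"
  obtains V g where "open V" "S \<subseteq> V" "Cinf V g" "\<And>x. x \<in> S \<Longrightarrow> g x = f x"
  using assms unfolding smooth_on_def Cinf_def by blast

lemma smooth_on_open_Cinf:
  assumes "open U" "smooth_on U f"
  shows "Cinf U f"
proof -
  obtain V g where g: "open V" "U \<subseteq> V" "Cinf V g" "\<And>x. x \<in> U \<Longrightarrow> g x = f x"
    using smooth_onE[OF assms(2)] by blast
  show ?thesis by (rule Cinf_cong[OF assms(1) g(4) Cinf_subset[OF g(3,2)]])
qed

lemma Ck_const: "Ck_on_open k U (\<lambda>x. c)"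
proof (induction k arbitrary: c)
  case (Suc k)
  show ?case by (rule Ck_SucI) (simp_all add: Suc)
qed (simp add: Ck_0)

lemma Cinf_const [intro!]: "Cinf U (\<lambda>x. c)"
  by (rule CinfI[OF Ck_const])

lemma pd_bounded_linear: "bounded_linear f \<Longrightarrow> pd v f x = f v"
  by (intro pd_eqI bounded_linear_imp_has_derivative)

lemma Cinf_bounded_linear:
  assumes f: "bounded_linear f"
  shows "Cinf U f"
proof (rule CinfI)
  fix k
  show "Ck_on_open k U f"
  proof (cases k)
    case 0
    then show ?thesis by (simp add: f linear_continuous_on Ck_0)
  next
    case (Suc l)
    have "f differentiable at x" for x
      using bounded_linear_imp_has_derivative[OF f] differentiable_def by blast
    moreover have "(\<lambda>x. pd v f x) = (\<lambda>x. f v)" for v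
      by (simp add: pd_bounded_linear[OF f])
    ultimately show ?thesis using Suc by (auto intro!: Ck_SucI simp: Ck_const)
  qed
qed

lemma pd_add: "f differentiable at x \<Longrightarrow> g differentiable at x \<Longrightarrow>
    pd v (\<lambda>x. f x + g x) x = pd v f x + pd v g x"
  by (rule pd_eqI) (intro has_derivative_add pd_has)

lemma pd_diff: "f differentiable at x \<Longrightarrow> g differentiable at x \<Longrightarrow>
    pd v (\<lambda>x. f x - g x) x = pd v f x - pd v g x"
  by (rule pd_eqI) (intro has_derivative_diff pd_has)

lemma pd_mult: "f differentiable at x \<Longrightarrow> g differentiable at x \<Longrightarrow>
    pd v (\<lambda>x. f x * g x) x = f x * pd v g x + pd v f x * g x"
  by (rule pd_eqI) (intro has_derivative_mult pd_has)

lemma pd_cmult: "f differentiable at x \<Longrightarrow> pd v (\<lambda>x. c * f x) x = c * pd v f x"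
  using pd_mult[of "\<lambda>x. c" x f v] by simp

lemma pd_sum: "(\<And>i. i \<in> I \<Longrightarrow> f i differentiable at x) \<Longrightarrow>
    pd v (\<lambda>x. \<Sum>i\<in>I. f i x) x = (\<Sum>i\<in>I. pd v (f i) x)"
  by (rule pd_eqI) (intro has_derivative_sum pd_has)

lemma pd_comp: "f differentiable at x \<Longrightarrow> (h has_real_derivative h') (at (f x)) \<Longrightarrow>
    pd v (\<lambda>x. h (f x)) x = h' * pd v f x"
  using has_derivative_compose[OF pd_has, of f x h "(*) h'"]
  by (intro pd_eqI) (auto simp: has_field_derivative_def)

lemma Ck_add:
  assumes "open U"
  shows "Ck_on_open k U f \<Longrightarrow> Ck_on_open k U g \<Longrightarrow> Ck_on_open k U (\<lambda>x. f x + g x)"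
proof (induction k arbitrary: f g)
  case 0
  then show ?case by (auto intro: continuous_intros simp: Ck_0)
next
  case (Suc k)
  note d = Ck_SucD[OF Suc.prems(1)] Ck_SucD[OF Suc.prems(2)]
  show ?case
  proof (rule Ck_SucI)
    show "(\<lambda>x. f x + g x) differentiable at x" if "x \<in> U" for x
      using d(1,3)[OF that] by (rule differentiable_add)
    show "Ck_on_open k U (\<lambda>x. pd v (\<lambda>x. f x + g x) x)" for v
      by (rule Ck_cong[OF assms(1) _ Suc.IH[OF d(2)[of v] d(4)[of v]]])
        (rule pd_add[OF d(1) d(3), symmetric])
  qed
qed

lemma Ck_mult:
  assumes "open U"
  shows "Ck_on_open k U f \<Longrightarrow> Ck_on_open k U g \<Longrightarrow> Ck_on_open k U (\<lambda>x. f x * g x)"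
proof (induction k arbitrary: f g)
  case 0
  then show ?case by (auto intro: continuous_intros simp: Ck_0)
next
  case (Suc k)
  note d = Ck_SucD[OF Suc.prems(1)] Ck_SucD[OF Suc.prems(2)]
  note fg = Ck_Suc_imp_Ck[OF Suc.prems(1)] Ck_Suc_imp_Ck[OF Suc.prems(2)]
  show ?case
  proof (rule Ck_SucI)
    show "(\<lambda>x. f x * g x) differentiable at x" if "x \<in> U" for x
      using d(1,3)[OF that] by (rule differentiable_mult)
    show "Ck_on_open k U (\<lambda>x. pd v (\<lambda>x. f x * g x) x)" for v
      by (rule Ck_cong[OF assms(1) _ Ck_add[OF assms(1) Suc.IH[OF fg(1) d(4)[of v]]
            Suc.IH[OF d(2)[of v] fg(2)]]])
        (rule pd_mult[OF d(1) d(3), symmetric])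
  qed
qed

lemma frechet_real: "h differentiable at x \<Longrightarrow> (h has_real_derivative (pd 1 h x)) (at x)"
  for h :: "real \<Rightarrow> real"
proof -
  assume h: "h differentiable at x"
  have "(h has_derivative (\<lambda>v. pd v h x)) (at x)" using pd_has h by blast
  moreover have "(\<lambda>v. pd v h x) = (*) (pd 1 h x)"
  proof
    fix v
    have "pd (v *\<^sub>R 1) h x = v *\<^sub>R pd 1 h x"
      by (rule linear_scale[OF linear_frechet_derivative[OF h]])
    then show "pd v h x = pd 1 h x * v" by (metis mult.commute mult.right_neutral real_scaleR_def)
  qed
  ultimately have "(h has_derivative (*) (pd 1 h x)) (at x)"
    by (rule back_subst[of "\<lambda>D. (h has_derivative D) (at x)"])
  then show ?thesis unfolding has_field_derivative_def .
qed

lemma Ck_comp: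
  fixes h :: "real \<Rightarrow> real"
  assumes "open U" and fI: "\<And>x. x \<in> U \<Longrightarrow> f x \<in> I"
  shows "Ck_on_open k U f \<Longrightarrow> Ck_on_open k I h \<Longrightarrow> Ck_on_open k U (\<lambda>x. h (f x))"
proof (induction k arbitrary: h)
  case 0
  then show ?case using fI
    by (auto intro!: continuous_on_compose2[of I h U f] simp: Ck_0)
next
  case (Suc k)
  note d = Ck_SucD[OF Suc.prems(1)] Ck_SucD[OF Suc.prems(2)]
  note fg = Ck_Suc_imp_Ck[OF Suc.prems(1)]
  show ?case
  proof (rule Ck_SucI)
    show "(\<lambda>x. h (f x)) differentiable at x" if "x \<in> U" for x
      using differentiable_chain_at[OF d(1)[OF that] d(3)[OF fI[OF that]]] by (simp add: o_def)
    show "Ck_on_open k U (\<lambda>x. pd v (\<lambda>x. h (f x)) x)" for v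
      by (rule Ck_cong[OF assms(1) _ Ck_mult[OF assms(1) Suc.IH[OF fg d(4)[of 1]] d(2)[of v]]])
        (rule pd_comp[of f _ h, OF d(1) frechet_real[OF d(3)[OF fI]], symmetric])
  qed
qed

lemma Cinf_add: "open U \<Longrightarrow> Cinf U f \<Longrightarrow> Cinf U g \<Longrightarrow> Cinf U (\<lambda>x. f x + g x)"
  by (rule CinfI) (rule Ck_add[OF _ CinfD CinfD])

lemma Cinf_mult: "open U \<Longrightarrow> Cinf U f \<Longrightarrow> Cinf U g \<Longrightarrow> Cinf U (\<lambda>x. f x * g x)"
  by (rule CinfI) (rule Ck_mult[OF _ CinfD CinfD])

lemma Cinf_uminus: "open U \<Longrightarrow> Cinf U f \<Longrightarrow> Cinf U (\<lambda>x. - f x)"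
  using Cinf_mult[of U "\<lambda>x. -1" f] by (simp add: Cinf_const)

lemma Cinf_diff: "open U \<Longrightarrow> Cinf U f \<Longrightarrow> Cinf U g \<Longrightarrow> Cinf U (\<lambda>x. f x - g x)"
  using Cinf_add[of U f "\<lambda>x. - g x"] Cinf_uminus[of U g] by simp

lemma Cinf_sum: "open U \<Longrightarrow> (\<And>i. i \<in> I \<Longrightarrow> Cinf U (f i)) \<Longrightarrow> Cinf U (\<lambda>x. \<Sum>i\<in>I. f i x)"
  by (induction I rule: infinite_finite_induct) (simp_all add: Cinf_const Cinf_add)

lemma Cinf_comp:
  fixes h :: "real \<Rightarrow> real"
  assumes "open U" "Cinf U f" "Cinf I h" "\<And>x. x \<in> U \<Longrightarrow> f x \<in> I"
  shows "Cinf U (\<lambda>x. h (f x))"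
  by (rule CinfI) (rule Ck_comp[of U f I _ h, OF assms(1,4) CinfD[OF assms(2)] CinfD[OF assms(3)]])

lemma Cinf_inner [intro!]: "Cinf U (\<lambda>x. x \<bullet> v)" "Cinf U (\<lambda>x. v \<bullet> x)"
  by (auto intro: Cinf_bounded_linear bounded_linear_inner_left bounded_linear_inner_right)

lemma Cinf_inner_self: "open U \<Longrightarrow> Cinf U (\<lambda>x. x \<bullet> x)"
proof -
  assume "open U"
  then have "Cinf U (\<lambda>x. \<Sum>b\<in>Basis. (x \<bullet> b) * (x \<bullet> b))" by (intro Cinf_sum Cinf_mult) auto
  moreover have "(\<lambda>x::'a. \<Sum>b\<in>Basis. (x \<bullet> b) * (x \<bullet> b)) = (\<lambda>x. x \<bullet> x)"
    by (rule ext) (rule euclidean_inner[symmetric])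
  ultimately show ?thesis by simp
qed

text \<open>The induction on \<open>k\<close> runs over the whole family at once: if every member is
  \<open>C^k\<close> and each derivative is assembled from members, then every member is
  \<open>C^(k+1)\<close>. This fits the powers, whose exponent drops, and \<open>flat_exp\<close>,
  whose index rises.\<close>

lemma Cinf_realI:
  fixes g :: "'i \<Rightarrow> real \<Rightarrow> real"
  assumes U: "open U"
    and d: "\<And>i x. x \<in> U \<Longrightarrow> (g i has_real_derivative g' i x) (at x)"
    and g': "\<And>k i. (\<And>j. Ck_on_open k U (g j)) \<Longrightarrow> Ck_on_open k U (g' i)"
  shows "Cinf U (g i)"
proof (rule CinfI)
  fix k show "Ck_on_open k U (g i)"
  proof (induction k arbitrary: i)
    case 0
    have "isCont (g i) x" if "x \<in> U" for x using d[OF that] DERIV_isCont by blast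
    then show ?case by (simp add: continuous_at_imp_continuous_on Ck_0)
  next
    case (Suc k)
    have dd: "g i differentiable at x" if "x \<in> U" for x
      using d[OF that] by (auto simp: real_differentiable_def)
    have "Ck_on_open k U (\<lambda>x. v * g' i x)" for v
      by (intro Ck_mult[OF U] Ck_const g' Suc)
    moreover have "v * g' i x = pd v (g i) x" if "x \<in> U" for v x
      using pd_comp[of "\<lambda>x. x" x "g i" "g' i x" v] d[OF that] by (simp add: mult.commute)
    ultimately have "Ck_on_open k U (\<lambda>x. pd v (g i) x)" for v
      by (rule Ck_cong[OF U, rotated])
    then show ?case by (intro Ck_SucI dd)
  qed
qed

lemma Cinf_powr: "Cinf {0<..} (\<lambda>x::real. x powr a)"
proof (rule Cinf_realI[where g="\<lambda>a x. x powr a" and g'="\<lambda>a x. a * x powr (a - 1)"])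
  show "((\<lambda>x. x powr i) has_real_derivative i * x powr (i - 1)) (at x)" if "x \<in> {0<..}" for i x
    using that by (auto intro!: has_real_derivative_powr)
qed (auto intro!: Ck_mult Ck_const)

lemma Cinf_comp_powr: "open U \<Longrightarrow> Cinf U f \<Longrightarrow> (\<And>x. x \<in> U \<Longrightarrow> f x > 0) \<Longrightarrow> Cinf U (\<lambda>x. f x powr a)"
  by (rule Cinf_comp[OF _ _ Cinf_powr]) auto

lemma pd_powr: "f differentiable at x \<Longrightarrow> f x > 0 \<Longrightarrow>
    pd v (\<lambda>x. f x powr a) x = a * f x powr (a - 1) * pd v f x"
  by (rule pd_comp) (auto intro!: has_real_derivative_powr)

text \<open>Positivity of \<open>g\<close>, rather than \<open>g \<noteq> 0\<close>, is asked
  because the reciprocal is written as \<open>g powr (-1)\<close>, which is smooth on the positive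
  axis.\<close>

lemma Cinf_divide: 
  assumes "open U" "Cinf U f" "Cinf U g" "\<And>x. x \<in> U \<Longrightarrow> g x > 0"
  shows "Cinf U (\<lambda>x. f x / g x)"
proof -
  have "Cinf U (\<lambda>x. f x * g x powr (-1))" using assms by (intro Cinf_mult Cinf_comp_powr) auto
  then show ?thesis
    by (rule Cinf_cong[OF assms(1), rotated])
      (use assms(4) in \<open>fastforce simp: powr_minus divide_inverse\<close>)
qed

subsection \<open>A smooth step\<close>

text \<open>The case \<open>m = 0\<close> is the classical flat function \<open>exp (-1/x)\<close>;
  the extra powers of \<open>1/x\<close> make the family closed under differentiation up to linear
  combinations.\<close>

definition flat_exp :: "nat \<Rightarrow> real \<Rightarrow> real" where
  "flat_exp m x = (if x > 0 then inverse x ^ m * exp (- inverse x) else 0)"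

lemma flat_exp_tendsto: "(flat_exp m \<longlongrightarrow> 0) (at_right 0)"
proof -
  have "((\<lambda>x::real. inverse x ^ m / exp (inverse x)) \<longlongrightarrow> 0) (at_right 0)"
    by (rule filterlim_compose[OF tendsto_power_div_exp_0 filterlim_inverse_at_top_right])
  then show ?thesis
    by (rule Lim_transform_eventually)
      (auto simp: flat_exp_def eventually_at_filter exp_minus divide_inverse)
qed

lemma flat_exp_DERIV:
  "(flat_exp m has_real_derivative flat_exp (m + 2) x - real m * flat_exp (m + 1) x) (at x)"
proof -
  consider "x > 0" | "x < 0" | "x = 0" by linarith
  then show ?thesis
  proof cases
    case 1
    have "((\<lambda>x. inverse x ^ m * exp (- inverse x)) has_real_derivative
        flat_exp (m + 2) x - real m * flat_exp (m + 1) x) (at x)"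
    proof -
      have "((\<lambda>x. inverse x) has_real_derivative - (inverse x)\<^sup>2) (at x)"
        using 1 DERIV_inverse[of x] by (simp add: numeral_2_eq_2)
      note d1 = DERIV_power[OF this, of m]
      have d2: "((\<lambda>x. exp (- inverse x)) has_real_derivative exp (- inverse x) * (inverse x)\<^sup>2) (at x)"
        using 1 by (auto intro!: derivative_eq_intros simp: power2_eq_square)
      \<comment> \<open>The split on \<open>m\<close> isolates \<open>m = 0\<close>, where the
        exponent \<open>m - 1\<close> of the power rule is truncated.\<close>
      show ?thesis
        using 1 by (intro DERIV_cong[OF DERIV_mult[OF d1 d2]], cases m)
          (auto simp: flat_exp_def power2_eq_square algebra_simps)
    qed
    then show ?thesis
      by (rule has_field_derivative_transform_within_open[of _ _ _ "{0<..}"])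
        (use 1 in \<open>auto simp: flat_exp_def\<close>)
  next
    case 2
    have "((\<lambda>x. 0) has_real_derivative flat_exp (m + 2) x - real m * flat_exp (m + 1) x) (at x)"
      using 2 by (simp add: flat_exp_def)
    then show ?thesis
      by (rule has_field_derivative_transform_within_open[of _ _ _ "{..<0}"])
        (use 2 in \<open>auto simp: flat_exp_def\<close>)
  next
    case 3
    have "((\<lambda>y. (flat_exp m y - flat_exp m 0) / (y - 0)) \<longlongrightarrow> 0) (at 0)"
    proof (rule filterlim_split_at)
      show "((\<lambda>y. (flat_exp m y - flat_exp m 0) / (y - 0)) \<longlongrightarrow> 0) (at_left 0)"
        by (rule Lim_transform_eventually[OF tendsto_const])
          (auto simp: flat_exp_def eventually_at_filter)
      \<comment> \<open>Dividing by \<open>y\<close> adds a factor \<open>1/y\<close>, so on the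
        right the quotient is \<open>flat_exp (m + 1)\<close>, which tends to zero.\<close>
      show "((\<lambda>y. (flat_exp m y - flat_exp m 0) / (y - 0)) \<longlongrightarrow> 0) (at_right 0)"
        by (rule Lim_transform_eventually[OF flat_exp_tendsto[of "m + 1"]])
          (auto simp: flat_exp_def eventually_at_filter divide_inverse)
    qed
    then show ?thesis using 3 by (simp add: has_field_derivative_iff flat_exp_def)
  qed
qed

lemma Cinf_flat_exp: "Cinf UNIV (flat_exp m)"
proof (rule Cinf_realI[where g=flat_exp and
      g'="\<lambda>m x. flat_exp (m + 2) x + (- real m) * flat_exp (m + 1) x"])
  show "(flat_exp i has_real_derivative flat_exp (i + 2) x + - real i * flat_exp (i + 1) x) (at x)"
    for i x using flat_exp_DERIV[of i x] by simp
next
  fix k i assume "\<And>j. Ck_on_open k UNIV (flat_exp j)"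
  then show "Ck_on_open k UNIV (\<lambda>x. flat_exp (i + 2) x + - real i * flat_exp (i + 1) x)"
    by (intro Ck_add Ck_mult Ck_const) auto
qed auto

text \<open>The transition runs from \<open>1/4\<close> to \<open>1\<close> because the argument
  will be a squared relative distance: in terms of radii this is from \<open>\<rho>/2\<close> to
  \<open>\<rho>\<close>.\<close>

definition smooth_step :: "real \<Rightarrow> real" where
  "smooth_step s = flat_exp 0 (s - 1/4) / (flat_exp 0 (s - 1/4) + flat_exp 0 (1 - s))"

lemma smooth_step_simps:
  "s \<le> 1/4 \<Longrightarrow> smooth_step s = 0" "1 \<le> s \<Longrightarrow> smooth_step s = 1"
  by (auto simp: smooth_step_def flat_exp_def)

lemma flat_exp_nonneg: "0 \<le> flat_exp m x"
  by (simp add: flat_exp_def)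

lemma smooth_step_bounds: "0 \<le> smooth_step s" "smooth_step s \<le> 1"
  using flat_exp_nonneg[of 0 "s - 1/4"] flat_exp_nonneg[of 0 "1 - s"]
  unfolding smooth_step_def by (auto simp: divide_le_eq_1)

text \<open>The denominator is positive, since \<open>s - 1/4\<close> and \<open>1 - s\<close> are
  never both nonpositive.\<close>

lemma Cinf_smooth_step: "Cinf UNIV smooth_step"
proof -
  have "Cinf UNIV (\<lambda>s. flat_exp 0 (1 * s - 1/4) / (flat_exp 0 (1 * s - 1/4) + flat_exp 0 (1 - 1 * s)))"
    by (intro Cinf_divide Cinf_add Cinf_comp[OF _ _ Cinf_flat_exp] Cinf_diff Cinf_const
        Cinf_mult Cinf_bounded_linear bounded_linear_ident)
      (auto simp: flat_exp_def intro: add_pos_nonneg add_nonneg_pos)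
  then show ?thesis by (simp add: smooth_step_def[abs_def])
qed

subsection \<open>Second derivatives\<close>

lemma linear_pd: "f differentiable at x \<Longrightarrow> linear (\<lambda>v. pd v f x)"
  using linear_frechet_derivative[of f "at x"] by simp

lemma gradient_inner_gen: "f differentiable F \<Longrightarrow> gradient f F \<bullet> v = frechet_derivative f F v"
proof -
  assume d: "f differentiable F"
  note l = linear_frechet_derivative[OF d]
  have "frechet_derivative f F v = frechet_derivative f F (\<Sum>b\<in>Basis. (v \<bullet> b) *\<^sub>R b)"
    by (simp add: euclidean_representation)
  also have "\<dots> = (\<Sum>b\<in>Basis. (v \<bullet> b) * frechet_derivative f F b)"
    by (simp add: linear_sum[OF l] linear_scale[OF l])
  also have "\<dots> = gradient f F \<bullet> v"
    by (simp add: gradient_def inner_sum_left inner_sum_right mult.commute inner_commute)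
  finally show ?thesis by simp
qed

lemma gradient_inner: "f differentiable at x \<Longrightarrow> gradient f (at x) \<bullet> v = pd v f x"
  by (rule gradient_inner_gen)

lemma gradient_eqI:
  assumes "f differentiable at x" "\<And>v. pd v f x = w \<bullet> v"
  shows "gradient f (at x) = w"
  by (rule vector_eq_rdot[THEN iffD1]) (simp add: gradient_inner[OF assms(1)] assms(2))

lemma norm_gradient: "f differentiable at x \<Longrightarrow>
    (norm (gradient f (at x)))\<^sup>2 = (\<Sum>b\<in>Basis. (pd b f x)\<^sup>2)"
  unfolding power2_norm_eq_inner
  by (subst euclidean_inner) (simp add: gradient_inner power2_eq_square)

text \<open>The mean value theorem is applied twice, first along \<open>v\<close> to the difference
  over \<open>s w\<close>, then along \<open>w\<close> to the directional derivative. The left side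
  is symmetric in the two directions while the right side is not, which is the lever for
  \<open>pd_commute\<close>.\<close>

lemma second_difference:
  fixes f :: "'a::euclidean_space \<Rightarrow> real"
  assumes f: "Cinf U f" and s: "0 < s"
    and U: "\<And>a b. 0 \<le> a \<Longrightarrow> a \<le> s \<Longrightarrow> 0 \<le> b \<Longrightarrow> b \<le> s \<Longrightarrow> x + a *\<^sub>R v + b *\<^sub>R w \<in> U"
  shows "\<exists>a b. 0 \<le> a \<and> a \<le> s \<and> 0 \<le> b \<and> b \<le> s \<and>
    f (x + s *\<^sub>R v + s *\<^sub>R w) - f (x + s *\<^sub>R v) - f (x + s *\<^sub>R w) + f x
      = s\<^sup>2 * pd w (pd v f) (x + a *\<^sub>R v + b *\<^sub>R w)"
proof -
  have line: "((\<lambda>a. h (z + a *\<^sub>R d)) has_real_derivative pd d h (z + a *\<^sub>R d)) (at a)"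
    if "Cinf U h" "z + a *\<^sub>R d \<in> U" for h z d a
  proof -
    have "((\<lambda>a. h (z + a *\<^sub>R d)) has_derivative (\<lambda>t. pd (t *\<^sub>R d) h (z + a *\<^sub>R d))) (at a)"
      by (rule has_derivative_compose[of "\<lambda>a. z + a *\<^sub>R d" _ _ _ h, OF _ Cinf_has_derivative[OF that]])
        (auto intro!: derivative_eq_intros)
    moreover have "pd (t *\<^sub>R d) h (z + a *\<^sub>R d) = pd d h (z + a *\<^sub>R d) * t" for t
      using linear_scale[OF linear_pd[OF Cinf_differentiable[OF that]]] by simp
    ultimately show ?thesis by (simp add: has_field_derivative_def)
  qed
  let ?F = "\<lambda>a. f ((x + s *\<^sub>R w) + a *\<^sub>R v) - f (x + a *\<^sub>R v)"
  let ?F' = "\<lambda>a. pd v f ((x + s *\<^sub>R w) + a *\<^sub>R v) - pd v f (x + a *\<^sub>R v)"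
  have U1: "(x + s *\<^sub>R w) + a *\<^sub>R v \<in> U" "x + a *\<^sub>R v \<in> U" if "0 \<le> a" "a \<le> s" for a
    using U[of a s] U[of a 0] that s by (simp_all add: algebra_simps)
  have "\<exists>z. 0 < z \<and> z < s \<and> ?F s - ?F 0 = (s - 0) * ?F' z"
    by (rule MVT2[OF s]) (intro DERIV_diff line f U1)
  then obtain a where a: "0 < a" "a < s" "?F s - ?F 0 = s * ?F' a" by auto
  let ?G = "\<lambda>b. pd v f ((x + a *\<^sub>R v) + b *\<^sub>R w)"
  have "\<exists>z. 0 < z \<and> z < s \<and> ?G s - ?G 0 = (s - 0) * pd w (pd v f) ((x + a *\<^sub>R v) + z *\<^sub>R w)"
    by (rule MVT2[OF s]) (intro line Cinf_pd f U; use a in simp)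
  then obtain b where b: "0 < b" "b < s" "?G s - ?G 0 = s * pd w (pd v f) ((x + a *\<^sub>R v) + b *\<^sub>R w)"
    by auto
  have "?F' a = ?G s - ?G 0" by (simp add: algebra_simps)
  then have "?F s - ?F 0 = s\<^sup>2 * pd w (pd v f) ((x + a *\<^sub>R v) + b *\<^sub>R w)"
    using a b by (simp add: power2_eq_square)
  moreover have "?F s - ?F 0 = f (x + s *\<^sub>R v + s *\<^sub>R w) - f (x + s *\<^sub>R v) - f (x + s *\<^sub>R w) + f x"
    by (simp add: algebra_simps)
  ultimately show ?thesis using a b by (intro exI[of _ a] exI[of _ b]) auto
qed

text \<open>Written as a mean value in either order, the second difference over a small
  parallelogram equals \<open>s^2\<close> times each of the two mixed derivatives at nearby points;
  continuity forces them to agree at \<open>x\<close>.\<close>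

lemma pd_commute:
  fixes f :: "'a::euclidean_space \<Rightarrow> real"
  assumes f: "Cinf U f" and U: "open U" and x: "x \<in> U"
  shows "pd v (pd w f) x = pd w (pd v f) x"
proof (rule ccontr)
  let ?g = "pd w (pd v f)" and ?h = "pd v (pd w f)"
  assume ne: "?h x \<noteq> ?g x"
  define e where "e = \<bar>?h x - ?g x\<bar> / 2"
  have e: "e > 0" using ne by (simp add: e_def)
  have c: "isCont ?g x" "isCont ?h x"
    using Cinf_continuous_on[OF Cinf_pd[OF Cinf_pd[OF f]]] U x
    by (auto simp: continuous_on_eq_continuous_at)
  obtain r where r: "r > 0" "ball x r \<subseteq> U" using U x openE by blast
  obtain d1 where d1: "d1 > 0" "\<And>y. dist y x < d1 \<Longrightarrow> dist (?g y) (?g x) < e"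
    using c(1) e unfolding continuous_at_eps_delta by metis
  obtain d2 where d2: "d2 > 0" "\<And>y. dist y x < d2 \<Longrightarrow> dist (?h y) (?h x) < e"
    using c(2) e unfolding continuous_at_eps_delta by metis
  \<comment> \<open>\<open>s * M\<close> bounds the size of the parallelogram, so that it stays in
    \<open>U\<close> and within the two continuity radii; the \<open>+ 1\<close> keeps
    \<open>M\<close> positive when both directions vanish.\<close>
  define M where "M = norm v + norm w + 1"
  define s where "s = min r (min d1 d2) / (2 * M)"
  have M: "M > 0" by (simp add: M_def add_nonneg_pos)
  have s: "s > 0" using r d1 d2 M by (simp add: s_def)
  have "s * M = min r (min d1 d2) / 2" using M by (simp add: s_def)
  moreover have "min r (min d1 d2) > 0" using r d1 d2 by simp
  ultimately have sM: "s * M < min r (min d1 d2)" by linarith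
  have near: "dist (x + a *\<^sub>R v + b *\<^sub>R w) x < min r (min d1 d2)"
    if "0 \<le> a" "a \<le> s" "0 \<le> b" "b \<le> s" for a b
  proof -
    have "dist (x + a *\<^sub>R v + b *\<^sub>R w) x = norm (a *\<^sub>R v + b *\<^sub>R w)"
      by (simp add: dist_norm algebra_simps)
    also have "\<dots> \<le> a * norm v + b * norm w"
      using norm_triangle_ineq[of "a *\<^sub>R v" "b *\<^sub>R w"] that by simp
    also have "\<dots> \<le> s * norm v + s * norm w"
      using that by (intro add_mono mult_right_mono) auto
    also have "\<dots> \<le> s * M" using s by (simp add: M_def algebra_simps)
    finally show ?thesis using sM by linarith
  qed
  have inU: "x + a *\<^sub>R v + b *\<^sub>R w \<in> U" "x + b *\<^sub>R w + a *\<^sub>R v \<in> U"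
    if "0 \<le> a" "a \<le> s" "0 \<le> b" "b \<le> s" for a b
    using near[OF that] r(2) by (auto simp: dist_commute subset_iff algebra_simps)
  obtain a b where 1: "0 \<le> a" "a \<le> s" "0 \<le> b" "b \<le> s"
    "f (x + s *\<^sub>R v + s *\<^sub>R w) - f (x + s *\<^sub>R v) - f (x + s *\<^sub>R w) + f x
      = s\<^sup>2 * ?g (x + a *\<^sub>R v + b *\<^sub>R w)"
    using second_difference[OF f s, of x v w] inU by blast
  obtain a' b' where 2: "0 \<le> a'" "a' \<le> s" "0 \<le> b'" "b' \<le> s"
    "f (x + s *\<^sub>R w + s *\<^sub>R v) - f (x + s *\<^sub>R w) - f (x + s *\<^sub>R v) + f x
      = s\<^sup>2 * ?h (x + a' *\<^sub>R w + b' *\<^sub>R v)"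
    using second_difference[OF f s, of x w v] inU by blast
  have "s\<^sup>2 * ?g (x + a *\<^sub>R v + b *\<^sub>R w) = s\<^sup>2 * ?h (x + a' *\<^sub>R w + b' *\<^sub>R v)"
    using 1(5) 2(5) by (simp add: algebra_simps)
  then have "?g (x + a *\<^sub>R v + b *\<^sub>R w) = ?h (x + b' *\<^sub>R v + a' *\<^sub>R w)"
    using s by (simp add: algebra_simps)
  moreover have "dist (?g (x + a *\<^sub>R v + b *\<^sub>R w)) (?g x) < e"
    "dist (?h (x + b' *\<^sub>R v + a' *\<^sub>R w)) (?h x) < e"
    using near[OF 1(1-4)] near[OF 2(3,4,1,2)] d1(2) d2(2) by auto
  ultimately have "\<bar>?h x - ?g x\<bar> < 2 * e" by (simp add: dist_real_def)
  then show False by (simp add: e_def)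
qed

section \<open>Hausdorff measure\<close>

definition hausdorff_size :: "nat \<Rightarrow> 'a::euclidean_space set \<Rightarrow> ennreal" where
  "hausdorff_size k C = (if C = {} then 0
     else ennreal (unit_ball_vol (real k) * (diameter C / 2) ^ k))"

definition hausdorff_covers :: "real \<Rightarrow> 'a::euclidean_space set \<Rightarrow> (nat \<Rightarrow> 'a set) set" where
  "hausdorff_covers \<delta> A =
    {C. A \<subseteq> (\<Union>i. C i) \<and> (\<forall>i. bounded (C i) \<and> diameter (C i) \<le> \<delta>)}"

definition hausdorff_pre :: "nat \<Rightarrow> real \<Rightarrow> 'a::euclidean_space set \<Rightarrow> ennreal" where
  "hausdorff_pre k \<delta> A = (INF C\<in>hausdorff_covers \<delta> A. \<Sum>i. hausdorff_size k (C i))"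

section \<open>The Hausdorff outer measure and the measurability of Borel sets\<close>

lemma hausdorff_outer_eq: "hausdorff_outer k A = (SUP \<delta>\<in>{0<..}. hausdorff_pre k \<delta> A)"
  unfolding hausdorff_outer_def hausdorff_pre_def hausdorff_size_def hausdorff_covers_def ..

lemma hausdorff_pre_le: "C \<in> hausdorff_covers \<delta> A \<Longrightarrow> hausdorff_pre k \<delta> A \<le> (\<Sum>i. hausdorff_size k (C i))"
  unfolding hausdorff_pre_def by (rule INF_lower)

lemma hausdorff_pre_le_outer: "0 < \<delta> \<Longrightarrow> hausdorff_pre k \<delta> A \<le> hausdorff_outer k A"
  unfolding hausdorff_outer_eq by (rule SUP_upper) simp

lemma hausdorff_outer_leI:
  "(\<And>\<delta>. 0 < \<delta> \<Longrightarrow> hausdorff_pre k \<delta> A \<le> x) \<Longrightarrow> hausdorff_outer k A \<le> x"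
  unfolding hausdorff_outer_eq by (rule SUP_least) simp

lemma hausdorff_covers_mono: "A \<subseteq> B \<Longrightarrow> \<delta> \<le> \<epsilon> \<Longrightarrow> hausdorff_covers \<delta> B \<subseteq> hausdorff_covers \<epsilon> A"
  unfolding hausdorff_covers_def by (intro Collect_mono impI) (meson order_trans)

lemma hausdorff_pre_mono: "A \<subseteq> B \<Longrightarrow> \<delta> \<le> \<epsilon> \<Longrightarrow> hausdorff_pre k \<epsilon> A \<le> hausdorff_pre k \<delta> B"
  unfolding hausdorff_pre_def by (rule INF_superset_mono[OF hausdorff_covers_mono]) auto

lemma hausdorff_outer_mono: "A \<subseteq> B \<Longrightarrow> hausdorff_outer k A \<le> hausdorff_outer k B"
  unfolding hausdorff_outer_eq by (intro SUP_mono') (rule hausdorff_pre_mono, auto)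

lemma hausdorff_outer_empty: "hausdorff_outer k {} = 0"
proof -
  have "hausdorff_pre k \<delta> {} \<le> 0" if "0 < \<delta>" for \<delta>
    using hausdorff_pre_le[of "\<lambda>_. {}" \<delta> "{}" k] that
    by (simp add: hausdorff_covers_def hausdorff_size_def)
  then have "hausdorff_outer k {} \<le> 0" by (rule hausdorff_outer_leI)
  then show ?thesis by simp
qed

text \<open>Near-optimal covers of the \<open>A i\<close>, with errors summing to \<open>e\<close>,
  are merged into a single sequence by the pairing function.\<close>

lemma hausdorff_pre_subadditive:
  assumes \<delta>: "0 < \<delta>"
  shows "hausdorff_pre k \<delta> (\<Union>i. A i) \<le> (\<Sum>i. hausdorff_pre k \<delta> (A i))"
proof (rule ennreal_le_epsilon)
  fix e :: real
  assume fin: "(\<Sum>i. hausdorff_pre k \<delta> (A i)) < top" and e: "0 < e"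
  define d where "d n = e * (1/2) ^ Suc n" for n
  have d: "d n > 0" for n using e by (simp add: d_def)
  have "\<exists>C\<in>hausdorff_covers \<delta> (A i). (\<Sum>j. hausdorff_size k (C j)) \<le> hausdorff_pre k \<delta> (A i) + d i" for i
  proof -
    have "hausdorff_pre k \<delta> (A i) < top"
      using fin ennreal_suminf_lessD by blast
    then have "hausdorff_pre k \<delta> (A i) < hausdorff_pre k \<delta> (A i) + d i"
      using d[of i] by (simp add: ennreal_add_left_cancel_less less_top)
    then show ?thesis
      unfolding hausdorff_pre_def INF_less_iff by (auto intro: less_imp_le)
  qed
  then obtain C where C: "\<And>i. C i \<in> hausdorff_covers \<delta> (A i)"
    "\<And>i. (\<Sum>j. hausdorff_size k (C i j)) \<le> hausdorff_pre k \<delta> (A i) + d i"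
    by metis
  define D where "D n = (case prod_decode n of (i, j) \<Rightarrow> C i j)" for n
  have "D \<in> hausdorff_covers \<delta> (\<Union>i. A i)"
    unfolding hausdorff_covers_def
  proof safe
    fix x i assume "x \<in> A i"
    then obtain j where "x \<in> C i j" using C(1)[of i] unfolding hausdorff_covers_def by blast
    then have "x \<in> D (prod_encode (i, j))" by (simp add: D_def)
    then show "x \<in> (\<Union>i. D i)" by blast
  next
    fix n
    obtain i j where "prod_decode n = (i, j)" by force
    then show "bounded (D n)" "diameter (D n) \<le> \<delta>"
      using C(1)[of i] unfolding hausdorff_covers_def D_def by auto
  qed
  then have "hausdorff_pre k \<delta> (\<Union>i. A i) \<le> (\<Sum>n. hausdorff_size k (D n))"
    by (rule hausdorff_pre_le)
  also have "\<dots> = (\<Sum>n. (\<lambda>(i, j). hausdorff_size k (C i j)) (prod_decode n))"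
    by (simp add: D_def split_def)
  also have "\<dots> = (\<Sum>i. \<Sum>j. hausdorff_size k (C i j))"
    by (rule suminf_ennreal_2dimen) simp
  also have "\<dots> \<le> (\<Sum>i. hausdorff_pre k \<delta> (A i) + d i)"
    by (intro suminf_le C(2)) auto
  also have "\<dots> = (\<Sum>i. hausdorff_pre k \<delta> (A i)) + (\<Sum>i. ennreal (d i))"
    by (rule suminf_add[symmetric]) auto
  also have "(\<Sum>i. ennreal (d i)) = ennreal e"
  proof (rule suminf_ennreal_eq)
    show "d sums e" using sums_mult[OF power_half_series, of e] by (simp add: d_def[abs_def])
  qed (use d less_imp_le in blast)
  finally show "hausdorff_pre k \<delta> (\<Union>i. A i) \<le> (\<Sum>i. hausdorff_pre k \<delta> (A i)) + ennreal e" .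
qed

lemma hausdorff_outer_subadditive:
  "hausdorff_outer k (\<Union>i. A i) \<le> (\<Sum>i. hausdorff_outer k (A i))"
proof (rule hausdorff_outer_leI)
  fix \<delta> :: real assume \<delta>: "0 < \<delta>"
  have "hausdorff_pre k \<delta> (\<Union>i. A i) \<le> (\<Sum>i. hausdorff_pre k \<delta> (A i))"
    by (rule hausdorff_pre_subadditive[OF \<delta>])
  also have "\<dots> \<le> (\<Sum>i. hausdorff_outer k (A i))"
    by (intro suminf_le hausdorff_pre_le_outer[OF \<delta>]) auto
  finally show "hausdorff_pre k \<delta> (\<Union>i. A i) \<le> (\<Sum>i. hausdorff_outer k (A i))" .
qed

lemma hausdorff_outer_Un: "hausdorff_outer k (A \<union> B) \<le> hausdorff_outer k A + hausdorff_outer k B"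
proof -
  define F where "F i = (if i = 0 then A else if i = 1 then B else {})" for i :: nat
  have U: "(\<Union>i. F i) = A \<union> B" unfolding F_def by (auto split: if_splits)
  have "(\<Sum>i. hausdorff_outer k (F i)) = (\<Sum>i\<in>{0, 1}. hausdorff_outer k (F i))"
    by (rule suminf_finite) (auto simp: F_def hausdorff_outer_empty)
  with hausdorff_outer_subadditive[of k F] show ?thesis by (simp add: U) (simp add: F_def)
qed

text \<open>Covers by sets of diameter below the separation \<open>\<rho>\<close> have no member
  meeting both sets, so such a cover of the union splits into covers of \<open>A\<close> and of
  \<open>B\<close>.\<close>

lemma hausdorff_outer_metric:
  assumes \<rho>: "0 < \<rho>" and sep: "\<And>x y. x \<in> A \<Longrightarrow> y \<in> B \<Longrightarrow> \<rho> \<le> dist x y"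
  shows "hausdorff_outer k A + hausdorff_outer k B \<le> hausdorff_outer k (A \<union> B)"
proof -
  have *: "hausdorff_pre k \<delta> A + hausdorff_pre k \<delta> B \<le> hausdorff_pre k \<delta> (A \<union> B)"
    if "\<delta> < \<rho>" "0 < \<delta>" for \<delta>
  proof -
    have "hausdorff_pre k \<delta> A + hausdorff_pre k \<delta> B \<le> (\<Sum>i. hausdorff_size k (C i))"
      if C: "C \<in> hausdorff_covers \<delta> (A \<union> B)" for C
    proof -
      define C1 where "C1 i = (if C i \<inter> A = {} then {} else C i)" for i
      define C2 where "C2 i = (if C i \<inter> B = {} then {} else C i)" for i
      have c: "C1 \<in> hausdorff_covers \<delta> A" "C2 \<in> hausdorff_covers \<delta> B"
        using C \<open>0 < \<delta>\<close> unfolding hausdorff_covers_def C1_def C2_def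
        by (auto split: if_splits) (metis (full_types) IntI UN_iff empty_iff subsetD)+
      have "C i \<inter> A = {} \<or> C i \<inter> B = {}" for i
      proof (rule ccontr)
        assume "\<not> ?thesis"
        then obtain x y where xy: "x \<in> C i" "x \<in> A" "y \<in> C i" "y \<in> B" by blast
        have "dist x y \<le> \<delta>"
          using C xy diameter_bounded_bound[of "C i" x y] unfolding hausdorff_covers_def
          by (auto intro: order_trans)
        then show False using sep[OF xy(2,4)] \<open>\<delta> < \<rho>\<close> by simp
      qed
      then have le: "hausdorff_size k (C1 i) + hausdorff_size k (C2 i) \<le> hausdorff_size k (C i)" for i
        by (auto simp: C1_def C2_def hausdorff_size_def)
      have "hausdorff_pre k \<delta> A + hausdorff_pre k \<delta> B
          \<le> (\<Sum>i. hausdorff_size k (C1 i)) + (\<Sum>i. hausdorff_size k (C2 i))"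
        by (intro add_mono hausdorff_pre_le c)
      also have "\<dots> = (\<Sum>i. hausdorff_size k (C1 i) + hausdorff_size k (C2 i))"
        by (rule suminf_add) auto
      also have "\<dots> \<le> (\<Sum>i. hausdorff_size k (C i))" by (intro suminf_le le) auto
      finally show ?thesis .
    qed
    then show ?thesis unfolding hausdorff_pre_def[of k \<delta> "A \<union> B"] by (rule INF_greatest)
  qed
  have ne: "{0::real<..} \<noteq> {}" by (simp add: gt_ex)
  \<comment> \<open>Two independent scales are kept so that the two suprema can be taken one after
    the other; both are lowered to a common \<open>\<eta>\<close> below
    \<open>\<rho>\<close>.\<close>
  have "hausdorff_pre k \<delta> A + hausdorff_pre k \<epsilon> B \<le> hausdorff_outer k (A \<union> B)"
    if "0 < \<delta>" "0 < \<epsilon>" for \<delta> \<epsilon>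
  proof -
    define \<eta> where "\<eta> = min (min \<delta> \<epsilon>) (\<rho> / 2)"
    have \<eta>: "0 < \<eta>" "\<eta> \<le> \<delta>" "\<eta> \<le> \<epsilon>" "\<eta> < \<rho>" using that \<rho> by (auto simp: \<eta>_def)
    have "hausdorff_pre k \<delta> A + hausdorff_pre k \<epsilon> B \<le> hausdorff_pre k \<eta> A + hausdorff_pre k \<eta> B"
      by (intro add_mono hausdorff_pre_mono \<eta>) auto
    also have "\<dots> \<le> hausdorff_outer k (A \<union> B)"
      using *[OF \<eta>(4,1)] hausdorff_pre_le_outer[OF \<eta>(1)] by (rule order_trans)
    finally show ?thesis .
  qed
  then have "hausdorff_outer k A + hausdorff_pre k \<epsilon> B \<le> hausdorff_outer k (A \<union> B)" if "0 < \<epsilon>" for \<epsilon>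
    unfolding hausdorff_outer_eq[of k A] ennreal_SUP_add_left[OF ne, symmetric]
    using that by (intro SUP_least) auto
  then show ?thesis
    unfolding hausdorff_outer_eq[of k B] ennreal_SUP_add_right[OF ne]
    by (intro SUP_least) auto
qed

lemma sum_even_odd: "(\<Sum>i<2 * m. f i) = (\<Sum>i<m. f (2 * i)) + (\<Sum>i<m. f (2 * i + 1))"
  for f :: "nat \<Rightarrow> ennreal"
  by (induction m) (auto simp: ac_simps)

text \<open>This is Caratheodory's criterion for metric outer measures. \<open>X - F\<close> is
  exhausted by the sets \<open>Y n\<close> at distance at least \<open>1/(n+1)\<close> from
  \<open>F\<close>, which are separated from \<open>X \<inter> F\<close>; what remains is the union
  of the shells \<open>R n\<close>. Shells of equal parity are separated from each other, so their
  measures add up to at most that of \<open>X\<close>. Hence the series over all shells converges,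
  and its tail can be made as small as desired.\<close>

lemma hausdorff_outer_closed_split:
  fixes F X :: "'a::euclidean_space set"
  assumes F: "closed F"
  shows "hausdorff_outer k (X \<inter> F) + hausdorff_outer k (X - F) \<le> hausdorff_outer k X"
proof (cases "F = {} \<or> hausdorff_outer k X = \<infinity>")
  case True
  then show ?thesis by (auto simp: hausdorff_outer_empty)
next
  case False
  let ?H = "hausdorff_outer k :: 'a set \<Rightarrow> ennreal"
  define Y where "Y n = {x \<in> X. 1 / real (n + 1) \<le> infdist x F}" for n
  define R where "R n = {x \<in> X. 1 / real (n + 2) \<le> infdist x F \<and> infdist x F < 1 / real (n + 1)}" for n
  have Fne: "F \<noteq> {}" and fin: "?H X \<noteq> \<infinity>" using False by auto
  have dist_infdist: "\<bar>infdist x F - infdist y F\<bar> \<le> dist x y" for x y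
    using infdist_triangle[of x F y] infdist_triangle[of y F x] by (simp add: dist_commute abs_le_iff)
  have parity: "(\<Sum>i<m. ?H (R (2 * i + p))) \<le> ?H (\<Union>i<m. R (2 * i + p))" for m p
  proof (induction m)
    case (Suc m)
    \<comment> \<open>For \<open>m = 0\<close> the union collected so far is empty and any positive
      gap will do; \<open>2 * m + p\<close> may then be zero, where the general expression would not
      be positive.\<close>
    define \<rho> where "\<rho> = (if m = 0 then 1 else 1 / real (2 * m + p) - 1 / real (2 * m + p + 1))"
    have \<rho>: "\<rho> > 0" by (auto simp: \<rho>_def intro!: divide_strict_left_mono)
    have "?H (\<Union>i<m. R (2 * i + p)) + ?H (R (2 * m + p)) \<le> ?H ((\<Union>i<m. R (2 * i + p)) \<union> R (2 * m + p))"
    proof (rule hausdorff_outer_metric[OF \<rho>])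
      fix x y assume "x \<in> (\<Union>i<m. R (2 * i + p))" and y: "y \<in> R (2 * m + p)"
      then obtain i where i: "i < m" "x \<in> R (2 * i + p)" by blast
      have "1 / real (2 * m + p) \<le> 1 / real (2 * i + p + 2)"
        using i(1) by (intro divide_left_mono) auto
      also have "\<dots> \<le> infdist x F" using i(2) by (simp add: R_def)
      finally have "\<rho> \<le> infdist x F - infdist y F" using y i(1) by (simp add: R_def \<rho>_def)
      then show "\<rho> \<le> dist x y" using dist_infdist[of x y] by linarith
    qed
    moreover have "(\<Union>i<m. R (2 * i + p)) \<union> R (2 * m + p) = (\<Union>i<Suc m. R (2 * i + p))"
      by (auto simp: less_Suc_eq)
    ultimately show ?case using Suc by simp (meson add_right_mono order_trans)
  qed (simp add: hausdorff_outer_empty)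
  have RX: "R n \<subseteq> X" for n by (auto simp: R_def)
  have parity': "(\<Sum>i<m. ?H (R (2 * i + p))) \<le> ?H X" for m p
    using parity[of p m] hausdorff_outer_mono[of "\<Union>i<m. R (2 * i + p)" X k] RX
    by (meson UN_least order_trans)
  have "(\<Sum>i<m. ?H (R i)) \<le> ?H X + ?H X" for m
  proof -
    have "(\<Sum>i<m. ?H (R i)) \<le> (\<Sum>i<2 * m. ?H (R i))" by (intro sum_mono2) auto
    also have "\<dots> \<le> ?H X + ?H X"
      unfolding sum_even_odd using parity'[of 0] parity'[of 1] by (intro add_mono) auto
    finally show ?thesis .
  qed
  then have "(\<Sum>i. ?H (R i)) \<le> ?H X + ?H X" unfolding suminf_eq_SUP by (intro SUP_least)
  then have sfin: "(\<Sum>i. ?H (R i)) \<noteq> top" using fin by (auto simp: top_unique)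
  define r where "r i = enn2real (?H (R i))" for i
  have r: "?H (R i) = ennreal (r i)" for i
    using hausdorff_outer_mono[OF RX, of k i] fin unfolding r_def
    by (metis ennreal_enn2real infinity_ennreal_def less_top order_le_less_trans)
  have r0: "0 \<le> r i" for i by (simp add: r_def)
  have sr: "summable r" using sfin r0 by (intro summable_suminf_not_top) (auto simp: r)
  show ?thesis
  proof (rule ennreal_le_epsilon)
    fix e :: real assume e: "0 < e"
    obtain N where N: "norm (\<Sum>i. r (i + N)) < e"
      using suminf_exist_split[OF e sr] by blast
    have tail: "(\<Sum>i. ?H (R (i + N))) \<le> ennreal e"
    proof -
      have "(\<Sum>i. ?H (R (i + N))) = ennreal (\<Sum>i. r (i + N))"
        unfolding r using r0 sr by (intro suminf_ennreal2) (auto simp: summable_iff_shift)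
      then show ?thesis using N by (simp add: ennreal_leI)
    qed
    have "X - F \<subseteq> Y N \<union> (\<Union>i. R (i + N))"
    proof
      fix x assume x: "x \<in> X - F"
      then have pos: "infdist x F > 0"
        using F Fne by (metis DiffD2 in_closed_iff_infdist_zero infdist_nonneg less_eq_real_def)
      show "x \<in> Y N \<union> (\<Union>i. R (i + N))"
      proof (cases "x \<in> Y N")
        case False
        define n where "n = (LEAST n. 1 / real (n + 1) \<le> infdist x F)"
        obtain n0 where "1 / real (n0 + 1) \<le> infdist x F"
          using reals_Archimedean[OF pos] by (auto simp: inverse_eq_divide intro: less_imp_le)
        then have n: "1 / real (n + 1) \<le> infdist x F" unfolding n_def by (rule LeastI)
        have "\<not> n \<le> N"
        proof
          assume "n \<le> N"
          then have "1 / real (N + 1) \<le> 1 / real (n + 1)" by (intro divide_left_mono) auto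
          then show False using n False x by (simp add: Y_def)
        qed
        then have "\<not> 1 / real (n - 1 + 1) \<le> infdist x F"
          using not_less_Least[of "n - 1" "\<lambda>n. 1 / real (n + 1) \<le> infdist x F"] by (simp add: n_def)
        then have "x \<in> R (n - 1)"
          using n x \<open>\<not> n \<le> N\<close> by (simp add: R_def numeral_2_eq_2 of_nat_diff not_le)
        then have "x \<in> R ((n - 1 - N) + N)" using \<open>\<not> n \<le> N\<close> by simp
        then show ?thesis by blast
      qed simp
    qed
    then have "?H (X - F) \<le> ?H (Y N \<union> (\<Union>i. R (i + N)))" by (rule hausdorff_outer_mono)
    also have "\<dots> \<le> ?H (Y N) + ?H (\<Union>i. R (i + N))" by (rule hausdorff_outer_Un)
    also have "\<dots> \<le> ?H (Y N) + ennreal e"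
      using hausdorff_outer_subadditive[of k "\<lambda>i. R (i + N)"] tail by (intro add_left_mono) simp
    finally have "?H (X \<inter> F) + ?H (X - F) \<le> (?H (X \<inter> F) + ?H (Y N)) + ennreal e"
      by (simp add: add.assoc add_left_mono)
    also have "?H (X \<inter> F) + ?H (Y N) \<le> ?H ((X \<inter> F) \<union> Y N)"
    proof (rule hausdorff_outer_metric[of "1 / real (N + 1)"])
      fix x y assume "x \<in> X \<inter> F" "y \<in> Y N"
      then show "1 / real (N + 1) \<le> dist x y"
        using infdist_le[of x F y] by (auto simp: Y_def dist_commute)
    qed simp
    also have "\<dots> \<le> ?H X" by (rule hausdorff_outer_mono) (auto simp: Y_def)
    finally show "?H (X \<inter> F) + ?H (X - F) \<le> ?H X + ennreal e" by simp
  qed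
qed

text \<open>Closed sets satisfy Caratheodory's condition by the splitting above, and the sets
  satisfying it form a sigma-algebra on which the outer measure is countably additive; this
  sigma-algebra therefore contains the Borel sets.\<close>

lemma measure_space_hausdorff:
  "measure_space UNIV (sets borel) (hausdorff_outer k :: 'a::euclidean_space set \<Rightarrow> ennreal)"
proof -
  let ?H = "hausdorff_outer k :: 'a set \<Rightarrow> ennreal"
  let ?L = "lambda_system UNIV (Pow UNIV) ?H"
  have oms: "outer_measure_space (Pow UNIV) ?H"
    unfolding outer_measure_space_def positive_def increasing_def countably_subadditive_def
    by (auto simp: hausdorff_outer_empty hausdorff_outer_mono hausdorff_outer_subadditive)
  have ms: "measure_space UNIV ?L ?H"
    by (rule sigma_algebra.caratheodory_lemma[OF sigma_algebra_Pow oms])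
  then have sa: "sigma_algebra UNIV ?L" by (simp add: measure_space_def)
  have "Collect closed \<subseteq> ?L"
  proof
    fix F :: "'a set" assume "F \<in> Collect closed"
    then have F: "closed F" by simp
    have "?H (F \<inter> X) + ?H ((UNIV - F) \<inter> X) = ?H X" for X
    proof (rule antisym)
      show "?H (F \<inter> X) + ?H ((UNIV - F) \<inter> X) \<le> ?H X"
        using hausdorff_outer_closed_split[OF F, of k X]
        by (metis Int_Diff Int_UNIV_left Int_commute)
      show "?H X \<le> ?H (F \<inter> X) + ?H ((UNIV - F) \<inter> X)"
      proof -
        have "(F \<inter> X) \<union> ((UNIV - F) \<inter> X) = X" by blast
        then show ?thesis using hausdorff_outer_Un[of k "F \<inter> X" "(UNIV - F) \<inter> X"] by simp
      qed
    qed
    then show "F \<in> ?L" by (simp add: lambda_system_def)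
  qed
  then have "sets borel \<subseteq> ?L"
    unfolding borel_eq_closed using sigma_algebra.sigma_sets_subset[OF sa] by simp
  then show ?thesis
    using ms sets.sigma_algebra_axioms[of "borel :: 'a measure"]
    unfolding measure_space_def positive_def countably_additive_def by (simp add: subset_iff image_subset_iff)
qed

section \<open>The Hausdorff measure on Borel sets and its behaviour under Lipschitz maps\<close>

lemma sets_hausdorff [simp, measurable_cong]: "sets (hausdorff_measure k) = sets borel"
  unfolding hausdorff_measure_def using sets.sets_measure_of_eq[of borel] by simp

lemma space_hausdorff [simp]: "space (hausdorff_measure k) = UNIV"
  unfolding hausdorff_measure_def by (simp add: space_measure_of_conv)

lemma emeasure_hausdorff:
  assumes "A \<in> sets borel"
  shows "emeasure (hausdorff_measure k) A = hausdorff_outer k A"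
  unfolding hausdorff_measure_def
  using measure_space_hausdorff[of k] assms
  by (intro emeasure_measure_of_sigma) (auto simp: measure_space_def)

text \<open>\<open>f\<close> is controlled on \<open>A\<close> only, so the covering sets are cut
  down to \<open>A\<close> before they are mapped; covers at scale \<open>\<delta> / L\<close> go to
  covers at scale \<open>\<delta>\<close>.\<close>

lemma hausdorff_outer_lipschitz:
  fixes f :: "'a::euclidean_space \<Rightarrow> 'a"
  assumes L: "0 < L" and lip: "\<And>x y. x \<in> A \<Longrightarrow> y \<in> A \<Longrightarrow> dist (f x) (f y) \<le> L * dist x y"
  shows "hausdorff_outer k (f ` A) \<le> ennreal (L ^ k) * hausdorff_outer k A"
proof (rule hausdorff_outer_leI)
  fix \<delta> :: real assume \<delta>: "0 < \<delta>"
  have Lk: "ennreal (L ^ k) * ennreal (1 / L ^ k) = 1"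
    using L by (simp add: ennreal_mult[symmetric])
  have "ennreal (1 / L ^ k) * hausdorff_pre k \<delta> (f ` A) \<le> (\<Sum>i. hausdorff_size k (C i))"
    if C: "C \<in> hausdorff_covers (\<delta> / L) A" for C
  proof -
    define D where "D i = f ` (C i \<inter> A)" for i
    have dD: "dist x y \<le> L * diameter (C i)" if "x \<in> D i" "y \<in> D i" for i x y
    proof -
      obtain a b where ab: "a \<in> C i" "a \<in> A" "b \<in> C i" "b \<in> A" "x = f a" "y = f b"
        using \<open>x \<in> D i\<close> \<open>y \<in> D i\<close> unfolding D_def by auto
      have "dist x y \<le> L * dist a b" using lip ab by auto
      also have "\<dots> \<le> L * diameter (C i)"
        using C ab L diameter_bounded_bound[of "C i" a b] unfolding hausdorff_covers_def
        by (intro mult_left_mono) auto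
      finally show ?thesis .
    qed
    have bD: "bounded (D i)" for i
      unfolding bounded_two_points using dD by blast
    have diamD: "diameter (D i) \<le> L * diameter (C i)" for i
    proof (rule diameter_le)
      show "D i \<noteq> {} \<or> 0 \<le> L * diameter (C i)"
        using C L diameter_ge_0[of "C i"] unfolding hausdorff_covers_def by auto
    qed (use dD in \<open>auto simp: dist_norm\<close>)
    have "D \<in> hausdorff_covers \<delta> (f ` A)"
      unfolding hausdorff_covers_def
    proof safe
      fix x assume "x \<in> A"
      then obtain i where "x \<in> C i" using C unfolding hausdorff_covers_def by blast
      then show "f x \<in> (\<Union>i. D i)" using \<open>x \<in> A\<close> by (auto simp: D_def)
    next
      fix i
      have "L * diameter (C i) \<le> L * (\<delta> / L)"
        using C L unfolding hausdorff_covers_def by (intro mult_left_mono) auto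
      then show "diameter (D i) \<le> \<delta>" using diamD[of i] L by simp
    qed (rule bD)
    then have "hausdorff_pre k \<delta> (f ` A) \<le> (\<Sum>i. hausdorff_size k (D i))"
      by (rule hausdorff_pre_le)
    also have "\<dots> \<le> (\<Sum>i. ennreal (L ^ k) * hausdorff_size k (C i))"
    proof (intro suminf_le)
      fix i
      show "hausdorff_size k (D i) \<le> ennreal (L ^ k) * hausdorff_size k (C i)"
      proof (cases "D i = {}")
        case False
        then have "C i \<noteq> {}" by (auto simp: D_def)
        have "(diameter (D i) / 2) ^ k \<le> (L * diameter (C i) / 2) ^ k"
          using diamD[of i] diameter_ge_0[OF bD, of i] by (intro power_mono) auto
        then have "unit_ball_vol (real k) * (diameter (D i) / 2) ^ k
            \<le> L ^ k * (unit_ball_vol (real k) * (diameter (C i) / 2) ^ k)"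
          using mult_left_mono[of _ _ "unit_ball_vol (real k)"]
          by (fastforce simp: power_mult_distrib power_divide mult_ac)
        then show ?thesis
          using False \<open>C i \<noteq> {}\<close> L
          by (simp add: hausdorff_size_def ennreal_mult'[symmetric] ennreal_leI)
      qed (simp add: hausdorff_size_def)
    qed auto
    also have "\<dots> = ennreal (L ^ k) * (\<Sum>i. hausdorff_size k (C i))" by simp
    finally have "ennreal (1 / L ^ k) * hausdorff_pre k \<delta> (f ` A)
        \<le> ennreal (1 / L ^ k) * (ennreal (L ^ k) * (\<Sum>i. hausdorff_size k (C i)))"
      by (rule mult_left_mono) simp
    also have "\<dots> = (\<Sum>i. hausdorff_size k (C i))"
      using Lk by (simp add: mult.assoc[symmetric] mult.commute)
    finally show ?thesis .
  qed
  then have "ennreal (1 / L ^ k) * hausdorff_pre k \<delta> (f ` A) \<le> hausdorff_pre k (\<delta> / L) A"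
    unfolding hausdorff_pre_def[of k "\<delta> / L"] by (rule INF_greatest)
  also have "\<dots> \<le> hausdorff_outer k A" using \<delta> L by (intro hausdorff_pre_le_outer) simp
  finally have "ennreal (L ^ k) * (ennreal (1 / L ^ k) * hausdorff_pre k \<delta> (f ` A))
      \<le> ennreal (L ^ k) * hausdorff_outer k A" by (rule mult_left_mono) simp
  then show "hausdorff_pre k \<delta> (f ` A) \<le> ennreal (L ^ k) * hausdorff_outer k A"
    using Lk by (simp add: mult.assoc[symmetric])
qed

lemma hausdorff_outer_isometry:
  fixes f :: "'a::euclidean_space \<Rightarrow> 'a"
  assumes iso: "\<And>x y. dist (f x) (f y) = dist x y" 
  shows "hausdorff_outer k (f ` A) = hausdorff_outer k A"
proof (rule antisym)
  show "hausdorff_outer k (f ` A) \<le> hausdorff_outer k A"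
    using hausdorff_outer_lipschitz[of 1 A f k] iso by simp
  have inj: "inj f" using iso by (metis dist_eq_0_iff injI)
  have "hausdorff_outer k (inv f ` (f ` A)) \<le> hausdorff_outer k (f ` A)"
    using hausdorff_outer_lipschitz[of 1 "f ` A" "inv f" k] iso inj
    by (fastforce simp: inv_f_f)
  then show "hausdorff_outer k A \<le> hausdorff_outer k (f ` A)"
    using inj by (simp add: image_image inv_f_f)
qed

section \<open>Hausdorff measure of hyperplanes\<close>

subsection \<open>Fubini along parallel lines\<close>

lemma nn_integral_lborel_translate:
  fixes f :: "'a::euclidean_space \<Rightarrow> ennreal"
  assumes [measurable]: "f \<in> borel_measurable borel"
  shows "(\<integral>\<^sup>+x. f (c + x) \<partial>lborel) = (\<integral>\<^sup>+x. f x \<partial>lborel)"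
proof -
  have "(\<integral>\<^sup>+x. f x \<partial>lborel) = (\<integral>\<^sup>+x. f x \<partial>distr lborel borel ((+) c))"
    by (simp add: lborel_distr_plus)
  then show ?thesis by (simp add: nn_integral_distr)
qed

text \<open>Inserting the integral of \<open>w (x - s e)\<close> over \<open>s\<close>, which is
  one, exchanging the integrals and translating by \<open>s e\<close> moves the shift from
  \<open>w\<close> to \<open>F\<close>. This is Fubini in direction \<open>e\<close> without a
  choice of coordinates; later \<open>w\<close> is the indicator of a slab.\<close>

lemma nn_integral_along_lines:
  fixes F w :: "'a::euclidean_space \<Rightarrow> ennreal"
  assumes [measurable]: "F \<in> borel_measurable borel" "w \<in> borel_measurable borel"
    and w: "\<And>x. (\<integral>\<^sup>+s. w (x - s *\<^sub>R e) \<partial>lborel) = 1"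
  shows "(\<integral>\<^sup>+x. F x \<partial>lborel) = (\<integral>\<^sup>+x. w x * (\<integral>\<^sup>+s. F (x + s *\<^sub>R e) \<partial>lborel) \<partial>lborel)"
proof -
  have "(\<integral>\<^sup>+x. F x \<partial>lborel) = (\<integral>\<^sup>+x. (\<integral>\<^sup>+s. F x * w (x - s *\<^sub>R e) \<partial>lborel) \<partial>lborel)"
    by (simp add: nn_integral_cmult w)
  also have "\<dots> = (\<integral>\<^sup>+s. (\<integral>\<^sup>+x. F x * w (x - s *\<^sub>R e) \<partial>lborel) \<partial>lborel)"
    by (rule lborel_pair.Fubini'[symmetric]) measurable
  also have "\<dots> = (\<integral>\<^sup>+s. (\<integral>\<^sup>+x. F (s *\<^sub>R e + x) * w x \<partial>lborel) \<partial>lborel)"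
  proof (rule nn_integral_cong)
    fix s :: real
    show "(\<integral>\<^sup>+x. F x * w (x - s *\<^sub>R e) \<partial>lborel) = (\<integral>\<^sup>+x. F (s *\<^sub>R e + x) * w x \<partial>lborel)"
      using nn_integral_lborel_translate[of "\<lambda>x. F x * w (x - s *\<^sub>R e)" "s *\<^sub>R e"] by simp
  qed
  also have "\<dots> = (\<integral>\<^sup>+x. (\<integral>\<^sup>+s. F (s *\<^sub>R e + x) * w x \<partial>lborel) \<partial>lborel)"
    by (rule lborel_pair.Fubini') measurable
  also have "\<dots> = (\<integral>\<^sup>+x. w x * (\<integral>\<^sup>+s. F (x + s *\<^sub>R e) \<partial>lborel) \<partial>lborel)"
    by (simp add: nn_integral_cmult[symmetric] mult.commute add.commute)
  finally show ?thesis .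
qed

definition slab :: "'a::euclidean_space \<Rightarrow> real \<Rightarrow> 'a set" where
  "slab N a = {x. \<bar>x \<bullet> N\<bar> \<le> a / 2}"

definition nproj :: "'a::euclidean_space \<Rightarrow> 'a \<Rightarrow> 'a" where
  "nproj N x = x - (x \<bullet> N) *\<^sub>R N"

text \<open>For unit \<open>N\<close> and \<open>E\<close> inside the hyperplane orthogonal to
  \<open>N\<close> this is the Lebesgue measure of \<open>E\<close> of one dimension less, encoded
  as the volume of the cylinder of height one over \<open>E\<close>.\<close>

definition flat_vol :: "'a::euclidean_space \<Rightarrow> 'a set \<Rightarrow> ennreal" where
  "flat_vol N E = emeasure lborel (slab N 1 \<inter> nproj N -` E)"

lemma slab_borel [measurable]: "slab N a \<in> sets borel"
proof -
  have "closed (slab N a)" unfolding slab_def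
    by (intro closed_Collect_le continuous_intros)
  then show ?thesis by (rule borel_closed)
qed

lemma nproj_measurable [measurable]: "nproj N \<in> borel_measurable borel"
  unfolding nproj_def[abs_def] by measurable

lemma nproj_vimage [measurable]: "E \<in> sets borel \<Longrightarrow> nproj N -` E \<in> sets borel"
  using measurable_sets[OF nproj_measurable, of E N] by simp

lemma slab_line:
  assumes a: "e \<bullet> N = a" "a > 0" and b: "0 \<le> b"
  shows "(\<integral>\<^sup>+s. indicator (slab N b) (x + s *\<^sub>R e) \<partial>lborel) = ennreal (b / a)"
    and "(\<integral>\<^sup>+s. indicator (slab N b) (x - s *\<^sub>R e) \<partial>lborel) = ennreal (b / a)"
proof -
  let ?c = "(x \<bullet> N) / a" and ?h = "b / (2 * a)"
  have 1: "x + s *\<^sub>R e \<in> slab N b \<longleftrightarrow> s \<in> {- ?c - ?h..- ?c + ?h}" for s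
    using a unfolding slab_def mem_Collect_eq inner_simps abs_le_iff by (auto simp: field_simps)
  have 2: "x - s *\<^sub>R e \<in> slab N b \<longleftrightarrow> s \<in> {?c - ?h..?c + ?h}" for s
    using a unfolding slab_def mem_Collect_eq inner_simps abs_le_iff by (auto simp: field_simps)
  have h: "0 \<le> ?h" using a b by simp
  have "(\<integral>\<^sup>+s. indicator (slab N b) (x + s *\<^sub>R e) \<partial>lborel) = (\<integral>\<^sup>+s. indicator {- ?c - ?h..- ?c + ?h} s \<partial>lborel)"
    using 1 by (intro nn_integral_cong) (simp add: indicator_def)
  also have "\<dots> = ennreal (b / a)" using h a by (simp add: field_simps)
  finally show "(\<integral>\<^sup>+s. indicator (slab N b) (x + s *\<^sub>R e) \<partial>lborel) = ennreal (b / a)" .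
  have "(\<integral>\<^sup>+s. indicator (slab N b) (x - s *\<^sub>R e) \<partial>lborel) = (\<integral>\<^sup>+s. indicator {?c - ?h..?c + ?h} s \<partial>lborel)"
    using 2 by (intro nn_integral_cong) (simp add: indicator_def)
  also have "\<dots> = ennreal (b / a)" using h a by (simp add: field_simps)
  finally show "(\<integral>\<^sup>+s. indicator (slab N b) (x - s *\<^sub>R e) \<partial>lborel) = ennreal (b / a)" .
qed

text \<open>With thickness \<open>e \<bullet> N\<close> every line in direction \<open>e\<close>
  spends parameter length exactly one in the slab, which makes its indicator an admissible
  weight.\<close>

lemma slab_weight:
  assumes a: "e \<bullet> N = a" "a > 0"
  shows "(\<integral>\<^sup>+s. indicator (slab N a) (x - s *\<^sub>R e) \<partial>lborel) = 1"
  using slab_line(2)[OF a, of a x] a by simp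

text \<open>A set invariant along \<open>e\<close> meets a slab in a volume that depends only on the
  parameter length its lines spend there. The two normals may differ: this will relate a slab
  orthogonal to \<open>e\<close> to one parallel to a tangent plane.\<close>

lemma slab_thickness:
  fixes e :: "'a::euclidean_space"
  assumes A[measurable]: "A \<in> sets borel" and inv: "\<And>x s. x + s *\<^sub>R e \<in> A \<longleftrightarrow> x \<in> A"
    and a: "e \<bullet> N = a" "a > 0" and a': "e \<bullet> N' = a'" "a' > 0" and b: "0 \<le> b"
  shows "emeasure lborel (slab N' b \<inter> A) = ennreal (b / a') * emeasure lborel (slab N a \<inter> A)"
proof -
  have "emeasure lborel (slab N' b \<inter> A) = (\<integral>\<^sup>+x. indicator (slab N' b \<inter> A) x \<partial>lborel)"
    by simp
  also have "\<dots> = (\<integral>\<^sup>+x. indicator (slab N a) x *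
      (\<integral>\<^sup>+s. indicator (slab N' b \<inter> A) (x + s *\<^sub>R e) \<partial>lborel) \<partial>lborel)"
    by (rule nn_integral_along_lines[OF _ _ slab_weight[OF a]]) measurable
  also have "\<dots> = (\<integral>\<^sup>+x. ennreal (b / a') * indicator (slab N a \<inter> A) x \<partial>lborel)"
  proof (rule nn_integral_cong)
    fix x
    have "(\<integral>\<^sup>+s. indicator (slab N' b \<inter> A) (x + s *\<^sub>R e) \<partial>lborel)
        = (\<integral>\<^sup>+s. indicator A x * indicator (slab N' b) (x + s *\<^sub>R e) \<partial>lborel)"
      by (intro nn_integral_cong) (auto simp: indicator_def inv)
    also have "\<dots> = indicator A x * ennreal (b / a')"
      by (subst nn_integral_cmult) (simp_all add: slab_line(1)[OF a' b])
    finally have eq: "(\<integral>\<^sup>+s. indicator (slab N' b \<inter> A) (x + s *\<^sub>R e) \<partial>lborel)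
        = indicator A x * ennreal (b / a')" .
    show "indicator (slab N a) x * (\<integral>\<^sup>+s. indicator (slab N' b \<inter> A) (x + s *\<^sub>R e) \<partial>lborel)
        = ennreal (b / a') * indicator (slab N a \<inter> A) x"
      unfolding eq by (simp add: indicator_inter_arith mult_ac)
  qed
  also have "\<dots> = ennreal (b / a') * emeasure lborel (slab N a \<inter> A)"
    by (simp add: nn_integral_cmult)
  finally show ?thesis .
qed

text \<open>Since \<open>h\<close> is constant along \<open>v\<close>, the map is a translation on
  each line parallel to \<open>v\<close>.\<close>

lemma emeasure_shear:
  fixes v :: "'a::euclidean_space"
  assumes B[measurable]: "B \<in> sets borel" and h[measurable]: "h \<in> borel_measurable borel"
    and inv: "\<And>x s. h (x + s *\<^sub>R v) = h x"
  shows "emeasure lborel {x. x + h x *\<^sub>R v \<in> B} = emeasure lborel B"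
proof (cases "v = 0")
  case False
  then have v: "v \<bullet> v = v \<bullet> v" "v \<bullet> v > 0" by auto
  let ?S = "{x. x + h x *\<^sub>R v \<in> B}"
  have S[measurable]: "?S \<in> sets borel"
  proof -
    have "(\<lambda>x. x + h x *\<^sub>R v) -` B \<inter> space borel \<in> sets borel"
      by (rule measurable_sets[OF _ B]) measurable
    then show ?thesis by (simp add: vimage_def)
  qed
  have "emeasure lborel ?S = (\<integral>\<^sup>+x. indicator ?S x \<partial>lborel)" by simp
  also have "\<dots> = (\<integral>\<^sup>+x. indicator (slab v (v \<bullet> v)) x *
      (\<integral>\<^sup>+s. indicator ?S (x + s *\<^sub>R v) \<partial>lborel) \<partial>lborel)"
    by (rule nn_integral_along_lines[OF _ _ slab_weight[OF v]]) measurable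
  also have "\<dots> = (\<integral>\<^sup>+x. indicator (slab v (v \<bullet> v)) x *
      (\<integral>\<^sup>+s. indicator B (x + s *\<^sub>R v) \<partial>lborel) \<partial>lborel)"
  proof (rule nn_integral_cong)
    fix x
    have "(\<integral>\<^sup>+s. indicator ?S (x + s *\<^sub>R v) \<partial>lborel)
        = (\<integral>\<^sup>+s. indicator B (x + (h x + s) *\<^sub>R v) \<partial>lborel)"
      by (intro nn_integral_cong) (simp add: indicator_def inv algebra_simps)
    also have "\<dots> = (\<integral>\<^sup>+s. indicator B (x + s *\<^sub>R v) \<partial>lborel)"
      by (rule nn_integral_lborel_translate[of "\<lambda>s. indicator B (x + s *\<^sub>R v)" "h x"]) measurable
    finally show "indicator (slab v (v \<bullet> v)) x * (\<integral>\<^sup>+s. indicator ?S (x + s *\<^sub>R v) \<partial>lborel) =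
        indicator (slab v (v \<bullet> v)) x * (\<integral>\<^sup>+s. indicator B (x + s *\<^sub>R v) \<partial>lborel)"
      by simp
  qed
  also have "\<dots> = (\<integral>\<^sup>+x. indicator B x \<partial>lborel)"
    by (rule nn_integral_along_lines[OF _ _ slab_weight[OF v], symmetric]) measurable
  also have "\<dots> = emeasure lborel B" by simp
  finally show ?thesis .
qed simp

lemma nproj_line: "norm N = 1 \<Longrightarrow> nproj N (x + s *\<^sub>R N) = nproj N x"
  by (simp add: nproj_def inner_simps norm_eq_1 algebra_simps)

lemma nproj_orthogonal: "norm N = 1 \<Longrightarrow> nproj N x \<bullet> N = 0"
  by (simp add: nproj_def inner_simps norm_eq_1)

lemma flat_vol_thickness:
  assumes N: "norm N = 1" and [measurable]: "E \<in> sets borel" and b: "0 \<le> b"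
  shows "emeasure lborel (slab N b \<inter> nproj N -` E) = ennreal b * flat_vol N E"
  unfolding flat_vol_def
  using slab_thickness[of "nproj N -` E" N N 1 N 1 b] N b by (simp add: nproj_line norm_eq_1)

text \<open>A shear parallel to the hyperplane preserves the slab and all volumes, and turns the
  projection along \<open>e\<close> into the orthogonal projection.\<close>

lemma oblique_cylinder:
  assumes N: "norm N = 1" and a: "e \<bullet> N = a" "a > 0" and E[measurable]: "E \<in> sets borel"
  shows "emeasure lborel (slab N a \<inter> {x. x - (x \<bullet> N / a) *\<^sub>R e \<in> E}) = ennreal a * flat_vol N E"
proof -
  define v where "v = e - a *\<^sub>R N"
  define h where "h x = - (x \<bullet> N) / a" for x
  have vN: "v \<bullet> N = 0" using a N by (simp add: v_def inner_simps norm_eq_1)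
  have proj: "nproj N (x + h x *\<^sub>R v) = x - (x \<bullet> N / a) *\<^sub>R e" for x
    using a vN by (simp add: nproj_def inner_simps h_def v_def algebra_simps)
  have "x + h x *\<^sub>R v \<in> slab N a \<longleftrightarrow> x \<in> slab N a" for x
    by (simp add: slab_def inner_simps vN)
  then have "slab N a \<inter> {x. x - (x \<bullet> N / a) *\<^sub>R e \<in> E} = {x. x + h x *\<^sub>R v \<in> slab N a \<inter> nproj N -` E}"
    using proj by auto
  also have "emeasure lborel \<dots> = emeasure lborel (slab N a \<inter> nproj N -` E)"
  proof (rule emeasure_shear)
    show "h \<in> borel_measurable borel" unfolding h_def[abs_def] by measurable
    show "h (x + s *\<^sub>R v) = h x" for x s by (simp add: h_def inner_simps vN)
  qed measurable
  also have "\<dots> = ennreal a * flat_vol N E"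
    using a by (intro flat_vol_thickness[OF N]) auto
  finally show ?thesis .
qed

subsection \<open>Uniqueness of translation-invariant measures\<close>

text \<open>Uniqueness of invariant measures by the argument for Haar measure: the double integral
  of \<open>A(x) B(x + y)\<close> is evaluated in both orders. \<open>T\<close> supplies the
  translations and also carries both measures, so that almost every point can itself serve as a
  translation. The reflection of \<open>A\<close> arises when \<open>A\<close> is evaluated at
  \<open>x - y\<close> as a function of \<open>y\<close>.\<close>

lemma translation_invariant_unique:
  fixes M1 M2 :: "'a::euclidean_space measure"
  assumes "sigma_finite_measure M1" "sigma_finite_measure M2"
    and s1[measurable_cong]: "sets M1 = sets borel" and s2[measurable_cong]: "sets M2 = sets borel"
    and T1: "AE x in M1. x \<in> T" and T2: "AE x in M2. x \<in> T"
    and i1: "\<And>A v. A \<in> sets borel \<Longrightarrow> v \<in> T \<Longrightarrow> emeasure M1 ((+) v -` A) = emeasure M1 A"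
    and i2: "\<And>A v. A \<in> sets borel \<Longrightarrow> v \<in> T \<Longrightarrow> emeasure M2 ((+) v -` A) = emeasure M2 A"
    and neg: "\<And>v. v \<in> T \<Longrightarrow> - v \<in> T"
    and A[measurable]: "A \<in> sets borel" and B[measurable]: "B \<in> sets borel"
  shows "emeasure M1 A * emeasure M2 B = emeasure M2 (uminus -` A) * emeasure M1 B"
proof -
  interpret M1: sigma_finite_measure M1 by fact
  interpret M2: sigma_finite_measure M2 by fact
  interpret P: pair_sigma_finite M1 M2 ..
  have tb: "(+) v -` X \<in> sets borel" if "X \<in> sets borel" for v :: 'a and X
    using measurable_sets[of "(+) v" borel borel X] that by simp
  have um: "uminus -` A \<in> sets borel"
    using measurable_sets[of uminus borel borel A] A by simp
  have "emeasure M1 A * emeasure M2 B = (\<integral>\<^sup>+x. indicator A x * emeasure M2 B \<partial>M1)"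
    by (simp add: nn_integral_multc s1)
  also have "\<dots> = (\<integral>\<^sup>+x. (\<integral>\<^sup>+y. indicator A x * indicator B (x + y) \<partial>M2) \<partial>M1)"
  proof (rule nn_integral_cong_AE, use T1 in eventually_elim)
    fix x assume x: "x \<in> T"
    have "(\<integral>\<^sup>+y. indicator B (x + y) \<partial>M2) = (\<integral>\<^sup>+y. indicator ((+) x -` B) y \<partial>M2)"
      by (intro nn_integral_cong) (simp add: indicator_def)
    also have "\<dots> = emeasure M2 B" using i2[OF B x] tb[OF B] by (simp add: s2)
    finally have "(\<integral>\<^sup>+y. indicator B (x + y) \<partial>M2) = emeasure M2 B" .
    then show "indicator A x * emeasure M2 B = (\<integral>\<^sup>+y. indicator A x * indicator B (x + y) \<partial>M2)"
      by (subst nn_integral_cmult) auto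
  qed
  also have "\<dots> = (\<integral>\<^sup>+y. (\<integral>\<^sup>+x. indicator A x * indicator B (x + y) \<partial>M1) \<partial>M2)"
    by (rule P.Fubini'[symmetric]) measurable
  also have "\<dots> = (\<integral>\<^sup>+y. (\<integral>\<^sup>+x. indicator A (x - y) * indicator B x \<partial>M1) \<partial>M2)"
  proof (rule nn_integral_cong_AE, use T2 in eventually_elim)
    fix y assume y: "y \<in> T"
    have "(\<integral>\<^sup>+x. indicator A x * indicator B (x + y) \<partial>M1) = (\<integral>\<^sup>+x. indicator (A \<inter> (+) y -` B) x \<partial>M1)"
      by (intro nn_integral_cong) (simp add: indicator_def add.commute)
    also have "\<dots> = emeasure M1 (A \<inter> (+) y -` B)" using A tb[OF B] by (simp add: s1)
    also have "A \<inter> (+) y -` B = (+) y -` ((+) (- y) -` A \<inter> B)" by auto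
    also have "emeasure M1 \<dots> = emeasure M1 ((+) (- y) -` A \<inter> B)"
      using tb[OF A] B by (intro i1 y) auto
    also have "\<dots> = (\<integral>\<^sup>+x. indicator ((+) (- y) -` A \<inter> B) x \<partial>M1)"
      using tb[OF A] B by (simp add: s1)
    also have "\<dots> = (\<integral>\<^sup>+x. indicator A (x - y) * indicator B x \<partial>M1)"
      by (intro nn_integral_cong) (simp add: indicator_def)
    finally show "(\<integral>\<^sup>+x. indicator A x * indicator B (x + y) \<partial>M1)
        = (\<integral>\<^sup>+x. indicator A (x - y) * indicator B x \<partial>M1)" .
  qed
  also have "\<dots> = (\<integral>\<^sup>+x. (\<integral>\<^sup>+y. indicator A (x - y) * indicator B x \<partial>M2) \<partial>M1)"
    by (rule P.Fubini') measurable
  also have "\<dots> = (\<integral>\<^sup>+x. emeasure M2 (uminus -` A) * indicator B x \<partial>M1)"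
  proof (rule nn_integral_cong_AE, use T1 in eventually_elim)
    fix x assume x: "x \<in> T"
    have "(\<integral>\<^sup>+y. indicator A (x - y) \<partial>M2) = (\<integral>\<^sup>+y. indicator ((+) (- x) -` (uminus -` A)) y \<partial>M2)"
      by (intro nn_integral_cong) (simp add: indicator_def)
    also have "\<dots> = emeasure M2 (uminus -` A)"
      using i2[OF um neg[OF x]] tb[OF um, of "- x"] by (simp add: s2)
    finally have "(\<integral>\<^sup>+y. indicator A (x - y) \<partial>M2) = emeasure M2 (uminus -` A)" .
    then show "(\<integral>\<^sup>+y. indicator A (x - y) * indicator B x \<partial>M2) = emeasure M2 (uminus -` A) * indicator B x"
      by (subst nn_integral_multc) auto
  qed
  also have "\<dots> = emeasure M2 (uminus -` A) * emeasure M1 B"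
    by (simp add: nn_integral_cmult s1)
  finally show ?thesis .
qed

section \<open>Invariance of Lebesgue measure under translations and linear isometries\<close>

lemma lborel_translate:
  assumes "A \<in> sets borel"
  shows "emeasure lborel ((+) (v::'a::euclidean_space) -` A) = emeasure lborel A"
proof -
  have "emeasure lborel A = emeasure (distr lborel borel ((+) v)) A" by (simp add: lborel_distr_plus)
  then show ?thesis using assms by (simp add: emeasure_distr)
qed

lemma emeasure_lborel_bounded_finite: "bounded A \<Longrightarrow> emeasure lborel A < \<infinity>"
  by (metis bounded_subset_cbox_symmetric emeasure_lborel_cbox_finite emeasure_mono
      order_le_less_trans sets_lborel cbox_borel)

lemma sigma_finite_cballI:
  fixes M :: "'a::euclidean_space measure"
  assumes "sets M = sets borel" "\<And>n::nat. emeasure M (cball 0 (real n)) < \<infinity>"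
  shows "sigma_finite_measure M"
proof
  have "(\<Union>n. cball 0 (real n)) = (UNIV :: 'a set)"
    by (auto intro: real_arch_simple)
  moreover have "space M = UNIV" using sets_eq_imp_space_eq[OF assms(1)] by simp
  ultimately show "\<exists>A. countable A \<and> A \<subseteq> sets M \<and> \<Union> A = space M \<and> (\<forall>a\<in>A. emeasure M a \<noteq> \<infinity>)"
    using assms by (intro exI[of _ "range (\<lambda>n. cball 0 (real n))"]) (auto simp: less_top)
qed

lemma unit_ball_vol_nonzero: "unit_ball_vol (real k) \<noteq> 0"
  using unit_ball_vol_pos[of "real k"] by linarith

text \<open>The image of Lebesgue measure under a linear isometry is translation invariant and
  agrees with it on the unit ball, so the two coincide up to the reflection left over from the
  uniqueness argument. Applying the same fact to the identity removes the reflection.\<close>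

lemma emeasure_lborel_isometry:
  fixes f :: "'a::euclidean_space \<Rightarrow> 'a"
  assumes f: "linear f" "\<And>x. norm (f x) = norm x" and A[measurable]: "A \<in> sets borel"
    and surj: "surj f"
  shows "emeasure lborel (f -` A) = emeasure lborel A"
proof -
  have fm: "f \<in> borel_measurable borel"
    using linear_continuous_on[OF linear_conv_bounded_linear[THEN iffD1, OF f(1)]]
    by (intro borel_measurable_continuous_onI) auto
  have um: "uminus -` X \<in> sets borel" if "X \<in> sets borel" for X :: "'a set"
    using measurable_sets[of uminus borel borel X] that by simp
  let ?B = "cball (0::'a) 1"
  have B: "emeasure lborel ?B \<noteq> 0" "emeasure lborel ?B \<noteq> \<infinity>"
    using emeasure_lborel_cball_finite[of "0::'a" 1] unit_ball_vol_nonzero[of "DIM('a)"]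
    by (auto simp: emeasure_cball)
  have key: "emeasure lborel X = emeasure lborel (g -` (uminus -` X))"
    if g: "linear g" "\<And>x. norm (g x) = norm x" "g \<in> borel_measurable borel" "surj g"
      and X: "X \<in> sets borel" for g :: "'a \<Rightarrow> 'a" and X
  proof -
    let ?M = "distr lborel borel g"
    have eB: "emeasure ?M ?B = emeasure lborel ?B"
    proof -
      have "g -` ?B = ?B" using g(2) by (auto simp: dist_norm)
      then show ?thesis using g(3) by (simp add: emeasure_distr)
    qed
    have vc: "g -` cball 0 (real n) = cball 0 (real n)" for n using g(2) by auto
    have "emeasure lborel X * emeasure ?M ?B = emeasure ?M (uminus -` X) * emeasure lborel ?B"
    proof (rule translation_invariant_unique[where T=UNIV])
      show "sigma_finite_measure ?M"
        using g(3) emeasure_lborel_cball_finite[of "0::'a"]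
        by (intro sigma_finite_cballI) (simp_all add: emeasure_distr vc)
      show "emeasure ?M ((+) v -` Y) = emeasure ?M Y" if Y: "Y \<in> sets borel" for Y v
      proof -
        obtain u where u: "v = g u" using g(4) by (metis surjD)
        have 1: "g -` ((+) v -` Y) = (+) u -` (g -` Y)"
          using linear_add[OF g(1)] by (auto simp: u)
        have 2: "g -` Y \<in> sets borel" using measurable_sets[OF g(3) Y] by simp
        have 3: "(+) v -` Y \<in> sets borel" using measurable_sets[of "(+) v" borel borel Y] Y by simp
        show ?thesis using lborel_translate[OF 2, of u] 1 3 Y g(3) by (simp add: emeasure_distr)
      qed
    qed (use X lborel_translate in \<open>auto intro: sigma_finite_lborel\<close>)
    then have "emeasure lborel X * emeasure lborel ?B / emeasure lborel ?B
        = emeasure ?M (uminus -` X) * emeasure lborel ?B / emeasure lborel ?B"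
      unfolding eB by (rule arg_cong)
    then have "emeasure lborel X = emeasure ?M (uminus -` X)"
      using B by (metis ennreal_mult_divide_eq infinity_ennreal_def)
    then show ?thesis using um[OF X] g(3) by (simp add: emeasure_distr)
  qed
  have "emeasure lborel (f -` A) = emeasure lborel (uminus -` A)"
    using key[OF f fm surj um[OF A]] by (simp add: vimage_def)
  also have "\<dots> = emeasure lborel A"
    using key[of "\<lambda>x. x" A] A by (auto simp: linear_id[unfolded id_def])
  finally show ?thesis .
qed

subsection \<open>The Hausdorff measure of a hyperplane\<close>

definition hyperplane :: "'a::euclidean_space \<Rightarrow> 'a set" where
  "hyperplane N = {x. x \<bullet> N = 0}"

lemma closed_hyperplane_N: "closed (hyperplane N)"
  unfolding hyperplane_def by (intro closed_Collect_eq continuous_intros)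

lemma hyperplane_borel [measurable]: "hyperplane N \<in> sets borel"
  by (rule borel_closed[OF closed_hyperplane_N])

lemma nproj_in_hyperplane: "norm N = 1 \<Longrightarrow> nproj N x \<in> hyperplane N"
  by (simp add: hyperplane_def nproj_orthogonal)

lemma flat_vol_mono: "E \<subseteq> F \<Longrightarrow> F \<in> sets borel \<Longrightarrow> flat_vol N E \<le> flat_vol N F"
  unfolding flat_vol_def by (rule emeasure_mono) auto

lemma norm_le_slab_nproj: "norm N = 1 \<Longrightarrow> norm x \<le> \<bar>x \<bullet> N\<bar> + norm (nproj N x)"
proof -
  assume N: "norm N = 1"
  have "x = (x \<bullet> N) *\<^sub>R N + nproj N x" by (simp add: nproj_def)
  then have "norm x \<le> norm ((x \<bullet> N) *\<^sub>R N) + norm (nproj N x)"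
    using norm_triangle_ineq[of "(x \<bullet> N) *\<^sub>R N" "nproj N x"] by simp
  then show ?thesis using N by simp
qed

lemma norm_nproj_le: "norm N = 1 \<Longrightarrow> norm (nproj N x) \<le> norm x"
proof -
  assume N: "norm N = 1"
  have "(norm (nproj N x))\<^sup>2 = (norm x)\<^sup>2 - (x \<bullet> N)\<^sup>2"
    using N unfolding nproj_def power2_norm_eq_inner norm_eq_1
    by (simp add: inner_diff_left inner_diff_right inner_commute power2_eq_square)
  then have "(norm (nproj N x))\<^sup>2 \<le> (norm x)\<^sup>2" by simp
  then show ?thesis by (rule power2_le_imp_le) simp
qed

lemma flat_vol_cball_finite: "norm N = 1 \<Longrightarrow> flat_vol N (cball 0 R) < \<infinity>"
proof -
  assume N: "norm N = 1"
  have "bounded (slab N 1 \<inter> nproj N -` cball 0 R)"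
  proof (rule boundedI)
    fix x assume "x \<in> slab N 1 \<inter> nproj N -` cball 0 R"
    then show "norm x \<le> 1 / 2 + R" using norm_le_slab_nproj[OF N, of x] by (simp add: slab_def)
  qed
  then show ?thesis unfolding flat_vol_def by (rule emeasure_lborel_bounded_finite)
qed

lemma flat_vol_cball_pos: "norm N = 1 \<Longrightarrow> flat_vol N (cball 0 1) > 0"
proof -
  assume N: "norm N = 1"
  have "ball 0 (1/2) \<subseteq> slab N 1 \<inter> nproj N -` cball 0 1"
  proof
    fix x :: 'a assume "x \<in> ball 0 (1/2)"
    then have x: "norm x < 1/2" by simp
    then have "\<bar>x \<bullet> N\<bar> \<le> 1/2" using Cauchy_Schwarz_ineq2[of x N] N by simp
    then show "x \<in> slab N 1 \<inter> nproj N -` cball 0 1"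
      using norm_nproj_le[OF N, of x] x by (simp add: slab_def)
  qed
  then have "emeasure lborel (ball (0::'a) (1/2)) \<le> flat_vol N (cball 0 1)"
    unfolding flat_vol_def by (rule emeasure_mono) measurable
  moreover have "emeasure lborel (ball (0::'a) (1/2)) > 0"
    by (simp add: emeasure_ball)
  ultimately show ?thesis by (rule order_less_le_trans[rotated])
qed

text \<open>The cylinder of height \<open>d\<close> over a ball of radius \<open>d\<close> fits into
  a ball of radius \<open>2 * d\<close>, and its volume is \<open>d\<close> times the flat
  volume.\<close>

lemma flat_vol_cball_le:
  fixes N :: "'a::euclidean_space"
  assumes N: "norm N = 1" and c: "c \<in> hyperplane N" and d: "0 < d" and D: "DIM('a) = Suc k"
  shows "flat_vol N (cball c d) \<le> ennreal (unit_ball_vol (real (Suc k)) * 2 ^ Suc k * d ^ k)"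
proof -
  have "slab N d \<inter> nproj N -` cball c d \<subseteq> cball c (2 * d)"
  proof
    fix x assume x: "x \<in> slab N d \<inter> nproj N -` cball c d"
    have "norm (x - c) \<le> \<bar>(x - c) \<bullet> N\<bar> + norm (nproj N (x - c))" by (rule norm_le_slab_nproj[OF N])
    also have "(x - c) \<bullet> N = x \<bullet> N" using c by (simp add: hyperplane_def inner_simps)
    also have "nproj N (x - c) = nproj N x - c" using c by (simp add: hyperplane_def inner_simps nproj_def)
    also have "\<bar>x \<bullet> N\<bar> + norm (nproj N x - c) \<le> d / 2 + d"
      using x by (intro add_mono) (auto simp: slab_def dist_norm norm_minus_commute)
    finally show "x \<in> cball c (2 * d)" using d by (simp add: dist_norm norm_minus_commute)
  qed
  then have "emeasure lborel (slab N d \<inter> nproj N -` cball c d) \<le> emeasure lborel (cball c (2 * d))"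
    by (rule emeasure_mono) simp
  also have "\<dots> = ennreal (unit_ball_vol (real (Suc k)) * (2 * d) ^ Suc k)"
    using d by (simp add: emeasure_cball D del: power_Suc)
  finally have "ennreal d * flat_vol N (cball c d)
      \<le> ennreal (unit_ball_vol (real (Suc k)) * (2 * d) ^ Suc k)"
    using d by (simp add: flat_vol_thickness[OF N])
  then have "ennreal (1 / d) * (ennreal d * flat_vol N (cball c d))
      \<le> ennreal (1 / d) * ennreal (unit_ball_vol (real (Suc k)) * (2 * d) ^ Suc k)"
    by (rule mult_left_mono) simp
  also have "ennreal (1 / d) * (ennreal d * flat_vol N (cball c d)) = flat_vol N (cball c d)"
    using d by (simp add: mult.assoc[symmetric] ennreal_mult[symmetric])
  also have "ennreal (1 / d) * ennreal (unit_ball_vol (real (Suc k)) * (2 * d) ^ Suc k)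
      = ennreal (unit_ball_vol (real (Suc k)) * 2 ^ Suc k * d ^ k)"
    using d by (subst ennreal_mult[symmetric]) (auto simp: power_mult_distrib)
  finally show ?thesis .
qed

text \<open>Radius zero matters because a covering set may be a single point; there
  \<open>k > 0\<close> gives a bound through \<open>r ^ k \<le> r\<close> for all small
  \<open>r\<close>.\<close>

lemma flat_vol_cball_le_size:
  fixes N :: "'a::euclidean_space"
  assumes N: "norm N = 1" and c: "c \<in> hyperplane N" and d: "0 \<le> d" and D: "DIM('a) = Suc k"
    and k: "0 < k"
  shows "flat_vol N (cball c d) \<le> ennreal (unit_ball_vol (real (Suc k)) * 2 ^ Suc k * d ^ k)"
proof (cases "d = 0")
  case True
  let ?K = "unit_ball_vol (real (Suc k)) * 2 ^ Suc k"
  have "flat_vol N (cball c d) \<le> ennreal e" if e: "e > 0" for e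
  proof -
    have K: "?K > 0" by simp
    define r where "r = min 1 (e / ?K)"
    have r: "0 < r" "r \<le> 1" "?K * r \<le> e"
      using e K by (auto simp: r_def min_def field_simps)
    have "flat_vol N (cball c d) \<le> flat_vol N (cball c r)"
      using True r by (intro flat_vol_mono) auto
    also have "\<dots> \<le> ennreal (?K * r ^ k)" by (rule flat_vol_cball_le[OF N c r(1) D])
    also have "?K * r ^ k \<le> ?K * r ^ 1"
      using r k K by (intro mult_left_mono power_decreasing) auto
    then have "ennreal (?K * r ^ k) \<le> ennreal e"
      by (intro ennreal_leI order_trans[OF _ r(3)]) (simp only: power_one_right)
    finally show ?thesis .
  qed
  then have "flat_vol N (cball c d) \<le> 0" using ennreal_le_epsilon[of 0] by simp
  then show ?thesis by simp
qed (use flat_vol_cball_le[OF N c _ D] d in auto)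

lemma flat_vol_subadditive:
  fixes A :: "nat \<Rightarrow> 'a::euclidean_space set"
  assumes "\<And>i. A i \<in> sets borel"
  shows "flat_vol N (\<Union>i. A i) \<le> (\<Sum>i. flat_vol N (A i))"
proof -
  have "slab N 1 \<inter> nproj N -` (\<Union>i. A i) = (\<Union>i. slab N 1 \<inter> nproj N -` A i)" by auto
  moreover have "range (\<lambda>i. slab N 1 \<inter> nproj N -` A i) \<subseteq> sets lborel"
    using assms by auto
  ultimately show ?thesis
    unfolding flat_vol_def using emeasure_subadditive_countably by metis
qed

text \<open>Each covering set is replaced by a ball centred in it whose radius is its diameter. The
  constant is crude; the inequality serves to show that a disc is not a null set for the Hausdorff
  measure.\<close>

lemma flat_vol_le_hausdorff:
  fixes N :: "'a::euclidean_space"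
  assumes N: "norm N = 1" and D: "DIM('a) = Suc k" and k: "0 < k"
    and E: "E \<subseteq> hyperplane N"
  shows "\<exists>c>0. flat_vol N E \<le> ennreal c * hausdorff_outer k E"
proof -
  define K where "K = unit_ball_vol (real (Suc k)) * 2 ^ Suc k"
  define c where "c = K / unit_ball_vol (real k) * 2 ^ k"
  have K: "K > 0" and c: "c > 0" by (simp_all add: K_def c_def)
  have "ennreal (1 / c) * flat_vol N E \<le> hausdorff_pre k 1 E"
    unfolding hausdorff_pre_def
  proof (rule INF_greatest)
    fix C assume C: "C \<in> hausdorff_covers 1 E"
    define G where "G i = (if C i \<inter> E = {} then {} else cball (SOME x. x \<in> C i \<inter> E) (diameter (C i)))" for i
    have some: "(SOME x. x \<in> C i \<inter> E) \<in> C i \<inter> E" if "C i \<inter> E \<noteq> {}" for i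
      using that by (meson ex_in_conv someI_ex)
    have Gb: "G i \<in> sets borel" for i by (simp add: G_def)
    have "E \<subseteq> (\<Union>i. G i)"
    proof
      fix x assume x: "x \<in> E"
      then obtain i where i: "x \<in> C i" using C unfolding hausdorff_covers_def by blast
      then have ne: "C i \<inter> E \<noteq> {}" using x by blast
      have "dist (SOME x. x \<in> C i \<inter> E) x \<le> diameter (C i)"
        using C some[OF ne] i unfolding hausdorff_covers_def
        by (intro diameter_bounded_bound) auto
      then have "x \<in> G i" using ne by (simp add: G_def)
      then show "x \<in> (\<Union>i. G i)" by blast
    qed
    then have "flat_vol N E \<le> flat_vol N (\<Union>i. G i)" using Gb by (intro flat_vol_mono) auto
    also have "\<dots> \<le> (\<Sum>i. flat_vol N (G i))" by (rule flat_vol_subadditive[OF Gb])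
    also have "\<dots> \<le> (\<Sum>i. ennreal c * hausdorff_size k (C i))"
    proof (intro suminf_le)
      fix i
      show "flat_vol N (G i) \<le> ennreal c * hausdorff_size k (C i)"
      proof (cases "C i \<inter> E = {}")
        case True
        then show ?thesis by (simp add: G_def flat_vol_def)
      next
        case False
        have d: "0 \<le> diameter (C i)" using C unfolding hausdorff_covers_def by (simp add: diameter_ge_0)
        have "flat_vol N (G i) \<le> ennreal (K * diameter (C i) ^ k)"
          using flat_vol_cball_le_size[OF N _ d D k, of "SOME x. x \<in> C i \<inter> E"] some[OF False] E False
          by (auto simp: G_def K_def)
        also have "K * diameter (C i) ^ k = c * (unit_ball_vol (real k) * (diameter (C i) / 2) ^ k)"
          using unit_ball_vol_nonzero[of k] by (simp add: c_def power_divide)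
        also have "ennreal \<dots> = ennreal c * hausdorff_size k (C i)"
          using False c by (subst ennreal_mult') (auto simp: hausdorff_size_def)
        finally show ?thesis .
      qed
    qed auto
    also have "\<dots> = ennreal c * (\<Sum>i. hausdorff_size k (C i))" by simp
    finally have "ennreal (1 / c) * flat_vol N E \<le> ennreal (1 / c) * (ennreal c * (\<Sum>i. hausdorff_size k (C i)))"
      by (rule mult_left_mono) simp
    then show "ennreal (1 / c) * flat_vol N E \<le> (\<Sum>i. hausdorff_size k (C i))"
      using c by (simp add: mult.assoc[symmetric] ennreal_mult[symmetric])
  qed
  also have "\<dots> \<le> hausdorff_outer k E" by (rule hausdorff_pre_le_outer) simp
  finally have "ennreal c * (ennreal (1 / c) * flat_vol N E) \<le> ennreal c * hausdorff_outer k E"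
    by (rule mult_left_mono) simp
  then have "flat_vol N E \<le> ennreal c * hausdorff_outer k E"
    using c by (simp add: mult.assoc[symmetric] ennreal_mult[symmetric])
  then show ?thesis using c by blast
qed

text \<open>A maximal \<open>d\<close>-separated set of points gives an efficient cover, since the balls of
  radius \<open>d / 2\<close> around them are disjoint subsets of a slab of thickness \<open>d\<close>.\<close>
lemma hausdorff_hyperplane_finite:
  fixes N :: "'a::euclidean_space"
  assumes N: "norm N = 1" and D: "DIM('a) = Suc k"
  shows "hausdorff_outer k (hyperplane N \<inter> cball 0 R) < \<infinity>"
proof -
  let ?S = "hyperplane N \<inter> cball 0 R"
  define w where "w = unit_ball_vol (real (Suc k))"
  have w: "w > 0" by (simp add: w_def)
  obtain V where V: "flat_vol N (cball 0 (R + 1)) = ennreal V" "0 \<le> V"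
    using flat_vol_cball_finite[OF N, of "R + 1"] by (cases "flat_vol N (cball 0 (R + 1))") auto
  define b where "b d = V * 2 ^ Suc k / w / d ^ k" for d
  have card_le: "real (card P) \<le> b d"
    if P: "finite P" "P \<subseteq> ?S" "\<And>x y. x \<in> P \<Longrightarrow> y \<in> P \<Longrightarrow> x \<noteq> y \<Longrightarrow> d \<le> dist x y" and d: "0 < d" "d \<le> 1" for P d
  proof -
    have "disjoint_family_on (\<lambda>p. ball p (d / 2)) P"
      unfolding disjoint_family_on_def
    proof (intro ballI impI)
      fix x y assume "x \<in> P" "y \<in> P" "x \<noteq> y"
      then have "d \<le> dist x y" using P by blast
      then show "ball x (d / 2) \<inter> ball y (d / 2) = {}"
        by (intro disjoint_ballI) simp
    qed
    then have "(\<Sum>p\<in>P. emeasure lborel (ball p (d / 2))) = emeasure lborel (\<Union>p\<in>P. ball p (d / 2))"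
      using P by (intro sum_emeasure) auto
    also have "\<dots> \<le> emeasure lborel (slab N d \<inter> nproj N -` cball 0 (R + 1))"
    proof (rule emeasure_mono)
      show "(\<Union>p\<in>P. ball p (d / 2)) \<subseteq> slab N d \<inter> nproj N -` cball 0 (R + 1)"
      proof
        fix x assume "x \<in> (\<Union>p\<in>P. ball p (d / 2))"
        then obtain p where p: "p \<in> P" "norm (x - p) < d / 2"
          by (auto simp: dist_norm norm_minus_commute)
        then have p0: "p \<bullet> N = 0" "norm p \<le> R" using P by (auto simp: hyperplane_def)
        have "\<bar>(x - p) \<bullet> N\<bar> \<le> norm (x - p)" using Cauchy_Schwarz_ineq2[of "x - p" N] N by simp
        then have "x \<in> slab N d" using p p0 by (simp add: slab_def inner_simps)
        moreover have "norm x \<le> R + 1"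
          using norm_triangle_ineq[of "x - p" p] p p0 d by simp
        ultimately show "x \<in> slab N d \<inter> nproj N -` cball 0 (R + 1)"
          using norm_nproj_le[OF N, of x] by simp
      qed
    qed measurable
    also have "\<dots> = ennreal (d * V)"
      using d V by (simp add: flat_vol_thickness[OF N] ennreal_mult)
    also have "(\<Sum>p\<in>P. emeasure lborel (ball p (d / 2))) = ennreal (real (card P) * (w * (d / 2) ^ Suc k))"
      using d w by (simp add: emeasure_ball D w_def ennreal_of_nat_eq_real_of_nat ennreal_mult' del: power_Suc)
    finally have "real (card P) * (w * (d / 2) ^ Suc k) \<le> d * V"
      using d V by (subst (asm) ennreal_le_iff) auto
    then have "d * (real (card P) * w * d ^ k) \<le> d * (V * 2 ^ Suc k)"
      by (simp add: power_divide field_simps)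
    then have "real (card P) * w * d ^ k \<le> V * 2 ^ Suc k" using d by simp
    then show ?thesis using w d by (simp add: b_def field_simps)
  qed
  have pre: "hausdorff_pre k (2 * d) ?S \<le> ennreal (V * 2 ^ Suc k / w * unit_ball_vol (real k))"
    if d: "0 < d" "d \<le> 1" for d
  proof -
    define sep where "sep P \<longleftrightarrow> finite P \<and> P \<subseteq> ?S \<and> (\<forall>x\<in>P. \<forall>y\<in>P. x \<noteq> y \<longrightarrow> d \<le> dist x y)" for P
    have "card P \<le> nat \<lfloor>b d\<rfloor>" if "sep P" for P
      using card_le[of P d] that d unfolding sep_def by (simp add: le_nat_floor)
    then have bound: "\<forall>P. sep P \<longrightarrow> card P < nat \<lfloor>b d\<rfloor> + 1" by fastforce
    have "sep {}" by (simp add: sep_def)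
    then obtain P where P: "sep P" "\<And>Q. sep Q \<Longrightarrow> card Q \<le> card P"
      using ex_has_greatest_nat[of sep "{}" card, OF _ bound] by blast
    have finP: "finite P" using P(1) by (simp add: sep_def)
    have cover: "\<exists>p\<in>P. dist p x \<le> d" if x: "x \<in> ?S" for x
    proof (rule ccontr)
      assume far: "\<not> ?thesis"
      then have "x \<notin> P" using d by force
      have "sep (insert x P)"
        using P(1) x far unfolding sep_def by (auto simp: dist_commute not_le intro: less_imp_le)
      then have "card (insert x P) \<le> card P" by (rule P(2))
      then show False using \<open>x \<notin> P\<close> finP by simp
    qed
    obtain h where h: "bij_betw h {..<card P} P"
      using ex_bij_betw_nat_finite[OF finP] by (auto simp: atLeast0LessThan)
    define C where "C i = (if i < card P then cball (h i) d else {})" for i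
    have diam: "diameter (C i) \<le> 2 * d" for i
      using d by (auto simp: C_def)
    have "C \<in> hausdorff_covers (2 * d) ?S"
      unfolding hausdorff_covers_def mem_Collect_eq
    proof (intro conjI subsetI allI)
      fix x assume "x \<in> ?S"
      then obtain p where p: "p \<in> P" "dist p x \<le> d" using cover by blast
      then obtain i where "i < card P" "p = h i" using h unfolding bij_betw_def by auto
      then have "x \<in> C i" using p by (simp add: C_def)
      then show "x \<in> (\<Union>i. C i)" by blast
    next
      show "bounded (C i)" for i by (simp add: C_def)
    qed (rule diam)
    then have "hausdorff_pre k (2 * d) ?S \<le> (\<Sum>i. hausdorff_size k (C i))"
      by (rule hausdorff_pre_le)
    also have "\<dots> = (\<Sum>i<card P. hausdorff_size k (C i))"
      by (rule suminf_finite) (auto simp: C_def hausdorff_size_def)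
    also have "\<dots> \<le> (\<Sum>i<card P. ennreal (unit_ball_vol (real k) * d ^ k))"
    proof (rule sum_mono)
      fix i
      have "(diameter (C i) / 2) ^ k \<le> d ^ k"
        using diam[of i] diameter_ge_0[of "C i"] by (intro power_mono) (auto simp: C_def)
      then show "hausdorff_size k (C i) \<le> ennreal (unit_ball_vol (real k) * d ^ k)"
        by (auto simp: hausdorff_size_def intro!: ennreal_leI mult_left_mono)
    qed
    also have "\<dots> = ennreal (real (card P) * (unit_ball_vol (real k) * d ^ k))"
      using d by (simp add: ennreal_of_nat_eq_real_of_nat ennreal_mult')
    also have "real (card P) * (unit_ball_vol (real k) * d ^ k) \<le> b d * (unit_ball_vol (real k) * d ^ k)"
      using P(1) d by (intro mult_right_mono card_le) (auto simp: sep_def)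
    then have "ennreal (real (card P) * (unit_ball_vol (real k) * d ^ k))
        \<le> ennreal (V * 2 ^ Suc k / w * unit_ball_vol (real k))"
      using d w by (intro ennreal_leI) (simp add: b_def)
    finally show ?thesis .
  qed
  have "hausdorff_outer k ?S \<le> ennreal (V * 2 ^ Suc k / w * unit_ball_vol (real k))"
  proof (rule hausdorff_outer_leI)
    fix \<delta> :: real assume "0 < \<delta>"
    then have "hausdorff_pre k \<delta> ?S \<le> hausdorff_pre k (2 * min 1 (\<delta> / 2)) ?S"
      by (intro hausdorff_pre_mono) auto
    also have "\<dots> \<le> ennreal (V * 2 ^ Suc k / w * unit_ball_vol (real k))"
      using \<open>0 < \<delta>\<close> by (intro pre) auto
    finally show "hausdorff_pre k \<delta> ?S \<le> ennreal (V * 2 ^ Suc k / w * unit_ball_vol (real k))" .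
  qed
  then show ?thesis by (rule order_le_less_trans) simp
qed

section \<open>Comparison of surface measure and flat volume on a hyperplane\<close>

definition hyperplane_measure :: "'a::euclidean_space \<Rightarrow> 'a measure" where
  "hyperplane_measure N = density surface_measure (indicator (hyperplane N))"

definition flat_measure :: "'a::euclidean_space \<Rightarrow> 'a measure" where
  "flat_measure N = distr (density lborel (indicator (slab N 1))) borel (nproj N)"

lemma sets_surface [simp, measurable_cong]: "sets surface_measure = sets borel"
  by (simp add: surface_measure_def)

lemma space_surface [simp]: "space surface_measure = UNIV"
  by (simp add: surface_measure_def)

lemma emeasure_surface:
  "A \<in> sets borel \<Longrightarrow> emeasure (surface_measure :: 'a measure) A = hausdorff_outer (DIM('a::euclidean_space) - 1) A"
  by (simp add: surface_measure_def emeasure_hausdorff)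

lemma sets_hyperplane_measure [simp]: "sets (hyperplane_measure N) = sets borel"
  by (simp add: hyperplane_measure_def)

lemma sets_flat_measure [simp]: "sets (flat_measure N) = sets borel"
  by (simp add: flat_measure_def)

lemma emeasure_hyperplane_measure:
  "A \<in> sets borel \<Longrightarrow> emeasure (hyperplane_measure N) A = emeasure surface_measure (hyperplane N \<inter> A)"
  unfolding hyperplane_measure_def
  by (subst emeasure_density) (auto simp: indicator_inter_arith[symmetric] nn_integral_indicator)

lemma emeasure_flat_measure:
  "A \<in> sets borel \<Longrightarrow> emeasure (flat_measure N) A = flat_vol N A"
  unfolding flat_measure_def flat_vol_def
  by (subst emeasure_distr) (auto simp: emeasure_density indicator_inter_arith[symmetric] nn_integral_indicator)

lemma flat_vol_translate:
  assumes N: "norm N = 1" and v: "v \<in> hyperplane N" and A: "A \<in> sets borel"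
  shows "flat_vol N ((+) v -` A) = flat_vol N A"
proof -
  have "slab N 1 \<inter> nproj N -` ((+) v -` A) = (+) v -` (slab N 1 \<inter> nproj N -` A)"
    using v by (auto simp: slab_def nproj_def hyperplane_def inner_simps algebra_simps)
  then show ?thesis using lborel_translate[of "slab N 1 \<inter> nproj N -` A" v] A
    unfolding flat_vol_def by simp
qed

lemma surface_translate:
  assumes A: "A \<in> sets borel"
  shows "emeasure surface_measure ((+) (v::'a::euclidean_space) -` A) = emeasure surface_measure A"
proof -
  have "(+) v -` A \<in> sets borel" using measurable_sets[of "(+) v" borel borel A] A by simp
  moreover have "(+) v -` A = (+) (- v) ` A" by force
  moreover have "hausdorff_outer (DIM('a) - 1) ((+) (- v) ` A) = hausdorff_outer (DIM('a) - 1) A"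
    by (rule hausdorff_outer_isometry) (simp add: dist_norm)
  ultimately show ?thesis using A by (simp add: emeasure_surface)
qed

lemma uminus_vimage_borel: "A \<in> sets borel \<Longrightarrow> uminus -` (A :: 'a::euclidean_space set) \<in> sets borel"
  using measurable_sets[of uminus borel borel A] by simp

lemma flat_vol_uminus:
  assumes A: "A \<in> sets borel"
  shows "flat_vol N (uminus -` A) = flat_vol N A"
proof -
  have "slab N 1 \<inter> nproj N -` (uminus -` A) = uminus -` (slab N 1 \<inter> nproj N -` A)"
    by (auto simp: slab_def nproj_def algebra_simps)
  moreover have "surj (uminus :: 'a \<Rightarrow> 'a)" by (metis add.inverse_inverse surjI)
  ultimately show ?thesis
    unfolding flat_vol_def using emeasure_lborel_isometry[of uminus "slab N 1 \<inter> nproj N -` A"] A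
    by (simp add: bounded_linear.linear bounded_linear_minus)
qed

text \<open>Both measures live on the hyperplane and are invariant under its translations, so they
  are proportional; flat volume is invariant under \<open>uminus\<close>, which disposes of the
  reflection. The product form avoids dividing by values that may be zero or infinite.\<close>

lemma surface_flat_ratio:
  fixes N :: "'a::euclidean_space"
  assumes N: "norm N = 1" and D: "2 \<le> DIM('a)" and A: "A \<in> sets borel" and B: "B \<in> sets borel"
  shows "emeasure surface_measure (hyperplane N \<inter> A) * flat_vol N B
    = flat_vol N A * emeasure surface_measure (hyperplane N \<inter> B)"
proof -
  let ?k = "DIM('a) - 1"
  have k: "DIM('a) = Suc ?k" "0 < ?k" using D by auto
  have hp: "v \<in> hyperplane N \<Longrightarrow> - v \<in> hyperplane N" for v by (simp add: hyperplane_def)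
  have tb: "(+) v -` X \<in> sets borel" if "X \<in> sets borel" for v :: 'a and X
    using measurable_sets[of "(+) v" borel borel X] that by simp
  have "emeasure (hyperplane_measure N) A * emeasure (flat_measure N) B
      = emeasure (flat_measure N) (uminus -` A) * emeasure (hyperplane_measure N) B"
  proof (rule translation_invariant_unique[where T="hyperplane N"])
    show "sigma_finite_measure (hyperplane_measure N)"
    proof (rule sigma_finite_cballI)
      show "emeasure (hyperplane_measure N) (cball 0 (real n)) < \<infinity>" for n
        using hausdorff_hyperplane_finite[OF N k(1), of "real n"]
        by (simp add: emeasure_hyperplane_measure emeasure_surface)
    qed simp
    show "sigma_finite_measure (flat_measure N)"
      using flat_vol_cball_finite[OF N]
      by (intro sigma_finite_cballI) (simp_all add: emeasure_flat_measure)
    show "AE x in hyperplane_measure N. x \<in> hyperplane N"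
      unfolding hyperplane_measure_def by (subst AE_density) (auto simp: indicator_def)
    show "AE x in flat_measure N. x \<in> hyperplane N"
      unfolding flat_measure_def by (subst AE_distr_iff) (auto simp: nproj_in_hyperplane[OF N])
    show "emeasure (hyperplane_measure N) ((+) v -` X) = emeasure (hyperplane_measure N) X"
      if X: "X \<in> sets borel" and v: "v \<in> hyperplane N" for X v
    proof -
      have "hyperplane N \<inter> (+) v -` X = (+) v -` (hyperplane N \<inter> X)"
        using v by (auto simp: hyperplane_def inner_simps)
      then show ?thesis using surface_translate[of "hyperplane N \<inter> X" v] tb[OF X] X
        by (simp add: emeasure_hyperplane_measure)
    qed
    show "emeasure (flat_measure N) ((+) v -` X) = emeasure (flat_measure N) X"
      if X: "X \<in> sets borel" and v: "v \<in> hyperplane N" for X v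
      using flat_vol_translate[OF N v X] tb[OF X] X by (simp add: emeasure_flat_measure)
  qed (use A B hp in auto)
  then show ?thesis
    using A B uminus_vimage_borel[OF A] flat_vol_uminus[OF A]
    by (simp add: emeasure_hyperplane_measure emeasure_flat_measure)
qed

text \<open>Householder reflection in the hyperplane orthogonal to \<open>w\<close>; for
  \<open>w = 0\<close> it is the identity, so \<open>reflect (M - N)\<close> also covers
  \<open>M = N\<close>.\<close>

definition reflect :: "'a::euclidean_space \<Rightarrow> 'a \<Rightarrow> 'a" where
  "reflect w x = x - (2 * (x \<bullet> w) / (w \<bullet> w)) *\<^sub>R w"

lemma reflect_linear: "linear (reflect w)"
  by (rule linearI) (simp_all add: reflect_def inner_simps algebra_simps add_divide_distrib)

lemma reflect_inner: "reflect w x \<bullet> reflect w y = x \<bullet> y"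
  by (cases "w = 0") (simp_all add: reflect_def inner_simps inner_commute field_simps)

lemma reflect_reflect: "reflect w (reflect w x) = x"
  by (cases "w = 0") (simp_all add: reflect_def inner_simps algebra_simps)

lemma reflect_swap:
  assumes "norm M = 1" "norm N = 1"
  shows "reflect (M - N) M = N"
proof (cases "M = N")
  case False
  have "M \<bullet> M = 1" "N \<bullet> N = 1" using assms by (simp_all add: norm_eq_1)
  then have 1: "(M - N) \<bullet> (M - N) = 2 * (M \<bullet> (M - N))"
    by (simp add: inner_diff_left inner_diff_right inner_commute)
  have "(M - N) \<bullet> (M - N) \<noteq> 0" using False by simp
  with 1 show ?thesis unfolding reflect_def by simp
qed (simp add: reflect_def)

definition surface_const :: "'a::euclidean_space itself \<Rightarrow> real" where
  "surface_const _ = enn2real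
    (emeasure surface_measure (hyperplane (SOME b::'a. b \<in> Basis) \<inter> cball 0 1)
      / flat_vol (SOME b::'a. b \<in> Basis) (cball 0 1))"

text \<open>The proportionality factor is read off on the unit disc. It is the same for every normal
  because the reflection exchanging \<open>N\<close> with a basis vector preserves both the
  Hausdorff measure and the volume.\<close>

lemma surface_const:
  fixes N :: "'a::euclidean_space"
  assumes N: "norm N = 1" and D: "2 \<le> DIM('a)" and A: "A \<in> sets borel" "A \<subseteq> hyperplane N"
  shows "emeasure surface_measure A = ennreal (surface_const TYPE('a)) * flat_vol N A"
proof -
  let ?k = "DIM('a) - 1"
  have k: "DIM('a) = Suc ?k" "0 < ?k" using D by auto
  define b :: 'a where "b = (SOME b::'a. b \<in> Basis)"
  have b: "norm b = 1" using SOME_Basis by (simp add: b_def)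
  let ?B = "cball (0::'a) 1"
  define f where "f = reflect (N - b)"
  have fN: "f N = b" "f b = N" using reflect_swap[OF N b] reflect_reflect[of "N - b" N] by (auto simp: f_def)
  have fi: "f x \<bullet> f y = x \<bullet> y" and ff: "f (f x) = x" for x y
    by (simp_all add: f_def reflect_inner reflect_reflect)
  have fnorm: "norm (f x) = norm x" for x by (simp add: norm_eq_sqrt_inner fi)
  have fl: "linear f" by (simp add: f_def reflect_linear)
  have fb: "f x \<bullet> N = x \<bullet> b" for x using fi[of x b] fN by simp
  have "dist (f x) (f y) = dist x y" for x y
    using fnorm[of "x - y"] linear_diff[OF fl] by (simp add: dist_norm)
  then have "hausdorff_outer ?k (f ` (hyperplane b \<inter> ?B)) = hausdorff_outer ?k (hyperplane b \<inter> ?B)"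
    by (rule hausdorff_outer_isometry)
  moreover have "f ` (hyperplane b \<inter> ?B) = hyperplane N \<inter> ?B"
  proof (intro subset_antisym subsetI)
    fix x assume x: "x \<in> hyperplane N \<inter> ?B"
    have "f x \<in> hyperplane b \<inter> ?B" using x fb[of "f x"] fnorm[of x] by (simp add: hyperplane_def ff)
    then show "x \<in> f ` (hyperplane b \<inter> ?B)" by (metis ff imageI)
  qed (auto simp: hyperplane_def fb fnorm)
  ultimately have eqH: "emeasure surface_measure (hyperplane N \<inter> ?B) = emeasure surface_measure (hyperplane b \<inter> ?B)"
    by (simp add: emeasure_surface)
  have "f -` (slab N 1 \<inter> nproj N -` ?B) = slab b 1 \<inter> nproj b -` ?B"
  proof -
    have "nproj N (f x) = f (nproj b x)" for x
      by (simp add: nproj_def fb linear_diff[OF fl] linear_scale[OF fl] fN)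
    then show ?thesis by (auto simp: slab_def fb fnorm)
  qed
  moreover have "surj f" using ff by (metis surjI)
  ultimately have eqF: "flat_vol N ?B = flat_vol b ?B"
    using emeasure_lborel_isometry[OF fl fnorm, of "slab N 1 \<inter> nproj N -` ?B"]
    by (simp add: flat_vol_def)
  have F0: "flat_vol b ?B \<noteq> 0" "flat_vol b ?B \<noteq> \<infinity>"
    using flat_vol_cball_pos[OF b] flat_vol_cball_finite[OF b, of 1] by auto
  have H1: "emeasure surface_measure (hyperplane b \<inter> ?B) \<noteq> \<infinity>"
    using hausdorff_hyperplane_finite[OF b k(1), of 1] by (simp add: emeasure_surface)
  have C: "ennreal (surface_const TYPE('a)) = emeasure surface_measure (hyperplane b \<inter> ?B) / flat_vol b ?B"
    unfolding surface_const_def b_def[symmetric] using F0 H1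
    by (intro ennreal_enn2real) (simp add: ennreal_divide_eq_top_iff less_top[symmetric])
  have "emeasure surface_measure A * flat_vol b ?B = flat_vol N A * emeasure surface_measure (hyperplane b \<inter> ?B)"
    using surface_flat_ratio[OF N D A(1), of ?B] A(2) eqH eqF by (simp add: Int_absorb1)
  then have "emeasure surface_measure A * flat_vol b ?B / flat_vol b ?B
      = flat_vol N A * emeasure surface_measure (hyperplane b \<inter> ?B) / flat_vol b ?B" by simp
  then show ?thesis using F0 C
    by (simp add: ennreal_mult_divide_eq ennreal_times_divide mult.commute)
qed

text \<open>A vanishing constant would make the unit disc a null set, against the bound of flat
  volume by Hausdorff measure. Positivity lets the constant be cancelled from inequalities between
  fluxes.\<close>

lemma surface_const_pos:
  assumes D: "2 \<le> DIM('a::euclidean_space)"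
  shows "surface_const TYPE('a) > 0"
proof -
  let ?k = "DIM('a) - 1"
  have k: "DIM('a) = Suc ?k" "0 < ?k" using D by auto
  obtain b :: 'a where b: "b \<in> Basis" using nonempty_Basis by blast
  then have N: "norm b = 1" by simp
  let ?E = "hyperplane b \<inter> cball 0 1"
  obtain c where c: "c > 0" "flat_vol b ?E \<le> ennreal c * hausdorff_outer ?k ?E"
    using flat_vol_le_hausdorff[OF N k, of ?E] by auto
  have "nproj b -` ?E = nproj b -` cball 0 1" using nproj_in_hyperplane[OF N] by auto
  then have F: "flat_vol b ?E > 0" using flat_vol_cball_pos[OF N] by (simp add: flat_vol_def)
  have "surface_const TYPE('a) \<noteq> 0"
  proof
    assume "surface_const TYPE('a) = 0"
    then have "hausdorff_outer ?k ?E = 0"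
      using surface_const[OF N D, of ?E] by (simp add: emeasure_surface)
    then show False using c F by simp
  qed
  then show ?thesis by (simp add: surface_const_def less_le)
qed

section \<open>The divergence theorem in a boundary chart\<close>

lemma integral_lborel_translate:
  fixes f :: "'a::euclidean_space \<Rightarrow> real"
  assumes [measurable]: "f \<in> borel_measurable borel"
  shows "(\<integral>x. f (c + x) \<partial>lborel) = (\<integral>x. f x \<partial>lborel)"
proof -
  have "(\<integral>x. f x \<partial>lborel) = (\<integral>x. f x \<partial>distr lborel borel ((+) c))"
    by (simp add: lborel_distr_plus)
  then show ?thesis by (simp add: integral_distr)
qed

text \<open>The signed version. The nonnegative one, applied to the absolute value of
  \<open>F\<close>, supplies the integrability that both exchanges of integrals require.\<close>

lemma integral_along_lines:
  fixes F w :: "'a::euclidean_space \<Rightarrow> real"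
  assumes F: "integrable lborel F" and w[measurable]: "w \<in> borel_measurable borel"
    and w0: "\<And>x. 0 \<le> w x" and w1: "\<And>x. (\<integral>\<^sup>+s. ennreal (w (x - s *\<^sub>R e)) \<partial>lborel) = 1"
  shows "(\<integral>x. F x \<partial>lborel) = (\<integral>x. w x * (\<integral>s. F (x + s *\<^sub>R e) \<partial>lborel) \<partial>lborel)"
proof -
  have [measurable]: "F \<in> borel_measurable borel" using F by auto
  have fin: "(\<integral>\<^sup>+x. ennreal (norm (F x)) \<partial>lborel) < \<infinity>"
    using F by (simp add: integrable_iff_bounded)
  have i2: "integrable (lborel \<Otimes>\<^sub>M lborel) (case_prod (\<lambda>x s. w x * F (x + s *\<^sub>R e)))"
  proof (rule integrableI_bounded)
    have "(\<integral>\<^sup>+z. ennreal (norm (case_prod (\<lambda>x s. w x * F (x + s *\<^sub>R e)) z)) \<partial>(lborel \<Otimes>\<^sub>M lborel))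
        = (\<integral>\<^sup>+x. (\<integral>\<^sup>+s. ennreal (w x) * ennreal (norm (F (x + s *\<^sub>R e))) \<partial>lborel) \<partial>lborel)"
      by (subst lborel.nn_integral_fst[symmetric]) (simp_all add: abs_mult w0 ennreal_mult)
    also have "\<dots> = (\<integral>\<^sup>+x. ennreal (w x) * (\<integral>\<^sup>+s. ennreal (norm (F (x + s *\<^sub>R e))) \<partial>lborel) \<partial>lborel)"
      by (simp add: nn_integral_cmult)
    also have "\<dots> = (\<integral>\<^sup>+x. ennreal (norm (F x)) \<partial>lborel)"
      by (rule nn_integral_along_lines[symmetric, OF _ _ w1]) measurable
    finally show "(\<integral>\<^sup>+z. ennreal (norm (case_prod (\<lambda>x s. w x * F (x + s *\<^sub>R e)) z)) \<partial>(lborel \<Otimes>\<^sub>M lborel)) < \<infinity>"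
      using fin by simp
  qed measurable
  have i1: "integrable (lborel \<Otimes>\<^sub>M lborel) (case_prod (\<lambda>x s. w (x - s *\<^sub>R e) * F x))"
  proof (rule integrableI_bounded)
    have "(\<integral>\<^sup>+z. ennreal (norm (case_prod (\<lambda>x s. w (x - s *\<^sub>R e) * F x) z)) \<partial>(lborel \<Otimes>\<^sub>M lborel))
        = (\<integral>\<^sup>+x. (\<integral>\<^sup>+s. ennreal (w (x - s *\<^sub>R e)) * ennreal (norm (F x)) \<partial>lborel) \<partial>lborel)"
      by (subst lborel.nn_integral_fst[symmetric]) (simp_all add: abs_mult w0 ennreal_mult)
    also have "\<dots> = (\<integral>\<^sup>+x. ennreal (norm (F x)) \<partial>lborel)"
      by (simp add: nn_integral_multc w1)
    finally show "(\<integral>\<^sup>+z. ennreal (norm (case_prod (\<lambda>x s. w (x - s *\<^sub>R e) * F x) z)) \<partial>(lborel \<Otimes>\<^sub>M lborel)) < \<infinity>"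
      using fin by simp
  qed measurable
  have w1': "(\<integral>s. w (x - s *\<^sub>R e) \<partial>lborel) = 1" for x
    by (subst integral_eq_nn_integral) (simp_all add: w0 w1)
  have "(\<integral>x. w x * (\<integral>s. F (x + s *\<^sub>R e) \<partial>lborel) \<partial>lborel)
      = (\<integral>x. (\<integral>s. w x * F (x + s *\<^sub>R e) \<partial>lborel) \<partial>lborel)" by simp
  also have "\<dots> = (\<integral>s. (\<integral>x. w x * F (x + s *\<^sub>R e) \<partial>lborel) \<partial>lborel)"
    by (rule lborel_pair.Fubini_integral[OF i2, symmetric])
  also have "\<dots> = (\<integral>s. (\<integral>x. w (x - s *\<^sub>R e) * F x \<partial>lborel) \<partial>lborel)"
  proof (rule Bochner_Integration.integral_cong[OF refl])
    fix s :: real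
    show "(\<integral>x. w x * F (x + s *\<^sub>R e) \<partial>lborel) = (\<integral>x. w (x - s *\<^sub>R e) * F x \<partial>lborel)"
      using integral_lborel_translate[of "\<lambda>x. w (x - s *\<^sub>R e) * F x" "s *\<^sub>R e"] by (simp add: add.commute)
  qed
  also have "\<dots> = (\<integral>x. (\<integral>s. w (x - s *\<^sub>R e) * F x \<partial>lborel) \<partial>lborel)"
    by (rule lborel_pair.Fubini_integral[OF i1])
  also have "\<dots> = (\<integral>x. F x \<partial>lborel)" by (simp add: w1')
  finally show ?thesis by simp
qed

lemma DERIV_line:
  assumes "h differentiable at (z + a *\<^sub>R d)"
  shows "((\<lambda>a. h (z + a *\<^sub>R d)) has_real_derivative pd d h (z + a *\<^sub>R d)) (at a)"
proof -
  have "((\<lambda>a. h (z + a *\<^sub>R d)) has_derivative (\<lambda>t. pd (t *\<^sub>R d) h (z + a *\<^sub>R d))) (at a)"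
    by (rule has_derivative_compose[of "\<lambda>a. z + a *\<^sub>R d" _ _ _ h, OF _ pd_has[OF assms]])
      (auto intro!: derivative_eq_intros)
  moreover have "pd (t *\<^sub>R d) h (z + a *\<^sub>R d) = pd d h (z + a *\<^sub>R d) * t" for t
    using linear_scale[OF linear_pd[OF assms]] by simp
  ultimately show ?thesis by (simp add: has_field_derivative_def)
qed

definition lines_through :: "'a::euclidean_space \<Rightarrow> 'a set \<Rightarrow> 'a set" where
  "lines_through e E = {x. \<exists>s. x + s *\<^sub>R e \<in> E}"

lemma lines_through_shift: "x + s *\<^sub>R e \<in> lines_through e E \<longleftrightarrow> x \<in> lines_through e E"
proof
  assume "x + s *\<^sub>R e \<in> lines_through e E"
  then obtain t where "x + (s + t) *\<^sub>R e \<in> E" by (auto simp: lines_through_def algebra_simps)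
  then show "x \<in> lines_through e E" unfolding lines_through_def by blast
next
  assume "x \<in> lines_through e E"
  then obtain t where t: "x + t *\<^sub>R e \<in> E" by (auto simp: lines_through_def)
  have "x + s *\<^sub>R e + (t - s) *\<^sub>R e \<in> E" using t by (simp add: algebra_simps)
  then show "x + s *\<^sub>R e \<in> lines_through e E" unfolding lines_through_def by blast
qed

lemma closed_lines_through_compact:
  assumes "compact K"
  shows "closed (lines_through e K)"
proof -
  have "lines_through e K = (\<Union>x\<in>K. \<Union>y\<in>span {e}. {x + y})"
  proof (intro set_eqI iffI)
    fix x assume "x \<in> lines_through e K"
    then obtain s where s: "x + s *\<^sub>R e \<in> K" by (auto simp: lines_through_def)
    have "x = (x + s *\<^sub>R e) + (- s) *\<^sub>R e" by simp
    moreover have "(- s) *\<^sub>R e \<in> span {e}" by (intro span_scale span_base) simp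
    ultimately show "x \<in> (\<Union>x\<in>K. \<Union>y\<in>span {e}. {x + y})" using s by blast
  next
    fix x assume "x \<in> (\<Union>x\<in>K. \<Union>y\<in>span {e}. {x + y})"
    then obtain y k where "x = y + k *\<^sub>R e" "y \<in> K" by (auto simp: span_singleton)
    then have "x + (- k) *\<^sub>R e \<in> K" by simp
    then show "x \<in> lines_through e K" unfolding lines_through_def by blast
  qed
  then show ?thesis
    using compact_closed_sums[OF assms closed_subspace[OF subspace_span, of "{e}"]] by simp
qed

text \<open>A local comparison up to every factor \<open>L > 1\<close> becomes exact: a countable
  subcover by balls is made disjoint, the inequalities are summed, and \<open>L\<close> tends to
  one. The limit is taken only where \<open>emeasure M2 E\<close> is finite.\<close>

lemma measure_le_local:
  fixes M1 M2 :: "'a::euclidean_space measure"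
  assumes s: "sets M1 = sets borel" "sets M2 = sets borel"
    and loc: "\<And>L q. 1 < L \<Longrightarrow> q \<in> S \<Longrightarrow>
      \<exists>\<rho>>0. \<forall>E\<in>sets borel. E \<subseteq> S \<inter> ball q \<rho> \<longrightarrow> emeasure M1 E \<le> ennreal L * emeasure M2 E"
    and E: "E \<in> sets borel" "E \<subseteq> S"
  shows "emeasure M1 E \<le> emeasure M2 E"
proof -
  have L: "emeasure M1 E \<le> ennreal L * emeasure M2 E" if L: "1 < L" for L
  proof (cases "S = {}")
    case False
    obtain \<rho> where \<rho>: "\<And>q. q \<in> S \<Longrightarrow> 0 < \<rho> q"
      "\<And>q F. q \<in> S \<Longrightarrow> F \<in> sets borel \<Longrightarrow> F \<subseteq> S \<inter> ball q (\<rho> q) \<Longrightarrow> emeasure M1 F \<le> ennreal L * emeasure M2 F"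
      using loc[OF L] by metis
    obtain \<F> where \<F>: "\<F> \<subseteq> (\<lambda>q. ball q (\<rho> q)) ` S" "countable \<F>" "\<Union>\<F> = (\<Union>q\<in>S. ball q (\<rho> q))"
      using Lindelof[of "(\<lambda>q. ball q (\<rho> q)) ` S"] by (auto simp: image_iff)
    have cov: "S \<subseteq> \<Union>\<F>" using \<F>(3) \<rho>(1) by auto
    then have ne: "\<F> \<noteq> {}" using False by auto
    define W where "W = from_nat_into \<F>"
    have rO: "range W = \<F>" using ne \<F>(2) by (simp add: W_def range_from_nat_into)
    have Ob: "W n \<in> sets borel" for n
      using rO \<F>(1) by (metis borel_open imageE open_ball rangeI subsetD)
    define D where "D n = E \<inter> disjointed W n" for n
    have dj: "disjointed W n \<in> sets borel" for n
      using sets.range_disjointed_sets[of W borel] Ob by auto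
    have Db: "D n \<in> sets borel" for n using E dj by (simp add: D_def)
    have UD: "(\<Union>n. D n) = E"
    proof -
      have "(\<Union>n. D n) = E \<inter> (\<Union>n. disjointed W n)" by (auto simp: D_def)
      also have "\<dots> = E \<inter> \<Union>\<F>" using UN_disjointed_eq[of W] rO by simp
      finally show ?thesis using E cov by auto
    qed
    have disj: "disjoint_family D"
      using disjoint_family_disjointed[of W] unfolding disjoint_family_on_def D_def by blast
    have le: "emeasure M1 (D n) \<le> ennreal L * emeasure M2 (D n)" for n
    proof -
      obtain q where q: "q \<in> S" "W n = ball q (\<rho> q)" using rO \<F>(1) by (metis imageE rangeI subsetD)
      have "D n \<subseteq> S \<inter> ball q (\<rho> q)" using E q disjointed_subset[of W n] by (auto simp: D_def)
      then show ?thesis using \<rho>(2)[OF q(1) Db] by blast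
    qed
    have "emeasure M1 E = (\<Sum>n. emeasure M1 (D n))"
      unfolding UD[symmetric] using Db disj s by (intro suminf_emeasure[symmetric]) auto
    also have "\<dots> \<le> (\<Sum>n. ennreal L * emeasure M2 (D n))" by (intro suminf_le le) auto
    also have "\<dots> = ennreal L * (\<Sum>n. emeasure M2 (D n))" by simp
    also have "(\<Sum>n. emeasure M2 (D n)) = emeasure M2 E"
      unfolding UD[symmetric] using Db disj s by (intro suminf_emeasure) auto
    finally show ?thesis .
  qed (use E in simp)
  show ?thesis
  proof (rule ennreal_le_epsilon)
    fix \<epsilon> :: real assume fin: "emeasure M2 E < top" and \<epsilon>: "0 < \<epsilon>"
    obtain y where y: "emeasure M2 E = ennreal y" "0 \<le> y"
      using fin by (cases "emeasure M2 E") auto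
    have "emeasure M1 E \<le> ennreal (1 + \<epsilon> / (y + 1)) * ennreal y"
      unfolding y(1)[symmetric] using \<epsilon> y by (intro L) simp
    also have "\<dots> = ennreal (y + \<epsilon> * (y / (y + 1)))"
      using \<epsilon> y by (subst ennreal_mult[symmetric]) (auto simp: algebra_simps)
    also have "\<dots> \<le> ennreal (y + \<epsilon>)"
    proof (rule ennreal_leI)
      have "\<epsilon> * (y / (y + 1)) \<le> \<epsilon> * 1"
        using \<epsilon> y by (intro mult_left_mono) (auto simp: divide_le_eq_1)
      then show "y + \<epsilon> * (y / (y + 1)) \<le> y + \<epsilon>" by simp
    qed
    finally show "emeasure M1 E \<le> emeasure M2 E + ennreal \<epsilon>" using y \<epsilon> by simp
  qed
qed

text \<open>The direction \<open>e\<close> is transversal to the level sets of \<open>\<phi>\<close>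
  throughout the ball. Hence \<open>\<phi>\<close> increases along lines in direction
  \<open>e\<close>, each such line meets the boundary piece \<open>S\<close> at most once, and
  \<open>S\<close> is a graph without a parametrisation being constructed. Allowing every
  transversal \<open>e\<close>, not only the normal, is what later gives the divergence theorem in
  all directions.\<close>

locale boundary_chart =
  fixes \<Omega> :: "'a::euclidean_space set" and U :: "'a set" and \<phi> :: "'a \<Rightarrow> real" and p e :: 'a and r :: real
  assumes chart: "local_defining_function \<Omega> U \<phi>" and r: "0 < r" and BU: "ball p r \<subseteq> U"
    and p: "p \<in> frontier \<Omega>" and pos: "\<And>x. x \<in> ball p r \<Longrightarrow> pd e \<phi> x > 0"
    and dim: "2 \<le> DIM('a)" and open_\<Omega>: "open \<Omega>"
begin

definition S :: "'a set" where "S = frontier \<Omega> \<inter> ball p r"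

lemma chart_facts:
  "open U" "Cinf U \<phi>" "\<And>x. x \<in> U \<Longrightarrow> gradient \<phi> (at x) \<noteq> 0"
  "\<And>x. x \<in> U \<Longrightarrow> x \<in> \<Omega> \<longleftrightarrow> \<phi> x < 0" "\<And>x. x \<in> U \<Longrightarrow> x \<in> frontier \<Omega> \<longleftrightarrow> \<phi> x = 0"
proof -
  from chart show "open U" "\<And>x. x \<in> U \<Longrightarrow> gradient \<phi> (at x) \<noteq> 0"
    unfolding local_defining_function_def by blast+
  from chart show "Cinf U \<phi>" 
    unfolding local_defining_function_def using smooth_on_open_Cinf by blast
  from chart have "\<Omega> \<inter> U = {x \<in> U. \<phi> x < 0}" "frontier \<Omega> \<inter> U = {x \<in> U. \<phi> x = 0}"
    unfolding local_defining_function_def by blast+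
  then show "\<And>x. x \<in> U \<Longrightarrow> x \<in> \<Omega> \<longleftrightarrow> \<phi> x < 0" "\<And>x. x \<in> U \<Longrightarrow> x \<in> frontier \<Omega> \<longleftrightarrow> \<phi> x = 0"
    by blast+
qed

lemma diff_\<phi>: "x \<in> ball p r \<Longrightarrow> \<phi> differentiable at x"
  using Cinf_differentiable[OF chart_facts(2)] BU by blast

lemma S_iff: "x \<in> S \<longleftrightarrow> x \<in> ball p r \<and> \<phi> x = 0"
  using chart_facts(5) BU by (auto simp: S_def)

lemma e_nonzero: "e \<noteq> 0"
  using pos[of p] r linear_0[OF linear_pd[OF diff_\<phi>[of p]]] by auto

lemma ee: "e \<bullet> e = e \<bullet> e" "e \<bullet> e > 0"
  using e_nonzero by auto

lemma ball_segment:
  assumes "x + a *\<^sub>R e \<in> ball p r" "x + b *\<^sub>R e \<in> ball p r" "a \<le> t" "t \<le> b"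
  shows "x + t *\<^sub>R e \<in> ball p r"
proof (cases "a = b")
  case False
  define l where "l = (t - a) / (b - a)"
  have l: "0 \<le> l" "l \<le> 1" using assms False by (auto simp: l_def divide_simps)
  have "l * (b - a) = t - a" using False by (simp add: l_def)
  then have t: "t = (1 - l) * a + l * b" by (simp add: algebra_simps)
  have "x + t *\<^sub>R e = (1 - l) *\<^sub>R (x + a *\<^sub>R e) + l *\<^sub>R (x + b *\<^sub>R e)"
    unfolding t by (simp add: algebra_simps)
  moreover have "\<dots> \<in> ball p r"
    using convexD[OF convex_ball assms(1,2), of "1 - l" l] l by simp
  ultimately show ?thesis by simp
qed (use assms in auto)

lemma \<phi>_strict:
  assumes "x + a *\<^sub>R e \<in> ball p r" "x + b *\<^sub>R e \<in> ball p r" "a < b"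
  shows "\<phi> (x + a *\<^sub>R e) < \<phi> (x + b *\<^sub>R e)"
proof (rule DERIV_pos_imp_increasing[OF assms(3)])
  fix t assume "a \<le> t" "t \<le> b"
  then have "x + t *\<^sub>R e \<in> ball p r" using ball_segment assms by blast
  then show "\<exists>y. ((\<lambda>t. \<phi> (x + t *\<^sub>R e)) has_real_derivative y) (at t) \<and> 0 < y"
    using DERIV_line[OF diff_\<phi>] pos by blast
qed

lemma S_unique:
  assumes "x + a *\<^sub>R e \<in> S" "x + b *\<^sub>R e \<in> S"
  shows "a = b"
  using assms \<phi>_strict[of x a b] \<phi>_strict[of x b a] unfolding S_iff
  by (metis less_irrefl linorder_neqE_linordered_idom)

abbreviation hits :: "'a set \<Rightarrow> 'a set" where "hits \<equiv> lines_through e"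

text \<open>Projection to \<open>S\<close> along \<open>e\<close>. The value \<open>p\<close> off
  \<open>hits S\<close> is a default; the measures and integrals below carry the indicator of
  \<open>hits S\<close>.\<close>

definition foot :: "'a \<Rightarrow> 'a" where
  "foot x = (if x \<in> hits S then x + (THE s. x + s *\<^sub>R e \<in> S) *\<^sub>R e else p)"

lemma foot_eq: "x + s *\<^sub>R e \<in> S \<Longrightarrow> foot x = x + s *\<^sub>R e"
proof -
  assume s: "x + s *\<^sub>R e \<in> S"
  then have "(THE s. x + s *\<^sub>R e \<in> S) = s" using S_unique by blast
  then show ?thesis using s by (auto simp: foot_def lines_through_def)
qed

lemma hits_foot: "E \<subseteq> S \<Longrightarrow> hits E = {x. x \<in> hits S \<and> foot x \<in> E}"
proof (intro set_eqI iffI)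
  fix x assume E: "E \<subseteq> S"
  {
    assume "x \<in> hits E"
    then obtain s where "x + s *\<^sub>R e \<in> E" by (auto simp: lines_through_def)
    then show "x \<in> {x. x \<in> hits S \<and> foot x \<in> E}"
      using E foot_eq[of x s] by (auto simp: lines_through_def)
  next
    assume "x \<in> {x. x \<in> hits S \<and> foot x \<in> E}"
    then obtain s where "x + s *\<^sub>R e \<in> S" "foot x \<in> E" by (auto simp: lines_through_def)
    then show "x \<in> hits E" using foot_eq[of x s] by (auto simp: lines_through_def)
  }
qed

lemma foot_in_S: "x \<in> hits S \<Longrightarrow> foot x \<in> S"
  using hits_foot[of S] by blast

text \<open>\<open>S\<close> is only relatively closed in an open ball, so it is exhausted by
  compact pieces in smaller closed balls; the cylinder over a compact set is closed.\<close>

lemma hits_closed_borel: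
  assumes "closed F"
  shows "hits (S \<inter> F) \<in> sets borel"
proof -
  define K where "K n = frontier \<Omega> \<inter> F \<inter> cball p (r - 1 / real (Suc n))" for n :: nat
  have cK: "compact (K n)" for n
    unfolding K_def using assms by (intro closed_Int_compact closed_Int) auto
  have "S \<inter> F = (\<Union>n. K n)"
  proof (intro set_eqI iffI)
    fix x assume x: "x \<in> S \<inter> F"
    then have "r - dist p x > 0" by (simp add: S_def)
    then obtain n where "1 / real (Suc n) < r - dist p x"
      by (metis inverse_eq_divide reals_Archimedean)
    then have "x \<in> K n" using x by (simp add: K_def S_def)
    then show "x \<in> (\<Union>n. K n)" by blast
  next
    fix x assume "x \<in> (\<Union>n. K n)"
    then obtain n where n: "x \<in> K n" by blast
    then have "dist p x \<le> r - 1 / real (Suc n)" by (simp add: K_def)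
    moreover have "1 / real (Suc n) > 0" by simp
    ultimately have "dist p x < r" by linarith
    then show "x \<in> S \<inter> F" using n by (simp add: K_def S_def)
  qed
  then have "hits (S \<inter> F) = (\<Union>n. hits (K n))" by (auto simp: lines_through_def)
  then show ?thesis using closed_lines_through_compact[OF cK] by (simp add: borel_closed)
qed

lemma hits_S_borel [measurable]: "hits S \<in> sets borel"
  using hits_closed_borel[OF closed_UNIV] by simp

lemma S_borel [measurable]: "S \<in> sets borel"
  unfolding S_def by (simp add: borel_closed frontier_closed)

lemma foot_measurable [measurable]: "foot \<in> borel_measurable borel"
  unfolding borel_eq_closed[where 'a='a]
proof (rule measurable_measure_of)
  fix F :: "'a set" assume "F \<in> Collect closed"
  then have F: "closed F" by simp
  have "foot -` F = hits (S \<inter> F) \<union> (if p \<in> F then - hits S else {})"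
  proof (intro set_eqI iffI)
    fix x assume "x \<in> foot -` F"
    then show "x \<in> hits (S \<inter> F) \<union> (if p \<in> F then - hits S else {})"
      using foot_in_S hits_foot[of "S \<inter> F"] by (cases "x \<in> hits S") (auto simp: foot_def)
  next
    fix x assume "x \<in> hits (S \<inter> F) \<union> (if p \<in> F then - hits S else {})"
    then show "x \<in> foot -` F"
      using hits_foot[of "S \<inter> F"] by (auto simp: foot_def split: if_splits)
  qed
  then show "foot -` F \<inter> space (sigma UNIV (Collect closed)) \<in> sets (sigma UNIV (Collect closed))"
    using hits_closed_borel[OF F] hits_S_borel unfolding borel_eq_closed[symmetric] by auto
qed (auto simp: borel_eq_closed[symmetric])

lemma hits_borel:
  assumes E: "E \<in> sets borel" "E \<subseteq> S"
  shows "hits E \<in> sets borel"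
proof -
  have "hits E = hits S \<inter> foot -` E" using hits_foot[OF E(2)] by auto
  then show ?thesis using measurable_sets[OF foot_measurable E(1)] by simp
qed

subsection \<open>The fundamental theorem of calculus along the lines\<close>

text \<open>If the line meets \<open>S\<close>, then within the ball \<open>\<Omega>\<close> is the
  part before the meeting point, and the fundamental theorem leaves the value of
  \<open>\<psi>\<close> there. Otherwise the line does not change sides within the ball, and the
  integral is a multiple of that of the full derivative of a function with compact support.\<close>

lemma line_integral:
  fixes \<psi> :: "'a \<Rightarrow> real"
  assumes \<psi>: "Cinf UNIV \<psi>" and K: "compact K" "K \<subseteq> ball p r" and supp: "\<And>x. x \<notin> K \<Longrightarrow> \<psi> x = 0"
  shows "(\<integral>s. indicator \<Omega> (x + s *\<^sub>R e) * pd e \<psi> (x + s *\<^sub>R e) \<partial>lborel)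
    = indicator (hits S) x * \<psi> (foot x)"
proof -
  have pd0: "pd e \<psi> y = 0" if "y \<notin> K" for y
  proof -
    have "pd e \<psi> y = pd e (\<lambda>x. 0) y"
      by (rule pd_cong[of "- K"]) (use that supp compact_imp_closed[OF K(1)] in auto)
    then show ?thesis by simp
  qed
  let ?f = "\<lambda>s. \<psi> (x + s *\<^sub>R e)" and ?f' = "\<lambda>s. pd e \<psi> (x + s *\<^sub>R e)"
  have d: "(?f has_real_derivative ?f' s) (at s)" for s
    by (rule DERIV_line[OF Cinf_differentiable[OF \<psi>]]) simp
  have c: "isCont ?f' s" for s
  proof -
    have "isCont (pd e \<psi>) (x + s *\<^sub>R e)"
      using Cinf_continuous_on[OF Cinf_pd[OF \<psi>]] by (simp add: continuous_on_eq_continuous_at)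
    moreover have "isCont (\<lambda>s. x + s *\<^sub>R e) s" by (intro continuous_intros)
    ultimately show ?thesis by (rule isCont_o2[where f="\<lambda>s. x + s *\<^sub>R e" and g="pd e \<psi>", rotated])
  qed
  have [measurable]: "\<Omega> \<in> sets borel" using open_\<Omega> by simp
  have [measurable]: "pd e \<psi> \<in> borel_measurable borel"
    by (rule borel_measurable_continuous_onI[OF Cinf_continuous_on[OF Cinf_pd[OF \<psi>]]])
  obtain R where R: "\<And>y. y \<in> K \<Longrightarrow> norm y \<le> R" using compact_imp_bounded[OF K(1)] by (auto simp: bounded_iff)
  \<comment> \<open>Beyond parameter \<open>M\<close> in either direction the line has left
    \<open>K\<close>, so \<open>\<psi>\<close> vanishes there.\<close>
  define M where "M = (\<bar>R\<bar> + norm x) / norm e + 1"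
  have M: "x + s *\<^sub>R e \<notin> K" if "M \<le> \<bar>s\<bar>" for s
  proof
    assume "x + s *\<^sub>R e \<in> K"
    then have "norm (x + s *\<^sub>R e) \<le> R" by (rule R)
    moreover have "norm (s *\<^sub>R e) \<le> norm (x + s *\<^sub>R e) + norm x"
      using norm_triangle_ineq4[of "x + s *\<^sub>R e" x] by simp
    ultimately have "\<bar>s\<bar> * norm e \<le> \<bar>R\<bar> + norm x" by simp
    then have "\<bar>s\<bar> \<le> (\<bar>R\<bar> + norm x) / norm e" using e_nonzero by (simp add: field_simps)
    then show False using that by (simp add: M_def)
  qed
  have M0: "M > 0" by (auto simp: M_def intro!: add_nonneg_pos divide_nonneg_nonneg)
  have FTC: "(\<integral>s. ?f' s * indicator {a..b} s \<partial>lborel) = ?f b - ?f a" if "a \<le> b" for a b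
    using has_bochner_integral_FTC_Icc_real[OF that d c] by (simp add: has_bochner_integral_iff)
  show ?thesis
  proof (cases "x \<in> hits S")
    case True
    then obtain s0 where s0: "x + s0 *\<^sub>R e \<in> S" by (auto simp: lines_through_def)
    \<comment> \<open>The lower limit is at most \<open>s0\<close>, so the interval is a proper one,
      and at most \<open>- M\<close>, so \<open>\<psi>\<close> vanishes there. The single parameter
      \<open>s0\<close> is negligible.\<close>
    have "(\<integral>s. indicator \<Omega> (x + s *\<^sub>R e) * ?f' s \<partial>lborel) = (\<integral>s. ?f' s * indicator {min s0 (- M)..s0} s \<partial>lborel)"
    proof (rule integral_cong_AE)
      show "AE s in lborel. indicator \<Omega> (x + s *\<^sub>R e) * ?f' s = ?f' s * indicator {min s0 (- M)..s0} s"
        using AE_lborel_singleton[of s0]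
      proof eventually_elim
        fix s assume "s \<noteq> s0"
        show "indicator \<Omega> (x + s *\<^sub>R e) * ?f' s = ?f' s * indicator {min s0 (- M)..s0} s"
        proof (cases "x + s *\<^sub>R e \<in> K")
          case True
          then have B: "x + s *\<^sub>R e \<in> ball p r" using K by blast
          have "\<bar>s\<bar> < M" using M[of s] True by linarith
          then have "- M \<le> s" by linarith
          have "x + s *\<^sub>R e \<in> \<Omega> \<longleftrightarrow> \<phi> (x + s *\<^sub>R e) < 0" using chart_facts(4) BU B by blast
          also have "\<dots> \<longleftrightarrow> s < s0"
            using \<phi>_strict[of x s s0] \<phi>_strict[of x s0 s] s0 B \<open>s \<noteq> s0\<close> unfolding S_iff
            by (metis less_asym linorder_neqE_linordered_idom)
          finally show ?thesis using \<open>s \<noteq> s0\<close> \<open>- M \<le> s\<close> by (auto simp: indicator_def)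
        qed (simp add: pd0)
      qed
    qed measurable
    also have "\<dots> = ?f s0 - ?f (min s0 (- M))" by (rule FTC) simp
    also have "?f (min s0 (- M)) = 0" using M0 by (intro supp M) auto
    finally show ?thesis using True foot_eq[OF s0] by simp
  next
    case False
    then have no: "x + s *\<^sub>R e \<notin> S" for s by (auto simp: lines_through_def)
    define I where "I = {s. x + s *\<^sub>R e \<in> ball p r}"
    \<comment> \<open>A change of sides would, by the intermediate value theorem for
      \<open>\<phi>\<close>, produce a point of \<open>S\<close> on the line.\<close>
    have same: "x + s *\<^sub>R e \<in> \<Omega> \<longleftrightarrow> x + t *\<^sub>R e \<in> \<Omega>" if "s \<in> I" "t \<in> I" for s t
    proof -
      have aux: "x + b *\<^sub>R e \<in> \<Omega>" if ab: "a \<in> I" "b \<in> I" "x + a *\<^sub>R e \<in> \<Omega>" for a b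
      proof (rule ccontr)
        assume "x + b *\<^sub>R e \<notin> \<Omega>"
        then have "\<phi> (x + b *\<^sub>R e) > 0"
          using chart_facts(4)[of "x + b *\<^sub>R e"] ab BU no[of b] unfolding I_def S_iff by fastforce
        moreover have "\<phi> (x + a *\<^sub>R e) < 0" using chart_facts(4)[of "x + a *\<^sub>R e"] ab BU unfolding I_def by fastforce
        ultimately have "a < b"
          using \<phi>_strict[of x b a] ab unfolding I_def by (metis less_asym less_trans linorder_neqE_linordered_idom mem_Collect_eq)
        have "\<exists>t\<ge>a. t \<le> b \<and> \<phi> (x + t *\<^sub>R e) = 0"
        proof (rule IVT)
          show "\<forall>t. a \<le> t \<and> t \<le> b \<longrightarrow> isCont (\<lambda>t. \<phi> (x + t *\<^sub>R e)) t"
          proof (intro allI impI)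
            fix t assume "a \<le> t \<and> t \<le> b"
            then have "x + t *\<^sub>R e \<in> ball p r" using ball_segment[of x a b t] ab unfolding I_def by blast
            then show "isCont (\<lambda>t. \<phi> (x + t *\<^sub>R e)) t" using DERIV_line[OF diff_\<phi>] DERIV_isCont by blast
          qed
        qed (use \<open>a < b\<close> \<open>\<phi> (x + b *\<^sub>R e) > 0\<close> \<open>\<phi> (x + a *\<^sub>R e) < 0\<close> in auto)
        then obtain t where "a \<le> t" "t \<le> b" "\<phi> (x + t *\<^sub>R e) = 0" by blast
        then have "x + t *\<^sub>R e \<in> S" using ball_segment[of x a b t] ab unfolding I_def S_iff by blast
        then show False using no by blast
      qed
      show ?thesis using aux that by blast
    qed
    have outside: "?f' s = 0" if "s \<notin> I" for s
    proof (rule pd0)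
      show "x + s *\<^sub>R e \<notin> K" using that K(2) unfolding I_def by blast
    qed
    have "\<exists>c. \<forall>s. indicator \<Omega> (x + s *\<^sub>R e) * ?f' s = c * ?f' s"
    proof (cases "\<exists>t\<in>I. x + t *\<^sub>R e \<in> \<Omega>")
      case True
      then have "\<forall>s. indicator \<Omega> (x + s *\<^sub>R e) * ?f' s = 1 * ?f' s"
        using same outside by (metis indicator_simps(1) mult_zero_right)
      then show ?thesis by blast
    next
      case False
      then have "\<forall>s. indicator \<Omega> (x + s *\<^sub>R e) * ?f' s = 0 * ?f' s"
        using outside by (metis indicator_simps(2) mult_zero_left mult_zero_right)
      then show ?thesis by blast
    qed
    then obtain c where c': "\<And>s. indicator \<Omega> (x + s *\<^sub>R e) * ?f' s = c * ?f' s" by blast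
    have "(\<integral>s. ?f' s \<partial>lborel) = (\<integral>s. ?f' s * indicator {- M..M} s \<partial>lborel)"
    proof (rule Bochner_Integration.integral_cong[OF refl])
      fix s show "?f' s = ?f' s * indicator {- M..M} s"
        using M[of s] pd0[of "x + s *\<^sub>R e"] by (cases "s \<in> {- M..M}") auto
    qed
    also have "\<dots> = ?f M - ?f (- M)" using M0 by (intro FTC) simp
    also have "\<dots> = 0" using M0 supp[OF M[of M]] supp[OF M[of "- M"]] by simp
    finally show ?thesis using False by (simp add: c')
  qed
qed

subsection \<open>The surface measure in a chart\<close>

text \<open>On \<open>S\<close> this is \<open>e \<bullet> \<nu>\<close>: the volume, per unit of
  surface, of the cylinder swept along \<open>e\<close> over parameter length one.\<close>

definition speed :: "'a \<Rightarrow> real" where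
  "speed x = (if x \<in> ball p r then pd e \<phi> x / norm (gradient \<phi> (at x)) else 0)"

text \<open>Lebesgue measure on a slab in which every line has parameter length one, transported to
  \<open>S\<close> along the lines. Identifying it with \<open>speed\<close> times surface measure
  is the change of variables formula for the graph \<open>S\<close>.\<close>

definition foot_measure :: "'a measure" where
  "foot_measure = distr (density lborel (\<lambda>x. ennreal (surface_const TYPE('a) * indicator (slab e (e \<bullet> e) \<inter> hits S) x))) borel foot"

lemma C_pos: "surface_const TYPE('a) > 0"
  by (rule surface_const_pos[OF dim])

lemma sets_foot_measure [simp]: "sets foot_measure = sets borel"
  by (simp add: foot_measure_def)

lemma emeasure_foot_measure:
  assumes E[measurable]: "E \<in> sets borel"
  shows "emeasure foot_measure E = ennreal (surface_const TYPE('a)) * emeasure lborel (slab e (e \<bullet> e) \<inter> hits (E \<inter> S))"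
proof -
  have [measurable]: "foot -` E \<in> sets borel" using measurable_sets[OF foot_measurable E] by simp
  have h: "hits (E \<inter> S) = hits S \<inter> foot -` E" using hits_foot[of "E \<inter> S"] foot_in_S by auto
  have "emeasure foot_measure E
      = (\<integral>\<^sup>+x. ennreal (surface_const TYPE('a) * indicator (slab e (e \<bullet> e) \<inter> hits S) x) * indicator (foot -` E) x \<partial>lborel)"
    unfolding foot_measure_def by (subst emeasure_distr) (auto simp: emeasure_density)
  also have "\<dots> = (\<integral>\<^sup>+x. ennreal (surface_const TYPE('a)) * indicator (slab e (e \<bullet> e) \<inter> hits (E \<inter> S)) x \<partial>lborel)"
    by (intro nn_integral_cong) (auto simp: indicator_def h)
  also have "\<dots> = ennreal (surface_const TYPE('a)) * emeasure lborel (slab e (e \<bullet> e) \<inter> hits (E \<inter> S))"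
    using hits_borel[of "E \<inter> S"] by (subst nn_integral_cmult) auto
  finally show ?thesis .
qed

lemma gradient_continuous: "continuous_on U (\<lambda>x. gradient \<phi> (at x))"
  unfolding gradient_def
  by (intro continuous_intros Cinf_continuous_on Cinf_pd chart_facts(2))

lemma speed_continuous: "continuous_on (ball p r) speed"
proof -
  have "continuous_on (ball p r) (\<lambda>x. pd e \<phi> x / norm (gradient \<phi> (at x)))"
    using chart_facts(3) BU
    by (intro continuous_intros continuous_on_subset[OF gradient_continuous]
        continuous_on_subset[OF Cinf_continuous_on[OF Cinf_pd[OF chart_facts(2)]]]) auto
  then show ?thesis by (rule continuous_on_eq) (auto simp: speed_def)
qed

lemma speed_pos: "x \<in> ball p r \<Longrightarrow> speed x > 0"
  using pos[of x] chart_facts(3)[of x] BU by (auto simp: speed_def)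

lemma speed_nonneg: "speed x \<ge> 0"
  using speed_pos[of x] by (cases "x \<in> ball p r") (auto simp: speed_def)

lemma speed_measurable [measurable]: "speed \<in> borel_measurable borel"
proof -
  have "(\<lambda>x. indicator (ball p r) x *\<^sub>R speed x) \<in> borel_measurable borel"
    by (rule borel_measurable_continuous_on_indicator[OF _ speed_continuous]) simp
  moreover have "(\<lambda>x. indicator (ball p r) x *\<^sub>R speed x) = speed"
    by (auto simp: speed_def indicator_def)
  ultimately show ?thesis by simp
qed

text \<open>The mean value theorem along the chord from \<open>y\<close> to \<open>x\<close> gives a
  point where the gradient is orthogonal to the chord; by continuity this gradient is close to the
  one at \<open>q\<close>.\<close>

lemma nearly_flat:
  assumes q: "q \<in> S" and \<eta>: "0 < \<eta>"
  shows "\<exists>\<rho>>0. ball q \<rho> \<subseteq> ball p r \<and> (\<forall>x\<in>S \<inter> ball q \<rho>. \<forall>y\<in>S \<inter> ball q \<rho>.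
    \<bar>(x - y) \<bullet> gradient \<phi> (at q)\<bar> \<le> \<eta> * norm (x - y))"
proof -
  have qB: "q \<in> ball p r" using q S_iff by blast
  then have "isCont (\<lambda>x. gradient \<phi> (at x)) q"
    using gradient_continuous chart_facts(1) BU by (auto simp: continuous_on_eq_continuous_at)
  then obtain d where d: "d > 0" "\<And>x. dist x q < d \<Longrightarrow> dist (gradient \<phi> (at x)) (gradient \<phi> (at q)) < \<eta>"
    using \<eta> unfolding continuous_at_eps_delta by metis
  obtain d' where d': "d' > 0" "ball q d' \<subseteq> ball p r" using qB openE[OF open_ball] by blast
  define \<rho> where "\<rho> = min d d'"
  have \<rho>: "\<rho> > 0" "ball q \<rho> \<subseteq> ball p r" using d d' by (auto simp: \<rho>_def)
  have "\<bar>(x - y) \<bullet> gradient \<phi> (at q)\<bar> \<le> \<eta> * norm (x - y)"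
    if x: "x \<in> S \<inter> ball q \<rho>" and y: "y \<in> S \<inter> ball q \<rho>" for x y
  proof -
    have seg: "y + t *\<^sub>R (x - y) \<in> ball q \<rho>" if "0 \<le> t" "t \<le> 1" for t
    proof -
      have "(1 - t) *\<^sub>R y + t *\<^sub>R x \<in> ball q \<rho>"
        using convexD[OF convex_ball, of y q \<rho> x "1 - t" t] x y that by simp
      then show ?thesis by (simp add: algebra_simps)
    qed
    have "\<exists>z. 0 < z \<and> z < 1 \<and> \<phi> (y + 1 *\<^sub>R (x - y)) - \<phi> (y + 0 *\<^sub>R (x - y))
        = (1 - 0) * pd (x - y) \<phi> (y + z *\<^sub>R (x - y))"
    proof (rule MVT2)
      fix t :: real assume "0 \<le> t" "t \<le> 1"
      then have "y + t *\<^sub>R (x - y) \<in> ball p r" using seg \<rho> by blast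
      then show "((\<lambda>t. \<phi> (y + t *\<^sub>R (x - y))) has_real_derivative pd (x - y) \<phi> (y + t *\<^sub>R (x - y))) (at t)"
        by (intro DERIV_line diff_\<phi>)
    qed simp
    then obtain z where z: "0 < z" "z < 1" "pd (x - y) \<phi> (y + z *\<^sub>R (x - y)) = 0"
      using x y S_iff by auto
    let ?z = "y + z *\<^sub>R (x - y)"
    have zb: "?z \<in> ball q \<rho>" using seg z by simp
    then have "gradient \<phi> (at ?z) \<bullet> (x - y) = 0"
      using z(3) \<rho> gradient_inner[OF diff_\<phi>, of ?z "x - y"] by auto
    then have "(x - y) \<bullet> gradient \<phi> (at q) = (x - y) \<bullet> (gradient \<phi> (at q) - gradient \<phi> (at ?z))"
      by (simp add: inner_diff_right inner_commute)
    also have "\<bar>\<dots>\<bar> \<le> norm (x - y) * norm (gradient \<phi> (at q) - gradient \<phi> (at ?z))"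
      by (rule Cauchy_Schwarz_ineq2)
    also have "\<dots> \<le> norm (x - y) * \<eta>"
      using d(2)[of ?z] zb by (intro mult_left_mono) (auto simp: \<rho>_def dist_norm norm_minus_commute)
    finally show ?thesis by (simp add: mult.commute)
  qed
  then show ?thesis using \<rho> by blast
qed

text \<open>Projecting along \<open>e\<close> to the tangent plane at \<open>q\<close> is almost isometric on the boundary
  near \<open>q\<close> and does not change the lines in direction \<open>e\<close>.\<close>
lemma foot_measure_near:
  assumes q: "q \<in> S" and \<theta>: "0 < \<theta>" "\<theta> < 1"
  shows "\<exists>\<rho>>0. \<forall>E\<in>sets borel. E \<subseteq> S \<inter> ball q \<rho> \<longrightarrow>
    emeasure foot_measure E \<le> ennreal ((1 + \<theta>) ^ (DIM('a) - 1) * speed q) * emeasure surface_measure E \<and>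
    ennreal (speed q) * emeasure surface_measure E \<le> ennreal ((1 / (1 - \<theta>)) ^ (DIM('a) - 1)) * emeasure foot_measure E"
proof -
  let ?k = "DIM('a) - 1"
  define G where "G = gradient \<phi> (at q)"
  define N where "N = G /\<^sub>R norm G"
  define a where "a = e \<bullet> N"
  have qB: "q \<in> ball p r" using q S_iff by blast
  have G: "G \<noteq> 0" using chart_facts(3)[of q] qB BU unfolding G_def by blast
  then have N: "norm N = 1" by (simp add: N_def)
  have a: "a = speed q"
    using qB gradient_inner[OF diff_\<phi>[OF qB], of e]
    by (simp add: a_def N_def speed_def G_def inner_commute divide_inverse mult.commute)
  have a0: "a > 0" using speed_pos[OF qB] a by simp
  have aN: "e \<bullet> N = a" "a > 0" using a0 by (simp_all add: a_def)
  \<comment> \<open>Chosen so that the displacement along \<open>e\<close> between two boundary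
    points, estimated in \<open>small\<close>, is at most \<open>\<theta>\<close> times their
    distance.\<close>
  define \<eta> where "\<eta> = \<theta> * a * norm G / norm e"
  have \<eta>: "\<eta> > 0" using \<theta> a0 G e_nonzero by (simp add: \<eta>_def)
  obtain \<rho> where \<rho>: "\<rho> > 0" "ball q \<rho> \<subseteq> ball p r"
    "\<And>x y. x \<in> S \<inter> ball q \<rho> \<Longrightarrow> y \<in> S \<inter> ball q \<rho> \<Longrightarrow> \<bar>(x - y) \<bullet> G\<bar> \<le> \<eta> * norm (x - y)"
    using nearly_flat[OF q \<eta>] unfolding G_def by blast
  define \<pi> where "\<pi> x = (x - q) - ((x - q) \<bullet> N / a) *\<^sub>R e" for x
  have \<pi>_diff: "\<pi> x - \<pi> y = (x - y) - ((x - y) \<bullet> N / a) *\<^sub>R e" for x y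
    by (simp add: \<pi>_def inner_diff_left diff_divide_distrib algebra_simps)
  have \<pi>_line: "\<pi> (x + s *\<^sub>R e) = \<pi> x" for x s
    using a0 aN by (simp add: \<pi>_def inner_add_left inner_diff_left diff_divide_distrib add_divide_distrib algebra_simps)
  have \<pi>_N: "\<pi> x \<bullet> N = 0" for x using a0 aN by (simp add: \<pi>_def inner_diff_left)
  have small: "norm (((x - y) \<bullet> N / a) *\<^sub>R e) \<le> \<theta> * norm (x - y)"
    if "x \<in> S \<inter> ball q \<rho>" "y \<in> S \<inter> ball q \<rho>" for x y
  proof -
    have "\<bar>(x - y) \<bullet> N\<bar> = \<bar>(x - y) \<bullet> G\<bar> / norm G" by (simp add: N_def abs_mult divide_inverse mult.commute)
    also have "\<dots> \<le> \<eta> * norm (x - y) / norm G" using \<rho>(3)[OF that] by (intro divide_right_mono) auto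
    finally have "\<bar>(x - y) \<bullet> N\<bar> \<le> \<theta> * a * norm (x - y) / norm e" using G by (simp add: \<eta>_def)
    then show ?thesis using a0 e_nonzero by (simp add: abs_mult field_simps)
  qed
  have up: "dist (\<pi> x) (\<pi> y) \<le> (1 + \<theta>) * dist x y"
    and low: "(1 - \<theta>) * dist x y \<le> dist (\<pi> x) (\<pi> y)"
    if "x \<in> S \<inter> ball q \<rho>" "y \<in> S \<inter> ball q \<rho>" for x y
    using small[OF that] norm_triangle_ineq4[of "x - y" "((x - y) \<bullet> N / a) *\<^sub>R e"]
      norm_triangle_ineq2[of "x - y" "((x - y) \<bullet> N / a) *\<^sub>R e"]
    unfolding dist_norm \<pi>_diff by (simp_all add: algebra_simps)
  have main: "emeasure foot_measure E \<le> ennreal ((1 + \<theta>) ^ ?k * speed q) * emeasure surface_measure E \<and>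
    ennreal (speed q) * emeasure surface_measure E \<le> ennreal ((1 / (1 - \<theta>)) ^ ?k) * emeasure foot_measure E"
    if E: "E \<in> sets borel" "E \<subseteq> S \<inter> ball q \<rho>" for E
  proof -
    define E' where "E' = \<pi> ` E"
    have E'_eq: "E' = hyperplane N \<inter> (+) q -` hits E"
    proof (intro set_eqI iffI)
      fix z assume "z \<in> E'"
      then obtain x where x: "x \<in> E" "z = \<pi> x" by (auto simp: E'_def)
      have "q + z + ((x - q) \<bullet> N / a) *\<^sub>R e = x" by (simp add: x \<pi>_def)
      then have "q + z \<in> hits E" using x(1)
        unfolding lines_through_def mem_Collect_eq by (intro exI[of _ "(x - q) \<bullet> N / a"]) simp
      then show "z \<in> hyperplane N \<inter> (+) q -` hits E" using x \<pi>_N by (simp add: hyperplane_def)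
    next
      fix z assume z: "z \<in> hyperplane N \<inter> (+) q -` hits E"
      then obtain s where s: "q + z + s *\<^sub>R e \<in> E" by (auto simp: lines_through_def)
      have "\<pi> (q + z + s *\<^sub>R e) = z"
        using z \<pi>_line[of "q + z" s] by (simp add: \<pi>_def hyperplane_def)
      then show "z \<in> E'" using s unfolding E'_def by force
    qed
    have hE: "hits E \<in> sets borel" using E by (intro hits_borel) auto
    have E'b: "E' \<in> sets borel"
      unfolding E'_eq using measurable_sets[of "(+) q" borel borel "hits E"] hE by auto
    \<comment> \<open>\<open>\<pi>\<close> is the linear projection along \<open>e\<close> followed
      by the translation by \<open>- q'\<close> inside the hyperplane, which affects neither the
      slab nor volumes.\<close>
    define q' where "q' = q - (q \<bullet> N / a) *\<^sub>R e"
    have q'N: "q' \<bullet> N = 0" using a0 aN by (simp add: q'_def inner_diff_left)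
    define A0 where "A0 = {x. x - (x \<bullet> N / a) *\<^sub>R e \<in> E'}"
    have A0b: "A0 \<in> sets borel"
    proof -
      have "(\<lambda>x. x - (x \<bullet> N / a) *\<^sub>R e) -` E' \<inter> space borel \<in> sets borel"
        by (rule measurable_sets[OF _ E'b]) measurable
      then show ?thesis by (simp add: A0_def vimage_def)
    qed
    have hits_iff: "x \<in> hits E \<longleftrightarrow> \<pi> x \<in> E'" for x
    proof
      assume "x \<in> hits E"
      then obtain s where "x + s *\<^sub>R e \<in> E" by (auto simp: lines_through_def)
      then show "\<pi> x \<in> E'" using \<pi>_line[of x s] unfolding E'_def by (metis imageI)
    next
      assume "\<pi> x \<in> E'"
      then obtain y where y: "y \<in> E" "\<pi> x = \<pi> y" by (auto simp: E'_def)
      then have "x + (- ((x - y) \<bullet> N / a)) *\<^sub>R e = y" using \<pi>_diff[of x y] by (simp add: algebra_simps)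
      then show "x \<in> hits E" using y(1) unfolding lines_through_def by (metis (mono_tags, lifting) mem_Collect_eq)
    qed
    have "slab N a \<inter> hits E = (+) (- q') -` (slab N a \<inter> A0)"
    proof -
      have "(- q' + x) \<bullet> N = x \<bullet> N" for x using q'N by (simp add: inner_simps)
      moreover have "- q' + x - ((- q' + x) \<bullet> N / a) *\<^sub>R e = \<pi> x" for x
        using calculation[of x] by (simp add: q'_def \<pi>_def inner_diff_left diff_divide_distrib algebra_simps)
      ultimately show ?thesis by (auto simp: slab_def A0_def hits_iff)
    qed
    then have "emeasure lborel (slab N a \<inter> hits E) = emeasure lborel (slab N a \<inter> A0)"
      using lborel_translate[of "slab N a \<inter> A0" "- q'"] A0b by simp
    also have "\<dots> = ennreal a * flat_vol N E'"
      unfolding A0_def by (rule oblique_cylinder[OF N aN E'b])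
    finally have slabN: "emeasure lborel (slab N a \<inter> hits E) = ennreal a * flat_vol N E'" .
    have "emeasure lborel (slab e (e \<bullet> e) \<inter> hits E) = ennreal ((e \<bullet> e) / (e \<bullet> e)) * emeasure lborel (slab N a \<inter> hits E)"
      by (rule slab_thickness[OF hE _ aN ee]) (use ee in \<open>auto simp: lines_through_shift\<close>)
    then have "emeasure lborel (slab e (e \<bullet> e) \<inter> hits E) = ennreal a * flat_vol N E'"
      using ee slabN by simp
    moreover have "E \<inter> S = E" using E by auto
    ultimately have "emeasure foot_measure E = ennreal a * (ennreal (surface_const TYPE('a)) * flat_vol N E')"
      using emeasure_foot_measure[OF E(1)] by (simp add: mult_ac)
    also have "ennreal (surface_const TYPE('a)) * flat_vol N E' = emeasure surface_measure E'"
      using surface_const[OF N dim E'b] by (simp add: E'_eq)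
    finally have fm: "emeasure foot_measure E = ennreal a * emeasure surface_measure E'" .
    have up': "emeasure surface_measure E' \<le> ennreal ((1 + \<theta>) ^ ?k) * emeasure surface_measure E"
      using hausdorff_outer_lipschitz[of "1 + \<theta>" E \<pi> ?k] up E \<theta> E'b
      by (auto simp: emeasure_surface E'_def subset_iff)
    have inj: "inj_on \<pi> E"
    proof (rule inj_onI)
      fix x y assume "x \<in> E" "y \<in> E" "\<pi> x = \<pi> y"
      then have "(1 - \<theta>) * dist x y \<le> 0" using low[OF subsetD[OF E(2)] subsetD[OF E(2)], of x y] by simp
      then have "dist x y \<le> 0" using \<theta> by (simp add: mult_le_0_iff)
      then show "x = y" by simp
    qed
    have "inv_into E \<pi> ` E' = E" using inj by (simp add: E'_def)
    moreover have "dist (inv_into E \<pi> x) (inv_into E \<pi> y) \<le> 1 / (1 - \<theta>) * dist x y"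
      if xy: "x \<in> E'" "y \<in> E'" for x y
    proof -
      obtain u v where uv: "u \<in> E" "v \<in> E" "x = \<pi> u" "y = \<pi> v" using xy by (auto simp: E'_def)
      then have "(1 - \<theta>) * dist u v \<le> dist x y" using low[OF subsetD[OF E(2)] subsetD[OF E(2)], of u v] by simp
      then show ?thesis using \<theta> uv inj by (simp add: field_simps)
    qed
    ultimately have low': "emeasure surface_measure E \<le> ennreal ((1 / (1 - \<theta>)) ^ ?k) * emeasure surface_measure E'"
      using hausdorff_outer_lipschitz[of "1 / (1 - \<theta>)" E' "inv_into E \<pi>" ?k] \<theta> E E'b
      by (simp add: emeasure_surface)
    have "emeasure foot_measure E \<le> ennreal a * (ennreal ((1 + \<theta>) ^ ?k) * emeasure surface_measure E)"
      unfolding fm by (intro mult_left_mono up') simp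
    also have "\<dots> = ennreal ((1 + \<theta>) ^ ?k * speed q) * emeasure surface_measure E"
      using \<theta> a0 a by (simp add: ennreal_mult mult_ac)
    finally have 1: "emeasure foot_measure E \<le> ennreal ((1 + \<theta>) ^ ?k * speed q) * emeasure surface_measure E" .
    have "ennreal a * emeasure surface_measure E \<le> ennreal a * (ennreal ((1 / (1 - \<theta>)) ^ ?k) * emeasure surface_measure E')"
      by (intro mult_left_mono low') simp
    also have "\<dots> = ennreal ((1 / (1 - \<theta>)) ^ ?k) * emeasure foot_measure E"
      unfolding fm by (simp only: mult_ac)
    finally show ?thesis using 1 a by simp
  qed
  then show ?thesis using \<rho>(1) by blast
qed

lemma p_in_S: "p \<in> S"
  using p r by (simp add: S_def)

text \<open>Only a bounded part of the slab lies on lines that meet the boundary piece, so its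
  \<open>foot_measure\<close> is finite; the comparison with \<open>\<theta> = 1/2\<close> carries
  this over to surface measure near \<open>p\<close>.\<close>

lemma surface_finite_near: "\<exists>\<rho>>0. emeasure surface_measure (frontier \<Omega> \<inter> ball p \<rho>) < \<infinity>"
proof -
  obtain \<rho> where \<rho>: "\<rho> > 0" "\<And>E. E \<in> sets borel \<Longrightarrow> E \<subseteq> S \<inter> ball p \<rho> \<Longrightarrow>
     ennreal (speed p) * emeasure surface_measure E \<le> ennreal ((1 / (1 - 1/2)) ^ (DIM('a) - 1)) * emeasure foot_measure E"
    using foot_measure_near[OF p_in_S, of "1/2"] by auto
  define E where "E = S \<inter> ball p (min \<rho> r)"
  have E: "E \<in> sets borel" "E \<subseteq> S \<inter> ball p \<rho>" by (auto simp: E_def)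
  have "bounded (slab e (e \<bullet> e) \<inter> hits (E \<inter> S))"
  proof (rule boundedI)
    fix x assume x: "x \<in> slab e (e \<bullet> e) \<inter> hits (E \<inter> S)"
    then obtain s where s: "x + s *\<^sub>R e \<in> ball p r" by (auto simp: lines_through_def S_def)
    have ny: "norm (x + s *\<^sub>R e) \<le> norm p + r"
      using s norm_triangle_ineq2[of "x + s *\<^sub>R e" p] by (simp add: dist_norm norm_minus_commute)
    have "s * (e \<bullet> e) = (x + s *\<^sub>R e) \<bullet> e - x \<bullet> e" by (simp add: inner_simps)
    also have "\<bar>\<dots>\<bar> \<le> norm (x + s *\<^sub>R e) * norm e + (e \<bullet> e) / 2"
    proof -
      have "\<bar>x \<bullet> e\<bar> \<le> (e \<bullet> e) / 2" using x by (simp add: slab_def)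
      then show ?thesis
        using Cauchy_Schwarz_ineq2[of "x + s *\<^sub>R e" e] abs_triangle_ineq4[of "(x + s *\<^sub>R e) \<bullet> e" "x \<bullet> e"]
        by linarith
    qed
    also have "\<dots> \<le> (norm p + r) * norm e + (e \<bullet> e) / 2"
      using ny by (intro add_right_mono mult_right_mono) auto
    finally have "\<bar>s\<bar> \<le> ((norm p + r) * norm e + (e \<bullet> e) / 2) / (e \<bullet> e)"
      using ee by (simp add: abs_mult field_simps)
    then have "\<bar>s\<bar> * norm e \<le> ((norm p + r) * norm e + (e \<bullet> e) / 2) / (e \<bullet> e) * norm e"
      by (intro mult_right_mono) auto
    moreover have "norm x \<le> norm (x + s *\<^sub>R e) + \<bar>s\<bar> * norm e"
      using norm_triangle_ineq4[of "x + s *\<^sub>R e" "s *\<^sub>R e"] by simp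
    ultimately show "norm x \<le> (norm p + r) + ((norm p + r) * norm e + (e \<bullet> e) / 2) / (e \<bullet> e) * norm e"
      using ny by linarith
  qed
  then have "emeasure lborel (slab e (e \<bullet> e) \<inter> hits (E \<inter> S)) < \<infinity>"
    by (rule emeasure_lborel_bounded_finite)
  then have "ennreal ((1 / (1 - 1/2)) ^ (DIM('a) - 1)) * emeasure foot_measure E < \<infinity>"
    using emeasure_foot_measure[OF E(1)] by (simp add: ennreal_mult_less_top)
  then have "ennreal (speed p) * emeasure surface_measure E < \<infinity>"
    using \<rho>(2)[OF E] by (rule order_le_less_trans[rotated])
  then have "emeasure surface_measure E < \<infinity>"
    using speed_pos[of p] r by (auto simp: ennreal_mult_less_top)
  moreover have "E = frontier \<Omega> \<inter> ball p (min \<rho> r)" by (auto simp: E_def S_def)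
  ultimately show ?thesis using \<rho>(1) r by (intro exI[of _ "min \<rho> r"]) auto
qed

definition speed_measure :: "'a measure" where
  "speed_measure = density surface_measure (\<lambda>x. ennreal (speed x * indicator S x))"

lemma sets_speed_measure [simp]: "sets speed_measure = sets borel"
  by (simp add: speed_measure_def)

lemma emeasure_speed_measure:
  assumes E[measurable]: "E \<in> sets borel"
  shows "emeasure speed_measure E = (\<integral>\<^sup>+x. ennreal (speed x) * indicator (E \<inter> S) x \<partial>surface_measure)"
proof -
  have "emeasure speed_measure E = (\<integral>\<^sup>+x. ennreal (speed x * indicator S x) * indicator E x \<partial>surface_measure)"
    unfolding speed_measure_def by (subst emeasure_density) auto
  also have "\<dots> = (\<integral>\<^sup>+x. ennreal (speed x) * indicator (E \<inter> S) x \<partial>surface_measure)"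
    by (intro nn_integral_cong) (auto simp: indicator_def)
  finally show ?thesis .
qed

text \<open>The factor \<open>L = l * l\<close> is spent in two halves: one \<open>l\<close> for the
  distortion by the projection to the tangent plane at \<open>q\<close>, one for the oscillation of
  \<open>speed\<close> around \<open>q\<close>.\<close>

lemma foot_speed_local:
  assumes L: "1 < L" and q: "q \<in> S"
  shows "\<exists>\<rho>>0. \<forall>E\<in>sets borel. E \<subseteq> S \<inter> ball q \<rho> \<longrightarrow>
    emeasure foot_measure E \<le> ennreal L * emeasure speed_measure E \<and>
    emeasure speed_measure E \<le> ennreal L * emeasure foot_measure E"
proof -
  let ?k = "DIM('a) - 1"
  define l where "l = sqrt L"
  have l: "1 < l" "l * l = L" using L by (auto simp: l_def)
  have qB: "q \<in> ball p r" using q S_iff by blast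
  have a0: "speed q > 0" by (rule speed_pos[OF qB])
  have "((\<lambda>t::real. (1 + t) ^ ?k) \<longlongrightarrow> (1 + 0) ^ ?k) (at_right 0)" by (intro tendsto_intros)
  then have e1: "\<forall>\<^sub>F t in at_right 0. (1 + t) ^ ?k < l" using l by (auto intro: order_tendstoD)
  have "((\<lambda>t::real. (1 / (1 - t)) ^ ?k) \<longlongrightarrow> (1 / (1 - 0)) ^ ?k) (at_right 0)" by (intro tendsto_intros) auto
  then have e2: "\<forall>\<^sub>F t in at_right 0. (1 / (1 - t)) ^ ?k < l" using l by (auto intro: order_tendstoD)
  have e3: "\<forall>\<^sub>F t::real in at_right 0. 0 < t \<and> t < 1" unfolding eventually_at_right[OF zero_less_one] by (intro exI[of _ 1]) auto
  obtain \<theta> :: real where \<theta>: "0 < \<theta>" "\<theta> < 1" "(1 + \<theta>) ^ ?k < l" "(1 / (1 - \<theta>)) ^ ?k < l"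
    using eventually_happens'[OF _ eventually_conj[OF e1 eventually_conj[OF e2 e3]]] by auto
  obtain \<rho>1 where \<rho>1: "\<rho>1 > 0" "\<And>E. E \<in> sets borel \<Longrightarrow> E \<subseteq> S \<inter> ball q \<rho>1 \<Longrightarrow>
    emeasure foot_measure E \<le> ennreal ((1 + \<theta>) ^ ?k * speed q) * emeasure surface_measure E \<and>
    ennreal (speed q) * emeasure surface_measure E \<le> ennreal ((1 / (1 - \<theta>)) ^ ?k) * emeasure foot_measure E"
    using foot_measure_near[OF q \<theta>(1,2)] by blast
  have "isCont speed q" using speed_continuous qB by (simp add: continuous_on_eq_continuous_at)
  then have "(speed \<longlongrightarrow> speed q) (nhds q)" by (simp add: continuous_within tendsto_at_iff_tendsto_nhds)
  moreover have "speed q / l < speed q" "speed q < speed q * l" using a0 l by (auto simp: field_simps)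
  ultimately have "\<forall>\<^sub>F x in nhds q. speed q / l < speed x \<and> speed x < speed q * l"
    by (auto intro!: eventually_conj order_tendstoD)
  then obtain \<rho>2 where \<rho>2: "\<rho>2 > 0" "\<And>x. dist x q < \<rho>2 \<Longrightarrow> speed q / l < speed x \<and> speed x < speed q * l"
    unfolding eventually_nhds_metric by blast
  have "emeasure foot_measure E \<le> ennreal L * emeasure speed_measure E \<and>
    emeasure speed_measure E \<le> ennreal L * emeasure foot_measure E"
    if E: "E \<in> sets borel" "E \<subseteq> S \<inter> ball q (min \<rho>1 \<rho>2)" for E
  proof -
    have ES: "E \<inter> S = E" using E by auto
    have "E \<subseteq> S \<inter> ball q \<rho>1" using E(2) by auto
    note b = \<rho>1(2)[OF E(1) this]
    have sp: "speed q / l \<le> speed x" "speed x \<le> speed q * l" if "x \<in> E" for x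
    proof -
      have "x \<in> ball q (min \<rho>1 \<rho>2)" using E(2) that by blast
      then have "dist x q < \<rho>2" by (simp add: dist_commute)
      then show "speed q / l \<le> speed x" "speed x \<le> speed q * l" using \<rho>2(2) by (auto intro: less_imp_le)
    qed
    have "ennreal (speed q / l) * emeasure surface_measure E
        = (\<integral>\<^sup>+x. ennreal (speed q / l) * indicator E x \<partial>surface_measure)"
      using E by (simp add: nn_integral_cmult)
    also have "\<dots> \<le> emeasure speed_measure E"
      unfolding emeasure_speed_measure[OF E(1)] ES
      by (intro nn_integral_mono) (auto simp: indicator_def sp intro!: ennreal_leI)
    finally have s1: "ennreal (speed q / l) * emeasure surface_measure E \<le> emeasure speed_measure E" .
    have "emeasure speed_measure E \<le> (\<integral>\<^sup>+x. ennreal (speed q * l) * indicator E x \<partial>surface_measure)"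
      unfolding emeasure_speed_measure[OF E(1)] ES
      by (intro nn_integral_mono) (auto simp: indicator_def sp intro!: ennreal_leI)
    also have "\<dots> = ennreal (speed q * l) * emeasure surface_measure E"
      using E by (simp add: nn_integral_cmult)
    finally have s2: "emeasure speed_measure E \<le> ennreal (speed q * l) * emeasure surface_measure E" .
    have "emeasure foot_measure E \<le> ennreal ((1 + \<theta>) ^ ?k * speed q) * emeasure surface_measure E"
      using b by blast
    also have "\<dots> \<le> ennreal (l * speed q) * emeasure surface_measure E"
      using \<theta> a0 by (intro mult_right_mono ennreal_leI) auto
    also have "\<dots> = ennreal L * (ennreal (speed q / l) * emeasure surface_measure E)"
    proof -
      have eq: "l * speed q = L * (speed q / l)" unfolding l(2)[symmetric] using l(1) by simp
      show ?thesis unfolding eq using L l a0 by (subst ennreal_mult) (auto simp: mult.assoc)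
    qed
    also have "\<dots> \<le> ennreal L * emeasure speed_measure E" by (intro mult_left_mono s1) simp
    finally have 1: "emeasure foot_measure E \<le> ennreal L * emeasure speed_measure E" .
    have "emeasure speed_measure E \<le> ennreal l * (ennreal (speed q) * emeasure surface_measure E)"
    proof -
      have "ennreal (speed q * l) = ennreal l * ennreal (speed q)"
        using l a0 by (subst ennreal_mult[symmetric]) (auto simp: mult.commute)
      then show ?thesis using s2 by (simp add: mult.assoc)
    qed
    also have "\<dots> \<le> ennreal l * (ennreal ((1 / (1 - \<theta>)) ^ ?k) * emeasure foot_measure E)"
      using b by (intro mult_left_mono) auto
    also have "\<dots> \<le> ennreal l * (ennreal l * emeasure foot_measure E)"
      using \<theta> by (intro mult_left_mono mult_right_mono ennreal_leI) auto
    also have "\<dots> = ennreal L * emeasure foot_measure E"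
      using l by (simp add: mult.assoc[symmetric] ennreal_mult[symmetric])
    finally show ?thesis using 1 by blast
  qed
  then show ?thesis using \<rho>1(1) \<rho>2(1) by (intro exI[of _ "min \<rho>1 \<rho>2"]) auto
qed

lemma foot_speed: "foot_measure = speed_measure"
proof (rule measure_eqI)
  fix E assume "E \<in> sets foot_measure"
  then have E: "E \<in> sets borel" by simp
  then have ES: "E \<inter> S \<in> sets borel" by simp
  have "emeasure foot_measure E = emeasure foot_measure (E \<inter> S)"
    using E ES by (simp add: emeasure_foot_measure Int_assoc)
  also have "\<dots> = emeasure speed_measure (E \<inter> S)"
  proof (rule antisym)
    have loc: "\<exists>\<rho>>0. \<forall>F\<in>sets borel. F \<subseteq> S \<inter> ball q \<rho> \<longrightarrow>
        emeasure foot_measure F \<le> ennreal L * emeasure speed_measure F"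
      "\<exists>\<rho>>0. \<forall>F\<in>sets borel. F \<subseteq> S \<inter> ball q \<rho> \<longrightarrow>
        emeasure speed_measure F \<le> ennreal L * emeasure foot_measure F"
      if Lq: "1 < L" "q \<in> S" for L q
    proof -
      obtain \<rho> where "\<rho> > 0" "\<forall>F\<in>sets borel. F \<subseteq> S \<inter> ball q \<rho> \<longrightarrow>
        emeasure foot_measure F \<le> ennreal L * emeasure speed_measure F \<and>
        emeasure speed_measure F \<le> ennreal L * emeasure foot_measure F"
        using foot_speed_local[OF Lq] by (elim exE conjE)
      then show "\<exists>\<rho>>0. \<forall>F\<in>sets borel. F \<subseteq> S \<inter> ball q \<rho> \<longrightarrow>
        emeasure foot_measure F \<le> ennreal L * emeasure speed_measure F"
        "\<exists>\<rho>>0. \<forall>F\<in>sets borel. F \<subseteq> S \<inter> ball q \<rho> \<longrightarrow>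
        emeasure speed_measure F \<le> ennreal L * emeasure foot_measure F" by blast+
    qed
    have sub: "E \<inter> S \<subseteq> S" by simp
    show "emeasure foot_measure (E \<inter> S) \<le> emeasure speed_measure (E \<inter> S)"
      by (rule measure_le_local[OF sets_foot_measure sets_speed_measure loc(1) ES sub])
    show "emeasure speed_measure (E \<inter> S) \<le> emeasure foot_measure (E \<inter> S)"
      by (rule measure_le_local[OF sets_speed_measure sets_foot_measure loc(2) ES sub])
  qed
  also have "\<dots> = emeasure speed_measure E"
    using E ES by (simp add: emeasure_speed_measure Int_assoc)
  finally show "emeasure foot_measure E = emeasure speed_measure E" .
qed simp

text \<open>Integration along the lines replaces the derivative by the value of
  \<open>\<psi>\<close> at the foot; pushing the slab measure forward to \<open>S\<close> then
  produces the weight \<open>speed\<close>, which is the component of \<open>e\<close> along the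
  outer normal.\<close>

lemma chart_divergence:
  fixes \<psi> :: "'a \<Rightarrow> real"
  assumes \<psi>: "Cinf UNIV \<psi>" and K: "compact K" "K \<subseteq> ball p r" and supp: "\<And>x. x \<notin> K \<Longrightarrow> \<psi> x = 0"
  shows "surface_const TYPE('a) * (\<integral>x. indicator \<Omega> x * pd e \<psi> x \<partial>lborel) = (\<integral>x. indicator S x * (speed x * \<psi> x) \<partial>surface_measure)"
proof -
  have [measurable]: "\<Omega> \<in> sets borel" using open_\<Omega> by simp
  have [measurable]: "pd e \<psi> \<in> borel_measurable borel"
    by (rule borel_measurable_continuous_onI[OF Cinf_continuous_on[OF Cinf_pd[OF \<psi>]]])
  have [measurable]: "\<psi> \<in> borel_measurable borel"
    by (rule borel_measurable_continuous_onI[OF Cinf_continuous_on[OF \<psi>]])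
  have pd0: "pd e \<psi> y = 0" if "y \<notin> K" for y
  proof -
    have "pd e \<psi> y = pd e (\<lambda>x. 0) y"
      by (rule pd_cong[of "- K"]) (use that supp compact_imp_closed[OF K(1)] in auto)
    then show ?thesis by simp
  qed
  have "integrable lborel (\<lambda>x. indicator K x *\<^sub>R pd e \<psi> x)"
    using borel_integrable_compact[OF K(1), of "pd e \<psi>"] continuous_on_subset[OF Cinf_continuous_on[OF Cinf_pd[OF \<psi>]]]
    by (simp add: indicator_scaleR_eq_if)
  then have "integrable lborel (\<lambda>x. indicator \<Omega> x *\<^sub>R (indicator K x *\<^sub>R pd e \<psi> x))"
    by (rule integrable_mult_indicator[rotated]) simp
  moreover have "(\<lambda>x. indicator \<Omega> x *\<^sub>R (indicator K x *\<^sub>R pd e \<psi> x)) = (\<lambda>x. indicator \<Omega> x * pd e \<psi> x)"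
  proof
    show "indicator \<Omega> x *\<^sub>R (indicator K x *\<^sub>R pd e \<psi> x) = indicator \<Omega> x * pd e \<psi> x" for x
      by (cases "x \<in> K") (simp_all add: pd0)
  qed
  ultimately have int: "integrable lborel (\<lambda>x. indicator \<Omega> x * pd e \<psi> x)" by simp
  have "(\<integral>x. indicator \<Omega> x * pd e \<psi> x \<partial>lborel)
      = (\<integral>x. indicator (slab e (e \<bullet> e)) x * (\<integral>s. indicator \<Omega> (x + s *\<^sub>R e) * pd e \<psi> (x + s *\<^sub>R e) \<partial>lborel) \<partial>lborel)"
  proof (rule integral_along_lines[OF int])
    show "(\<integral>\<^sup>+s. ennreal (indicator (slab e (e \<bullet> e)) (x - s *\<^sub>R e)) \<partial>lborel) = 1" for x
      using slab_weight[OF ee, of x] by (simp add: ennreal_indicator)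
  qed auto
  also have "\<dots> = (\<integral>x. indicator (slab e (e \<bullet> e)) x * (indicator (hits S) x * \<psi> (foot x)) \<partial>lborel)"
  proof (rule Bochner_Integration.integral_cong[OF refl])
    fix x
    have "(\<integral>s. indicator \<Omega> (x + s *\<^sub>R e) * pd e \<psi> (x + s *\<^sub>R e) \<partial>lborel)
      = indicator (hits S) x * \<psi> (foot x)"
      by (rule line_integral[OF \<psi> K]) (rule supp)
    then show "indicator (slab e (e \<bullet> e)) x * (\<integral>s. indicator \<Omega> (x + s *\<^sub>R e) * pd e \<psi> (x + s *\<^sub>R e) \<partial>lborel)
      = indicator (slab e (e \<bullet> e)) x * (indicator (hits S) x * \<psi> (foot x))" by (rule arg_cong)
  qed
  finally have "surface_const TYPE('a) * (\<integral>x. indicator \<Omega> x * pd e \<psi> x \<partial>lborel)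
      = (\<integral>x. surface_const TYPE('a) * (indicator (slab e (e \<bullet> e)) x * (indicator (hits S) x * \<psi> (foot x))) \<partial>lborel)" by simp
  also have "\<dots> = (\<integral>x. (surface_const TYPE('a) * indicator (slab e (e \<bullet> e) \<inter> hits S) x) *\<^sub>R \<psi> (foot x) \<partial>lborel)"
    by (intro Bochner_Integration.integral_cong) (auto simp: indicator_def)
  also have "\<dots> = (\<integral>x. \<psi> (foot x) \<partial>density lborel (\<lambda>x. ennreal (surface_const TYPE('a) * indicator (slab e (e \<bullet> e) \<inter> hits S) x)))"
    using C_pos by (intro integral_density[symmetric]) auto
  also have "\<dots> = (\<integral>x. \<psi> x \<partial>foot_measure)"
    unfolding foot_measure_def by (rule integral_distr[symmetric]) measurable
  also have "\<dots> = (\<integral>x. (speed x * indicator S x) *\<^sub>R \<psi> x \<partial>surface_measure)"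
    unfolding foot_speed speed_measure_def using speed_nonneg by (intro integral_density) auto
  also have "\<dots> = (\<integral>x. indicator S x * (speed x * \<psi> x) \<partial>surface_measure)"
    by (simp add: mult_ac)
  finally show ?thesis .
qed

end

section \<open>The divergence theorem on smooth domains\<close>

lemma Ck_Un:
  assumes "open U" "open V"
  shows "Ck_on_open k U f \<Longrightarrow> Ck_on_open k V f \<Longrightarrow> Ck_on_open k (U \<union> V) f"
proof (induction k arbitrary: f)
  case 0
  then show ?case using assms by (simp add: Ck_0 continuous_on_open_Un)
next
  case (Suc k)
  note d = Ck_SucD[OF Suc.prems(1)] Ck_SucD[OF Suc.prems(2)]
  show ?case
  proof (rule Ck_SucI)
    show "f differentiable at x" if "x \<in> U \<union> V" for x using that d(1,3) by blast
    show "Ck_on_open k (U \<union> V) (\<lambda>x. pd v f x)" for v by (rule Suc.IH[OF d(2) d(4)])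
  qed
qed

lemma Cinf_Un:
  assumes "open U" "open V" "Cinf U f" "Cinf V f"
  shows "Cinf (U \<union> V) f"
  by (rule CinfI) (rule Ck_Un[OF assms(1,2) CinfD[OF assms(3)] CinfD[OF assms(4)]])

lemma Cinf_cutoff:
  assumes V: "open V" and f: "Cinf V f" and b: "Cinf UNIV b" and K: "closed K" "K \<subseteq> V"
    and supp: "\<And>x. x \<notin> K \<Longrightarrow> b x = 0"
  shows "Cinf UNIV (\<lambda>x. b x * f x)"
proof -
  have oK: "open (- K)" using K(1) by (simp add: open_Compl)
  have 1: "Cinf V (\<lambda>x. b x * f x)"
    by (rule Cinf_mult[OF V Cinf_subset[OF b subset_UNIV] f])
  have 2: "Cinf (- K) (\<lambda>x. b x * f x)"
    by (rule Cinf_cong[OF oK _ Cinf_const[of _ 0]]) (simp add: supp)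
  have "V \<union> - K = UNIV" using K(2) by blast
  with Cinf_Un[OF V oK 1 2] show ?thesis by simp
qed

lemma Cinf_prod: "open U \<Longrightarrow> (\<And>i. i \<in> I \<Longrightarrow> Cinf U (f i)) \<Longrightarrow> Cinf U (\<lambda>x. \<Prod>i\<in>I. f i x)"
  by (induction I rule: infinite_finite_induct) (simp_all add: Cinf_const Cinf_mult)

definition bump :: "'a::euclidean_space \<Rightarrow> real \<Rightarrow> 'a \<Rightarrow> real" where
  "bump p \<rho> x = 1 - smooth_step ((1 / \<rho>\<^sup>2) * ((x - p) \<bullet> (x - p)))"

lemma Cinf_dist_square: "Cinf UNIV (\<lambda>x. (x - p) \<bullet> (x - p))"
proof -
  have "Cinf UNIV (\<lambda>x. x \<bullet> x - 2 * (x \<bullet> p) + p \<bullet> p)"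
    by (intro Cinf_add Cinf_diff Cinf_mult Cinf_inner_self Cinf_inner Cinf_const) auto
  moreover have "(\<lambda>x. x \<bullet> x - 2 * (x \<bullet> p) + p \<bullet> p) = (\<lambda>x. (x - p) \<bullet> (x - p))"
    by (rule ext) (simp add: inner_diff_left inner_diff_right inner_commute)
  ultimately show ?thesis by simp
qed

lemma Cinf_bump: "Cinf UNIV (bump p \<rho>)"
  unfolding bump_def[abs_def]
  by (intro Cinf_diff Cinf_const Cinf_comp[OF _ _ Cinf_smooth_step] Cinf_mult Cinf_dist_square) auto

lemma dist_square: "(x - p) \<bullet> (x - p) = (dist p x)\<^sup>2"
  by (metis dist_commute dist_norm power2_norm_eq_inner)

lemma bump_eq_1: "0 < \<rho> \<Longrightarrow> dist p x \<le> \<rho> / 2 \<Longrightarrow> bump p \<rho> x = 1"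
proof -
  assume \<rho>: "0 < \<rho>" and d: "dist p x \<le> \<rho> / 2"
  have "(x - p) \<bullet> (x - p) = (dist p x)\<^sup>2" by (rule dist_square)
  also have "\<dots> \<le> (\<rho> / 2)\<^sup>2" using d by (intro power_mono) auto
  finally have "(1 / \<rho>\<^sup>2) * ((x - p) \<bullet> (x - p)) \<le> 1 / 4" using \<rho> by (simp add: field_simps power2_eq_square)
  then show ?thesis by (simp add: bump_def smooth_step_simps)
qed

lemma bump_eq_0: "0 < \<rho> \<Longrightarrow> \<rho> \<le> dist p x \<Longrightarrow> bump p \<rho> x = 0"
proof -
  assume \<rho>: "0 < \<rho>" and d: "\<rho> \<le> dist p x"
  have "\<rho>\<^sup>2 \<le> (dist p x)\<^sup>2" using d \<rho> by (intro power_mono) auto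
  also have "\<dots> = (x - p) \<bullet> (x - p)" by (rule dist_square[symmetric])
  finally have "1 \<le> (1 / \<rho>\<^sup>2) * ((x - p) \<bullet> (x - p))" using \<rho> by (simp add: field_simps)
  then show ?thesis by (simp add: bump_def smooth_step_simps)
qed

lemma pd_zero_off_support:
  assumes "closed K" "\<And>x. x \<notin> K \<Longrightarrow> f x = 0" "x \<notin> K"
  shows "pd v f x = 0"
proof -
  have "pd v f x = pd v (\<lambda>x. 0) x"
    by (rule pd_cong[of "- K"]) (use assms in auto)
  then show ?thesis by simp
qed

lemma integrable_continuous_compact_support:
  fixes f :: "'a::euclidean_space \<Rightarrow> real"
  assumes "continuous_on UNIV f" "compact K" "\<And>x. x \<notin> K \<Longrightarrow> f x = 0"
  shows "integrable lborel f"
proof -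
  have "integrable lborel (\<lambda>x. indicator K x *\<^sub>R f x)"
    using borel_integrable_compact[OF assms(2), of f] continuous_on_subset[OF assms(1)]
    by (simp add: indicator_scaleR_eq_if)
  moreover have "(\<lambda>x. indicator K x *\<^sub>R f x) = f"
  proof
    show "indicator K x *\<^sub>R f x = f x" for x by (cases "x \<in> K") (simp_all add: assms(3))
  qed
  ultimately show ?thesis by simp
qed

text \<open>The integral vanishes already along each single line in direction
  \<open>v\<close>.\<close>

lemma integral_pd_compact_support:
  fixes f :: "'a::euclidean_space \<Rightarrow> real"
  assumes f: "Cinf UNIV f" and K: "compact K" and supp: "\<And>x. x \<notin> K \<Longrightarrow> f x = 0"
  shows "(\<integral>x. pd v f x \<partial>lborel) = 0"
proof (cases "v = 0")
  case True
  then have "pd v f x = 0" for x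
    using linear_0[OF linear_pd[OF Cinf_differentiable[OF f]]] by simp
  then show ?thesis by simp
next
  case False
  then have v: "v \<bullet> v = v \<bullet> v" "v \<bullet> v > 0" by auto
  note Kc = compact_imp_closed[OF K]
  have pd0: "y \<notin> K \<Longrightarrow> pd v f y = 0" for y by (rule pd_zero_off_support[OF Kc supp])
  have int: "integrable lborel (pd v f)"
    by (rule integrable_continuous_compact_support[OF Cinf_continuous_on[OF Cinf_pd[OF f]] K pd0])
  obtain R where R: "\<And>y. y \<in> K \<Longrightarrow> norm y \<le> R" using compact_imp_bounded[OF K] by (auto simp: bounded_iff)
  have line: "(\<integral>s. pd v f (x + s *\<^sub>R v) \<partial>lborel) = 0" for x
  proof -
    define M where "M = (\<bar>R\<bar> + norm x) / norm v + 1"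
    have M: "x + s *\<^sub>R v \<notin> K" if "M \<le> \<bar>s\<bar>" for s
    proof
      assume "x + s *\<^sub>R v \<in> K"
      then have "norm (x + s *\<^sub>R v) \<le> R" by (rule R)
      moreover have "norm (s *\<^sub>R v) \<le> norm (x + s *\<^sub>R v) + norm x"
        using norm_triangle_ineq4[of "x + s *\<^sub>R v" x] by simp
      ultimately have "\<bar>s\<bar> * norm v \<le> \<bar>R\<bar> + norm x" by simp
      then have "\<bar>s\<bar> \<le> (\<bar>R\<bar> + norm x) / norm v" using False by (simp add: field_simps)
      then show False using that by (simp add: M_def)
    qed
    have M0: "M > 0" by (auto simp: M_def intro!: add_nonneg_pos divide_nonneg_nonneg)
    have d: "((\<lambda>s. f (x + s *\<^sub>R v)) has_real_derivative pd v f (x + s *\<^sub>R v)) (at s)" for s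
      by (rule DERIV_line[OF Cinf_differentiable[OF f]]) simp
    have c: "isCont (\<lambda>s. pd v f (x + s *\<^sub>R v)) s" for s
    proof -
      have "isCont (pd v f) (x + s *\<^sub>R v)"
        using Cinf_continuous_on[OF Cinf_pd[OF f]] by (simp add: continuous_on_eq_continuous_at)
      moreover have "isCont (\<lambda>s. x + s *\<^sub>R v) s" by (intro continuous_intros)
      ultimately show ?thesis by (rule isCont_o2[where f="\<lambda>s. x + s *\<^sub>R v" and g="pd v f", rotated])
    qed
    have "(\<integral>s. pd v f (x + s *\<^sub>R v) \<partial>lborel) = (\<integral>s. pd v f (x + s *\<^sub>R v) * indicator {- M..M} s \<partial>lborel)"
    proof (rule Bochner_Integration.integral_cong[OF refl])
      fix s show "pd v f (x + s *\<^sub>R v) = pd v f (x + s *\<^sub>R v) * indicator {- M..M} s"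
        using M[of s] pd0[of "x + s *\<^sub>R v"] by (cases "s \<in> {- M..M}") auto
    qed
    also have "\<dots> = f (x + M *\<^sub>R v) - f (x + (- M) *\<^sub>R v)"
      using has_bochner_integral_FTC_Icc_real[OF _ d c, of "- M" M] M0 by (simp add: has_bochner_integral_iff)
    also have "\<dots> = 0" using M0 supp[OF M[of M]] supp[OF M[of "- M"]] by simp
    finally show ?thesis .
  qed
  have "(\<integral>x. pd v f x \<partial>lborel) = (\<integral>x. indicator (slab v (v \<bullet> v)) x * (\<integral>s. pd v f (x + s *\<^sub>R v) \<partial>lborel) \<partial>lborel)"
  proof (rule integral_along_lines[OF int])
    show "(\<integral>\<^sup>+s. ennreal (indicator (slab v (v \<bullet> v)) (x - s *\<^sub>R v)) \<partial>lborel) = 1" for x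
      using slab_weight[OF v, of x] by (simp add: ennreal_indicator)
  qed auto
  then show ?thesis by (simp add: line)
qed

subsection \<open>The outer unit normal\<close>

lemma descent_direction:
  assumes U: "open U" "p \<in> U" and f: "f differentiable at p" and f0: "f p = 0" and v: "pd v f p < 0"
  shows "\<forall>\<^sub>F t in at_right 0. p + t *\<^sub>R v \<in> U \<and> f (p + t *\<^sub>R v) < (0::real)"
proof (rule eventually_conj)
  have "((\<lambda>t. p + t *\<^sub>R v) \<longlongrightarrow> p + 0 *\<^sub>R v) (at_right 0)" by (intro tendsto_intros)
  then show "\<forall>\<^sub>F t in at_right 0. p + t *\<^sub>R v \<in> U" using U by (auto elim: topological_tendstoD)
  have "((\<lambda>t. f (p + t *\<^sub>R v)) has_real_derivative pd v f (p + 0 *\<^sub>R v)) (at 0)"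
    by (rule DERIV_line) (simp add: f)
  then obtain d where "d > 0" "\<And>t. 0 < t \<Longrightarrow> t < d \<Longrightarrow> f (p + (0 + t) *\<^sub>R v) < f (p + 0 *\<^sub>R v)"
    using DERIV_neg_dec_right[of "\<lambda>t. f (p + t *\<^sub>R v)" _ 0] v by auto
  then show "\<forall>\<^sub>F t in at_right 0. f (p + t *\<^sub>R v) < 0"
    using f0 by (auto simp: eventually_at_right_field intro!: exI[of _ d])
qed

lemma local_defining_functionD:
  assumes "local_defining_function \<Omega> U \<phi>"
  shows "open U" "Cinf U \<phi>" "\<And>x. x \<in> U \<Longrightarrow> gradient \<phi> (at x) \<noteq> 0"
    "\<And>x. x \<in> U \<Longrightarrow> x \<in> \<Omega> \<longleftrightarrow> \<phi> x < 0" "\<And>x. x \<in> U \<Longrightarrow> x \<in> frontier \<Omega> \<longleftrightarrow> \<phi> x = 0"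
    "\<And>x. x \<in> U \<Longrightarrow> \<phi> differentiable at x"
proof -
  show U: "open U" "\<And>x. x \<in> U \<Longrightarrow> gradient \<phi> (at x) \<noteq> 0"
    using assms unfolding local_defining_function_def by blast+
  show c: "Cinf U \<phi>"
    using assms unfolding local_defining_function_def using smooth_on_open_Cinf by blast
  show "\<And>x. x \<in> U \<Longrightarrow> \<phi> differentiable at x" by (rule Cinf_differentiable[OF c])
  have "\<Omega> \<inter> U = {x \<in> U. \<phi> x < 0}" "frontier \<Omega> \<inter> U = {x \<in> U. \<phi> x = 0}"
    using assms unfolding local_defining_function_def by blast+
  then show "\<And>x. x \<in> U \<Longrightarrow> x \<in> \<Omega> \<longleftrightarrow> \<phi> x < 0" "\<And>x. x \<in> U \<Longrightarrow> x \<in> frontier \<Omega> \<longleftrightarrow> \<phi> x = 0"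
    by blast+
qed

lemma inward_direction:
  assumes ldf: "local_defining_function \<Omega> U \<phi>" and p: "p \<in> U" "p \<in> frontier \<Omega>" and v: "pd v \<phi> p < 0"
  shows "\<forall>\<^sub>F t in at_right 0. p + t *\<^sub>R v \<in> \<Omega>"
proof -
  note l = local_defining_functionD[OF ldf]
  have "\<forall>\<^sub>F t in at_right 0. p + t *\<^sub>R v \<in> U \<and> \<phi> (p + t *\<^sub>R v) < 0"
    using descent_direction[OF l(1) p(1) l(6)[OF p(1)] _ v] l(5)[OF p(1)] p(2) by blast
  then show ?thesis by eventually_elim (use l(4) in blast)
qed

text \<open>This makes the definite description in \<open>outer_unit_normal\<close> meaningful. If
  the unit gradients \<open>m\<close> and \<open>n\<close> differed, the direction
  \<open>n - m\<close> would point into \<open>\<Omega>\<close> according to one defining function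
  and out of it according to the other.\<close>

lemma unit_gradient_unique:
  assumes 1: "local_defining_function \<Omega> U \<phi>" and 2: "local_defining_function \<Omega> V \<psi>"
    and p: "p \<in> U" "p \<in> V" "p \<in> frontier \<Omega>"
  shows "gradient \<phi> (at p) /\<^sub>R norm (gradient \<phi> (at p)) = gradient \<psi> (at p) /\<^sub>R norm (gradient \<psi> (at p))"
proof (rule ccontr)
  note l1 = local_defining_functionD[OF 1] and l2 = local_defining_functionD[OF 2]
  define m where "m = gradient \<phi> (at p) /\<^sub>R norm (gradient \<phi> (at p))"
  define n where "n = gradient \<psi> (at p) /\<^sub>R norm (gradient \<psi> (at p))"
  assume "\<not> ?thesis"
  then have ne: "m \<noteq> n" by (simp add: m_def n_def)
  have mn: "norm m = 1" "norm n = 1" using l1(3)[OF p(1)] l2(3)[OF p(2)] by (simp_all add: m_def n_def)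
  have lt: "m \<bullet> n < 1"
  proof -
    have "(norm (m - n))\<^sup>2 = 2 - 2 * (m \<bullet> n)"
      using mn by (simp add: power2_norm_eq_inner inner_diff_left inner_diff_right inner_commute norm_eq_1)
    moreover have "(norm (m - n))\<^sup>2 > 0" using ne by simp
    ultimately show ?thesis by simp
  qed
  define v where "v = n - m"
  have "v \<bullet> m < 0" "- v \<bullet> n < 0"
    using lt mn by (simp_all add: v_def inner_diff_left inner_diff_right norm_eq_1 inner_commute)
  then have "pd v \<phi> p < 0" "pd v (\<lambda>x. - \<psi> x) p < 0"
  proof -
    have "pd v \<phi> p = gradient \<phi> (at p) \<bullet> v" by (rule gradient_inner[OF l1(6)[OF p(1)], symmetric])
    also have "\<dots> = norm (gradient \<phi> (at p)) * (v \<bullet> m)" using l1(3)[OF p(1)] by (simp add: m_def inner_commute)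
    finally show "pd v \<phi> p < 0" using \<open>v \<bullet> m < 0\<close> l1(3)[OF p(1)] by (simp add: mult_less_0_iff)
    have "pd v (\<lambda>x. - \<psi> x) p = - pd v \<psi> p"
      using pd_cmult[OF l2(6)[OF p(2)], of "-1" v] by simp
    also have "\<dots> = - (gradient \<psi> (at p) \<bullet> v)" by (simp add: gradient_inner[OF l2(6)[OF p(2)]])
    also have "\<dots> = norm (gradient \<psi> (at p)) * (- v \<bullet> n)" using l2(3)[OF p(2)] by (simp add: n_def inner_commute)
    finally show "pd v (\<lambda>x. - \<psi> x) p < 0" using \<open>- v \<bullet> n < 0\<close> l2(3)[OF p(2)]
      by (simp add: mult_less_0_iff zero_less_mult_iff)
  qed
  then have ev: "\<forall>\<^sub>F t in at_right 0. p + t *\<^sub>R v \<in> \<Omega>"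
    "\<forall>\<^sub>F t in at_right 0. p + t *\<^sub>R v \<in> V \<and> - \<psi> (p + t *\<^sub>R v) < 0"
    using inward_direction[OF 1 p(1,3)] descent_direction[OF l2(1) p(2), of "\<lambda>x. - \<psi> x" v]
      l2(5)[OF p(2)] l2(6)[OF p(2)] p(3) by auto
  then have "\<forall>\<^sub>F t in at_right (0::real). False"
    by eventually_elim (use l2(4) in fastforce)
  then show False by simp
qed

lemma outer_unit_normal_eq:
  assumes "local_defining_function \<Omega> U \<phi>" "p \<in> U" "p \<in> frontier \<Omega>"
  shows "outer_unit_normal \<Omega> p = gradient \<phi> (at p) /\<^sub>R norm (gradient \<phi> (at p))"
  unfolding outer_unit_normal_def
proof (rule the_equality)
  show "\<exists>U \<psi>. p \<in> U \<and> local_defining_function \<Omega> U \<psi> \<and>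
      gradient \<phi> (at p) /\<^sub>R norm (gradient \<phi> (at p)) = gradient \<psi> (at p) /\<^sub>R norm (gradient \<psi> (at p))"
    using assms by blast
  fix \<nu> assume "\<exists>U \<psi>. p \<in> U \<and> local_defining_function \<Omega> U \<psi> \<and>
      \<nu> = gradient \<psi> (at p) /\<^sub>R norm (gradient \<psi> (at p))"
  then show "\<nu> = gradient \<phi> (at p) /\<^sub>R norm (gradient \<phi> (at p))"
    using unit_gradient_unique[OF assms(1) _ assms(2) _ assms(3)] by metis
qed

locale smooth_domain =
  fixes \<Omega> :: "'a::euclidean_space set"
  assumes dim: "2 \<le> DIM('a)" and open_\<Omega>: "open \<Omega>" and bounded_\<Omega>: "bounded \<Omega>"
    and smooth: "smooth_boundary \<Omega>"
begin

abbreviation \<nu> :: "'a \<Rightarrow> 'a" where "\<nu> \<equiv> outer_unit_normal \<Omega>"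

lemma chart_at:
  assumes "p \<in> frontier \<Omega>"
  obtains U \<phi> where "p \<in> U" "local_defining_function \<Omega> U \<phi>"
  using smooth assms unfolding smooth_boundary_def by blast

lemma compact_frontier: "compact (frontier \<Omega>)"
  by (rule compact_frontier_bounded[OF bounded_\<Omega>])

lemma compact_closure: "compact (closure \<Omega>)"
  using bounded_\<Omega> by (simp add: compact_closure)

lemma \<Omega>_borel [measurable]: "\<Omega> \<in> sets borel"
  using open_\<Omega> by simp

lemma frontier_borel [measurable]: "frontier \<Omega> \<in> sets borel"
  by (simp add: borel_closed)

lemma frontier_disjoint: "x \<in> frontier \<Omega> \<Longrightarrow> x \<notin> \<Omega>"
  using open_\<Omega> by (simp add: frontier_def interior_open)

lemma norm_normal: "x \<in> frontier \<Omega> \<Longrightarrow> norm (\<nu> x) = 1"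
proof -
  assume x: "x \<in> frontier \<Omega>"
  obtain U \<phi> where U: "x \<in> U" "local_defining_function \<Omega> U \<phi>" using chart_at[OF x] .
  show ?thesis using outer_unit_normal_eq[OF U(2,1) x] local_defining_functionD(3)[OF U(2,1)] by simp
qed

lemma continuous_normal: "continuous_on (frontier \<Omega>) \<nu>"
  unfolding continuous_on_eq_continuous_within
proof
  fix x assume x: "x \<in> frontier \<Omega>"
  obtain U \<phi> where U: "x \<in> U" "local_defining_function \<Omega> U \<phi>" using chart_at[OF x] .
  note l = local_defining_functionD[OF U(2)]
  let ?g = "\<lambda>y. gradient \<phi> (at y) /\<^sub>R norm (gradient \<phi> (at y))"
  have "continuous_on U ?g"
    unfolding gradient_def using l(3)[unfolded gradient_def]
    by (intro continuous_intros Cinf_continuous_on Cinf_pd l(2)) auto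
  then have "isCont ?g x" using l(1) U(1) by (simp add: continuous_on_eq_continuous_at)
  then have "continuous (at x within frontier \<Omega>) ?g" by (rule continuous_at_imp_continuous_at_within)
  moreover have "?g y = \<nu> y" if "y \<in> frontier \<Omega> \<inter> U" for y
    using outer_unit_normal_eq[OF U(2), of y] that by simp
  ultimately show "continuous (at x within frontier \<Omega>) \<nu>"
  proof -
    obtain d where d: "d > 0" "ball x d \<subseteq> U" using l(1) U(1) openE by blast
    show ?thesis
      by (rule continuous_transform_within[OF \<open>continuous (at x within frontier \<Omega>) ?g\<close> d(1) x])
        (use d(2) \<open>\<And>y. y \<in> frontier \<Omega> \<inter> U \<Longrightarrow> ?g y = \<nu> y\<close> in \<open>auto simp: dist_commute subset_iff\<close>)
  qed
qed

lemma chart_exists: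
  assumes p: "p \<in> frontier \<Omega>" and U: "p \<in> U" "local_defining_function \<Omega> U \<phi>" and e: "pd e \<phi> p > 0"
  shows "\<exists>r. boundary_chart \<Omega> U \<phi> p e r"
proof -
  note l = local_defining_functionD[OF U(2)]
  have "continuous_on U (pd e \<phi>)" by (rule Cinf_continuous_on[OF Cinf_pd[OF l(2)]])
  then have "isCont (pd e \<phi>) p" using l(1) U(1) by (simp add: continuous_on_eq_continuous_at)
  then have "(pd e \<phi> \<longlongrightarrow> pd e \<phi> p) (nhds p)"
    by (subst tendsto_at_iff_tendsto_nhds[of "pd e \<phi>" p, symmetric]) (simp add: isCont_def)
  then have "\<forall>\<^sub>F x in nhds p. pd e \<phi> x > 0" using e by (rule order_tendstoD)
  then obtain d where d: "d > 0" "\<And>x. dist x p < d \<Longrightarrow> pd e \<phi> x > 0" unfolding eventually_nhds_metric by blast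
  obtain d' where d': "d' > 0" "ball p d' \<subseteq> U" using l(1) U(1) openE by blast
  have "boundary_chart \<Omega> U \<phi> p e (min d d')"
    by unfold_locales (use U p dim open_\<Omega> d d' in \<open>auto simp: dist_commute subset_iff\<close>)
  then show ?thesis by blast
qed

lemma surface_finite: "emeasure surface_measure (frontier \<Omega>) < \<infinity>"
proof -
  have "\<exists>\<rho>>0. emeasure surface_measure (frontier \<Omega> \<inter> ball p \<rho>) < \<infinity>" if p: "p \<in> frontier \<Omega>" for p
  proof -
    obtain U \<phi> where U: "p \<in> U" "local_defining_function \<Omega> U \<phi>" using chart_at[OF p] .
    note l = local_defining_functionD[OF U(2)]
    have "pd (gradient \<phi> (at p)) \<phi> p > 0"
      using gradient_inner[OF l(6)[OF U(1)], of "gradient \<phi> (at p)"] l(3)[OF U(1)] by (metis inner_gt_zero_iff)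
    then obtain r where "boundary_chart \<Omega> U \<phi> p (gradient \<phi> (at p)) r" using chart_exists[OF p U] by blast
    then show ?thesis by (rule boundary_chart.surface_finite_near)
  qed
  then obtain \<rho> where \<rho>: "\<And>p. p \<in> frontier \<Omega> \<Longrightarrow> \<rho> p > 0"
    "\<And>p. p \<in> frontier \<Omega> \<Longrightarrow> emeasure surface_measure (frontier \<Omega> \<inter> ball p (\<rho> p)) < \<infinity>" by metis
  obtain D where D: "D \<subseteq> frontier \<Omega>" "finite D" "frontier \<Omega> \<subseteq> (\<Union>p\<in>D. ball p (\<rho> p))"
    by (rule compactE_image[OF compact_frontier, of "frontier \<Omega>" "\<lambda>p. ball p (\<rho> p)"])
      (use \<rho>(1) in \<open>auto intro: centre_in_ball[THEN iffD2]\<close>)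
  have "emeasure surface_measure (frontier \<Omega>) = emeasure surface_measure (\<Union>p\<in>D. frontier \<Omega> \<inter> ball p (\<rho> p))"
    using D(3) by (intro arg_cong[of _ _ "emeasure surface_measure"]) blast
  also have "\<dots> \<le> (\<Sum>p\<in>D. emeasure surface_measure (frontier \<Omega> \<inter> ball p (\<rho> p)))"
    by (rule emeasure_subadditive_finite[OF D(2)]) auto
  also have "\<dots> < \<infinity>" using \<rho>(2) D(1,2) by (simp add: subset_iff)
  finally show ?thesis .
qed

lemma frontier_measurable:
  fixes F :: "'a \<Rightarrow> real"
  assumes F: "continuous_on (frontier \<Omega>) F"
  shows "(\<lambda>x. indicator (frontier \<Omega>) x *\<^sub>R F x) \<in> borel_measurable surface_measure"
proof -
  have "(\<lambda>x. indicator (frontier \<Omega>) x *\<^sub>R F x) \<in> borel_measurable borel"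
    by (rule borel_measurable_continuous_on_indicator[OF _ F]) simp
  then show ?thesis by (simp cong: measurable_cong_sets)
qed

lemma frontier_integrable:
  fixes F :: "'a \<Rightarrow> real"
  assumes F: "continuous_on (frontier \<Omega>) F"
  shows "integrable surface_measure (\<lambda>x. indicator (frontier \<Omega>) x *\<^sub>R F x)"
proof -
  obtain B where B: "\<And>x. x \<in> frontier \<Omega> \<Longrightarrow> norm (F x) \<le> B"
    using compact_imp_bounded[OF compact_continuous_image[OF F compact_frontier]]
    by (auto simp: bounded_iff)
  show ?thesis
  proof (rule integrableI_bounded_set[of "frontier \<Omega>" _ _ B])
    show "emeasure surface_measure (frontier \<Omega>) < \<infinity>" by (rule surface_finite)
  qed (use frontier_measurable[OF F] B in auto)
qed

abbreviation SI :: "('a \<Rightarrow> real) \<Rightarrow> real" where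
  "SI F \<equiv> (LINT x:frontier \<Omega>|surface_measure. F x)"

lemma frontier_set_integrable:
  fixes F :: "'a \<Rightarrow> real"
  shows "continuous_on (frontier \<Omega>) F \<Longrightarrow> set_integrable surface_measure (frontier \<Omega>) F"
  unfolding set_integrable_def by (rule frontier_integrable)

lemma SI_add:
  assumes "continuous_on (frontier \<Omega>) F" "continuous_on (frontier \<Omega>) G"
  shows "SI (\<lambda>x. F x + G x) = SI F + SI G"
  by (rule set_integral_add(2)[OF frontier_set_integrable[OF assms(1)] frontier_set_integrable[OF assms(2)]])

lemma SI_cong: "(\<And>x. x \<in> frontier \<Omega> \<Longrightarrow> F x = G x) \<Longrightarrow> SI F = SI G"
  by (rule set_lebesgue_integral_cong) auto

lemma SI_mono:
  assumes "continuous_on (frontier \<Omega>) F" "continuous_on (frontier \<Omega>) G"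
    "\<And>x. x \<in> frontier \<Omega> \<Longrightarrow> F x \<le> G x"
  shows "SI F \<le> SI G"
  by (rule set_integral_mono[OF frontier_set_integrable[OF assms(1)] frontier_set_integrable[OF assms(2)] assms(3)])

lemma \<Omega>_integrable:
  fixes F :: "'a \<Rightarrow> real"
  assumes V: "closure \<Omega> \<subseteq> V" and F: "continuous_on V F"
  shows "set_integrable lborel \<Omega> F"
proof -
  have "set_integrable lborel (closure \<Omega>) F"
    using borel_integrable_compact[OF compact_closure continuous_on_subset[OF F V]]
    by (simp add: set_integrable_def indicator_scaleR_eq_if)
  then show ?thesis by (rule set_integrable_subset) (auto simp: closure_subset)
qed

text \<open>The error in the divergence theorem for the field \<open>f v\<close>. It is additive in
  \<open>f\<close> and in \<open>v\<close>, so its vanishing can be checked for functions of small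
  support and for transversal directions.\<close>

definition flux_defect :: "'a \<Rightarrow> ('a \<Rightarrow> real) \<Rightarrow> real" where
  "flux_defect v f = surface_const TYPE('a) * (LINT x:\<Omega>|lborel. pd v f x) - SI (\<lambda>x. (v \<bullet> \<nu> x) * f x)"

lemma continuous_normal_times:
  assumes V: "closure \<Omega> \<subseteq> V" and f: "Cinf V f"
  shows "continuous_on (frontier \<Omega>) (\<lambda>x. (v \<bullet> \<nu> x) * f x)"
proof -
  have "frontier \<Omega> \<subseteq> V" using V frontier_subset_closed[of "closure \<Omega>"] by (auto simp: frontier_def)
  then show ?thesis
    by (intro continuous_intros continuous_normal continuous_on_subset[OF Cinf_continuous_on[OF f]])
qed

lemma flux_defect_add:
  assumes V: "open V" "closure \<Omega> \<subseteq> V" and f: "Cinf V f" "Cinf V g"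
  shows "flux_defect v (\<lambda>x. f x + g x) = flux_defect v f + flux_defect v g"
proof -
  have \<Omega>V: "x \<in> \<Omega> \<Longrightarrow> x \<in> V" for x using V closure_subset by blast
  have "(LINT x:\<Omega>|lborel. pd v (\<lambda>x. f x + g x) x) = (LINT x:\<Omega>|lborel. pd v f x + pd v g x)"
    using pd_add[OF Cinf_differentiable[OF f(1) \<Omega>V] Cinf_differentiable[OF f(2) \<Omega>V]]
    by (intro set_lebesgue_integral_cong) auto
  also have "\<dots> = (LINT x:\<Omega>|lborel. pd v f x) + (LINT x:\<Omega>|lborel. pd v g x)"
    by (intro set_integral_add(2) \<Omega>_integrable[OF V(2)] Cinf_continuous_on Cinf_pd f)
  finally have 1: "(LINT x:\<Omega>|lborel. pd v (\<lambda>x. f x + g x) x)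
      = (LINT x:\<Omega>|lborel. pd v f x) + (LINT x:\<Omega>|lborel. pd v g x)" .
  have "SI (\<lambda>x. (v \<bullet> \<nu> x) * (f x + g x)) = SI (\<lambda>x. (v \<bullet> \<nu> x) * f x + (v \<bullet> \<nu> x) * g x)"
    by (simp add: distrib_left)
  also have "\<dots> = SI (\<lambda>x. (v \<bullet> \<nu> x) * f x) + SI (\<lambda>x. (v \<bullet> \<nu> x) * g x)"
    by (intro SI_add continuous_normal_times[OF V(2)] f)
  finally show ?thesis using 1 by (simp add: flux_defect_def algebra_simps)
qed

lemma flux_defect_direction:
  assumes f: "Cinf UNIV f"
  shows "flux_defect (v + w) f = flux_defect v f + flux_defect w f"
proof -
  have "(LINT x:\<Omega>|lborel. pd (v + w) f x) = (LINT x:\<Omega>|lborel. pd v f x + pd w f x)"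
    using linear_add[OF linear_pd[OF Cinf_differentiable[OF f]]]
    by (intro set_lebesgue_integral_cong) auto
  also have "\<dots> = (LINT x:\<Omega>|lborel. pd v f x) + (LINT x:\<Omega>|lborel. pd w f x)"
    by (intro set_integral_add(2) \<Omega>_integrable[of UNIV] Cinf_continuous_on Cinf_pd f) auto
  finally have 1: "(LINT x:\<Omega>|lborel. pd (v + w) f x)
      = (LINT x:\<Omega>|lborel. pd v f x) + (LINT x:\<Omega>|lborel. pd w f x)" .
  have "SI (\<lambda>x. ((v + w) \<bullet> \<nu> x) * f x) = SI (\<lambda>x. (v \<bullet> \<nu> x) * f x + (w \<bullet> \<nu> x) * f x)"
    by (simp add: inner_add_left distrib_right)
  also have "\<dots> = SI (\<lambda>x. (v \<bullet> \<nu> x) * f x) + SI (\<lambda>x. (w \<bullet> \<nu> x) * f x)"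
    by (intro SI_add continuous_normal_times[OF _ f]) auto
  finally show ?thesis using 1 by (simp add: flux_defect_def algebra_simps)
qed

lemma flux_defect_transversal:
  assumes p: "p \<in> frontier \<Omega>" and U: "p \<in> U" "local_defining_function \<Omega> U \<phi>" and e: "pd e \<phi> p > 0"
  shows "\<exists>r>0. \<forall>f K. Cinf UNIV f \<longrightarrow> compact K \<longrightarrow> K \<subseteq> ball p r \<longrightarrow> (\<forall>x. x \<notin> K \<longrightarrow> f x = 0)
    \<longrightarrow> flux_defect e f = 0"
proof -
  obtain r where "boundary_chart \<Omega> U \<phi> p e r" using chart_exists[OF p U e] by blast
  then interpret bc: boundary_chart \<Omega> U \<phi> p e r .
  have "flux_defect e f = 0"
    if f: "Cinf UNIV f" and K: "compact K" "K \<subseteq> ball p r" and supp: "\<And>x. x \<notin> K \<Longrightarrow> f x = 0" for f K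
  proof -
    have "surface_const TYPE('a) * (\<integral>x. indicator \<Omega> x * pd e f x \<partial>lborel)
        = (\<integral>x. indicator bc.S x * (bc.speed x * f x) \<partial>surface_measure)"
      by (rule bc.chart_divergence[OF f K]) (rule supp)
    also have "\<dots> = SI (\<lambda>x. (e \<bullet> \<nu> x) * f x)"
      unfolding set_lebesgue_integral_def
    proof (rule Bochner_Integration.integral_cong[OF refl])
      fix x
      show "indicator bc.S x * (bc.speed x * f x) = indicator (frontier \<Omega>) x *\<^sub>R ((e \<bullet> \<nu> x) * f x)"
      proof (cases "x \<in> bc.S")
        case True
        then have x: "x \<in> frontier \<Omega>" "x \<in> ball p r" by (auto simp: bc.S_def)
        have xU: "x \<in> U" using x(2) bc.BU by blast
        have "e \<bullet> \<nu> x = bc.speed x"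
          using outer_unit_normal_eq[OF U(2) xU x(1)] gradient_inner[OF local_defining_functionD(6)[OF U(2) xU], of e] x(2)
          by (simp add: bc.speed_def inner_commute divide_inverse mult.commute)
        then show ?thesis using True x by simp
      next
        case False
        show ?thesis
        proof (cases "x \<in> frontier \<Omega>")
          case True
          then have "x \<notin> K" using False K(2) by (auto simp: bc.S_def)
          then show ?thesis using supp False by simp
        qed (use False in simp)
      qed
    qed
    finally show ?thesis by (simp add: flux_defect_def set_lebesgue_integral_def)
  qed
  then show ?thesis using bc.r by blast
qed

text \<open>The chart formula covers only directions that leave \<open>\<Omega>\<close>; any
  \<open>v\<close> is the difference of two such directions, \<open>v + w\<close> and a long outward
  \<open>w\<close>.\<close>

lemma flux_defect_local:
  assumes p: "p \<in> frontier \<Omega>"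
  shows "\<exists>r>0. \<forall>f K. Cinf UNIV f \<longrightarrow> compact K \<longrightarrow> K \<subseteq> ball p r \<longrightarrow> (\<forall>x. x \<notin> K \<longrightarrow> f x = 0)
    \<longrightarrow> flux_defect v f = 0"
proof -
  obtain U \<phi> where U: "p \<in> U" "local_defining_function \<Omega> U \<phi>" using chart_at[OF p] .
  note l = local_defining_functionD[OF U(2)]
  define G where "G = gradient \<phi> (at p)"
  have G: "G \<noteq> 0" using l(3)[OF U(1)] by (simp add: G_def)
  have pdG: "pd w \<phi> p = G \<bullet> w" for w unfolding G_def by (rule gradient_inner[OF l(6)[OF U(1)], symmetric])
  \<comment> \<open>Scaled so that \<open>G \<bullet> w = \<bar>G \<bullet> v\<bar> + 1\<close>,
    which makes both \<open>w\<close> and \<open>v + w\<close> transversal.\<close>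
  define w where "w = ((\<bar>G \<bullet> v\<bar> + 1) / (G \<bullet> G)) *\<^sub>R G"
  have Gw: "G \<bullet> w = \<bar>G \<bullet> v\<bar> + 1" using G by (simp add: w_def)
  have e1: "pd w \<phi> p > 0" using Gw by (simp add: pdG)
  have e2: "pd (v + w) \<phi> p > 0" using Gw by (simp add: pdG inner_add_right)
  obtain r1 where r1: "r1 > 0" "\<And>f K. Cinf UNIV f \<Longrightarrow> compact K \<Longrightarrow> K \<subseteq> ball p r1 \<Longrightarrow> (\<And>x. x \<notin> K \<Longrightarrow> f x = 0)
    \<Longrightarrow> flux_defect w f = 0"
    using flux_defect_transversal[OF p U e1] by blast
  obtain r2 where r2: "r2 > 0" "\<And>f K. Cinf UNIV f \<Longrightarrow> compact K \<Longrightarrow> K \<subseteq> ball p r2 \<Longrightarrow> (\<And>x. x \<notin> K \<Longrightarrow> f x = 0)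
    \<Longrightarrow> flux_defect (v + w) f = 0"
    using flux_defect_transversal[OF p U e2] by blast
  have "flux_defect v f = 0" if f: "Cinf UNIV f" "compact K" "K \<subseteq> ball p (min r1 r2)" "\<forall>x. x \<notin> K \<longrightarrow> f x = 0" for f K
  proof -
    have "K \<subseteq> ball p r1" "K \<subseteq> ball p r2" using f(3) by auto
    then have "flux_defect w f = 0" "flux_defect (v + w) f = 0" using r1(2) r2(2) f by blast+
    then show ?thesis using flux_defect_direction[OF f(1), of v w] by simp
  qed
  then show ?thesis using r1(1) r2(1) by (intro exI[of _ "min r1 r2"]) auto
qed

lemma flux_defect_interior:
  assumes f: "Cinf UNIV f" and K: "compact K" "K \<subseteq> \<Omega>" and supp: "\<And>x. x \<notin> K \<Longrightarrow> f x = 0"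
  shows "flux_defect v f = 0"
proof -
  have "(LINT x:\<Omega>|lborel. pd v f x) = (\<integral>x. pd v f x \<partial>lborel)"
    unfolding set_lebesgue_integral_def
  proof (rule Bochner_Integration.integral_cong[OF refl])
    fix x show "indicator \<Omega> x *\<^sub>R pd v f x = pd v f x"
    proof (cases "x \<in> \<Omega>")
      case False
      then have "x \<notin> K" using K(2) by blast
      then have "pd v f x = 0" using pd_zero_off_support[OF compact_imp_closed[OF K(1)], of f x v] supp by blast
      then show ?thesis by simp
    qed simp
  qed
  also have "\<dots> = 0" by (rule integral_pd_compact_support[OF f K(1)]) (rule supp)
  finally have 1: "(LINT x:\<Omega>|lborel. pd v f x) = 0" .
  have "SI (\<lambda>x. (v \<bullet> \<nu> x) * f x) = SI (\<lambda>x. 0)"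
    using supp K(2) frontier_disjoint by (intro SI_cong) (metis mult_zero_right subsetD)
  then show ?thesis using 1 by (simp add: flux_defect_def)
qed

text \<open>In place of a partition of unity, factors \<open>1 - bump\<close> are multiplied onto
  \<open>f\<close> one at a time. Each step removes a function supported in one small ball, where
  the defect is known to vanish; after all of them the function is zero on a neighbourhood of the
  closure.\<close>

theorem divergence:
  assumes V: "open V" "closure \<Omega> \<subseteq> V" and f: "Cinf V f"
  shows "surface_const TYPE('a) * (LINT x:\<Omega>|lborel. pd v f x) = SI (\<lambda>x. (v \<bullet> \<nu> x) * f x)"
proof -
  have "\<exists>\<rho>>0. cball p \<rho> \<subseteq> V \<and> (\<forall>g. Cinf UNIV g \<longrightarrow> (\<forall>x. x \<notin> cball p \<rho> \<longrightarrow> g x = 0) \<longrightarrow> flux_defect v g = 0)"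
    if p: "p \<in> closure \<Omega>" for p
  proof -
    obtain s where s: "s > 0" "cball p s \<subseteq> V" using V p open_contains_cball by blast
    show ?thesis
    proof (cases "p \<in> \<Omega>")
      case True
      obtain t where t: "t > 0" "cball p t \<subseteq> \<Omega>" using open_\<Omega> True open_contains_cball by blast
      have "cball p (min s t) \<subseteq> \<Omega>" "cball p (min s t) \<subseteq> V" using s t by auto
      then show ?thesis
        using flux_defect_interior[OF _ compact_cball, of _ p "min s t" v] s t
        by (intro exI[of _ "min s t"]) auto
    next
      case False
      then have "p \<in> frontier \<Omega>" using p open_\<Omega> by (simp add: frontier_def interior_open)
      then obtain r where r: "r > 0" "\<And>f K. Cinf UNIV f \<Longrightarrow> compact K \<Longrightarrow> K \<subseteq> ball p r \<Longrightarrow> (\<And>x. x \<notin> K \<Longrightarrow> f x = 0)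
        \<Longrightarrow> flux_defect v f = 0"
        using flux_defect_local by blast
      define t where "t = min s (r / 2)"
      have t: "0 < t" "cball p t \<subseteq> V" "cball p t \<subseteq> ball p r" using s r by (auto simp: t_def)
      then show ?thesis using r(2)[OF _ compact_cball t(3)] by (intro exI[of _ t]) auto
    qed
  qed
  then obtain \<rho> where \<rho>: "\<And>p. p \<in> closure \<Omega> \<Longrightarrow> \<rho> p > 0" "\<And>p. p \<in> closure \<Omega> \<Longrightarrow> cball p (\<rho> p) \<subseteq> V"
    "\<And>p g. p \<in> closure \<Omega> \<Longrightarrow> Cinf UNIV g \<Longrightarrow> (\<And>x. x \<notin> cball p (\<rho> p) \<Longrightarrow> g x = 0) \<Longrightarrow> flux_defect v g = 0"
    by metis
  \<comment> \<open>The balls of half radius have to cover, because \<open>bump\<close> equals one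
    there.\<close>
  obtain D where D: "D \<subseteq> closure \<Omega>" "finite D" "closure \<Omega> \<subseteq> (\<Union>p\<in>D. ball p (\<rho> p / 2))"
    by (rule compactE_image[OF compact_closure, of "closure \<Omega>" "\<lambda>p. ball p (\<rho> p / 2)"])
      (use \<rho>(1) in \<open>auto intro: centre_in_ball[THEN iffD2]\<close>)
  define P where "P F x = (\<Prod>p\<in>F. 1 - bump p (\<rho> p) x)" for F x
  have CP: "Cinf UNIV (P F)" for F
    unfolding P_def[abs_def] by (intro Cinf_prod Cinf_diff Cinf_const Cinf_bump) auto
  have step: "flux_defect v f = flux_defect v (\<lambda>x. P F x * f x)" if "F \<subseteq> D" for F
    using finite_subset[OF that D(2)] that
  proof (induction F rule: finite_induct)
    case (insert q F)
    have q: "q \<in> closure \<Omega>" using insert.prems D(1) by blast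
    have c1: "Cinf V (\<lambda>x. P F x * f x)" by (rule Cinf_mult[OF V(1) Cinf_subset[OF CP] f]) simp
    have c2: "Cinf UNIV (\<lambda>x. bump q (\<rho> q) x * (P F x * f x))"
      by (rule Cinf_cutoff[OF V(1) c1 Cinf_bump _ \<rho>(2)[OF q]])
        (use \<rho>(1)[OF q] in \<open>auto intro!: bump_eq_0\<close>)
    have c3: "Cinf V (\<lambda>x. P (insert q F) x * f x)" by (rule Cinf_mult[OF V(1) Cinf_subset[OF CP] f]) simp
    have "flux_defect v (\<lambda>x. bump q (\<rho> q) x * (P F x * f x)) = 0"
      by (rule \<rho>(3)[OF q c2]) (use \<rho>(1)[OF q] in \<open>auto intro!: bump_eq_0\<close>)
    moreover have "(\<lambda>x. P F x * f x) = (\<lambda>x. bump q (\<rho> q) x * (P F x * f x) + P (insert q F) x * f x)"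
      using insert.hyps by (intro ext) (simp add: P_def algebra_simps)
    ultimately have "flux_defect v (\<lambda>x. P F x * f x) = flux_defect v (\<lambda>x. P (insert q F) x * f x)"
      using flux_defect_add[OF V Cinf_subset[OF c2 subset_UNIV] c3, of v] by simp
    then show ?case using insert by simp
  qed (simp add: P_def)
  have P0: "P D x * f x = 0" if x: "x \<in> (\<Union>p\<in>D. ball p (\<rho> p / 2))" for x
  proof -
    obtain p where p: "p \<in> D" "dist p x < \<rho> p / 2" using x by auto
    then have "bump p (\<rho> p) x = 1" using \<rho>(1)[of p] D(1) by (intro bump_eq_1) auto
    then show ?thesis using p(1) D(2) by (auto simp: P_def)
  qed
  have op: "open (\<Union>p\<in>D. ball p (\<rho> p / 2))" by auto
  have pd0: "pd v (\<lambda>x. P D x * f x) x = 0" if x: "x \<in> \<Omega>" for x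
  proof -
    have "x \<in> (\<Union>p\<in>D. ball p (\<rho> p / 2))" using x D(3) closure_subset by blast
    then have "pd v (\<lambda>x. P D x * f x) x = pd v (\<lambda>x. 0) x" using P0 by (rule pd_cong[OF op])
    then show ?thesis by simp
  qed
  have fr: "P D x * f x = 0" if "x \<in> frontier \<Omega>" for x
  proof (rule P0)
    have "x \<in> closure \<Omega>" using that by (simp add: frontier_def)
    then show "x \<in> (\<Union>p\<in>D. ball p (\<rho> p / 2))" using D(3) by blast
  qed
  have "(LINT x:\<Omega>|lborel. pd v (\<lambda>x. P D x * f x) x) = (LINT x:\<Omega>|lborel. 0)"
    using pd0 by (intro set_lebesgue_integral_cong) auto
  moreover have "SI (\<lambda>x. (v \<bullet> \<nu> x) * (P D x * f x)) = SI (\<lambda>x. 0)"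
    using fr by (intro SI_cong) simp
  ultimately have "flux_defect v (\<lambda>x. P D x * f x) = 0" by (simp add: flux_defect_def)
  then show ?thesis using step[OF order_refl] by (simp add: flux_defect_def)
qed

lemma closure_frontier_subset: "closure \<Omega> \<subseteq> V \<Longrightarrow> frontier \<Omega> \<subseteq> V" "closure \<Omega> \<subseteq> V \<Longrightarrow> \<Omega> \<subseteq> V"
  using closure_subset[of \<Omega>] by (auto simp: frontier_def)

lemma divergence_field:
  fixes X :: "'a \<Rightarrow> 'a \<Rightarrow> real"
  assumes V: "open V" "closure \<Omega> \<subseteq> V" and X: "\<And>b. Cinf V (X b)"
  shows "surface_const TYPE('a) * (LINT x:\<Omega>|lborel. (\<Sum>b\<in>Basis. pd b (X b) x))
    = SI (\<lambda>x. \<Sum>b\<in>Basis. (b \<bullet> \<nu> x) * X b x)"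
proof -
  have "(LINT x:\<Omega>|lborel. (\<Sum>b\<in>Basis. pd b (X b) x)) = (\<Sum>b\<in>Basis. LINT x:\<Omega>|lborel. pd b (X b) x)"
    unfolding set_lebesgue_integral_def scaleR_sum_right
    by (rule Bochner_Integration.integral_sum)
      (rule \<Omega>_integrable[OF V(2) Cinf_continuous_on[OF Cinf_pd[OF X]], unfolded set_integrable_def])
  then have "surface_const TYPE('a) * (LINT x:\<Omega>|lborel. (\<Sum>b\<in>Basis. pd b (X b) x))
      = (\<Sum>b\<in>Basis. surface_const TYPE('a) * (LINT x:\<Omega>|lborel. pd b (X b) x))"
    by (simp add: sum_distrib_left)
  also have "\<dots> = (\<Sum>b\<in>Basis. SI (\<lambda>x. (b \<bullet> \<nu> x) * X b x))"
    by (intro sum.cong refl divergence[OF V X])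
  also have "\<dots> = SI (\<lambda>x. \<Sum>b\<in>Basis. (b \<bullet> \<nu> x) * X b x)"
    unfolding set_lebesgue_integral_def scaleR_sum_right
    by (rule Bochner_Integration.integral_sum[symmetric])
      (rule frontier_integrable[OF continuous_normal_times[OF V(2) X]])
  finally show ?thesis .
qed

end

section \<open>Green's formula with a cutoff at the origin\<close>

lemma pd_sum_Basis: "f differentiable at x \<Longrightarrow> (\<Sum>b\<in>Basis. (b \<bullet> v) * pd b f x) = pd v f x"
proof -
  assume f: "f differentiable at x"
  have "pd v f x = pd (\<Sum>b\<in>Basis. (v \<bullet> b) *\<^sub>R b) f x" by (simp add: euclidean_representation)
  also have "\<dots> = (\<Sum>b\<in>Basis. (v \<bullet> b) * pd b f x)"
    by (simp add: linear_sum[OF linear_pd[OF f]] linear_scale[OF linear_pd[OF f]])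
  finally show ?thesis by (simp add: inner_commute)
qed

lemma Cinf_laplacian: "open U \<Longrightarrow> Cinf U f \<Longrightarrow> Cinf U (laplacian f)"
  unfolding laplacian_def[abs_def] by (intro Cinf_sum Cinf_pd)

definition cutoff :: "real \<Rightarrow> 'a::euclidean_space \<Rightarrow> real" where
  "cutoff \<epsilon> x = 1 - bump 0 \<epsilon> x"

lemma Cinf_cutoff_fun: "Cinf UNIV (cutoff \<epsilon>)"
  unfolding cutoff_def[abs_def] by (intro Cinf_diff Cinf_const Cinf_bump) auto

lemma cutoff_eq_0: "0 < \<epsilon> \<Longrightarrow> norm x \<le> \<epsilon> / 2 \<Longrightarrow> cutoff \<epsilon> x = 0"
  using bump_eq_1[of \<epsilon> 0 x] by (simp add: cutoff_def)

lemma cutoff_eq_1: "0 < \<epsilon> \<Longrightarrow> \<epsilon> \<le> norm x \<Longrightarrow> cutoff \<epsilon> x = 1"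
  using bump_eq_0[of \<epsilon> 0 x] by (simp add: cutoff_def)

lemma cutoff_bounds: "0 \<le> cutoff \<epsilon> x" "cutoff \<epsilon> x \<le> 1"
  using smooth_step_bounds by (simp_all add: cutoff_def bump_def)

lemma pd_cutoff_0:
  assumes "0 < \<epsilon>" "norm x < \<epsilon> / 2 \<or> \<epsilon> < norm x"
  shows "pd v (cutoff \<epsilon>) x = 0"
proof -
  have o: "open {y::'a. norm y < \<epsilon> / 2}" "open {y::'a. \<epsilon> < norm y}"
    by (auto intro!: open_Collect_less continuous_intros)
  from assms(2) have "pd v (cutoff \<epsilon>) x = pd v (\<lambda>x. 0) x \<or> pd v (cutoff \<epsilon>) x = pd v (\<lambda>x. 1) x"
  proof
    assume x: "norm x < \<epsilon> / 2"
    show ?thesis by (rule disjI1, rule pd_cong[OF o(1)]) (use x assms(1) in \<open>auto intro!: cutoff_eq_0\<close>)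
  next
    assume x: "\<epsilon> < norm x"
    show ?thesis by (rule disjI2, rule pd_cong[OF o(2)]) (use x assms(1) in \<open>auto intro!: cutoff_eq_1\<close>)
  qed
  then show ?thesis by auto
qed

lemma laplacian_cutoff_0:
  assumes "0 < \<epsilon>" "norm x < \<epsilon> / 2 \<or> \<epsilon> < norm x"
  shows "laplacian (cutoff \<epsilon>) x = 0"
proof -
  have o: "open ({y::'a. norm y < \<epsilon> / 2} \<union> {y::'a. \<epsilon> < norm y})"
    by (auto intro!: open_Un open_Collect_less continuous_intros)
  have "pd b (pd b (cutoff \<epsilon>)) x = pd b (\<lambda>x. 0) x" for b
    by (rule pd_cong[OF o]) (use assms pd_cutoff_0 in auto)
  then show ?thesis by (simp add: laplacian_def)
qed

text \<open>The field \<open>cutoff DW - W D cutoff\<close> extends smoothly by zero across the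
  origin, where \<open>W\<close> may be singular, and equals \<open>DW\<close> at the boundary; in
  its divergence the products of first derivatives cancel.\<close>

lemma (in smooth_domain) green:
  assumes V: "open V" "closure \<Omega> \<subseteq> V" and W: "Cinf (V - {0}) W"
    and \<epsilon>: "0 < \<epsilon>" "cball 0 \<epsilon> \<subseteq> \<Omega>"
  shows "surface_const TYPE('a) * (LINT x:\<Omega>|lborel. cutoff \<epsilon> x * laplacian W x - W x * laplacian (cutoff \<epsilon>) x)
    = SI (\<lambda>x. pd (\<nu> x) W x)"
proof -
  let ?z = "cutoff \<epsilon> :: 'a \<Rightarrow> real"
  define X where "X b x = ?z x * pd b W x - W x * pd b ?z x" for b x
  have oV: "open (V - {0})" using V(1) by (simp add: open_delete)
  have oB: "open (ball (0::'a) (\<epsilon> / 2))" by simp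
  have zV: "Cinf (V - {0}) ?z" by (rule Cinf_subset[OF Cinf_cutoff_fun subset_UNIV])
  have z0: "?z y = 0" "pd b ?z y = 0" if "y \<in> ball 0 (\<epsilon> / 2)" for y b
    using that \<epsilon>(1) by (auto intro!: cutoff_eq_0 pd_cutoff_0)
  have X: "Cinf V (X b)" for b
  proof -
    have 1: "Cinf (V - {0}) (X b)"
      unfolding X_def[abs_def] by (intro Cinf_diff Cinf_mult oV Cinf_pd W zV)
    have 2: "Cinf (ball 0 (\<epsilon> / 2)) (X b)"
      by (rule Cinf_cong[OF oB _ Cinf_const[of _ 0]])
        (use z0 in \<open>simp add: X_def\<close>)
    have "V \<subseteq> (V - {0}) \<union> ball 0 (\<epsilon> / 2)" using \<epsilon> by auto
    then show ?thesis by (rule Cinf_subset[OF Cinf_Un[OF oV oB 1 2]])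
  qed
  have div: "(\<Sum>b\<in>Basis. pd b (X b) x) = ?z x * laplacian W x - W x * laplacian ?z x" if x: "x \<in> \<Omega>" for x
  proof (cases "norm x < \<epsilon> / 2")
    case True
    have "pd b (X b) x = pd b (\<lambda>x. 0) x" for b
      by (rule pd_cong[OF oB]) (use True z0 in \<open>auto simp: X_def\<close>)
    then show ?thesis using True \<epsilon>(1) by (simp add: cutoff_eq_0 laplacian_cutoff_0)
  next
    case False
    then have xV: "x \<in> V - {0}" using x V(2) closure_subset \<epsilon>(1) by auto
    have "pd b (X b) x = ?z x * pd b (pd b W) x - W x * pd b (pd b ?z) x" for b
    proof -
      note d = Cinf_differentiable[OF W xV] Cinf_differentiable[OF Cinf_pd[OF W] xV]
        Cinf_differentiable[OF zV xV] Cinf_differentiable[OF Cinf_pd[OF zV] xV]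
      have "pd b (X b) x = pd b (\<lambda>x. ?z x * pd b W x) x - pd b (\<lambda>x. W x * pd b ?z x) x"
        unfolding X_def[abs_def] by (rule pd_diff) (intro differentiable_mult d)+
      then show ?thesis by (simp add: pd_mult[OF d(3) d(2)] pd_mult[OF d(1) d(4)])
    qed
    then show ?thesis by (simp add: laplacian_def sum_subtractf sum_distrib_left)
  qed
  have bd: "(\<Sum>b\<in>Basis. (b \<bullet> \<nu> x) * X b x) = pd (\<nu> x) W x" if x: "x \<in> frontier \<Omega>" for x
  proof -
    have "x \<notin> cball 0 \<epsilon>" using frontier_disjoint[OF x] \<epsilon>(2) by blast
    then have n: "\<epsilon> < norm x" by simp
    then have "x \<in> V - {0}" using x V(2) closure_frontier_subset \<epsilon>(1) by auto
    then have "(\<Sum>b\<in>Basis. (b \<bullet> \<nu> x) * pd b W x) = pd (\<nu> x) W x"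
      by (intro pd_sum_Basis Cinf_differentiable[OF W])
    then show ?thesis using n \<epsilon>(1) by (simp add: X_def pd_cutoff_0 cutoff_eq_1)
  qed
  have "surface_const TYPE('a) * (LINT x:\<Omega>|lborel. ?z x * laplacian W x - W x * laplacian ?z x)
      = surface_const TYPE('a) * (LINT x:\<Omega>|lborel. (\<Sum>b\<in>Basis. pd b (X b) x))"
    using div by (intro arg_cong[of _ _ "(*) (surface_const TYPE('a))"] set_lebesgue_integral_cong) auto
  also have "\<dots> = SI (\<lambda>x. \<Sum>b\<in>Basis. (b \<bullet> \<nu> x) * X b x)" by (rule divergence_field[OF V X])
  also have "\<dots> = SI (\<lambda>x. pd (\<nu> x) W x)" by (rule SI_cong[OF bd])
  finally show ?thesis .
qed

lemma (in smooth_domain) laplacian_flux: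
  assumes V: "open V" "closure \<Omega> \<subseteq> V" and F: "Cinf V F"
  shows "surface_const TYPE('a) * (LINT x:\<Omega>|lborel. laplacian F x) = SI (\<lambda>x. pd (\<nu> x) F x)"
proof -
  have "surface_const TYPE('a) * (LINT x:\<Omega>|lborel. (\<Sum>b\<in>Basis. pd b (pd b F) x))
      = SI (\<lambda>x. \<Sum>b\<in>Basis. (b \<bullet> \<nu> x) * pd b F x)"
    by (rule divergence_field[OF V Cinf_pd[OF F]])
  also have "\<dots> = SI (\<lambda>x. pd (\<nu> x) F x)"
    using closure_frontier_subset[OF V(2)]
    by (intro SI_cong pd_sum_Basis Cinf_differentiable[OF F]) auto
  finally show ?thesis by (simp add: laplacian_def)
qed

text \<open>If the boundary were a null set, the divergence theorem for the linear function
  \<open>x \<bullet> b\<close> would give \<open>\<Omega>\<close> zero volume.\<close>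

lemma (in smooth_domain) area_pos:
  assumes "\<Omega> \<noteq> {}"
  shows "0 < area (frontier \<Omega>)"
proof (rule ccontr)
  assume "\<not> 0 < area (frontier \<Omega>)"
  then have "measure surface_measure (frontier \<Omega>) = 0"
    using measure_nonneg[of surface_measure "frontier \<Omega>"] unfolding area_def by linarith
  then have "emeasure surface_measure (frontier \<Omega>) = 0"
    using surface_finite emeasure_eq_ennreal_measure[of surface_measure "frontier \<Omega>"] by simp
  then have null: "frontier \<Omega> \<in> null_sets surface_measure" by (intro null_setsI) simp_all
  obtain b :: 'a where b: "b \<in> Basis" using nonempty_Basis by blast
  have "SI (\<lambda>x. (b \<bullet> \<nu> x) * (x \<bullet> b)) = 0"
  proof -
    have "AE x in surface_measure. indicator (frontier \<Omega>) x *\<^sub>R ((b \<bullet> \<nu> x) * (x \<bullet> b)) = 0"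
      using AE_not_in[OF null] by eventually_elim simp
    then show ?thesis unfolding set_lebesgue_integral_def by (rule integral_eq_zero_AE)
  qed
  then have "(LINT x:\<Omega>|lborel. pd b (\<lambda>x. x \<bullet> b) x) = 0"
    using divergence[of UNIV "\<lambda>x. x \<bullet> b" b] surface_const_pos[OF dim] by (simp add: Cinf_inner)
  moreover have "pd b (\<lambda>x. x \<bullet> b) x = 1" for x
    using b by (simp add: pd_bounded_linear[OF bounded_linear_inner_left])
  ultimately have "measure lborel \<Omega> = 0" by (simp add: set_lebesgue_integral_def)
  moreover have "emeasure lborel \<Omega> < \<infinity>" by (rule emeasure_lborel_bounded_finite[OF bounded_\<Omega>])
  ultimately have "emeasure lborel \<Omega> = 0"
    using emeasure_eq_ennreal_measure[of lborel \<Omega>] by simp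
  then have "\<Omega> \<in> null_sets lborel" by (intro null_setsI) simp_all
  then have "negligible \<Omega>" by (simp add: negligible_iff_null_sets null_sets_completionI)
  then show False using open_not_negligible[OF open_\<Omega> assms] by blast
qed

section \<open>Behaviour at the pole\<close>

lemma pd_affine:
  assumes "f differentiable at (c *\<^sub>R x + a)"
  shows "pd v (\<lambda>x. f (c *\<^sub>R x + a)) x = c * pd v f (c *\<^sub>R x + a)"
    and "(\<lambda>x. f (c *\<^sub>R x + a)) differentiable at x"
proof -
  have "((\<lambda>x. f (c *\<^sub>R x + a)) has_derivative (\<lambda>v. pd (c *\<^sub>R v) f (c *\<^sub>R x + a))) (at x)"
    by (rule has_derivative_compose[of "\<lambda>x. c *\<^sub>R x + a" _ _ _ f, OF _ pd_has[OF assms]])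
      (auto intro!: derivative_eq_intros)
  moreover have "pd (c *\<^sub>R v) f (c *\<^sub>R x + a) = c * pd v f (c *\<^sub>R x + a)" for v
    using linear_scale[OF linear_pd[OF assms]] by simp
  ultimately have d: "((\<lambda>x. f (c *\<^sub>R x + a)) has_derivative (\<lambda>v. c * pd v f (c *\<^sub>R x + a))) (at x)"
    by simp
  show "pd v (\<lambda>x. f (c *\<^sub>R x + a)) x = c * pd v f (c *\<^sub>R x + a)" by (rule pd_eqI[OF d])
  show "(\<lambda>x. f (c *\<^sub>R x + a)) differentiable at x" using d unfolding differentiable_def by blast
qed

lemma Ck_affine: "Ck_on_open k UNIV f \<Longrightarrow> Ck_on_open k UNIV (\<lambda>x. f (c *\<^sub>R x + a))"
proof (induction k arbitrary: f)
  case 0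
  then show ?case unfolding Ck_0 by (auto intro!: continuous_on_compose2[of UNIV f] continuous_intros)
next
  case (Suc k)
  note d = Ck_SucD[OF Suc.prems]
  show ?case
  proof (rule Ck_SucI)
    show "(\<lambda>x. f (c *\<^sub>R x + a)) differentiable at x" for x by (rule pd_affine(2)) (simp add: d(1))
    show "Ck_on_open k UNIV (\<lambda>x. pd v (\<lambda>x. f (c *\<^sub>R x + a)) x)" for v
      by (rule Ck_cong[OF open_UNIV _ Ck_mult[OF open_UNIV Ck_const[of _ _ c] Suc.IH[OF d(2)[of v]]]])
        (simp add: pd_affine(1) d(1))
  qed
qed

lemma Cinf_affine: "Cinf UNIV f \<Longrightarrow> Cinf UNIV (\<lambda>x. f (c *\<^sub>R x + a))"
  by (rule CinfI[OF Ck_affine[OF CinfD]])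

lemma laplacian_affine:
  assumes "Cinf UNIV f"
  shows "laplacian (\<lambda>x. f (c *\<^sub>R x + a)) x = c\<^sup>2 * laplacian f (c *\<^sub>R x + a)"
proof -
  note d = Cinf_differentiable[OF assms] Cinf_differentiable[OF Cinf_pd[OF assms]]
  have 1: "pd b (\<lambda>x. f (c *\<^sub>R x + a)) = (\<lambda>x. c * pd b f (c *\<^sub>R x + a))" for b
    by (rule ext) (simp add: pd_affine(1) d)
  have "pd b (pd b (\<lambda>x. f (c *\<^sub>R x + a))) x = c * (c * pd b (pd b f) (c *\<^sub>R x + a))" for b
  proof -
    have "(\<lambda>x. pd b f (c *\<^sub>R x + a)) differentiable at x" by (rule pd_affine(2)[OF d(2)[OF UNIV_I]])
    then have "pd b (\<lambda>x. c * pd b f (c *\<^sub>R x + a)) x = c * pd b (\<lambda>x. pd b f (c *\<^sub>R x + a)) x"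
      by (rule pd_cmult)
    then show ?thesis unfolding 1 by (simp only: pd_affine(1)[OF d(2)[OF UNIV_I]])
  qed
  then show ?thesis by (simp add: laplacian_def sum_distrib_left power2_eq_square mult.assoc)
qed

lemma laplacian_cmult:
  assumes "open U" "Cinf U f" "x \<in> U"
  shows "laplacian (\<lambda>x. c * f x) x = c * laplacian f x"
proof -
  have "pd b (pd b (\<lambda>x. c * f x)) x = c * pd b (pd b f) x" for b
  proof -
    have "pd b (pd b (\<lambda>x. c * f x)) x = pd b (\<lambda>x. c * pd b f x) x"
      by (rule pd_cong[OF assms(1,3)]) (rule pd_cmult[OF Cinf_differentiable[OF assms(2)]])
    then show ?thesis by (simp add: pd_cmult[OF Cinf_differentiable[OF Cinf_pd[OF assms(2)] assms(3)]])
  qed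
  then show ?thesis by (simp add: laplacian_def sum_distrib_left)
qed

lemma laplacian_diff:
  assumes "open U" "Cinf U f" "Cinf U g" "x \<in> U"
  shows "laplacian (\<lambda>x. f x - g x) x = laplacian f x - laplacian g x"
proof -
  have "pd b (pd b (\<lambda>x. f x - g x)) x = pd b (pd b f) x - pd b (pd b g) x" for b
  proof -
    have "pd b (pd b (\<lambda>x. f x - g x)) x = pd b (\<lambda>x. pd b f x - pd b g x) x"
      by (rule pd_cong[OF assms(1,4)])
        (rule pd_diff[OF Cinf_differentiable[OF assms(2)] Cinf_differentiable[OF assms(3)]])
    also have "\<dots> = pd b (pd b f) x - pd b (pd b g) x"
      by (rule pd_diff[OF Cinf_differentiable[OF Cinf_pd[OF assms(2)] assms(4)]
            Cinf_differentiable[OF Cinf_pd[OF assms(3)] assms(4)]])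
    finally show ?thesis .
  qed
  then show ?thesis by (simp add: laplacian_def sum_subtractf)
qed

lemma laplacian_const: "laplacian (\<lambda>x. c) x = 0"
  by (simp add: laplacian_def)

lemma laplacian_cong:
  assumes "open U" "x \<in> U" "\<And>y. y \<in> U \<Longrightarrow> f y = g y"
  shows "laplacian f x = laplacian g x"
  unfolding laplacian_def
  by (intro sum.cong refl pd_cong[OF assms(1,2)]) (rule pd_cong[OF assms(1) _ assms(3)])

lemma laplacian_zero_off_support:
  assumes "closed K" "\<And>x. x \<notin> K \<Longrightarrow> f x = 0" "x \<notin> K"
  shows "laplacian f x = 0"
proof -
  have "laplacian f x = laplacian (\<lambda>x. 0) x"
    by (rule laplacian_cong[of "- K"]) (use assms in auto)
  then show ?thesis by (simp add: laplacian_const)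
qed

subsection \<open>The fundamental solution\<close>

text \<open>The function \<open>|x|^(2 - n)\<close>, a multiple of the fundamental solution. It is
  written through \<open>x \<bullet> x\<close> because that is smooth, so that the calculus of
  \<open>powr\<close> applies off the origin.\<close>

definition gam :: "'a::euclidean_space \<Rightarrow> real" where
  "gam x = (x \<bullet> x) powr ((2 - real DIM('a)) / 2)"

lemma open_punctured [simp]: "open (- {0::'a::euclidean_space})"
  by (simp add: open_Compl)

lemma inner_self_powr: "(x \<bullet> x) powr (a / 2) = norm x powr a"
  by (simp add: power2_norm_eq_inner[symmetric] powr_powr powr_numeral[symmetric] del: powr_numeral)

lemma Cinf_powr_norm: "Cinf (- {0}) (\<lambda>x. (x \<bullet> x) powr a)"
  by (rule Cinf_comp_powr[OF open_punctured Cinf_inner_self]) auto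

lemma pd_inner_self: "pd v (\<lambda>x. x \<bullet> x) x = 2 * (x \<bullet> v)"
  by (rule pd_eqI) (auto intro!: derivative_eq_intros simp: inner_commute)

lemma pd_powr_norm:
  assumes "x \<noteq> 0"
  shows "pd v (\<lambda>x. (x \<bullet> x) powr a) x = 2 * a * (x \<bullet> v) * (x \<bullet> x) powr (a - 1)"
  using pd_powr[of "\<lambda>x. x \<bullet> x" x a v] assms
    Cinf_differentiable[OF Cinf_inner_self[of UNIV], of x] by (simp add: pd_inner_self)

lemma pd_gam: "x \<noteq> 0 \<Longrightarrow> pd v gam x = (2 - real DIM('a)) * (x \<bullet> v) * norm x powr (- real DIM('a))"
  for x :: "'a::euclidean_space"
  using pd_powr_norm[of x "(2 - real DIM('a)) / 2" v] inner_self_powr[of x "- real DIM('a)"]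
  by (simp add: gam_def[abs_def] diff_divide_distrib)

lemma gam_eq: "gam (x :: 'a::euclidean_space) = norm x powr (2 - real DIM('a))"
  by (simp add: gam_def inner_self_powr)

lemma Cinf_gam: "Cinf (- {0}) gam"
  unfolding gam_def[abs_def] by (rule Cinf_powr_norm)

lemma laplacian_gam:
  fixes x :: "'a::euclidean_space"
  assumes x: "x \<noteq> 0"
  shows "laplacian gam x = 0"
proof -
  define a where "a = (2 - real DIM('a)) / 2"
  let ?s = "x \<bullet> x"
  have "pd b (pd b gam) x = 2 * a * (?s powr (a - 1) * (b \<bullet> b) + 2 * (a - 1) * ?s powr (a - 2) * (x \<bullet> b)\<^sup>2)" for b
  proof -
    have "pd b (pd b gam) x = pd b (\<lambda>y. (2 * a) * ((y \<bullet> b) * (y \<bullet> y) powr (a - 1))) x"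
      by (rule pd_cong[OF open_punctured]) (use x pd_powr_norm[of _ a b] in \<open>auto simp: gam_def[abs_def] a_def mult_ac\<close>)
    also have "\<dots> = 2 * a * pd b (\<lambda>y. (y \<bullet> b) * (y \<bullet> y) powr (a - 1)) x"
      by (rule pd_cmult)
        (use x Cinf_differentiable[OF Cinf_inner(1)[of UNIV b]] Cinf_differentiable[OF Cinf_powr_norm[of "a - 1"]]
          in \<open>auto intro!: differentiable_mult\<close>)
    also have "pd b (\<lambda>y. (y \<bullet> b) * (y \<bullet> y) powr (a - 1)) x
        = (x \<bullet> b) * (2 * (a - 1) * (x \<bullet> b) * ?s powr (a - 1 - 1)) + (b \<bullet> b) * ?s powr (a - 1)"
      using x by (subst pd_mult)
        (auto simp: pd_powr_norm pd_bounded_linear[OF bounded_linear_inner_left]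
          Cinf_differentiable[OF Cinf_inner(1)[of UNIV b]] Cinf_differentiable[OF Cinf_powr_norm[of "a - 1"]])
    finally show ?thesis by (simp add: power2_eq_square algebra_simps)
  qed
  then have "laplacian gam x = (\<Sum>b\<in>Basis. 2 * a * (?s powr (a - 1) * (b \<bullet> b) + 2 * (a - 1) * ?s powr (a - 2) * (x \<bullet> b)\<^sup>2))"
    by (simp add: laplacian_def)
  also have "\<dots> = 2 * a * (?s powr (a - 1) * (\<Sum>b\<in>Basis. (b::'a) \<bullet> b) + 2 * (a - 1) * ?s powr (a - 2) * (\<Sum>b\<in>Basis. (x \<bullet> b)\<^sup>2))"
    by (simp only: sum_distrib_left[symmetric] sum.distrib)
  also have "(\<Sum>b\<in>Basis. (b::'a) \<bullet> b) = real DIM('a)" by simp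
  also have "(\<Sum>b\<in>Basis. (x \<bullet> b)\<^sup>2) = ?s"
    by (subst euclidean_inner[of x x]) (simp add: power2_eq_square)
  also have "?s powr (a - 2) * ?s = ?s powr (a - 1)"
    using x powr_add[of ?s "a - 2" 1] by simp
  then have "2 * (a - 1) * ?s powr (a - 2) * ?s = 2 * (a - 1) * ?s powr (a - 1)" by simp
  also have "2 * a * (?s powr (a - 1) * real DIM('a) + 2 * (a - 1) * ?s powr (a - 1))
      = 2 * a * ?s powr (a - 1) * (real DIM('a) + 2 * (a - 1))" by (simp add: algebra_simps)
  \<comment> \<open>The exponent \<open>2 - n\<close> is the one that makes this factor
    vanish.\<close>
  also have "real DIM('a) + 2 * (a - 1) = 0" by (simp add: a_def field_simps)
  finally show ?thesis by simp
qed

text \<open>A smooth function equal to \<open>gam\<close> outside the ball of radius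
  \<open>\<epsilon>\<close>. Its Laplacian is supported in that ball, is bounded by a multiple of
  \<open>\<epsilon>^(-n)\<close> and, for \<open>\<epsilon> < 1\<close>, has an integral independent
  of \<open>\<epsilon>\<close>; up to a factor it serves as an approximate identity, although its
  sign is not controlled.\<close>

definition reg_gam :: "real \<Rightarrow> 'a::euclidean_space \<Rightarrow> real" where
  "reg_gam \<epsilon> x = cutoff \<epsilon> x * gam x"

lemma Cinf_reg_gam:
  assumes "0 < \<epsilon>"
  shows "Cinf UNIV (reg_gam \<epsilon> :: 'a::euclidean_space \<Rightarrow> real)"
  unfolding reg_gam_def[abs_def]
proof (rule Cinf_cutoff[OF open_punctured Cinf_gam Cinf_cutoff_fun])
  show "closed {x::'a. \<epsilon> / 2 \<le> norm x}" by (intro closed_Collect_le continuous_intros)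
qed (use assms in \<open>auto intro!: cutoff_eq_0\<close>)

lemma reg_gam_eq_gam: "0 < \<epsilon> \<Longrightarrow> \<epsilon> \<le> norm x \<Longrightarrow> reg_gam \<epsilon> x = gam x"
  by (simp add: reg_gam_def cutoff_eq_1)

lemma reg_gam_minus: "reg_gam \<epsilon> (- x) = reg_gam \<epsilon> x"
  by (simp add: reg_gam_def cutoff_def bump_def gam_def)

lemma reg_gam_scale:
  fixes x :: "'a::euclidean_space"
  assumes "0 < \<epsilon>"
  shows "reg_gam \<epsilon> x = \<epsilon> powr (2 - real DIM('a)) * reg_gam 1 ((1 / \<epsilon>) *\<^sub>R x + 0)"
proof -
  have "cutoff \<epsilon> x = cutoff 1 ((1 / \<epsilon>) *\<^sub>R x)"
    by (simp add: cutoff_def bump_def power2_eq_square)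
  moreover have "gam x = \<epsilon> powr (2 - real DIM('a)) * gam ((1 / \<epsilon>) *\<^sub>R x)"
    using assms by (simp add: gam_eq powr_divide)
  ultimately show ?thesis by (simp add: reg_gam_def)
qed

lemma laplacian_reg_gam_zero:
  fixes x :: "'a::euclidean_space"
  assumes "0 < \<epsilon>" "\<epsilon> < norm x"
  shows "laplacian (reg_gam \<epsilon>) x = 0"
proof -
  have "laplacian (reg_gam \<epsilon>) x = laplacian gam x"
  proof (rule laplacian_cong)
    show "open {y::'a. \<epsilon> < norm y}" by (intro open_Collect_less continuous_intros)
  qed (use assms in \<open>auto simp: reg_gam_eq_gam\<close>)
  moreover have "x \<noteq> 0" using assms by auto
  ultimately show ?thesis using laplacian_gam[of x] by simp
qed

text \<open>By homogeneity of \<open>gam\<close> every \<open>\<epsilon>\<close> reduces to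
  \<open>\<epsilon> = 1\<close>, where the Laplacian is continuous and vanishes off the unit
  ball.\<close>

lemma laplacian_reg_gam_bound:
  "\<exists>M>0. \<forall>\<epsilon>>0. \<forall>x::'a::euclidean_space. \<bar>laplacian (reg_gam \<epsilon>) x\<bar> \<le> M * \<epsilon> powr (- real DIM('a))"
proof -
  let ?f = "laplacian (reg_gam 1 :: 'a \<Rightarrow> real)"
  have c: "Cinf UNIV ?f" by (rule Cinf_laplacian[OF open_UNIV Cinf_reg_gam]) simp
  have "bounded (?f ` cball 0 1)"
    by (intro compact_imp_bounded compact_continuous_image continuous_on_subset[OF Cinf_continuous_on[OF c]]) auto
  then obtain M0 where "\<forall>y\<in>?f ` cball 0 1. norm y \<le> M0" unfolding bounded_iff by blast
  then have M0: "\<bar>?f x\<bar> \<le> M0" if "x \<in> cball 0 1" for x using that by auto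
  define M where "M = \<bar>M0\<bar> + 1"
  have M: "\<bar>?f x\<bar> \<le> M" for x
    using M0[of x] laplacian_reg_gam_zero[of 1 x] by (cases "norm x \<le> 1") (auto simp: M_def)
  have "\<bar>laplacian (reg_gam \<epsilon>) x\<bar> \<le> M * \<epsilon> powr (- real DIM('a))" if \<epsilon>: "0 < \<epsilon>" for \<epsilon> and x :: 'a
  proof -
    have fe: "reg_gam \<epsilon> = (\<lambda>x::'a. \<epsilon> powr (2 - real DIM('a)) * reg_gam 1 ((1 / \<epsilon>) *\<^sub>R x + 0))"
      by (rule ext) (rule reg_gam_scale[OF \<epsilon>])
    have c1: "Cinf UNIV (reg_gam 1 :: 'a \<Rightarrow> real)" by (rule Cinf_reg_gam) simp
    have "laplacian (reg_gam \<epsilon>) x = \<epsilon> powr (2 - real DIM('a)) * ((1 / \<epsilon>)\<^sup>2 * ?f ((1 / \<epsilon>) *\<^sub>R x + 0))"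
      unfolding fe
      by (subst laplacian_cmult[OF open_UNIV Cinf_affine[OF c1]]) (simp_all only: laplacian_affine[OF c1] UNIV_I)
    also have "\<dots> = (\<epsilon> powr (2 - real DIM('a)) * (1 / \<epsilon>)\<^sup>2) * ?f ((1 / \<epsilon>) *\<^sub>R x + 0)" by simp
    also have "\<epsilon> powr (2 - real DIM('a)) * (1 / \<epsilon>)\<^sup>2 = \<epsilon> powr (- real DIM('a))"
      using \<epsilon> by (simp add: powr_diff powr_minus power_divide divide_inverse power_inverse)
    finally have eq: "laplacian (reg_gam \<epsilon>) x = \<epsilon> powr (- real DIM('a)) * ?f ((1 / \<epsilon>) *\<^sub>R x + 0)" .
    have "\<epsilon> powr (- real DIM('a)) * \<bar>?f ((1 / \<epsilon>) *\<^sub>R x + 0)\<bar> \<le> \<epsilon> powr (- real DIM('a)) * M"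
      by (intro mult_left_mono M) simp
    then show ?thesis unfolding eq abs_mult by (simp add: mult.commute)
  qed
  then show ?thesis by (intro exI[of _ M]) (auto simp: M_def)
qed

subsection \<open>The unit ball\<close>

lemma unit_ball_chart: "local_defining_function (ball (0::'a::euclidean_space) 1) (- {0}) (\<lambda>x. x \<bullet> x - 1)"
  and gradient_unit_ball: "gradient (\<lambda>x::'a. x \<bullet> x - 1) (at y) = 2 *\<^sub>R y"
proof -
  have c: "Cinf UNIV (\<lambda>x::'a. x \<bullet> x - 1)" by (intro Cinf_diff Cinf_inner_self Cinf_const) auto
  have g: "gradient (\<lambda>x::'a. x \<bullet> x - 1) (at x) = 2 *\<^sub>R x" for x
  proof (rule gradient_eqI)
    show "(\<lambda>x::'a. x \<bullet> x - 1) differentiable at x" using Cinf_differentiable[OF c] by simp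
    show "pd v (\<lambda>x::'a. x \<bullet> x - 1) x = (2 *\<^sub>R x) \<bullet> v" for v
      using pd_diff[of "\<lambda>x. x \<bullet> x" x "\<lambda>x. 1" v] Cinf_differentiable[OF Cinf_inner_self[of UNIV], of x]
      by (simp add: pd_inner_self)
  qed
  then show "gradient (\<lambda>x::'a. x \<bullet> x - 1) (at y) = 2 *\<^sub>R y" .
  have lt: "norm x < 1 \<longleftrightarrow> x \<bullet> x < 1" and eq: "norm x = 1 \<longleftrightarrow> x \<bullet> x = 1" for x :: 'a
    by (auto simp: norm_eq_sqrt_inner)
  show "local_defining_function (ball (0::'a) 1) (- {0}) (\<lambda>x. x \<bullet> x - 1)"
    unfolding local_defining_function_def
  proof (intro conjI)
    show "smooth_on (- {0}) (\<lambda>x::'a. x \<bullet> x - 1)"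
      by (rule Cinf_smooth_on[OF open_punctured Cinf_subset[OF c]]) simp
  qed (auto simp: g lt eq)
qed

lemma unit_ball_domain: "2 \<le> DIM('a) \<Longrightarrow> smooth_domain (ball (0::'a::euclidean_space) 1)"
proof
  show "smooth_boundary (ball (0::'a) 1)"
    unfolding smooth_boundary_def
  proof
    fix p :: 'a assume "p \<in> frontier (ball 0 1)"
    then have "p \<in> - {0}" by auto
    then show "\<exists>U \<phi>. p \<in> U \<and> local_defining_function (ball 0 1) U \<phi>"
      using unit_ball_chart by (intro exI[of _ "- {0}"] exI[of _ "\<lambda>x. x \<bullet> x - 1"] conjI)
  qed
qed auto

lemma unit_ball_normal: "norm x = 1 \<Longrightarrow> outer_unit_normal (ball 0 1) x = x" for x :: "'a::euclidean_space"
proof -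
  assume x: "norm x = 1"
  then have "x \<noteq> 0" by auto
  then show ?thesis using outer_unit_normal_eq[OF unit_ball_chart, of x] x by (simp add: gradient_unit_ball)
qed

text \<open>The divergence theorem on the unit ball, near whose boundary \<open>reg_gam\<close>
  coincides with \<open>gam\<close>. Here the area of the unit sphere enters, accompanied by the
  same \<open>surface_const\<close> that appears in the flux of \<open>u\<close>.\<close>

lemma integral_laplacian_reg_gam:
  assumes dim: "2 \<le> DIM('a::euclidean_space)" and \<epsilon>: "0 < \<epsilon>" "\<epsilon> < 1"
  shows "surface_const TYPE('a) * (\<integral>x. laplacian (reg_gam \<epsilon> :: 'a \<Rightarrow> real) x \<partial>lborel)
    = (2 - real DIM('a)) * area (sphere (0::'a) 1)"
proof -
  interpret B: smooth_domain "ball (0::'a) 1" by (rule unit_ball_domain[OF dim])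
  let ?E = "reg_gam \<epsilon> :: 'a \<Rightarrow> real"
  have "(\<integral>x. laplacian ?E x \<partial>lborel) = (LINT x:ball 0 1|lborel. laplacian ?E x)"
    unfolding set_lebesgue_integral_def
  proof (rule Bochner_Integration.integral_cong[OF refl])
    show "laplacian ?E x = indicator (ball 0 1) x *\<^sub>R laplacian ?E x" for x
      using laplacian_reg_gam_zero[OF \<epsilon>(1), of x] \<epsilon> by (cases "norm x < 1") auto
  qed
  then have "surface_const TYPE('a) * (\<integral>x. laplacian ?E x \<partial>lborel)
      = (LINT x:frontier (ball 0 1)|surface_measure. pd (outer_unit_normal (ball 0 1) x) ?E x)"
    using B.laplacian_flux[OF open_UNIV _ Cinf_reg_gam[OF \<epsilon>(1)]] by simp
  also have "\<dots> = (LINT x:frontier (ball (0::'a) 1)|surface_measure. 2 - real DIM('a))"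
  proof (rule B.SI_cong)
    fix x :: 'a assume "x \<in> frontier (ball 0 1)"
    then have x: "norm x = 1" by simp
    have "pd x ?E x = pd x gam x"
    proof (rule pd_cong)
      show "open {y::'a. \<epsilon> < norm y}" by (intro open_Collect_less continuous_intros)
    qed (use \<epsilon> x in \<open>auto simp: reg_gam_eq_gam\<close>)
    also have "\<dots> = 2 - real DIM('a)"
    proof -
      have "x \<noteq> 0" "x \<bullet> x = 1" using x by (auto simp: norm_eq_1)
      then show ?thesis using pd_gam[of x x] x by simp
    qed
    finally show "pd (outer_unit_normal (ball 0 1) x) ?E x = 2 - real DIM('a)"
      using unit_ball_normal[OF x] by simp
  qed
  also have "\<dots> = (2 - real DIM('a)) * area (sphere (0::'a) 1)"
    by (simp add: set_lebesgue_integral_def area_def)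
  finally show ?thesis .
qed

lemma area_sphere_pos: "2 \<le> DIM('a) \<Longrightarrow> area (sphere (0::'a::euclidean_space) 1) > 0"
  using smooth_domain.area_pos[OF unit_ball_domain] by force

subsection \<open>Compactly supported test functions\<close>

lemma AE_zero_continuous:
  fixes f :: "'a::euclidean_space \<Rightarrow> real"
  assumes U: "open U" and f: "continuous_on U f" and ae: "AE y in lborel. y \<in> U \<longrightarrow> f y = 0" and x: "x \<in> U"
  shows "f x = 0"
proof (rule ccontr)
  assume ne: "f x \<noteq> 0"
  let ?S = "U \<inter> f -` (- {0})"
  have o: "open ?S" by (rule continuous_open_preimage[OF f U]) (simp add: open_Compl)
  have "emeasure lborel ?S = 0"
  proof (rule AE_E3[OF ae])
    fix N :: "'a set" assume N: "\<And>y. y \<in> space lborel - N \<Longrightarrow> y \<in> U \<longrightarrow> f y = 0" "N \<in> null_sets lborel"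
    then have "?S \<subseteq> N" by auto
    then show ?thesis using N(2) o by (metis emeasure_eq_0 null_setsD1 null_setsD2 borel_open sets_lborel)
  qed
  then have "?S \<in> null_sets lborel" using o by (intro null_setsI) auto
  then have "negligible ?S" by (simp add: negligible_iff_null_sets null_sets_completionI)
  then show False using open_not_negligible[OF o] x ne by auto
qed

text \<open>\<open>f\<close> is smooth on \<open>U\<close> only; its products with
  \<open>\<phi>\<close> and the derivatives of \<open>\<phi>\<close> extend smoothly by zero, since
  these are supported in \<open>K\<close>.\<close>

lemma green_compact:
  fixes f \<phi> :: "'a::euclidean_space \<Rightarrow> real"
  assumes U: "open U" and f: "Cinf U f" and \<phi>: "Cinf UNIV \<phi>" and K: "compact K" "K \<subseteq> U"
    and supp: "\<And>x. x \<notin> K \<Longrightarrow> \<phi> x = 0"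
  shows "(\<integral>x. f x * laplacian \<phi> x \<partial>lborel) = (\<integral>x. \<phi> x * laplacian f x \<partial>lborel)"
    and "integrable lborel (\<lambda>x. \<phi> x * laplacian f x)"
proof -
  note Kc = compact_imp_closed[OF K(1)]
  note pd0 = pd_zero_off_support[OF Kc supp]
  have l0: "laplacian \<phi> x = 0" if "x \<notin> K" for x
    by (rule laplacian_zero_off_support[OF Kc _ that]) (rule supp)
  have p0: "pd b \<phi> x = 0" if "x \<notin> K" for x b
    by (rule pd_zero_off_support[OF Kc _ that]) (rule supp)
  have c1: "Cinf UNIV (\<lambda>x. laplacian \<phi> x * f x)"
    by (rule Cinf_cutoff[OF U f Cinf_laplacian[OF open_UNIV \<phi>] Kc K(2) l0])
  have c2: "Cinf UNIV (\<lambda>x. \<phi> x * laplacian f x)"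
    by (rule Cinf_cutoff[OF U Cinf_laplacian[OF U f] \<phi> Kc K(2) supp])
  have i1: "integrable lborel (\<lambda>x. laplacian \<phi> x * f x)"
    by (rule integrable_continuous_compact_support[OF Cinf_continuous_on[OF c1] K(1)]) (simp add: l0)
  show i2: "integrable lborel (\<lambda>x. \<phi> x * laplacian f x)"
    by (rule integrable_continuous_compact_support[OF Cinf_continuous_on[OF c2] K(1)]) (simp add: supp)
  define X where "X b x = pd b \<phi> x * f x - \<phi> x * pd b f x" for b x
  have cX: "Cinf UNIV (X b)" for b
    unfolding X_def[abs_def]
    by (intro Cinf_diff open_UNIV Cinf_cutoff[OF U f Cinf_pd[OF \<phi>] Kc K(2) p0]
        Cinf_cutoff[OF U Cinf_pd[OF f] \<phi> Kc K(2) supp])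
  have X0: "X b x = 0" if "x \<notin> K" for b x using that by (simp add: X_def p0 supp)
  have pX0: "pd b (X b) x = 0" if "x \<notin> K" for b x
    by (rule pd_zero_off_support[OF Kc _ that]) (rule X0)
  have div: "(\<Sum>b\<in>Basis. pd b (X b) x) = laplacian \<phi> x * f x - \<phi> x * laplacian f x" for x
  proof (cases "x \<in> K")
    case True
    then have xU: "x \<in> U" using K by blast
    note d = Cinf_differentiable[OF f xU] Cinf_differentiable[OF Cinf_pd[OF f] xU]
      Cinf_differentiable[OF \<phi> UNIV_I] Cinf_differentiable[OF Cinf_pd[OF \<phi>] UNIV_I]
    have "pd b (X b) x = pd b (pd b \<phi>) x * f x - \<phi> x * pd b (pd b f) x" for b
    proof -
      have "pd b (X b) x = pd b (\<lambda>x. pd b \<phi> x * f x) x - pd b (\<lambda>x. \<phi> x * pd b f x) x"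
        unfolding X_def[abs_def] by (rule pd_diff) (intro differentiable_mult d)+
      then show ?thesis by (simp add: pd_mult[OF d(4) d(1)] pd_mult[OF d(3) d(2)])
    qed
    then show ?thesis by (simp add: laplacian_def sum_subtractf sum_distrib_left sum_distrib_right)
  next
    case False
    then show ?thesis by (simp add: pX0 l0 supp)
  qed
  have "(\<integral>x. laplacian \<phi> x * f x \<partial>lborel) - (\<integral>x. \<phi> x * laplacian f x \<partial>lborel)
      = (\<integral>x. (\<Sum>b\<in>Basis. pd b (X b) x) \<partial>lborel)"
    unfolding div by (rule Bochner_Integration.integral_diff[OF i1 i2, symmetric])
  also have "\<dots> = (\<Sum>b\<in>Basis. \<integral>x. pd b (X b) x \<partial>lborel)"
    by (rule Bochner_Integration.integral_sum)
      (rule integrable_continuous_compact_support[OF Cinf_continuous_on[OF Cinf_pd[OF cX]] K(1) pX0])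
  also have "\<dots> = 0"
    by (intro sum.neutral ballI integral_pd_compact_support[OF cX K(1) X0])
  finally show "(\<integral>x. f x * laplacian \<phi> x \<partial>lborel) = (\<integral>x. \<phi> x * laplacian f x \<partial>lborel)"
    by (simp add: mult.commute)
qed

lemma pd_le_norm_gradient:
  assumes "f differentiable at x"
  shows "\<bar>pd v f x\<bar> \<le> norm (gradient f (at x)) * norm v"
  using Cauchy_Schwarz_ineq2[of "gradient f (at x)" v] gradient_inner[OF assms, of v] by simp

lemma Cinf_Lipschitz:
  fixes f :: "'a::euclidean_space \<Rightarrow> real"
  assumes f: "Cinf UNIV f"
  shows "\<exists>L>0. \<forall>x\<in>cball 0 R. \<forall>y\<in>cball 0 R. \<bar>f x - f y\<bar> \<le> L * norm (x - y)"
proof -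
  have c: "continuous_on UNIV (\<lambda>x. gradient f (at x))"
    unfolding gradient_def by (intro continuous_intros Cinf_continuous_on Cinf_pd f)
  have "bounded ((\<lambda>x. gradient f (at x)) ` cball 0 R)"
    by (rule compact_imp_bounded[OF compact_continuous_image[OF continuous_on_subset[OF c subset_UNIV] compact_cball]])
  then obtain L0 where "\<forall>y\<in>(\<lambda>x. gradient f (at x)) ` cball 0 R. norm y \<le> L0" unfolding bounded_iff by blast
  then have L0: "norm (gradient f (at x)) \<le> L0" if "x \<in> cball 0 R" for x using that by auto
  define L where "L = \<bar>L0\<bar> + 1"
  have "\<bar>f x - f y\<bar> \<le> L * norm (x - y)" if xy: "x \<in> cball 0 R" "y \<in> cball 0 R" for x y
  proof -
    have "\<exists>z. 0 < z \<and> z < 1 \<and> f (y + 1 *\<^sub>R (x - y)) - f (y + 0 *\<^sub>R (x - y)) = (1 - 0) * pd (x - y) f (y + z *\<^sub>R (x - y))"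
      by (rule MVT2) (auto intro!: DERIV_line Cinf_differentiable[OF f])
    then obtain z where z: "0 < z" "z < 1" "f x - f y = pd (x - y) f (y + z *\<^sub>R (x - y))" by auto
    have "(1 - z) *\<^sub>R y + z *\<^sub>R x \<in> cball 0 R"
      using convexD[OF convex_cball xy(2,1), of "1 - z" z] z by simp
    then have "y + z *\<^sub>R (x - y) \<in> cball 0 R" by (simp add: algebra_simps)
    then have "norm (gradient f (at (y + z *\<^sub>R (x - y)))) \<le> L" using L0[of "y + z *\<^sub>R (x - y)"] by (simp add: L_def)
    then have "norm (gradient f (at (y + z *\<^sub>R (x - y)))) * norm (x - y) \<le> L * norm (x - y)"
      by (rule mult_right_mono) simp
    moreover have "\<bar>pd (x - y) f (y + z *\<^sub>R (x - y))\<bar> \<le> norm (gradient f (at (y + z *\<^sub>R (x - y)))) * norm (x - y)"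
      by (rule pd_le_norm_gradient) (simp add: Cinf_differentiable[OF f])
    ultimately show ?thesis unfolding z(3) by linarith
  qed
  then show ?thesis by (intro exI[of _ L]) (auto simp: L_def)
qed

lemma pd_le_Lipschitz:
  fixes f :: "'a::euclidean_space \<Rightarrow> real"
  assumes U: "open U" "x \<in> U" and f: "f differentiable at x"
    and L: "\<And>y. y \<in> U \<Longrightarrow> \<bar>f y - f x\<bar> \<le> L * norm (y - x)"
  shows "\<bar>pd v f x\<bar> \<le> L * norm v"
proof -
  have "((\<lambda>t. f (x + t *\<^sub>R v)) has_real_derivative pd v f (x + 0 *\<^sub>R v)) (at 0)"
    by (rule DERIV_line) (simp add: f)
  then have "((\<lambda>t. (f (x + t *\<^sub>R v) - f x) / t) \<longlongrightarrow> pd v f x) (at 0)"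
    by (simp add: DERIV_def)
  then have lim: "((\<lambda>t. \<bar>(f (x + t *\<^sub>R v) - f x) / t\<bar>) \<longlongrightarrow> \<bar>pd v f x\<bar>) (at 0)" by (rule tendsto_rabs)
  have "((\<lambda>t. x + t *\<^sub>R v) \<longlongrightarrow> x + 0 *\<^sub>R v) (at 0)" by (intro tendsto_intros)
  then have "\<forall>\<^sub>F t in at 0. x + t *\<^sub>R v \<in> U" using U by (auto elim: topological_tendstoD)
  then have "\<forall>\<^sub>F t in at 0. \<bar>(f (x + t *\<^sub>R v) - f x) / t\<bar> \<le> L * norm v"
  proof (rule eventually_mp[rotated], intro eventually_at_filter[THEN iffD2] always_eventually allI impI)
    fix t :: real assume t: "t \<noteq> 0" "x + t *\<^sub>R v \<in> U"
    have "\<bar>f (x + t *\<^sub>R v) - f x\<bar> \<le> L * (\<bar>t\<bar> * norm v)" using L[OF t(2)] by simp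
    then show "\<bar>(f (x + t *\<^sub>R v) - f x) / t\<bar> \<le> L * norm v" using t(1) by (simp add: abs_divide field_simps)
  qed
  then show ?thesis by (intro tendsto_upperbound[OF lim]) auto
qed

lemma integrable_mult_bounded:
  fixes f g :: "'a::euclidean_space \<Rightarrow> real"
  assumes f: "integrable lborel f" and g: "g \<in> borel_measurable borel" and M: "\<And>x. \<bar>g x\<bar> \<le> M"
  shows "integrable lborel (\<lambda>x. f x * g x)"
proof (rule Bochner_Integration.integrable_bound[of _ "\<lambda>x. M * f x"])
  show "integrable lborel (\<lambda>x. M * f x)" using f by simp
  show "(\<lambda>x. f x * g x) \<in> borel_measurable lborel" using f g by auto
  have "\<bar>f x * g x\<bar> \<le> \<bar>M * f x\<bar>" for x
  proof -
    have "\<bar>f x\<bar> * \<bar>g x\<bar> \<le> \<bar>f x\<bar> * \<bar>M\<bar>" using M[of x] by (intro mult_left_mono) auto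
    then show ?thesis by (simp add: abs_mult mult.commute)
  qed
  then show "AE x in lborel. norm (f x * g x) \<le> norm (M * f x)" by simp
qed

section \<open>Distributional solutions with a point source\<close>

locale green_problem = smooth_domain \<Omega> for \<Omega> :: "'a::euclidean_space set" +
  fixes u :: "'a \<Rightarrow> real" and V :: "'a set" and m :: real
  assumes dim3: "3 \<le> DIM('a)" and zero: "0 \<in> \<Omega>" and V: "open V" "closure \<Omega> \<subseteq> V"
    and u: "Cinf (V - {0}) u"
    and int: "\<And>K. compact K \<Longrightarrow> K \<subseteq> \<Omega> \<Longrightarrow> set_integrable lborel K u"
    and weak: "\<And>\<phi>. test_function \<Omega> \<phi> \<Longrightarrow> - (LINT x:\<Omega>|lborel. u x * laplacian \<phi> x) = m * \<phi> 0"
begin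

lemma oV: "open (V - {0})"
  using V(1) by (simp add: open_delete)

lemma \<Omega>V: "x \<in> closure \<Omega> \<Longrightarrow> x \<noteq> 0 \<Longrightarrow> x \<in> V - {0}" "x \<in> \<Omega> \<Longrightarrow> x \<noteq> 0 \<Longrightarrow> x \<in> V - {0}"
  using V(2) closure_subset by blast+

lemma frontier_V: "x \<in> frontier \<Omega> \<Longrightarrow> x \<in> V - {0}" "x \<in> frontier \<Omega> \<Longrightarrow> x \<noteq> 0"
  using closure_frontier_subset[OF V(2)] frontier_disjoint[of x] zero by auto

lemma weak_compact:
  assumes \<phi>: "Cinf UNIV \<phi>" and K: "compact K" "K \<subseteq> \<Omega>" and supp: "\<And>x. x \<notin> K \<Longrightarrow> \<phi> x = 0"
  shows "(\<integral>x. u x * laplacian \<phi> x \<partial>lborel) = - m * \<phi> 0"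
    and "(LINT x:\<Omega>|lborel. u x * laplacian \<phi> x) = - m * \<phi> 0"
proof -
  have "test_function \<Omega> \<phi>"
    unfolding test_function_def using Cinf_smooth_on[OF open_UNIV \<phi>] K supp by blast
  from weak[OF this] show 1: "(LINT x:\<Omega>|lborel. u x * laplacian \<phi> x) = - m * \<phi> 0" by simp
  have "(LINT x:\<Omega>|lborel. u x * laplacian \<phi> x) = (\<integral>x. u x * laplacian \<phi> x \<partial>lborel)"
    unfolding set_lebesgue_integral_def
  proof (rule Bochner_Integration.integral_cong[OF refl])
    fix x
    show "indicator \<Omega> x *\<^sub>R (u x * laplacian \<phi> x) = u x * laplacian \<phi> x"
    proof (cases "x \<in> K")
      case True
      then show ?thesis using K(2) by auto
    next
      case False
      have "laplacian \<phi> x = 0"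
        by (rule laplacian_zero_off_support[OF compact_imp_closed[OF K(1)] _ False]) (rule supp)
      then show ?thesis by simp
    qed
  qed
  with 1 show "(\<integral>x. u x * laplacian \<phi> x \<partial>lborel) = - m * \<phi> 0" by simp
qed

lemma bump_nonneg: "0 \<le> bump p \<rho> x"
  using smooth_step_bounds by (simp add: bump_def)

text \<open>If the Laplacian were nonzero at \<open>x\<close>, it would keep its sign on a small
  ball; testing the equation with a bump there and integrating by parts gives zero for the integral
  of a function of one sign.\<close>

lemma harmonic:
  assumes x: "x \<in> \<Omega>" "x \<noteq> 0"
  shows "laplacian u x = 0"
proof (rule ccontr)
  assume ne: "laplacian u x \<noteq> 0"
  define s where "s = sgn (laplacian u x)"
  have s: "s * laplacian u x > 0" "s \<noteq> 0" using ne by (auto simp: s_def sgn_if)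
  have cl: "continuous_on (V - {0}) (laplacian u)" by (rule Cinf_continuous_on[OF Cinf_laplacian[OF oV u]])
  have "open ((V - {0}) \<inter> (\<lambda>y. s * laplacian u y) -` {0<..})"
    by (rule continuous_open_preimage[OF _ oV]) (auto intro!: continuous_intros cl)
  then have "open (\<Omega> \<inter> ((V - {0}) \<inter> (\<lambda>y. s * laplacian u y) -` {0<..}))" using open_\<Omega> by blast
  moreover have "x \<in> \<Omega> \<inter> ((V - {0}) \<inter> (\<lambda>y. s * laplacian u y) -` {0<..})"
    using x s \<Omega>V(2) by auto
  ultimately obtain \<delta> where \<delta>: "\<delta> > 0" "cball x \<delta> \<subseteq> \<Omega> \<inter> ((V - {0}) \<inter> (\<lambda>y. s * laplacian u y) -` {0<..})"
    using open_contains_cball by blast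
  have K: "cball x \<delta> \<subseteq> \<Omega>" "cball x \<delta> \<subseteq> V - {0}" using \<delta>(2) by auto
  have pos: "s * laplacian u y > 0" if "y \<in> cball x \<delta>" for y using \<delta>(2) that by blast
  let ?\<phi> = "bump x \<delta>"
  have supp: "?\<phi> y = 0" if "y \<notin> cball x \<delta>" for y using that \<delta>(1) by (intro bump_eq_0) auto
  have "?\<phi> 0 = 0" using K(2) by (intro supp) blast
  then have "(\<integral>y. u y * laplacian ?\<phi> y \<partial>lborel) = 0"
    using weak_compact(1)[OF Cinf_bump compact_cball K(1) supp] by simp
  then have 0: "(\<integral>y. ?\<phi> y * laplacian u y \<partial>lborel) = 0"
    using green_compact(1)[OF oV u Cinf_bump compact_cball K(2) supp] by simp
  have i: "integrable lborel (\<lambda>y. ?\<phi> y * laplacian u y)"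
    by (rule green_compact(2)[OF oV u Cinf_bump compact_cball K(2) supp])
  have "(\<integral>y. s * (?\<phi> y * laplacian u y) \<partial>lborel) = 0" using 0 by simp
  moreover have "integrable lborel (\<lambda>y. s * (?\<phi> y * laplacian u y))" using i by simp
  moreover have nn: "0 \<le> s * (?\<phi> y * laplacian u y)" for y
  proof (cases "y \<in> cball x \<delta>")
    case True
    have "0 \<le> ?\<phi> y * (s * laplacian u y)" by (rule mult_nonneg_nonneg[OF bump_nonneg less_imp_le[OF pos[OF True]]])
    then show ?thesis by (simp add: mult_ac)
  qed (simp add: supp)
  ultimately have "AE y in lborel. s * (?\<phi> y * laplacian u y) = 0"
    using integral_nonneg_eq_0_iff_AE[of lborel "\<lambda>y. s * (?\<phi> y * laplacian u y)"] by simp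
  then have ae: "AE y in lborel. y \<in> ball x \<delta> \<longrightarrow> s * (?\<phi> y * laplacian u y) = 0" by eventually_elim simp
  have sub: "ball x \<delta> \<subseteq> V - {0}" using K(2) ball_subset_cball by blast
  have "s * (?\<phi> x * laplacian u x) = 0"
    by (rule AE_zero_continuous[OF open_ball _ ae])
      (use \<delta>(1) in \<open>auto intro!: continuous_intros continuous_on_subset[OF cl sub]
         continuous_on_subset[OF Cinf_continuous_on[OF Cinf_bump]]\<close>)
  moreover have "?\<phi> x = 1" using \<delta>(1) by (intro bump_eq_1) auto
  ultimately show False using ne s by simp
qed

lemma small_ball: "\<exists>R>0. R < 1 \<and> cball 0 (2 * R) \<subseteq> \<Omega>"
proof -
  obtain r where r: "r > 0" "cball 0 r \<subseteq> \<Omega>" using open_\<Omega> zero open_contains_cball by blast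
  define R where "R = min (1/2) (r / 2)"
  have "cball 0 (2 * R) \<subseteq> cball (0::'a) r" by (auto simp: R_def)
  then show ?thesis using r by (intro exI[of _ R]) (auto simp: R_def)
qed

text \<open>\<open>bump 0 \<epsilon>\<close> is a test function with value one at the pole and
  \<open>cutoff\<close> is its complement, so Green's formula turns the equation into a statement on
  the total flux.\<close>

lemma flux: "SI (\<lambda>x. pd (\<nu> x) u x) = - surface_const TYPE('a) * m"
proof -
  obtain R where R: "R > 0" "cball 0 (2 * R) \<subseteq> \<Omega>" using small_ball by blast
  define \<epsilon> where "\<epsilon> = 2 * R"
  have \<epsilon>: "\<epsilon> > 0" "cball 0 \<epsilon> \<subseteq> \<Omega>" using R by (auto simp: \<epsilon>_def)
  have lz: "laplacian (cutoff \<epsilon>) x = - laplacian (bump 0 \<epsilon>) x" for x :: 'a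
    unfolding cutoff_def[abs_def]
    by (subst laplacian_diff[OF open_UNIV Cinf_const Cinf_bump]) (auto simp: laplacian_const)
  have "(LINT x:\<Omega>|lborel. cutoff \<epsilon> x * laplacian u x - u x * laplacian (cutoff \<epsilon>) x)
      = (LINT x:\<Omega>|lborel. u x * laplacian (bump 0 \<epsilon>) x)"
  proof (rule set_lebesgue_integral_cong)
    show "\<forall>x. x \<in> \<Omega> \<longrightarrow> cutoff \<epsilon> x * laplacian u x - u x * laplacian (cutoff \<epsilon>) x = u x * laplacian (bump 0 \<epsilon>) x"
    proof (intro allI impI)
      fix x assume "x \<in> \<Omega>"
      then show "cutoff \<epsilon> x * laplacian u x - u x * laplacian (cutoff \<epsilon>) x = u x * laplacian (bump 0 \<epsilon>) x"
        using harmonic[of x] cutoff_eq_0[OF \<epsilon>(1), of x] \<epsilon>(1) by (cases "x = 0") (auto simp: lz)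
    qed
  qed simp
  also have "\<dots> = - m * bump 0 \<epsilon> (0::'a)"
    by (rule weak_compact(2)[OF Cinf_bump compact_cball \<epsilon>(2)]) (use \<epsilon>(1) in \<open>auto intro!: bump_eq_0\<close>)
  also have "bump 0 \<epsilon> (0::'a) = 1" using \<epsilon>(1) by (intro bump_eq_1) auto
  finally show ?thesis using green[OF V u \<epsilon>] by simp
qed

text \<open>The mass of \<open>- laplacian gam\<close> at the origin, so that
  \<open>m / kap * gam\<close> has the singularity prescribed for \<open>u\<close>.\<close>

definition kap :: real where
  "kap = (real DIM('a) - 2) * area (sphere (0::'a) 1) / surface_const TYPE('a)"

lemma kap_pos: "kap > 0"
  using dim3 area_sphere_pos[OF dim] surface_const_pos[OF dim] by (simp add: kap_def)

lemma integral_reg: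
  fixes x :: 'a
  assumes "0 < \<epsilon>" "\<epsilon> < 1"
  shows "(\<integral>y. laplacian (reg_gam \<epsilon>) (y - x) \<partial>lborel) = - kap"
proof -
  have c: "Cinf UNIV (laplacian (reg_gam \<epsilon> :: 'a \<Rightarrow> real))"
    by (rule Cinf_laplacian[OF open_UNIV Cinf_reg_gam[OF assms(1)]])
  have "(\<integral>y. laplacian (reg_gam \<epsilon>) (- x + y) \<partial>lborel) = (\<integral>y. laplacian (reg_gam \<epsilon> :: 'a \<Rightarrow> real) y \<partial>lborel)"
    by (rule integral_lborel_translate[OF borel_measurable_continuous_onI[OF Cinf_continuous_on[OF c]]])
  moreover have "surface_const TYPE('a) \<noteq> 0" using surface_const_pos[OF dim] by simp
  ultimately show ?thesis
    using integral_laplacian_reg_gam[OF dim assms]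
    by (simp add: kap_def field_simps)
qed

text \<open>The test function is the difference of two regularised kernels centred at
  \<open>x\<close>. Both equal \<open>gam (y - x)\<close> for \<open>|y - x| \<ge> R\<close>, so its
  support is compact in \<open>\<Omega>\<close>. As \<open>\<epsilon>\<close> tends to zero the
  first kernel reproduces \<open>- kap * u x\<close>, while the second one contributes the
  convolution on the left.\<close>

lemma representation:
  assumes R: "0 < R" "R < 1" "cball 0 (2 * R) \<subseteq> \<Omega>" and x: "x \<noteq> 0" "norm x < R"
  shows "kap * u x + (\<integral>y. indicator (cball 0 (2 * R)) y * u y * laplacian (reg_gam R) (y - x) \<partial>lborel)
    = m * (gam x - reg_gam R x)"
proof -
  let ?B = "cball (0::'a) (2 * R)"
  let ?\<rho> = "\<lambda>\<epsilon>. laplacian (reg_gam \<epsilon> :: 'a \<Rightarrow> real)"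
  define D where "D = (\<integral>y. indicator ?B y * u y * ?\<rho> R (y - x) \<partial>lborel)"
  obtain M where M: "M > 0" "\<And>\<epsilon> y. 0 < \<epsilon> \<Longrightarrow> \<bar>?\<rho> \<epsilon> y\<bar> \<le> M * \<epsilon> powr (- real DIM('a))"
    using laplacian_reg_gam_bound[where 'a='a] by blast
  have xV: "x \<in> V - {0}" using x R by (intro \<Omega>V(2)) auto
  have iu: "integrable lborel (\<lambda>y. indicator ?B y * u y)"
    using int[OF compact_cball R(3)] by (simp add: set_integrable_def)
  have cr: "Cinf UNIV (\<lambda>y. reg_gam \<epsilon> (1 *\<^sub>R y + (- x)))" if "0 < \<epsilon>" for \<epsilon>
    by (rule Cinf_affine[OF Cinf_reg_gam[OF that]])
  have lr: "laplacian (\<lambda>y. reg_gam \<epsilon> (1 *\<^sub>R y + (- x))) y = ?\<rho> \<epsilon> (y - x)" if "0 < \<epsilon>" for \<epsilon> y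
    using laplacian_affine[OF Cinf_reg_gam[OF that], of 1 "- x" y] by simp
  have meas: "(\<lambda>y. ?\<rho> \<epsilon> (y - x)) \<in> borel_measurable borel" if "0 < \<epsilon>" for \<epsilon>
    using borel_measurable_continuous_onI[OF Cinf_continuous_on[OF Cinf_affine[OF Cinf_laplacian[OF open_UNIV Cinf_reg_gam[OF that]], of 1 "- x"]]]
    by simp
  have rho0: "?\<rho> \<epsilon> (y - x) = 0" if "0 < \<epsilon>" "\<epsilon> < dist x y" for \<epsilon> y
    using that by (intro laplacian_reg_gam_zero) (auto simp: dist_norm norm_minus_commute)
  have inB: "y \<in> ?B" if "dist x y \<le> R" for y
    using that x(2) norm_triangle_ineq[of x "y - x"] by (simp add: dist_norm norm_minus_commute)
  have ii: "integrable lborel (\<lambda>y. indicator ?B y * u y * ?\<rho> \<epsilon> (y - x))" if "0 < \<epsilon>" for \<epsilon>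
    by (rule integrable_mult_bounded[OF iu meas[OF that] M(2)[OF that]])
  have key: "(\<integral>y. indicator ?B y * u y * ?\<rho> \<epsilon> (y - x) \<partial>lborel) = D - m * (gam x - reg_gam R x)"
    if \<epsilon>: "0 < \<epsilon>" "\<epsilon> \<le> R" "\<epsilon> \<le> norm x" for \<epsilon>
  proof -
    define \<phi> where "\<phi> y = reg_gam \<epsilon> (1 *\<^sub>R y + (- x)) - reg_gam R (1 *\<^sub>R y + (- x))" for y
    have c\<phi>: "Cinf UNIV \<phi>" unfolding \<phi>_def[abs_def] by (intro Cinf_diff cr open_UNIV \<epsilon>(1) R(1))
    have supp: "\<phi> y = 0" if "y \<notin> cball x R" for y
    proof -
      have "R \<le> norm (y - x)" using that by (simp add: dist_norm norm_minus_commute)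
      then show ?thesis using \<epsilon> R by (simp add: \<phi>_def reg_gam_eq_gam)
    qed
    have sub: "cball x R \<subseteq> \<Omega>" using inB R(3) by (auto simp: subset_iff)
    have "(\<integral>y. u y * laplacian \<phi> y \<partial>lborel) = - m * \<phi> 0"
      by (rule weak_compact(1)[OF c\<phi> compact_cball sub]) (rule supp)
    moreover have "\<phi> 0 = gam x - reg_gam R x" using \<epsilon> by (simp add: \<phi>_def reg_gam_minus reg_gam_eq_gam)
    moreover have "u y * laplacian \<phi> y
        = indicator ?B y * u y * ?\<rho> \<epsilon> (y - x) - indicator ?B y * u y * ?\<rho> R (y - x)" for y
    proof -
      have l: "laplacian \<phi> y = ?\<rho> \<epsilon> (y - x) - ?\<rho> R (y - x)"
        unfolding \<phi>_def[abs_def] laplacian_diff[OF open_UNIV cr[OF \<epsilon>(1)] cr[OF R(1)] UNIV_I] lr[OF \<epsilon>(1)] lr[OF R(1)] ..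
      show ?thesis
      proof (cases "y \<in> ?B")
        case True
        then show ?thesis by (simp add: l right_diff_distrib)
      next
        case False
        then have "dist x y > R" using inB[of y] by linarith
        then show ?thesis using rho0[OF \<epsilon>(1), of y] rho0[OF R(1), of y] \<epsilon>(2) by (simp add: l)
      qed
    qed
    ultimately have "(\<integral>y. indicator ?B y * u y * ?\<rho> \<epsilon> (y - x) - indicator ?B y * u y * ?\<rho> R (y - x) \<partial>lborel)
        = - m * (gam x - reg_gam R x)" by simp
    then show ?thesis
      using Bochner_Integration.integral_diff[OF ii[OF \<epsilon>(1)] ii[OF R(1)]] by (simp add: D_def)
  qed
  define w where "w = unit_ball_vol (real DIM('a))"
  have w: "w \<ge> 0" by (simp add: w_def)
  have "\<bar>kap * u x + D - m * (gam x - reg_gam R x)\<bar> \<le> 0 + e" if e: "e > 0" for e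
  proof -
    \<comment> \<open>Measured against \<open>M * w\<close>, which bounds the integral of the
      absolute value of the kernel for every \<open>\<epsilon>\<close>; the \<open>+ 1\<close> keeps
      the divisor positive.\<close>
    define e' where "e' = e / (M * w + 1)"
    have Mw: "M * w + 1 > 0" using M(1) w by (intro add_nonneg_pos) auto
    then have e': "e' > 0" "e' * (M * w + 1) = e" using e by (auto simp: e'_def)
    then have e'': "e' * (M * w) \<le> e" by (simp add: distrib_left)
    have "isCont u x" using Cinf_continuous_on[OF u] xV oV by (simp add: continuous_on_eq_continuous_at)
    then obtain d where d: "d > 0" "\<And>y. dist y x < d \<Longrightarrow> dist (u y) (u x) < e'"
      using e'(1) unfolding continuous_at_eps_delta by metis
    define \<epsilon> where "\<epsilon> = min (min R (norm x)) (min d 1) / 2"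
    have \<epsilon>: "0 < \<epsilon>" "\<epsilon> \<le> R" "\<epsilon> \<le> norm x" "\<epsilon> < d" "\<epsilon> < 1"
      using R x d by (auto simp: \<epsilon>_def min_def)
    have ir: "integrable lborel (\<lambda>y. ?\<rho> \<epsilon> (y - x))"
    proof (rule integrable_continuous_compact_support[of _ "cball x \<epsilon>"])
      show "continuous_on UNIV (\<lambda>y. ?\<rho> \<epsilon> (y - x))"
        using Cinf_continuous_on[OF Cinf_affine[OF Cinf_laplacian[OF open_UNIV Cinf_reg_gam[OF \<epsilon>(1)]], of 1 "- x"]] by simp
    qed (use rho0[OF \<epsilon>(1)] in auto)
    have "kap * u x + D - m * (gam x - reg_gam R x)
        = (\<integral>y. indicator ?B y * u y * ?\<rho> \<epsilon> (y - x) \<partial>lborel) - u x * (\<integral>y. ?\<rho> \<epsilon> (y - x) \<partial>lborel)"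
      using key[OF \<epsilon>(1-3)] integral_reg[OF \<epsilon>(1,5), of x] by simp
    also have "\<dots> = (\<integral>y. indicator ?B y * u y * ?\<rho> \<epsilon> (y - x) - u x * ?\<rho> \<epsilon> (y - x) \<partial>lborel)"
      using Bochner_Integration.integral_diff[OF ii[OF \<epsilon>(1)], of "\<lambda>y. u x * ?\<rho> \<epsilon> (y - x)"] ir by simp
    also have "\<bar>\<dots>\<bar> \<le> (\<integral>y. e' * (M * \<epsilon> powr (- real DIM('a))) * indicator (cball x \<epsilon>) y \<partial>lborel)"
    proof (rule integral_abs_bound[THEN order_trans], rule integral_mono)
      show "integrable lborel (\<lambda>y. \<bar>indicator ?B y * u y * ?\<rho> \<epsilon> (y - x) - u x * ?\<rho> \<epsilon> (y - x)\<bar>)"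
        using ii[OF \<epsilon>(1)] ir by (intro integrable_abs Bochner_Integration.integrable_diff integrable_mult_right) auto
      show "integrable lborel (\<lambda>y. e' * (M * \<epsilon> powr (- real DIM('a))) * indicator (cball x \<epsilon>) y)"
        using emeasure_lborel_cball_finite[of x \<epsilon>] by (intro integrable_mult_right integrable_real_indicator) auto
      fix y
      show "\<bar>indicator ?B y * u y * ?\<rho> \<epsilon> (y - x) - u x * ?\<rho> \<epsilon> (y - x)\<bar>
          \<le> e' * (M * \<epsilon> powr (- real DIM('a))) * indicator (cball x \<epsilon>) y"
      proof (cases "y \<in> cball x \<epsilon>")
        case True
        then have yB: "y \<in> ?B" using inB[of y] \<epsilon>(2) by simp
        have "\<bar>u y - u x\<bar> \<le> e'" using d(2)[of y] True \<epsilon>(4) by (simp add: dist_real_def dist_commute)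
        then have "\<bar>u y - u x\<bar> * \<bar>?\<rho> \<epsilon> (y - x)\<bar> \<le> e' * (M * \<epsilon> powr (- real DIM('a)))"
          using M(2)[OF \<epsilon>(1)] e'(1) by (intro mult_mono) auto
        then show ?thesis using True yB by (simp add: abs_mult[symmetric] left_diff_distrib)
      qed (use rho0[OF \<epsilon>(1), of y] in simp)
    qed
    also have "\<dots> = e' * (M * \<epsilon> powr (- real DIM('a))) * measure lborel (cball x \<epsilon>)" by simp
    also have "measure lborel (cball x \<epsilon>) = w * \<epsilon> ^ DIM('a)"
      using \<epsilon>(1) by (simp add: measure_def emeasure_cball w_def)
    also have "e' * (M * \<epsilon> powr (- real DIM('a))) * (w * \<epsilon> ^ DIM('a)) = e' * (M * w)"
      using \<epsilon>(1) by (simp add: powr_minus powr_realpow)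
    finally show ?thesis using e'' by linarith
  qed
  then have "\<bar>kap * u x + D - m * (gam x - reg_gam R x)\<bar> \<le> 0" by (rule field_le_epsilon)
  then show ?thesis by (simp add: D_def)
qed

text \<open>The difference of \<open>u\<close> and the multiple of the fundamental solution is a convolution
  with a smooth kernel, hence Lipschitz.\<close>
lemma pole_asymptotics:
  "\<exists>R>0. \<exists>L>0. cball 0 R \<subseteq> \<Omega> \<and> (\<forall>x. x \<noteq> 0 \<longrightarrow> norm x < R \<longrightarrow>
    \<bar>u x - m / kap * gam x\<bar> \<le> L \<and> (\<forall>v. \<bar>pd v u x - m / kap * pd v gam x\<bar> \<le> L * norm v))"
proof -
  obtain R where R: "R > 0" "R < 1" "cball 0 (2 * R) \<subseteq> \<Omega>" using small_ball by blast
  let ?B = "cball (0::'a) (2 * R)"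
  let ?\<rho> = "laplacian (reg_gam R :: 'a \<Rightarrow> real)"
  define D where "D x = (\<integral>y. indicator ?B y * u y * ?\<rho> (y - x) \<partial>lborel)" for x
  define h where "h x = u x - m / kap * gam x" for x
  have hD: "h x = - (D x + m * reg_gam R x) / kap" if "x \<noteq> 0" "norm x < R" for x
    using representation[OF R that] kap_pos by (simp add: h_def D_def field_simps)
  have c\<rho>: "Cinf UNIV ?\<rho>" by (rule Cinf_laplacian[OF open_UNIV Cinf_reg_gam[OF R(1)]])
  \<comment> \<open>Radius \<open>3 * R\<close> because \<open>y\<close> ranges over a ball of
    radius \<open>2 * R\<close> and \<open>x\<close> over one of radius \<open>R\<close>.\<close>
  obtain L1 where L1: "L1 > 0" "\<forall>x\<in>cball 0 (3 * R). \<forall>y\<in>cball 0 (3 * R). \<bar>?\<rho> x - ?\<rho> y\<bar> \<le> L1 * norm (x - y)"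
    using Cinf_Lipschitz[OF c\<rho>] by blast
  obtain L2 where L2: "L2 > 0" "\<forall>x\<in>cball 0 R. \<forall>y\<in>cball 0 R. \<bar>reg_gam R x - reg_gam R y\<bar> \<le> L2 * norm (x - y :: 'a)"
    using Cinf_Lipschitz[OF Cinf_reg_gam[OF R(1)]] by blast
  have iu: "integrable lborel (\<lambda>y. indicator ?B y * u y)"
    using int[OF compact_cball R(3)] by (simp add: set_integrable_def)
  obtain M where M: "\<And>y. \<bar>?\<rho> y\<bar> \<le> M * R powr (- real DIM('a))"
    using laplacian_reg_gam_bound[where 'a='a] R(1) by blast
  have meas: "(\<lambda>y. ?\<rho> (y - x)) \<in> borel_measurable borel" for x
    using borel_measurable_continuous_onI[OF Cinf_continuous_on[OF Cinf_affine[OF c\<rho>, of 1 "- x"]]] by simp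
  have ii: "integrable lborel (\<lambda>y. indicator ?B y * u y * ?\<rho> (y - x))" for x
    by (rule integrable_mult_bounded[OF iu meas M])
  define J where "J = (\<integral>y. \<bar>indicator ?B y * u y\<bar> \<partial>lborel)"
  have J: "J \<ge> 0" by (simp add: J_def)
  have DL: "\<bar>D x - D z\<bar> \<le> J * L1 * norm (x - z)" if xz: "norm x < R" "norm z < R" for x z
  proof -
    have "D x - D z = (\<integral>y. indicator ?B y * u y * ?\<rho> (y - x) - indicator ?B y * u y * ?\<rho> (y - z) \<partial>lborel)"
      unfolding D_def by (rule Bochner_Integration.integral_diff[OF ii ii, symmetric])
    also have "\<bar>\<dots>\<bar> \<le> (\<integral>y. \<bar>indicator ?B y * u y\<bar> * (L1 * norm (x - z)) \<partial>lborel)"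
    proof (rule integral_abs_bound[THEN order_trans], rule integral_mono)
      show "integrable lborel (\<lambda>y. \<bar>indicator ?B y * u y * ?\<rho> (y - x) - indicator ?B y * u y * ?\<rho> (y - z)\<bar>)"
        by (intro integrable_abs Bochner_Integration.integrable_diff ii)
      show "integrable lborel (\<lambda>y. \<bar>indicator ?B y * u y\<bar> * (L1 * norm (x - z)))"
        using integrable_abs[OF iu] by (rule integrable_mult_left)
      fix y
      show "\<bar>indicator ?B y * u y * ?\<rho> (y - x) - indicator ?B y * u y * ?\<rho> (y - z)\<bar>
          \<le> \<bar>indicator ?B y * u y\<bar> * (L1 * norm (x - z))"
      proof (cases "y \<in> ?B")
        case True
        then have "y - x \<in> cball 0 (3 * R)" "y - z \<in> cball 0 (3 * R)"
          using xz norm_triangle_ineq4[of y x] norm_triangle_ineq4[of y z] by auto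
        then have "\<bar>?\<rho> (y - x) - ?\<rho> (y - z)\<bar> \<le> L1 * norm ((y - x) - (y - z))" using L1(2) by blast
        then have "\<bar>?\<rho> (y - x) - ?\<rho> (y - z)\<bar> \<le> L1 * norm (x - z)" by (simp add: norm_minus_commute)
        then have "\<bar>u y\<bar> * \<bar>?\<rho> (y - x) - ?\<rho> (y - z)\<bar> \<le> \<bar>u y\<bar> * (L1 * norm (x - z))"
          by (rule mult_left_mono) simp
        then show ?thesis using True by (simp add: abs_mult[symmetric] right_diff_distrib)
      qed simp
    qed
    also have "\<dots> = J * L1 * norm (x - z)" by (simp add: J_def)
    finally show ?thesis .
  qed
  define L where "L = (J * L1 + \<bar>m\<bar> * L2) / kap"
  have L0: "L \<ge> 0" using J L1 L2 kap_pos by (simp add: L_def)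
  have hL: "\<bar>h x - h z\<bar> \<le> L * norm (x - z)"
    if "x \<noteq> 0" "norm x < R" "z \<noteq> 0" "norm z < R" for x z
  proof -
    have "h x - h z = - ((D x - D z) + m * (reg_gam R x - reg_gam R z)) / kap"
      by (simp add: hD that diff_divide_distrib add_divide_distrib algebra_simps)
    then have "\<bar>h x - h z\<bar> = \<bar>(D x - D z) + m * (reg_gam R x - reg_gam R z)\<bar> / kap"
      using kap_pos by (simp add: abs_divide abs_minus_commute)
    also have "\<dots> \<le> (J * L1 * norm (x - z) + \<bar>m\<bar> * (L2 * norm (x - z))) / kap"
    proof (intro divide_right_mono order_trans[OF abs_triangle_ineq] add_mono)
      show "\<bar>D x - D z\<bar> \<le> J * L1 * norm (x - z)" using DL that by blast
      have "\<bar>reg_gam R x - reg_gam R z\<bar> \<le> L2 * norm (x - z)" using L2(2) that by simp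
      then show "\<bar>m * (reg_gam R x - reg_gam R z)\<bar> \<le> \<bar>m\<bar> * (L2 * norm (x - z))"
        unfolding abs_mult by (rule mult_left_mono) simp
    qed (use kap_pos in simp)
    also have "\<dots> = L * norm (x - z)" by (simp add: L_def field_simps)
    finally show ?thesis .
  qed
  \<comment> \<open>A Lipschitz estimate bounds differences only; the reference point
    \<open>z\<close> turns it into a bound for \<open>h\<close> itself.\<close>
  obtain z :: 'a where z: "z \<noteq> 0" "norm z < R"
    using vector_choose_size[of "R / 2"] R(1) by (metis half_gt_zero_iff less_eq_real_def less_numeral_extra(3) norm_zero field_sum_of_halves less_add_same_cancel1)
  define L' where "L' = \<bar>h z\<bar> + L * (2 * R) + L + 1"
  have L': "L' > 0" "L \<le> L'" using L0 R(1) by (auto simp: L'_def intro!: add_nonneg_pos)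
  have main: "\<bar>h x\<bar> \<le> L' \<and> (\<forall>v. \<bar>pd v u x - m / kap * pd v gam x\<bar> \<le> L' * norm v)"
    if x: "x \<noteq> 0" "norm x < R" for x
  proof (intro conjI allI)
    have "\<bar>h x - h z\<bar> \<le> L * norm (x - z)" by (rule hL[OF x z])
    also have "\<dots> \<le> L * (2 * R)"
      using norm_triangle_ineq4[of x z] x z L0 by (intro mult_left_mono) auto
    finally show "\<bar>h x\<bar> \<le> L'" using L0 by (simp add: L'_def)
    fix v
    have xV: "x \<in> V - {0}" using x R by (intro \<Omega>V(2)) auto
    have d: "u differentiable at x" "gam differentiable at x"
      using Cinf_differentiable[OF u xV] Cinf_differentiable[OF Cinf_gam, of x] x by auto
    then have dg: "(\<lambda>x. m / kap * gam x) differentiable at x" by (intro differentiable_mult) auto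
    have "pd v h x = pd v u x - m / kap * pd v gam x"
      unfolding h_def[abs_def] by (simp only: pd_diff[OF d(1) dg] pd_cmult[OF d(2)])
    moreover have "\<bar>pd v h x\<bar> \<le> L * norm v"
    proof (rule pd_le_Lipschitz[of "ball 0 R - {0}"])
      show "h differentiable at x" unfolding h_def[abs_def] by (rule differentiable_diff[OF d(1) dg])
    qed (use x hL in \<open>auto simp: open_delete\<close>)
    moreover have "L * norm v \<le> L' * norm v" using L'(2) by (rule mult_right_mono) simp
    ultimately show "\<bar>pd v u x - m / kap * pd v gam x\<bar> \<le> L' * norm v" by simp
  qed
  have "cball 0 R \<subseteq> \<Omega>" using R(1,3) by (auto simp: subset_iff)
  then show ?thesis using R(1) L'(1) main by (intro exI[of _ R] conjI exI[of _ L']) (auto simp: h_def)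
qed

end

section \<open>The subharmonic function\<close>

lemma laplacian_mult:
  assumes U: "open U" "x \<in> U" and f: "Cinf U f" and g: "Cinf U g"
  shows "laplacian (\<lambda>x. f x * g x) x
    = f x * laplacian g x + 2 * (\<Sum>b\<in>Basis. pd b f x * pd b g x) + laplacian f x * g x"
proof -
  note d = Cinf_differentiable[OF f] Cinf_differentiable[OF g]
    Cinf_differentiable[OF Cinf_pd[OF f]] Cinf_differentiable[OF Cinf_pd[OF g]]
  have "pd b (pd b (\<lambda>x. f x * g x)) x
      = f x * pd b (pd b g) x + 2 * (pd b f x * pd b g x) + pd b (pd b f) x * g x" for b
  proof -
    have "pd b (pd b (\<lambda>x. f x * g x)) x = pd b (\<lambda>x. f x * pd b g x + pd b f x * g x) x"
      by (rule pd_cong[OF U]) (rule pd_mult[OF d(1,2)])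
    also have "\<dots> = pd b (\<lambda>x. f x * pd b g x) x + pd b (\<lambda>x. pd b f x * g x) x"
      by (rule pd_add) (intro differentiable_mult d U(2))+
    finally show ?thesis by (simp add: pd_mult[OF d(1)[OF U(2)] d(4)[OF U(2)]] pd_mult[OF d(3)[OF U(2)] d(2)[OF U(2)]])
  qed
  then show ?thesis
    by (simp add: laplacian_def sum.distrib sum_distrib_left sum_distrib_right)
qed

lemma laplacian_powr:
  assumes U: "open U" "x \<in> U" and w: "Cinf U w" and pos: "\<And>x. x \<in> U \<Longrightarrow> w x > 0"
  shows "laplacian (\<lambda>x. w x powr a) x
    = a * w x powr (a - 1) * laplacian w x + a * (a - 1) * w x powr (a - 2) * (\<Sum>b\<in>Basis. (pd b w x)\<^sup>2)"
proof -
  note d = Cinf_differentiable[OF w] Cinf_differentiable[OF Cinf_pd[OF w]]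
  have cp: "Cinf U (\<lambda>x. w x powr c)" for c by (rule Cinf_comp_powr[OF U(1) w pos])
  have "pd b (pd b (\<lambda>x. w x powr a)) x
      = a * w x powr (a - 1) * pd b (pd b w) x + a * (a - 1) * w x powr (a - 2) * (pd b w x)\<^sup>2" for b
  proof -
    have "pd b (pd b (\<lambda>x. w x powr a)) x = pd b (\<lambda>x. a * (w x powr (a - 1) * pd b w x)) x"
      by (rule pd_cong[OF U]) (simp add: pd_powr[OF d(1) pos])
    also have "\<dots> = a * pd b (\<lambda>x. w x powr (a - 1) * pd b w x) x"
      by (rule pd_cmult) (intro differentiable_mult Cinf_differentiable[OF cp] d(2) U(2))
    also have "pd b (\<lambda>x. w x powr (a - 1) * pd b w x) x
        = w x powr (a - 1) * pd b (pd b w) x + ((a - 1) * w x powr (a - 1 - 1) * pd b w x) * pd b w x"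
      by (simp only: pd_mult[OF Cinf_differentiable[OF cp U(2)] d(2)[OF U(2)]] pd_powr[OF d(1)[OF U(2)] pos[OF U(2)]])
    finally show ?thesis by (simp add: power2_eq_square algebra_simps)
  qed
  then show ?thesis by (simp add: laplacian_def sum.distrib sum_distrib_left)
qed

definition grad2 :: "('a::euclidean_space \<Rightarrow> real) \<Rightarrow> 'a \<Rightarrow> real" where
  "grad2 w x = (\<Sum>b\<in>Basis. (pd b w x)\<^sup>2)"

lemma Cinf_grad2: "open U \<Longrightarrow> Cinf U w \<Longrightarrow> Cinf U (grad2 w)"
  unfolding grad2_def[abs_def] power2_eq_square by (intro Cinf_sum Cinf_mult Cinf_pd)

lemma grad2_nonneg: "0 \<le> grad2 w x"
  by (simp add: grad2_def sum_nonneg)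

lemma grad2_norm: "w differentiable at x \<Longrightarrow> grad2 w x = (norm (gradient w (at x)))\<^sup>2"
  by (simp add: grad2_def norm_gradient)

lemma pd_grad2:
  assumes U: "open U" "x \<in> U" and w: "Cinf U w"
  shows "pd v (grad2 w) x = 2 * (\<Sum>b\<in>Basis. pd b w x * pd v (pd b w) x)"
proof -
  note d = Cinf_differentiable[OF Cinf_pd[OF w] U(2)]
  have "pd v (grad2 w) x = (\<Sum>b\<in>Basis. pd v (\<lambda>x. pd b w x * pd b w x) x)"
    unfolding grad2_def[abs_def] power2_eq_square by (rule pd_sum) (intro differentiable_mult d)
  also have "\<dots> = (\<Sum>b\<in>Basis. 2 * (pd b w x * pd v (pd b w) x))"
    by (intro sum.cong refl) (simp add: pd_mult[OF d d])
  finally show ?thesis by (simp add: sum_distrib_left)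
qed

lemma laplacian_pd:
  assumes U: "open U" "x \<in> U" and w: "Cinf U w"
  shows "laplacian (pd v w) x = pd v (laplacian w) x"
proof -
  have "pd b (pd b (pd v w)) x = pd v (pd b (pd b w)) x" for b
  proof -
    have "pd b (pd b (pd v w)) x = pd b (pd v (pd b w)) x"
      by (rule pd_cong[OF U]) (rule pd_commute[OF w U(1)])
    also have "\<dots> = pd v (pd b (pd b w)) x" by (rule pd_commute[OF Cinf_pd[OF w] U])
    finally show ?thesis .
  qed
  moreover have "pd v (laplacian w) x = (\<Sum>b\<in>Basis. pd v (pd b (pd b w)) x)"
    unfolding laplacian_def[abs_def] by (rule pd_sum) (rule Cinf_differentiable[OF Cinf_pd[OF Cinf_pd[OF w]] U(2)])
  ultimately show ?thesis by (simp add: laplacian_def)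
qed

text \<open>Bochner's formula; its third-order term contains the derivatives of
  \<open>laplacian w\<close> and vanishes.\<close>

lemma laplacian_grad2:
  assumes U: "open U" "x \<in> U" and w: "Cinf U w" and harm: "\<And>x. x \<in> U \<Longrightarrow> laplacian w x = 0"
  shows "laplacian (grad2 w) x = 2 * (\<Sum>i\<in>Basis. \<Sum>j\<in>Basis. (pd j (pd i w) x)\<^sup>2)"
proof -
  note d = Cinf_differentiable[OF Cinf_pd[OF w]] Cinf_differentiable[OF Cinf_pd[OF Cinf_pd[OF w]]]
  have harm': "laplacian (pd i w) x = 0" for i
  proof -
    have "pd i (laplacian w) x = pd i (\<lambda>x. 0) x" by (rule pd_cong[OF U harm])
    then show ?thesis by (simp add: laplacian_pd[OF U w])
  qed
  have "laplacian (grad2 w) x = (\<Sum>i\<in>Basis. laplacian (\<lambda>x. pd i w x * pd i w x) x)"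
  proof -
    have "pd b (pd b (grad2 w)) x = (\<Sum>i\<in>Basis. pd b (pd b (\<lambda>x. pd i w x * pd i w x)) x)" for b
    proof -
      have c: "Cinf U (\<lambda>x. pd i w x * pd i w x)" for i by (intro Cinf_mult U(1) Cinf_pd w)
      have "pd b (pd b (grad2 w)) x = pd b (\<lambda>x. \<Sum>i\<in>Basis. pd b (\<lambda>x. pd i w x * pd i w x) x) x"
        unfolding grad2_def[abs_def] power2_eq_square
        by (rule pd_cong[OF U], rule pd_sum) (rule Cinf_differentiable[OF c])
      also have "\<dots> = (\<Sum>i\<in>Basis. pd b (pd b (\<lambda>x. pd i w x * pd i w x)) x)"
        by (rule pd_sum) (rule Cinf_differentiable[OF Cinf_pd[OF c] U(2)])
      finally show ?thesis .
    qed
    then have "laplacian (grad2 w) x = (\<Sum>b\<in>Basis. \<Sum>i\<in>Basis. pd b (pd b (\<lambda>x. pd i w x * pd i w x)) x)"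
      unfolding laplacian_def by (intro sum.cong refl)
    also have "\<dots> = (\<Sum>i\<in>Basis. \<Sum>b\<in>Basis. pd b (pd b (\<lambda>x. pd i w x * pd i w x)) x)" by (rule sum.swap)
    finally show ?thesis unfolding laplacian_def .
  qed
  also have "\<dots> = (\<Sum>i\<in>Basis. 2 * (\<Sum>j\<in>Basis. (pd j (pd i w) x)\<^sup>2))"
    by (intro sum.cong refl)
      (simp add: laplacian_mult[OF U Cinf_pd[OF w] Cinf_pd[OF w]] harm' power2_eq_square)
  finally show ?thesis by (simp add: sum_distrib_left)
qed

text \<open>With this exponent \<open>w^(1 - \<alpha>)\<close> is a multiple of \<open>|x|^2\<close>
  whenever \<open>w\<close> is a positive multiple of \<open>|x|^(2 - n)\<close>, so the trace-free
  part of its Hessian measures the deviation from the radial model.\<close>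

definition alpha :: "'a::euclidean_space itself \<Rightarrow> real" where
  "alpha _ = real DIM('a) / (real DIM('a) - 2)"

text \<open>Up to the factor \<open>(1 - \<alpha>) w\<^sup>-\<^sup>\<alpha>\<close> this is the Hessian of \<open>w\<^sup>1\<^sup>-\<^sup>\<alpha>\<close> with its trace
  removed when \<open>w\<close> is harmonic.\<close>
definition tensor :: "('a::euclidean_space \<Rightarrow> real) \<Rightarrow> 'a \<Rightarrow> 'a \<Rightarrow> 'a \<Rightarrow> real" where
  "tensor w x i j = pd j (pd i w) x - alpha TYPE('a) * (pd i w x * pd j w x) / w x
    + (if i = j then alpha TYPE('a) / real DIM('a) * grad2 w x / w x else 0)"

definition pot_energy :: "('a::euclidean_space \<Rightarrow> real) \<Rightarrow> 'a \<Rightarrow> real" where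
  "pot_energy w x = w x powr (- alpha TYPE('a)) * grad2 w x"

lemma Cinf_pot_energy: "open U \<Longrightarrow> Cinf U w \<Longrightarrow> (\<And>x. x \<in> U \<Longrightarrow> w x > 0) \<Longrightarrow> Cinf U (pot_energy w)"
  unfolding pot_energy_def[abs_def] by (intro Cinf_mult Cinf_comp_powr Cinf_grad2)

text \<open>The first equation determines \<open>\<alpha>\<close>. It makes the last coefficient in
  the squared tensor agree with the one in the Laplacian of \<open>w^(-\<alpha>)\<close>.\<close>

lemma alpha_identity:
  assumes "3 \<le> DIM('a::euclidean_space)"
  shows "alpha TYPE('a) * (1 - 1 / real DIM('a)) = (alpha TYPE('a) + 1) / 2"
    and "alpha TYPE('a) > 1"
proof -
  have n: "real DIM('a) \<ge> 3" using assms by simp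
  show "alpha TYPE('a) * (1 - 1 / real DIM('a)) = (alpha TYPE('a) + 1) / 2"
    using n by (simp add: alpha_def field_simps)
  show "alpha TYPE('a) > 1" using n by (simp add: alpha_def field_simps)
qed

text \<open>The diagonal correction \<open>t\<close> meets the Hessian only through its trace, which
  is zero, and the gradient only through \<open>grad2\<close>. What is left in front of
  \<open>q^2 / W^2\<close> is \<open>a^2 (1 - 1/n)\<close>, that is
  \<open>a (a + 1) / 2\<close>.\<close>

lemma tensor_square_sum:
  fixes x :: "'a::euclidean_space"
  assumes dim: "3 \<le> DIM('a)" and harm: "laplacian w x = 0" and w0: "w x > 0"
  shows "(\<Sum>i\<in>Basis. \<Sum>j\<in>Basis. (tensor w x i j)\<^sup>2)
    = (\<Sum>i\<in>Basis. \<Sum>j\<in>Basis. (pd j (pd i w) x)\<^sup>2)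
      - 2 * alpha TYPE('a) / w x * (\<Sum>i\<in>Basis. \<Sum>j\<in>Basis. pd i w x * pd j w x * pd j (pd i w) x)
      + alpha TYPE('a) * (alpha TYPE('a) + 1) / 2 * (grad2 w x)\<^sup>2 / (w x)\<^sup>2"
proof -
  define a where "a = alpha TYPE('a)"
  define n where "n = real DIM('a)"
  define q where "q = grad2 w x"
  define W where "W = w x"
  define p where "p i = pd i w x" for i
  define h where "h i j = pd j (pd i w) x" for i j
  have n: "n > 0" using dim by (simp add: n_def)
  have q: "(\<Sum>b\<in>Basis. (p b)\<^sup>2) = q" by (simp add: q_def grad2_def p_def)
  have tr: "(\<Sum>b\<in>Basis. h b b) = 0" using harm by (simp add: laplacian_def h_def)
  define t where "t = a / n * q / W"
  have "(tensor w x i j)\<^sup>2 = (h i j)\<^sup>2 - 2 * a / W * (p i * p j * h i j) + a\<^sup>2 / W\<^sup>2 * ((p i)\<^sup>2 * (p j)\<^sup>2)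
      + (if i = j then t\<^sup>2 + 2 * t * h i i - 2 * t * a / W * (p i)\<^sup>2 else 0)" for i j
    unfolding tensor_def a_def[symmetric] n_def[symmetric] q_def[symmetric] W_def[symmetric]
      p_def[symmetric] h_def[symmetric] t_def[symmetric]
    by (simp add: power2_eq_square algebra_simps)
  then have "(\<Sum>i\<in>Basis. \<Sum>j\<in>Basis. (tensor w x i j)\<^sup>2)
      = (\<Sum>i\<in>Basis. \<Sum>j\<in>Basis. (h i j)\<^sup>2) - 2 * a / W * (\<Sum>i\<in>Basis. \<Sum>j\<in>Basis. p i * p j * h i j)
        + a\<^sup>2 / W\<^sup>2 * (\<Sum>i\<in>Basis. \<Sum>j\<in>Basis. (p i)\<^sup>2 * (p j)\<^sup>2)
        + (\<Sum>i\<in>Basis. t\<^sup>2 + 2 * t * h i i - 2 * t * a / W * (p i)\<^sup>2)"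
    by (simp only: sum.distrib sum_subtractf sum_distrib_left[symmetric] sum.delta' sum.delta finite_Basis if_True cong: sum.cong)
  also have "(\<Sum>i\<in>Basis. \<Sum>j\<in>Basis. (p i)\<^sup>2 * (p j)\<^sup>2) = q * q"
    by (simp only: sum_product[symmetric] q)
  also have "(\<Sum>i\<in>Basis. t\<^sup>2 + 2 * t * h i i - 2 * t * a / W * (p i)\<^sup>2)
      = n * t\<^sup>2 - 2 * t * a / W * q"
    by (simp only: sum.distrib sum_subtractf sum_distrib_left[symmetric] q tr) (simp add: n_def)
  also have "(\<Sum>i\<in>Basis. \<Sum>j\<in>Basis. (h i j)\<^sup>2) - 2 * a / W * (\<Sum>i\<in>Basis. \<Sum>j\<in>Basis. p i * p j * h i j)
        + a\<^sup>2 / W\<^sup>2 * (q * q) + (n * t\<^sup>2 - 2 * t * a / W * q)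
      = (\<Sum>i\<in>Basis. \<Sum>j\<in>Basis. (h i j)\<^sup>2) - 2 * a / W * (\<Sum>i\<in>Basis. \<Sum>j\<in>Basis. p i * p j * h i j)
        + a * (a * (1 - 1 / n)) * q\<^sup>2 / W\<^sup>2"
    using n w0 unfolding t_def W_def by (simp add: power2_eq_square field_simps)
  also have "a * (1 - 1 / n) = (a + 1) / 2" unfolding a_def n_def by (rule alpha_identity(1)[OF dim])
  finally show ?thesis by (simp add: a_def q_def W_def p_def h_def)
qed

text \<open>The product rule leaves Bochner's term, a cross term and the Laplacian of
  \<open>w^(-\<alpha>)\<close>; these match the three terms in the expansion of the squared
  tensor.\<close>

lemma laplacian_pot_energy:
  fixes w :: "'a::euclidean_space \<Rightarrow> real"
  assumes dim: "3 \<le> DIM('a)" and U: "open U" "x \<in> U" and w: "Cinf U w"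
    and pos: "\<And>x. x \<in> U \<Longrightarrow> w x > 0" and harm: "\<And>x. x \<in> U \<Longrightarrow> laplacian w x = 0"
  shows "laplacian (pot_energy w) x
    = 2 * w x powr (- alpha TYPE('a)) * (\<Sum>i\<in>Basis. \<Sum>j\<in>Basis. (tensor w x i j)\<^sup>2)"
proof -
  define a where "a = alpha TYPE('a)"
  define P where "P = w x powr (- a)"
  define H where "H = (\<Sum>i\<in>Basis. \<Sum>j\<in>Basis. (pd j (pd i w) x)\<^sup>2)"
  define B where "B = (\<Sum>i\<in>Basis. \<Sum>j\<in>Basis. pd i w x * pd j w x * pd j (pd i w) x)"
  have w0: "w x > 0" by (rule pos[OF U(2)])
  have cp: "Cinf U (\<lambda>x. w x powr (- a))" by (rule Cinf_comp_powr[OF U(1) w pos])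
  have p1: "w x powr (- a - 1) = P / w x" using w0 by (simp add: P_def powr_diff)
  have p2: "w x powr (- a - 2) = P / (w x)\<^sup>2" using w0 by (simp add: P_def powr_diff)
  have "(\<Sum>b\<in>Basis. pd b (\<lambda>x. w x powr (- a)) x * pd b (grad2 w) x)
      = (\<Sum>b\<in>Basis. (- a * (P / w x) * pd b w x) * (2 * (\<Sum>i\<in>Basis. pd i w x * pd b (pd i w) x)))"
    by (simp only: pd_powr[OF Cinf_differentiable[OF w U(2)] w0] p1 pd_grad2[OF U w])
  also have "\<dots> = - 2 * a * (P / w x) * (\<Sum>b\<in>Basis. \<Sum>i\<in>Basis. pd i w x * pd b w x * pd b (pd i w) x)"
    by (simp add: sum_distrib_left mult_ac)
  also have "(\<Sum>b\<in>Basis. \<Sum>i\<in>Basis. pd i w x * pd b w x * pd b (pd i w) x) = B"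
    unfolding B_def by (rule sum.swap)
  finally have cross: "(\<Sum>b\<in>Basis. pd b (\<lambda>x. w x powr (- a)) x * pd b (grad2 w) x) = - 2 * a * (P / w x) * B" .
  have "laplacian (pot_energy w) x = P * (2 * H) + 2 * (- 2 * a * (P / w x) * B)
      + laplacian (\<lambda>x. w x powr (- a)) x * grad2 w x"
    unfolding pot_energy_def[abs_def] a_def[symmetric]
    by (simp only: laplacian_mult[OF U cp Cinf_grad2[OF U(1) w]] cross laplacian_grad2[OF U w harm] P_def[symmetric] H_def[symmetric])
  also have "laplacian (\<lambda>x. w x powr (- a)) x = a * (a + 1) * (P / (w x)\<^sup>2) * grad2 w x"
    using laplacian_powr[OF U w pos, of "- a"] harm[OF U(2)] by (simp add: p2 grad2_def algebra_simps)
  also have "P * (2 * H) + 2 * (- 2 * a * (P / w x) * B) + a * (a + 1) * (P / (w x)\<^sup>2) * grad2 w x * grad2 w x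
      = 2 * P * (H - 2 * a / w x * B + a * (a + 1) / 2 * (grad2 w x)\<^sup>2 / (w x)\<^sup>2)"
    using w0 by (simp add: field_simps power2_eq_square)
  also have "H - 2 * a / w x * B + a * (a + 1) / 2 * (grad2 w x)\<^sup>2 / (w x)\<^sup>2
      = (\<Sum>i\<in>Basis. \<Sum>j\<in>Basis. (tensor w x i j)\<^sup>2)"
    unfolding a_def H_def B_def by (rule tensor_square_sum[OF dim harm[OF U(2)] w0, symmetric])
  finally show ?thesis by (simp add: P_def a_def)
qed

subsection \<open>Rigidity\<close>

text \<open>A vanishing tensor expresses the Hessian by first derivatives. Substituted, it says that
  \<open>w^(-\<alpha>-1) |Dw|^2\<close> is locally constant and that the derivative of the field
  \<open>w^(-\<alpha>) Dw\<close> is a multiple of the identity by that constant.\<close>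

lemma tensor_zero_constant:
  fixes w :: "'a::euclidean_space \<Rightarrow> real"
  assumes dim: "3 \<le> DIM('a)" and U: "open U" "x \<in> U" and w: "Cinf U w"
    and pos: "\<And>x. x \<in> U \<Longrightarrow> w x > 0" 
    and T: "\<And>x i j. x \<in> U \<Longrightarrow> i \<in> Basis \<Longrightarrow> j \<in> Basis \<Longrightarrow> tensor w x i j = 0"
    and j: "j \<in> Basis"
  shows "pd j (\<lambda>x. w x powr (- alpha TYPE('a) - 1) * grad2 w x) x = 0"
    and "i \<in> Basis \<Longrightarrow> pd j (\<lambda>x. w x powr (- alpha TYPE('a)) * pd i w x) x
      = (if i = j then - (alpha TYPE('a) / real DIM('a)) * (w x powr (- alpha TYPE('a) - 1) * grad2 w x) else 0)"
proof -
  define a where "a = alpha TYPE('a)"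
  define n where "n = real DIM('a)"
  have n: "n > 0" using dim by (simp add: n_def)
  have w0: "w x > 0" by (rule pos[OF U(2)])
  have dw: "w differentiable at x" by (rule Cinf_differentiable[OF w U(2)])
  have cp: "Cinf U (\<lambda>x. w x powr c)" for c by (rule Cinf_comp_powr[OF U(1) w pos])
  have h: "pd j (pd i w) x = a * (pd i w x * pd j w x) / w x - (if i = j then a / n * grad2 w x / w x else 0)"
    if "i \<in> Basis" for i
    using T[OF U(2) that j] unfolding tensor_def a_def[symmetric] n_def[symmetric] by (auto split: if_splits)
  have "(\<Sum>i\<in>Basis. pd i w x * pd j (pd i w) x)
      = (\<Sum>i\<in>Basis. a * pd j w x / w x * (pd i w x)\<^sup>2 - (if i = j then a / n * grad2 w x / w x * pd j w x else 0))"
    by (intro sum.cong refl) (simp add: h power2_eq_square algebra_simps)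
  also have "\<dots> = a * pd j w x / w x * grad2 w x - a / n * grad2 w x / w x * pd j w x"
    by (simp only: sum_subtractf sum_distrib_left[symmetric] grad2_def[symmetric]) (simp add: j)
  also have "\<dots> = (a * (1 - 1 / n)) * grad2 w x * pd j w x / w x" by (simp add: algebra_simps diff_divide_distrib)
  also have "a * (1 - 1 / n) = (a + 1) / 2" unfolding a_def n_def by (rule alpha_identity(1)[OF dim])
  finally have s: "(\<Sum>i\<in>Basis. pd i w x * pd j (pd i w) x) = (a + 1) / 2 * grad2 w x * pd j w x / w x" .
  have p1: "w x powr (- a - 1 - 1) = w x powr (- a - 1) / w x" using w0 by (subst powr_diff) simp
  have "pd j (\<lambda>x. w x powr (- a - 1) * grad2 w x) x
      = w x powr (- a - 1) * (2 * ((a + 1) / 2 * grad2 w x * pd j w x / w x))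
        + (- a - 1) * (w x powr (- a - 1) / w x) * pd j w x * grad2 w x"
    by (simp only: pd_mult[OF Cinf_differentiable[OF cp U(2)] Cinf_differentiable[OF Cinf_grad2[OF U(1) w] U(2)]]
        pd_powr[OF dw w0] pd_grad2[OF U w] s p1)
  also have "\<dots> = 0" using w0 by (simp add: field_simps)
  finally show "pd j (\<lambda>x. w x powr (- alpha TYPE('a) - 1) * grad2 w x) x = 0" by (simp add: a_def)
  assume i: "i \<in> Basis"
  have p2: "w x powr (- a - 1) = w x powr (- a) / w x" using w0 by (simp add: powr_diff)
  have "pd j (\<lambda>x. w x powr (- a) * pd i w x) x
      = w x powr (- a) * pd j (pd i w) x + (- a * (w x powr (- a) / w x) * pd j w x) * pd i w x"
    by (simp only: pd_mult[OF Cinf_differentiable[OF cp U(2)] Cinf_differentiable[OF Cinf_pd[OF w] U(2)]]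
        pd_powr[OF dw w0] p2)
  also have "\<dots> = (if i = j then - (a / n) * (w x powr (- a - 1) * grad2 w x) else 0)"
    using w0 by (simp add: h[OF i] p2 algebra_simps)
  finally show "pd j (\<lambda>x. w x powr (- alpha TYPE('a)) * pd i w x) x
      = (if i = j then - (alpha TYPE('a) / real DIM('a)) * (w x powr (- alpha TYPE('a) - 1) * grad2 w x) else 0)"
    by (simp add: a_def n_def)
qed

lemma zero_pd_constant:
  fixes f :: "'a::euclidean_space \<Rightarrow> real"
  assumes U: "open U" "connected U" and f: "Cinf U f" and 0: "\<And>x b. x \<in> U \<Longrightarrow> b \<in> Basis \<Longrightarrow> pd b f x = 0"
    and xy: "x \<in> U" "y \<in> U"
  shows "f x = f y"
proof -
  have "(f has_derivative (\<lambda>h. 0)) (at z)" if z: "z \<in> U" for z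
  proof -
    have "pd v f z = 0" for v
      using pd_sum_Basis[OF Cinf_differentiable[OF f z], of v] 0[OF z] by simp
    then show ?thesis using Cinf_has_derivative[OF f z] by simp
  qed
  then show ?thesis
    by (rule has_derivative_zero_unique_connected[OF U _ xy])
qed

text \<open>On the punctured domain, which is still connected, the field
  \<open>w^(-\<alpha>) Dw\<close> is affine, of the form \<open>c - s x\<close>. Its squared length
  is \<open>k w^(1 - \<alpha>)\<close>, which tends to zero at the pole because
  \<open>1 - \<alpha> < 0\<close> and \<open>w\<close> blows up; hence \<open>c = 0\<close>.\<close>

lemma radial_rigidity:
  fixes w :: "'a::euclidean_space \<Rightarrow> real"
  assumes dim: "3 \<le> DIM('a)" and O: "open \<Omega>" "connected \<Omega>" "0 \<in> \<Omega>" and w: "Cinf (\<Omega> - {0}) w"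
    and pos: "\<And>x. x \<in> \<Omega> - {0} \<Longrightarrow> w x > 0"
    and T: "\<And>x i j. x \<in> \<Omega> - {0} \<Longrightarrow> i \<in> Basis \<Longrightarrow> j \<in> Basis \<Longrightarrow> tensor w x i j = 0"
    and inf: "filterlim w at_top (at 0)"
  shows "\<exists>K>0. \<forall>x\<in>\<Omega> - {0}. w x powr (1 - alpha TYPE('a)) = K * (norm x)\<^sup>2"
proof -
  let ?U = "\<Omega> - {0::'a}"
  define a where "a = alpha TYPE('a)"
  have a1: "a > 1" unfolding a_def by (rule alpha_identity(2)[OF dim])
  define n where "n = real DIM('a)"
  have n: "n > 0" using dim by (simp add: n_def)
  have U: "open ?U" using O(1) by (simp add: open_delete)
  have cU: "connected ?U" using dim by (intro connected_open_delete O) auto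
  obtain x0 where x0: "x0 \<in> ?U"
  proof -
    obtain r where r: "r > 0" "ball 0 r \<subseteq> \<Omega>" using O openE by blast
    obtain b :: 'a where b: "b \<in> Basis" using nonempty_Basis by blast
    have "(r / 2) *\<^sub>R b \<in> ?U" using r b nonzero_Basis[OF b] by (auto simp: subset_iff)
    then show ?thesis using that by blast
  qed
  define k where "k = w x0 powr (- a - 1) * grad2 w x0"
  have ck: "Cinf ?U (\<lambda>x. w x powr (- a - 1) * grad2 w x)"
    by (intro Cinf_mult Cinf_comp_powr Cinf_grad2 U w pos)
  have k: "w x powr (- a - 1) * grad2 w x = k" if "x \<in> ?U" for x
    unfolding k_def
    by (rule zero_pd_constant[OF U cU ck _ that x0])
      (unfold a_def, rule tensor_zero_constant(1)[OF dim U _ w pos T])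
  have k0: "k \<ge> 0" by (simp add: k_def grad2_nonneg)
  define s where "s = a / n * k"
  have F: "\<exists>c. \<forall>x\<in>?U. w x powr (- a) * pd i w x + s * (x \<bullet> i) = c" if i: "i \<in> Basis" for i
  proof -
    have cF: "Cinf ?U (\<lambda>x. w x powr (- a) * pd i w x)"
      by (intro Cinf_mult Cinf_comp_powr Cinf_pd U w pos)
    have cG: "Cinf ?U (\<lambda>x. s * (x \<bullet> i))" by (intro Cinf_mult U Cinf_const Cinf_inner)
    have cFG: "Cinf ?U (\<lambda>x. w x powr (- a) * pd i w x + s * (x \<bullet> i))"
      by (rule Cinf_add[OF U cF cG])
    have pd0: "pd j (\<lambda>x. w x powr (- a) * pd i w x + s * (x \<bullet> i)) x = 0" if x: "x \<in> ?U" and j: "j \<in> Basis" for x j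
    proof -
      have "pd j (\<lambda>x. s * (x \<bullet> i)) x = s * (j \<bullet> i)"
        by (subst pd_cmult) (simp_all add: pd_bounded_linear[OF bounded_linear_inner_left]
            Cinf_differentiable[OF Cinf_inner(1)[of UNIV i]])
      moreover have "pd j (\<lambda>x. w x powr (- a) * pd i w x) x = (if i = j then - (a / n) * k else 0)"
        using tensor_zero_constant(2)[OF dim U x w pos T j i] k[OF x] unfolding a_def n_def by simp
      ultimately show ?thesis
        unfolding pd_add[OF Cinf_differentiable[OF cF x] Cinf_differentiable[OF cG x]]
        using i j by (simp add: s_def inner_Basis)
    qed
    have "w x powr (- a) * pd i w x + s * (x \<bullet> i) = w x0 powr (- a) * pd i w x0 + s * (x0 \<bullet> i)" if "x \<in> ?U" for x
      by (rule zero_pd_constant[OF U cU cFG pd0 that x0])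
    then show ?thesis by blast
  qed
  then obtain c where c: "\<And>i x. i \<in> Basis \<Longrightarrow> x \<in> ?U \<Longrightarrow> w x powr (- a) * pd i w x + s * (x \<bullet> i) = c i"
    by metis
  have main: "k * w x powr (1 - a) = (\<Sum>i\<in>Basis. (c i - s * (x \<bullet> i))\<^sup>2)" if x: "x \<in> ?U" for x
  proof -
    have w0: "w x > 0" by (rule pos[OF x])
    have "(\<Sum>i\<in>Basis. (c i - s * (x \<bullet> i))\<^sup>2) = (\<Sum>i\<in>Basis. (w x powr (- a))\<^sup>2 * (pd i w x)\<^sup>2)"
      using c[OF _ x] by (intro sum.cong refl) (simp add: power_mult_distrib[symmetric] eq_diff_eq[symmetric])
    also have "\<dots> = (w x powr (- a))\<^sup>2 * grad2 w x" by (simp add: grad2_def sum_distrib_left)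
    also have "(w x powr (- a))\<^sup>2 = w x powr (1 - a) * w x powr (- a - 1)"
      by (simp add: power2_eq_square powr_add[symmetric])
    finally show ?thesis using k[OF x] by (simp add: mult_ac)
  qed
  have lim0: "((\<lambda>x. k * w x powr (1 - a)) \<longlongrightarrow> 0) (at 0)"
  proof -
    have "((\<lambda>x. w x powr (1 - a)) \<longlongrightarrow> 0) (at 0)"
      using tendsto_neg_powr[of "1 - a" w "at 0"] a1 inf by simp
    then show ?thesis using tendsto_mult_right_zero by blast
  qed
  have ev: "\<forall>\<^sub>F x in at 0. x \<in> ?U"
    using O by (auto simp: eventually_at_topological intro!: exI[of _ \<Omega>])
  have "((\<lambda>x. \<Sum>i\<in>Basis. (c i - s * (x \<bullet> i))\<^sup>2) \<longlongrightarrow> (\<Sum>i\<in>Basis. (c i - s * (0 \<bullet> i))\<^sup>2)) (at 0)"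
    by (intro tendsto_intros)
  moreover have "((\<lambda>x. \<Sum>i\<in>Basis. (c i - s * (x \<bullet> i))\<^sup>2) \<longlongrightarrow> 0) (at 0)"
    by (rule Lim_transform_eventually[OF lim0]) (use ev main in \<open>auto elim: eventually_mono\<close>)
  ultimately have "(\<Sum>i\<in>Basis. (c i - s * (0 \<bullet> i))\<^sup>2) = 0"
    using tendsto_unique[of "at (0::'a)"] by fastforce
  then have c0: "c i = 0" if "i \<in> Basis" for i
    using that by (simp add: sum_nonneg_eq_0_iff)
  have main': "k * w x powr (1 - a) = s\<^sup>2 * (norm x)\<^sup>2" if x: "x \<in> ?U" for x
  proof -
    have "k * w x powr (1 - a) = (\<Sum>i\<in>Basis. s\<^sup>2 * ((x \<bullet> i) * (x \<bullet> i)))"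
      unfolding main[OF x] by (intro sum.cong refl) (simp add: c0 power2_eq_square)
    also have "\<dots> = s\<^sup>2 * (x \<bullet> x)" by (simp only: sum_distrib_left[symmetric] euclidean_inner[of x x, symmetric])
    finally show ?thesis by (simp add: power2_norm_eq_inner)
  qed
  \<comment> \<open>\<open>k = 0\<close> would mean a vanishing gradient and a constant
    \<open>w\<close>, against the blow-up at the origin.\<close>
  have "k \<noteq> 0"
  proof
    assume "k = 0"
    then have g0: "grad2 w x = 0" if "x \<in> ?U" for x
      using k[OF that] pos[OF that] by simp
    have "pd b w x = 0" if "x \<in> ?U" "b \<in> Basis" for x b
      using g0[OF that(1)] that(2) by (simp add: grad2_def sum_nonneg_eq_0_iff)
    then have const: "w x = w x0" if "x \<in> ?U" for x by (rule zero_pd_constant[OF U cU w _ that x0])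
    have "\<forall>\<^sub>F x in at 0. w x0 < w x" using inf by (simp add: filterlim_at_top_dense)
    then have "\<forall>\<^sub>F x in at (0::'a). False" using ev by eventually_elim (use const in auto)
    then show False by simp
  qed
  then have kp: "k > 0" using k0 by simp
  then have "s > 0" using a1 n by (simp add: s_def)
  then have "w x powr (1 - a) = s\<^sup>2 / k * (norm x)\<^sup>2" if "x \<in> ?U" for x
    using main'[OF that] kp by (simp add: field_simps)
  then show ?thesis using kp \<open>s > 0\<close> unfolding a_def by (intro exI[of _ "s\<^sup>2 / k"]) auto
qed

text \<open>The open ball and the exterior of the closed ball are connected and miss the frontier,
  so each lies in \<open>\<Omega>\<close> or is disjoint from it; the ball contains the point
  \<open>0\<close> of \<open>\<Omega>\<close>, and the exterior is unbounded.\<close>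

lemma ball_of_frontier_sphere:
  fixes \<Omega> :: "'a::euclidean_space set"
  assumes O: "open \<Omega>" "connected \<Omega>" "bounded \<Omega>" "0 \<in> \<Omega>" and dim: "2 \<le> DIM('a)" and r: "r > 0"
    and fr: "frontier \<Omega> \<subseteq> sphere 0 r"
  shows "\<Omega> = ball 0 r"
proof
  have "ball 0 r \<inter> frontier \<Omega> = {}" using fr by auto
  moreover have "connected (ball (0::'a) r)" by simp
  moreover have "0 \<in> ball 0 r \<inter> \<Omega>" using O(4) r by simp
  ultimately show "ball 0 r \<subseteq> \<Omega>" using connected_Int_frontier[of "ball 0 r" \<Omega>] by blast
  have "\<Omega> \<inter> - cball 0 r = {}"
  proof (rule ccontr)
    assume ne: "\<Omega> \<inter> - cball 0 r \<noteq> {}"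
    have "connected (- cball (0::'a) r)"
      by (rule connected_complement_bounded_convex) (use dim in auto)
    moreover have "- cball 0 r \<inter> frontier \<Omega> = {}" using fr by auto
    ultimately have "- cball 0 r \<subseteq> \<Omega>" using connected_Int_frontier[of "- cball 0 r" \<Omega>] ne by blast
    then have "bounded (- cball (0::'a) r)" using O(3) bounded_subset by blast
    then show False using bounded_cball[of "0::'a" r] not_bounded_UNIV
      by (metis Compl_partition bounded_Un)
  qed
  then have "\<Omega> \<subseteq> interior (cball 0 r)" by (intro interior_maximal O(1)) auto
  then show "\<Omega> \<subseteq> ball 0 r" by simp
qed

section \<open>The flux inequality\<close>

lemma laplacian_cutoff_bound:
  "\<exists>M>0. \<forall>\<epsilon>>0. \<forall>x::'a::euclidean_space. \<bar>laplacian (cutoff \<epsilon>) x\<bar> \<le> M / \<epsilon>\<^sup>2"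
proof -
  let ?f = "laplacian (cutoff 1 :: 'a \<Rightarrow> real)"
  have c: "Cinf UNIV ?f" by (rule Cinf_laplacian[OF open_UNIV Cinf_cutoff_fun])
  have "bounded (?f ` cball 0 1)"
    by (rule compact_imp_bounded[OF compact_continuous_image[OF continuous_on_subset[OF Cinf_continuous_on[OF c] subset_UNIV] compact_cball]])
  then obtain M0 where "\<forall>y\<in>?f ` cball 0 1. norm y \<le> M0" unfolding bounded_iff by blast
  then have M0: "\<bar>?f x\<bar> \<le> M0" if "x \<in> cball 0 1" for x using that by auto
  define M where "M = \<bar>M0\<bar> + 1"
  have M: "\<bar>?f x\<bar> \<le> M" for x
    using M0[of x] laplacian_cutoff_0[of 1 x] by (cases "norm x \<le> 1") (auto simp: M_def)
  have "\<bar>laplacian (cutoff \<epsilon>) x\<bar> \<le> M / \<epsilon>\<^sup>2" if \<epsilon>: "0 < \<epsilon>" for \<epsilon> and x :: 'a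
  proof -
    have fe: "cutoff \<epsilon> = (\<lambda>x::'a. cutoff 1 ((1 / \<epsilon>) *\<^sub>R x + 0))"
      by (rule ext) (simp add: cutoff_def bump_def power2_eq_square)
    have "laplacian (cutoff \<epsilon>) x = (1 / \<epsilon>)\<^sup>2 * ?f ((1 / \<epsilon>) *\<^sub>R x + 0)"
      by (subst fe) (rule laplacian_affine[OF Cinf_cutoff_fun])
    also have "\<bar>\<dots>\<bar> \<le> (1 / \<epsilon>)\<^sup>2 * M" unfolding abs_mult using M by (simp add: mult_left_mono)
    finally show ?thesis by (simp add: power_divide)
  qed
  then show ?thesis by (intro exI[of _ M]) (auto simp: M_def)
qed

text \<open>Green's formula bounds the integral of \<open>cutoff * laplacian W\<close> by that of
  \<open>W * laplacian cutoff\<close>. The latter lives where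
  \<open>\<epsilon>/2 \<le> |x| \<le> \<epsilon>\<close>; there \<open>laplacian cutoff\<close> is
  of order \<open>\<epsilon>^(-2)\<close>, the volume of order \<open>\<epsilon>^n\<close>, and
  \<open>W\<close> is \<open>o(\<epsilon>^(2 - n))\<close>. In the limit the nonnegative
  \<open>laplacian W\<close> has zero integral over a ball around \<open>x0\<close>.\<close>

lemma (in smooth_domain) subharmonic_flux:
  assumes V: "open V" "closure \<Omega> \<subseteq> V" and W: "Cinf (V - {0}) W" and zero: "0 \<in> \<Omega>"
    and sub: "\<And>x. x \<in> \<Omega> \<Longrightarrow> x \<noteq> 0 \<Longrightarrow> 0 \<le> laplacian W x"
    and lim: "((\<lambda>x. W x * norm x powr (real DIM('a) - 2)) \<longlongrightarrow> 0) (at 0)"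
    and flux: "SI (\<lambda>x. pd (\<nu> x) W x) \<le> 0" and x0: "x0 \<in> \<Omega>" "x0 \<noteq> 0"
  shows "laplacian W x0 = 0"
proof -
  let ?n = "real DIM('a)"
  have oV: "open (V - {0})" using V(1) by (simp add: open_delete)
  have cl: "Cinf (V - {0}) (laplacian W)" by (rule Cinf_laplacian[OF oV W])
  obtain M where M: "M > 0" "\<And>\<epsilon> x. 0 < \<epsilon> \<Longrightarrow> \<bar>laplacian (cutoff \<epsilon>) (x::'a)\<bar> \<le> M / \<epsilon>\<^sup>2"
    using laplacian_cutoff_bound[where 'a='a] by blast
  have "open (\<Omega> - {0})" using open_\<Omega> by (simp add: open_delete)
  then obtain \<delta> where \<delta>: "\<delta> > 0" "cball x0 \<delta> \<subseteq> \<Omega> - {0}" using x0 open_contains_cball by blast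
  have \<delta>V: "cball x0 \<delta> \<subseteq> V - {0}" using \<delta>(2) V(2) closure_subset[of \<Omega>] by blast
  have "0 \<notin> cball x0 \<delta>" using \<delta>(2) by blast
  then have x\<delta>: "\<delta> < norm x0" by simp
  obtain \<rho> where \<rho>: "\<rho> > 0" "cball 0 \<rho> \<subseteq> \<Omega>" using open_\<Omega> zero open_contains_cball by blast
  let ?g = "\<lambda>x. indicator (cball x0 \<delta>) x *\<^sub>R laplacian W x"
  have ig: "integrable lborel ?g"
    using borel_integrable_compact[OF compact_cball, of x0 \<delta> "laplacian W"]
      continuous_on_subset[OF Cinf_continuous_on[OF cl] \<delta>V]
    by (simp add: indicator_scaleR_eq_if)
  have gnn: "0 \<le> ?g x" for x
  proof (cases "x \<in> cball x0 \<delta>")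
    case True
    then have "x \<in> \<Omega> - {0}" using \<delta>(2) by blast
    then show ?thesis using sub[of x] by simp
  qed simp
  \<comment> \<open>Collects the constants of the estimate on the annulus;
    \<open>2 powr (?n - 2)\<close> comes from evaluating \<open>|x|^(2 - n)\<close> at the inner
    radius \<open>\<epsilon>/2\<close>.\<close>
  define K where "K = M * unit_ball_vol ?n * 2 powr (?n - 2) + 1"
  have K: "K > 0" using M(1) unit_ball_vol_nonneg[of ?n] by (auto simp: K_def intro!: add_nonneg_pos mult_nonneg_nonneg)
  have "(\<integral>x. ?g x \<partial>lborel) \<le> 0 + e" if e: "e > 0" for e
  proof -
    define e' where "e' = e / K"
    have e': "e' > 0" "e' * K = e" using e K by (auto simp: e'_def)
    have "\<forall>\<^sub>F x in at 0. dist (W x * norm x powr (?n - 2)) 0 < e'" using lim e'(1) by (rule tendstoD)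
    then obtain d where d: "d > 0" "\<And>x. x \<noteq> 0 \<Longrightarrow> dist x 0 < d \<Longrightarrow> dist (W x * norm x powr (?n - 2)) 0 < e'"
      unfolding eventually_at by auto
    \<comment> \<open>The last bound keeps the cutoff equal to one on the ball around
      \<open>x0\<close>.\<close>
    define \<epsilon> where "\<epsilon> = min \<rho> (min (d / 2) (norm x0 - \<delta>))"
    have \<epsilon>: "0 < \<epsilon>" "\<epsilon> \<le> \<rho>" "\<epsilon> < d" "\<epsilon> \<le> norm x0 - \<delta>"
      using \<rho> d x\<delta> by (auto simp: \<epsilon>_def min_def)
    have \<epsilon>\<Omega>: "cball 0 \<epsilon> \<subseteq> \<Omega>" using \<epsilon>(2) \<rho>(2) by auto
    let ?z = "cutoff \<epsilon> :: 'a \<Rightarrow> real"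
    have oB: "open (ball (0::'a) (\<epsilon> / 2))" by simp
    have VB: "V \<subseteq> (V - {0}) \<union> ball 0 (\<epsilon> / 2)" using \<epsilon>(1) by auto
    have z0: "?z y = 0" "laplacian ?z y = 0" if "y \<in> ball 0 (\<epsilon> / 2)" for y
      using that \<epsilon>(1) by (auto intro!: cutoff_eq_0 laplacian_cutoff_0)
    have c1: "Cinf V (\<lambda>x. ?z x * laplacian W x)"
    proof (rule Cinf_subset[OF Cinf_Un[OF oV oB] VB])
      show "Cinf (V - {0}) (\<lambda>x. ?z x * laplacian W x)"
        by (rule Cinf_mult[OF oV Cinf_subset[OF Cinf_cutoff_fun subset_UNIV] cl])
      show "Cinf (ball 0 (\<epsilon> / 2)) (\<lambda>x. ?z x * laplacian W x)"
        by (rule Cinf_cong[OF oB _ Cinf_const[of _ 0]]) (simp add: z0)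
    qed
    have c2: "Cinf V (\<lambda>x. W x * laplacian ?z x)"
    proof (rule Cinf_subset[OF Cinf_Un[OF oV oB] VB])
      show "Cinf (V - {0}) (\<lambda>x. W x * laplacian ?z x)"
        by (rule Cinf_mult[OF oV W Cinf_subset[OF Cinf_laplacian[OF open_UNIV Cinf_cutoff_fun] subset_UNIV]])
      show "Cinf (ball 0 (\<epsilon> / 2)) (\<lambda>x. W x * laplacian ?z x)"
        by (rule Cinf_cong[OF oB _ Cinf_const[of _ 0]]) (simp add: z0)
    qed
    note i1 = \<Omega>_integrable[OF V(2) Cinf_continuous_on[OF c1]]
    note i2 = \<Omega>_integrable[OF V(2) Cinf_continuous_on[OF c2]]
    have "surface_const TYPE('a) * (LINT x:\<Omega>|lborel. ?z x * laplacian W x - W x * laplacian ?z x) \<le> 0"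
      using green[OF V W \<epsilon>(1) \<epsilon>\<Omega>] flux by simp
    then have "(LINT x:\<Omega>|lborel. ?z x * laplacian W x - W x * laplacian ?z x) \<le> 0"
      using surface_const_pos[OF dim] by (simp add: mult_le_0_iff)
    then have le1: "(LINT x:\<Omega>|lborel. ?z x * laplacian W x) \<le> (LINT x:\<Omega>|lborel. W x * laplacian ?z x)"
      using set_integral_diff(2)[OF i1 i2] by simp
    have "(\<integral>x. ?g x \<partial>lborel) \<le> (LINT x:\<Omega>|lborel. ?z x * laplacian W x)"
      unfolding set_lebesgue_integral_def
    proof (rule integral_mono[OF ig i1[unfolded set_integrable_def]])
      fix x
      show "?g x \<le> indicator \<Omega> x *\<^sub>R (?z x * laplacian W x)"
      proof (cases "x \<in> cball x0 \<delta>")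
        case True
        then have "norm x0 - norm x \<le> \<delta>" using norm_triangle_ineq2[of x0 x] by (simp add: dist_norm)
        then have "?z x = 1" using \<epsilon> by (intro cutoff_eq_1) auto
        then show ?thesis using True \<delta>(2) by auto
      next
        case False
        have "0 \<le> ?z x * laplacian W x" if "x \<in> \<Omega>"
        proof (cases "x = 0")
          case True
          then show ?thesis using cutoff_eq_0[OF \<epsilon>(1), of x] \<epsilon>(1) by simp
        next
          case False
          then show ?thesis using sub[OF that] cutoff_bounds by (intro mult_nonneg_nonneg)
        qed
        then show ?thesis using False by (simp add: indicator_def)
      qed
    qed
    also note le1
    also have "(LINT x:\<Omega>|lborel. W x * laplacian ?z x)
        \<le> (\<integral>x. (e' * (\<epsilon> / 2) powr (2 - ?n) * (M / \<epsilon>\<^sup>2)) * indicator (cball (0::'a) \<epsilon>) x \<partial>lborel)"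
      unfolding set_lebesgue_integral_def
    proof (rule integral_mono)
      show "integrable lborel (\<lambda>x. indicator \<Omega> x *\<^sub>R (W x * laplacian ?z x))"
        using i2 by (simp add: set_integrable_def)
      show "integrable lborel (\<lambda>x::'a. (e' * (\<epsilon> / 2) powr (2 - ?n) * (M / \<epsilon>\<^sup>2)) * indicator (cball 0 \<epsilon>) x)"
        using emeasure_lborel_cball_finite[of "0::'a" \<epsilon>] by (intro integrable_mult_right integrable_real_indicator) auto
      fix x
      let ?c = "e' * (\<epsilon> / 2) powr (2 - ?n) * (M / \<epsilon>\<^sup>2)"
      have c0: "0 \<le> ?c" using e'(1) M(1) by simp
      show "indicator \<Omega> x *\<^sub>R (W x * laplacian ?z x) \<le> ?c * indicator (cball 0 \<epsilon>) x"
      proof (cases "norm x < \<epsilon> / 2 \<or> \<epsilon> < norm x")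
        case True
        then show ?thesis using laplacian_cutoff_0[OF \<epsilon>(1), of x] c0 by (simp add: indicator_def)
      next
        case False
        then have nx: "\<epsilon> / 2 \<le> norm x" "norm x \<le> \<epsilon>" "x \<noteq> 0" using \<epsilon>(1) by auto
        have "\<bar>W x\<bar> * norm x powr (?n - 2) \<le> e'"
          using d(2)[of x] nx \<epsilon>(3) by (simp add: abs_mult)
        then have "\<bar>W x\<bar> * norm x powr (?n - 2) * norm x powr (2 - ?n) \<le> e' * norm x powr (2 - ?n)"
          by (rule mult_right_mono) simp
        then have "\<bar>W x\<bar> \<le> e' * norm x powr (2 - ?n)"
          using nx(3) by (simp add: mult.assoc powr_add[symmetric])
        also have "norm x powr (2 - ?n) \<le> (\<epsilon> / 2) powr (2 - ?n)"
          using dim nx(1) \<epsilon>(1) by (intro powr_mono2') auto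
        finally have "\<bar>W x\<bar> \<le> e' * (\<epsilon> / 2) powr (2 - ?n)" using e'(1) by (simp add: mult_left_mono)
        then have "\<bar>W x\<bar> * \<bar>laplacian ?z x\<bar> \<le> ?c"
          using M(2)[OF \<epsilon>(1), of x] e'(1) by (intro mult_mono) auto
        then have "W x * laplacian ?z x \<le> ?c" using abs_ge_self[of "W x * laplacian ?z x"] by (simp add: abs_mult)
        then show ?thesis using nx(2) \<epsilon>\<Omega> by (auto simp: indicator_def subset_iff)
      qed
    qed
    also have "\<dots> = e' * (\<epsilon> / 2) powr (2 - ?n) * (M / \<epsilon>\<^sup>2) * (unit_ball_vol ?n * \<epsilon> ^ DIM('a))"
      using \<epsilon>(1) by (simp add: measure_def emeasure_cball)
    also have "\<dots> = e' * (M * unit_ball_vol ?n * 2 powr (?n - 2)) * (\<epsilon> powr (2 - ?n) * \<epsilon> powr ?n / \<epsilon>\<^sup>2)"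
    proof -
      have "(\<epsilon> / 2) powr (2 - ?n) = \<epsilon> powr (2 - ?n) * 2 powr (?n - 2)"
        using \<epsilon>(1) powr_minus_divide[of 2 "2 - ?n"] by (simp add: powr_divide)
      moreover have "\<epsilon> ^ DIM('a) = \<epsilon> powr ?n" using \<epsilon>(1) by (simp only: powr_realpow)
      ultimately show ?thesis by (simp only: times_divide_eq_right times_divide_eq_left mult_ac)
    qed
    also have "\<epsilon> powr (2 - ?n) * \<epsilon> powr ?n / \<epsilon>\<^sup>2 = 1"
      using \<epsilon>(1) by (simp add: powr_add[symmetric])
    also have "e' * (M * unit_ball_vol ?n * 2 powr (?n - 2)) * 1 \<le> e' * K"
      using e'(1) by (simp add: K_def)
    finally show ?thesis using e'(2) by simp
  qed
  then have "(\<integral>x. ?g x \<partial>lborel) \<le> 0" by (rule field_le_epsilon)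
  moreover have "0 \<le> (\<integral>x. ?g x \<partial>lborel)"
    by (rule integral_nonneg_AE) (rule AE_I2, rule gnn)
  ultimately have "(\<integral>x. ?g x \<partial>lborel) = 0" by linarith
  then have "AE x in lborel. ?g x = 0"
    by (rule integral_nonneg_eq_0_iff_AE[OF ig AE_I2[OF gnn], THEN iffD1])
  then have ae: "AE y in lborel. y \<in> ball x0 \<delta> \<longrightarrow> laplacian W y = 0"
    by eventually_elim (auto simp: indicator_def split: if_splits)
  show ?thesis
    by (rule AE_zero_continuous[OF open_ball continuous_on_subset[OF Cinf_continuous_on[OF cl]] ae])
      (rule order_trans[OF ball_subset_cball \<delta>V] centre_in_ball[THEN iffD2, OF \<delta>(1)])+
qed

section \<open>Comparison with the boundary value\<close>

lemma interior_min_second_derivative: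
  fixes f :: "'a::euclidean_space \<Rightarrow> real"
  assumes U: "open U" "z \<in> U" and f: "Cinf U f" and min: "\<And>y. y \<in> U \<Longrightarrow> f z \<le> f y"
  shows "0 \<le> pd b (pd b f) z"
proof (rule ccontr)
  assume neg: "\<not> ?thesis"
  have "((\<lambda>t. z + t *\<^sub>R b) \<longlongrightarrow> z + 0 *\<^sub>R b) (at 0)" by (intro tendsto_intros)
  then have "\<forall>\<^sub>F t in at 0. z + t *\<^sub>R b \<in> U" using U by (auto elim: topological_tendstoD)
  then obtain r where r: "r > 0" "\<And>t. t \<noteq> 0 \<Longrightarrow> \<bar>t\<bar> < r \<Longrightarrow> z + t *\<^sub>R b \<in> U"
    unfolding eventually_at by (auto simp: dist_real_def)
  have rU: "z + t *\<^sub>R b \<in> U" if "\<bar>t\<bar> < r" for t using r(2)[of t] U(2) that by (cases "t = 0") auto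
  let ?g = "\<lambda>t. f (z + t *\<^sub>R b)"
  have d1: "(?g has_real_derivative pd b f (z + t *\<^sub>R b)) (at t)" if "\<bar>t\<bar> < r" for t
    by (rule DERIV_line[OF Cinf_differentiable[OF f rU[OF that]]])
  have d2: "((\<lambda>t. pd b f (z + t *\<^sub>R b)) has_real_derivative pd b (pd b f) (z + t *\<^sub>R b)) (at t)" if "\<bar>t\<bar> < r" for t
    by (rule DERIV_line[OF Cinf_differentiable[OF Cinf_pd[OF f] rU[OF that]]])
  have "pd b f (z + 0 *\<^sub>R b) = 0"
    using DERIV_local_min[OF d1[of 0] r(1)] r(1) min rU by auto
  moreover obtain d where d: "d > 0" "\<And>h. h > 0 \<Longrightarrow> h < d \<Longrightarrow> pd b f (z + (0 + h) *\<^sub>R b) < pd b f (z + 0 *\<^sub>R b)"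
    using DERIV_neg_dec_right[OF d2[of 0]] r(1) neg by auto
  ultimately have d': "pd b f (z + h *\<^sub>R b) < 0" if "h > 0" "h < d" for h using that by simp
  define t where "t = min r d / 2"
  have t: "0 < t" "t < r" "t < d" using r d by (auto simp: t_def)
  have "\<exists>s. 0 < s \<and> s < t \<and> ?g t - ?g 0 = (t - 0) * pd b f (z + s *\<^sub>R b)"
    by (rule MVT2[OF t(1)]) (use d1 t in auto)
  then obtain s where s: "0 < s" "s < t" "?g t - ?g 0 = t * pd b f (z + s *\<^sub>R b)" by auto
  have "t * pd b f (z + s *\<^sub>R b) < 0" using t s d'[of s] by (simp add: mult_pos_neg)
  then have "f (z + t *\<^sub>R b) < f z" using s(3) by simp
  moreover have "f z \<le> f (z + t *\<^sub>R b)" using t by (intro min rU) auto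
  ultimately show False by simp
qed

lemma (in smooth_domain) inward_normal_direction:
  assumes p: "p \<in> frontier \<Omega>" and v: "v \<bullet> \<nu> p < 0"
  shows "\<forall>\<^sub>F t in at_right 0. p + t *\<^sub>R v \<in> \<Omega>"
proof -
  obtain U \<phi> where U: "p \<in> U" "local_defining_function \<Omega> U \<phi>" using chart_at[OF p] .
  note l = local_defining_functionD[OF U(2)]
  have "pd v \<phi> p = norm (gradient \<phi> (at p)) * (v \<bullet> \<nu> p)"
    using outer_unit_normal_eq[OF U(2,1) p] gradient_inner[OF l(6)[OF U(1)], of v] l(3)[OF U(1)]
    by (simp add: inner_commute)
  then have "pd v \<phi> p < 0" using v l(3)[OF U(1)] by (simp add: mult_pos_neg)
  then show ?thesis by (rule inward_direction[OF U(2,1) p])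
qed

section \<open>The solution with constant boundary values: pole, minimum principle, boundary
  gradient\<close>

locale green_function = green_problem \<Omega> u V m for \<Omega> :: "'a::euclidean_space set" and u V m +
  fixes c :: real
  assumes conn: "connected \<Omega>" and m_pos: "m > 0" and bc: "\<And>x. x \<in> frontier \<Omega> \<Longrightarrow> u x = c"
begin

definition A :: real where "A = m / kap"

lemma A_pos: "A > 0"
  using m_pos kap_pos by (simp add: A_def)

lemma n3: "real DIM('a) \<ge> 3"
  using dim3 by simp

lemma norm_powr_tendsto_0: "a > 0 \<Longrightarrow> ((\<lambda>x::'a. norm x powr a) \<longlongrightarrow> 0) (at 0)"
proof -
  assume a: "a > 0"
  have "((\<lambda>x::'a. norm x powr a) \<longlongrightarrow> norm (0::'a) powr a) (at 0)"
    by (rule tendsto_powr') (use a tendsto_norm_zero[OF tendsto_ident_at[of "0::'a" UNIV]] in auto)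
  then show ?thesis by simp
qed

lemma u_asymptotics:
  "((\<lambda>x. u x * norm x powr (real DIM('a) - 2)) \<longlongrightarrow> A) (at 0)"
  "((\<lambda>x. norm (gradient u (at x)) * norm x powr (real DIM('a) - 1)) \<longlongrightarrow> (real DIM('a) - 2) * A) (at 0)"
proof -
  obtain R L where R: "R > 0" "L > 0" "cball 0 R \<subseteq> \<Omega>"
    and b: "\<And>x. x \<noteq> 0 \<Longrightarrow> norm x < R \<Longrightarrow> \<bar>u x - A * gam x\<bar> \<le> L"
    "\<And>x v. x \<noteq> 0 \<Longrightarrow> norm x < R \<Longrightarrow> \<bar>pd v u x - A * pd v gam x\<bar> \<le> L * norm v"
    using pole_asymptotics unfolding A_def by blast
  have ev: "\<forall>\<^sub>F x::'a in at 0. x \<noteq> 0 \<and> norm x < R"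
    using R(1) by (auto simp: eventually_at intro!: exI[of _ R])
  have "((\<lambda>x. u x * norm x powr (real DIM('a) - 2) - A) \<longlongrightarrow> 0) (at 0)"
  proof (rule Lim_null_comparison)
    show "((\<lambda>x::'a. L * norm x powr (real DIM('a) - 2)) \<longlongrightarrow> 0) (at 0)"
      using tendsto_mult_right_zero[OF norm_powr_tendsto_0[of "real DIM('a) - 2"], of L] n3 by simp
    show "\<forall>\<^sub>F x in at 0. norm (u x * norm x powr (real DIM('a) - 2) - A) \<le> L * norm x powr (real DIM('a) - 2)"
      using ev
    proof eventually_elim
      fix x :: 'a assume x: "x \<noteq> 0 \<and> norm x < R"
      have "gam x * norm x powr (real DIM('a) - 2) = 1" using x by (simp add: gam_eq powr_add[symmetric])
      then have "u x * norm x powr (real DIM('a) - 2) - A = (u x - A * gam x) * norm x powr (real DIM('a) - 2)"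
        by (simp add: left_diff_distrib mult.assoc)
      then show "norm (u x * norm x powr (real DIM('a) - 2) - A) \<le> L * norm x powr (real DIM('a) - 2)"
        using b(1) x by (simp add: abs_mult mult_right_mono)
    qed
  qed
  then show "((\<lambda>x. u x * norm x powr (real DIM('a) - 2)) \<longlongrightarrow> A) (at 0)" by (simp add: LIM_zero_iff)
  have "((\<lambda>x. norm (gradient u (at x)) * norm x powr (real DIM('a) - 1) - (real DIM('a) - 2) * A) \<longlongrightarrow> 0) (at 0)"
  proof (rule Lim_null_comparison)
    show "((\<lambda>x::'a. L * norm x powr (real DIM('a) - 1)) \<longlongrightarrow> 0) (at 0)"
      using tendsto_mult_right_zero[OF norm_powr_tendsto_0[of "real DIM('a) - 1"], of L] n3 by simp
    show "\<forall>\<^sub>F x in at 0. norm (norm (gradient u (at x)) * norm x powr (real DIM('a) - 1) - (real DIM('a) - 2) * A) \<le> L * norm x powr (real DIM('a) - 1)"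
      using ev
    proof eventually_elim
      fix x :: 'a assume x: "x \<noteq> 0 \<and> norm x < R"
      have xV: "x \<in> V - {0}" using x R by (intro \<Omega>V(2)) auto
      have du: "u differentiable at x" by (rule Cinf_differentiable[OF u xV])
      define G where "G = (A * (2 - real DIM('a)) * norm x powr (- real DIM('a))) *\<^sub>R x"
      have pg: "A * pd v gam x = G \<bullet> v" for v using x by (simp add: pd_gam G_def)
      have "norm (gradient u (at x) - G) \<le> L"
      proof (cases "gradient u (at x) - G = 0")
        case False
        \<comment> \<open>The bound on directional derivatives is used in the direction of the error
          itself, which yields a bound for its norm.\<close>
        let ?v = "gradient u (at x) - G"
        have "norm ?v * norm ?v = ?v \<bullet> ?v" by (simp add: power2_norm_eq_inner[symmetric] power2_eq_square)
        also have "\<dots> = pd ?v u x - A * pd ?v gam x"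
          by (simp only: pg gradient_inner[OF du, symmetric] inner_diff_left)
        also have "\<dots> \<le> L * norm ?v" using b(2)[of x ?v] x by auto
        finally show ?thesis using False by simp
      qed (use R in simp)
      then have "\<bar>norm (gradient u (at x)) - norm G\<bar> \<le> L"
        using norm_triangle_ineq3[of "gradient u (at x)" G] by linarith
      then have "\<bar>norm (gradient u (at x)) - norm G\<bar> * norm x powr (real DIM('a) - 1) \<le> L * norm x powr (real DIM('a) - 1)"
        by (rule mult_right_mono) simp
      moreover have "norm G * norm x powr (real DIM('a) - 1) = (real DIM('a) - 2) * A"
      proof -
        have "norm G = A * (real DIM('a) - 2) * norm x powr (- real DIM('a)) * norm x"
          using A_pos n3 by (simp add: G_def abs_mult)
        moreover have "norm x powr (- real DIM('a)) * norm x * norm x powr (real DIM('a) - 1) = 1"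
        proof -
          have "norm x powr (- real DIM('a)) * norm x = norm x powr (1 - real DIM('a))"
            using x powr_add[of "norm x" "-real DIM('a)" 1] by simp
          then show ?thesis using x powr_add[of "norm x" "1 - real DIM('a)" "real DIM('a) - 1"] by simp
        qed
        ultimately show ?thesis by (simp add: mult_ac)
      qed
      ultimately show "norm (norm (gradient u (at x)) * norm x powr (real DIM('a) - 1) - (real DIM('a) - 2) * A) \<le> L * norm x powr (real DIM('a) - 1)"
        by (metis abs_mult abs_of_nonneg left_diff_distrib powr_ge_zero real_norm_def)
    qed
  qed
  then show "((\<lambda>x. norm (gradient u (at x)) * norm x powr (real DIM('a) - 1)) \<longlongrightarrow> (real DIM('a) - 2) * A) (at 0)"
    by (simp add: LIM_zero_iff)
qed

lemma shift_asymptotics: "((\<lambda>x. (u x + s) * norm x powr (real DIM('a) - 2)) \<longlongrightarrow> A) (at 0)"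
proof -
  have "((\<lambda>x. u x * norm x powr (real DIM('a) - 2) + s * norm x powr (real DIM('a) - 2)) \<longlongrightarrow> A + s * 0) (at 0)"
    using n3 by (intro tendsto_add u_asymptotics tendsto_mult tendsto_const norm_powr_tendsto_0) auto
  then show ?thesis by (simp add: distrib_right)
qed

lemma u_at_top: "filterlim (\<lambda>x. u x + s) at_top (at 0)"
proof -
  have "filterlim (\<lambda>x::'a. inverse (norm x powr (real DIM('a) - 2))) at_top (at 0)"
    by (rule filterlim_inverse_at_top)
      (use n3 norm_powr_tendsto_0[of "real DIM('a) - 2"] in \<open>auto simp: eventually_at_filter\<close>)
  then have "filterlim (\<lambda>x. ((u x + s) * norm x powr (real DIM('a) - 2)) * inverse (norm x powr (real DIM('a) - 2))) at_top (at 0)"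
    by (rule filterlim_tendsto_pos_mult_at_top[OF shift_asymptotics A_pos])
  then show ?thesis
    by (rule filterlim_mono_eventually) (auto simp: eventually_at_filter)
qed

text \<open>A minimum principle for a function that blows up at the pole. Subtracting
  \<open>\<delta> |y|^2\<close> makes \<open>u\<close> strictly superharmonic, so the minimum over
  the closure without a small ball cannot be interior; on the sphere bounding the removed ball
  \<open>u\<close> exceeds \<open>c\<close>.\<close>

lemma lower_bound:
  assumes x: "x \<in> \<Omega>" "x \<noteq> 0"
  shows "c \<le> u x"
proof (rule field_le_epsilon)
  fix e :: real assume e: "e > 0"
  obtain D where D: "D > 0" "\<And>y. y \<in> closure \<Omega> \<Longrightarrow> norm y \<le> D"
    using compact_imp_bounded[OF compact_closure] unfolding bounded_pos by blast
  \<comment> \<open>With this \<open>\<delta>\<close> the perturbation is at most \<open>e\<close>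
    on the closure.\<close>
  define \<delta> where "\<delta> = e / D\<^sup>2"
  have \<delta>: "\<delta> > 0" "\<delta> * D\<^sup>2 = e" using e D by (auto simp: \<delta>_def)
  have "\<forall>\<^sub>F y in at 0. c < u y + 0" using u_at_top[of 0] by (simp add: filterlim_at_top_dense)
  then obtain d where d: "d > 0" "\<And>y. y \<noteq> 0 \<Longrightarrow> dist y 0 < d \<Longrightarrow> c < u y"
    unfolding eventually_at by auto
  define \<epsilon> where "\<epsilon> = min d (norm x) / 2"
  have \<epsilon>: "\<epsilon> > 0" "\<epsilon> < d" "\<epsilon> < norm x" using d x by (auto simp: \<epsilon>_def min_def)
  define K where "K = closure \<Omega> - ball 0 \<epsilon>"
  have K: "compact K" "x \<in> K" "K \<subseteq> V - {0}"
  proof -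
    show "compact K" unfolding K_def by (intro compact_diff compact_closure open_ball)
    show "x \<in> K" using x closure_subset[of \<Omega>] \<epsilon> by (auto simp: K_def)
    show "K \<subseteq> V - {0}" using \<Omega>V(1) \<epsilon>(1) unfolding K_def by force
  qed
  let ?f = "\<lambda>y. u y - \<delta> * (y \<bullet> y)"
  have cf: "Cinf (V - {0}) ?f"
    by (intro Cinf_diff oV u Cinf_mult Cinf_const Cinf_inner_self)
  obtain z where z: "z \<in> K" "\<And>y. y \<in> K \<Longrightarrow> ?f z \<le> ?f y"
    using continuous_attains_inf[OF K(1) _ continuous_on_subset[OF Cinf_continuous_on[OF cf] K(3)]] K(2) by blast
  have "c \<le> u z"
  proof (rule ccontr)
    assume zc: "\<not> c \<le> u z"
    have z0: "z \<noteq> 0" "z \<in> closure \<Omega>" "\<epsilon> \<le> norm z" using z(1) \<epsilon>(1) by (auto simp: K_def)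
    have "z \<notin> frontier \<Omega>" using bc[of z] zc by auto
    then have z\<Omega>: "z \<in> \<Omega>" using z0(2) open_\<Omega> by (simp add: frontier_def interior_open)
    have "\<epsilon> \<noteq> norm z" using d(2)[of z] zc \<epsilon>(2) z0(1) by auto
    then have nz: "\<epsilon> < norm z" using z0(3) by simp
    define U where "U = \<Omega> - cball 0 \<epsilon>"
    have U: "open U" "z \<in> U" "U \<subseteq> K" "U \<subseteq> V - {0}"
      using z\<Omega> nz open_\<Omega> closure_subset[of \<Omega>] K(3) by (auto simp: U_def K_def)
    have cU: "Cinf U ?f" by (rule Cinf_subset[OF cf U(4)])
    have "0 \<le> pd b (pd b ?f) z" for b
      by (rule interior_min_second_derivative[OF U(1,2) cU]) (use z(2) U(3) in blast)
    then have "0 \<le> laplacian ?f z" by (simp add: laplacian_def sum_nonneg)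
    also have "laplacian ?f z = laplacian u z - laplacian (\<lambda>y. \<delta> * (y \<bullet> y)) z"
      by (rule laplacian_diff[OF U(1) Cinf_subset[OF u U(4)] _ U(2)])
        (intro Cinf_mult U Cinf_const Cinf_inner_self)
    also have "laplacian (\<lambda>y. \<delta> * (y \<bullet> y)) z = \<delta> * laplacian (\<lambda>y. y \<bullet> y) z"
      by (rule laplacian_cmult[OF open_UNIV Cinf_inner_self]) auto
    also have "laplacian (\<lambda>y. y \<bullet> y) z = 2 * real DIM('a)"
    proof -
      have "pd b (pd b (\<lambda>y. y \<bullet> y)) z = 2 * (b \<bullet> b)" for b :: 'a
      proof -
        have "pd b (\<lambda>y. y \<bullet> y) = (\<lambda>y. 2 * (y \<bullet> b))" by (rule ext) (rule pd_inner_self)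
        then show ?thesis
          by (simp add: pd_cmult pd_bounded_linear[OF bounded_linear_inner_left]
              Cinf_differentiable[OF Cinf_inner(1)[of UNIV b]])
      qed
      then show ?thesis by (simp add: laplacian_def)
    qed
    finally show False using harmonic[OF z\<Omega> z0(1)] mult_pos_pos[OF \<delta>(1), of "real DIM('a)"] by simp
  qed
  moreover have "?f z \<le> ?f x" by (rule z(2)[OF K(2)])
  moreover have "\<delta> * (z \<bullet> z) \<le> e"
  proof -
    have "norm z \<le> D" using z(1) by (intro D(2)) (simp add: K_def)
    then have "(norm z)\<^sup>2 \<le> D\<^sup>2" by (intro power_mono) auto
    then have "\<delta> * (norm z)\<^sup>2 \<le> \<delta> * D\<^sup>2" using \<delta>(1) by (intro mult_left_mono) auto
    then show ?thesis using \<delta>(2) by (simp add: power2_norm_eq_inner)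
  qed
  moreover have "0 \<le> \<delta> * (x \<bullet> x)" using \<delta>(1) by simp
  ultimately show "c \<le> u x + e" by linarith
qed

text \<open>A negative derivative would push \<open>u\<close> below its boundary value
  \<open>c\<close> at points of \<open>\<Omega>\<close>.\<close>

lemma inward_derivative:
  assumes p: "p \<in> frontier \<Omega>" and v: "v \<bullet> \<nu> p < 0"
  shows "0 \<le> pd v u p"
proof (rule ccontr)
  assume neg: "\<not> ?thesis"
  have e1: "\<forall>\<^sub>F t in at_right 0. p + t *\<^sub>R v \<in> \<Omega>" by (rule inward_normal_direction[OF p v])
  have pV: "p \<in> V - {0}" by (rule frontier_V(1)[OF p])
  have du: "u differentiable at p" by (rule Cinf_differentiable[OF u pV])
  have pd: "pd v (\<lambda>x. u x - c) p = pd v u p" by (simp add: pd_diff[OF du])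
  have "\<forall>\<^sub>F t in at_right 0. p + t *\<^sub>R v \<in> V - {0} \<and> u (p + t *\<^sub>R v) - c < 0"
    by (rule descent_direction[OF oV pV]) (use du bc[OF p] neg pd in auto)
  with e1 have "\<forall>\<^sub>F t in at_right (0::real). False"
    by eventually_elim (use lower_bound in force)
  then show False by simp
qed

text \<open>Derivatives in inward directions are nonnegative. A tangential \<open>v\<close> is a
  limit of the inward directions \<open>v - t \<nu>\<close>, so the gradient has a nonnegative
  product with every tangential vector, in particular with its own tangential part reversed, which
  is therefore zero. The gradient itself may still vanish.\<close>

lemma gradient_frontier:
  assumes p: "p \<in> frontier \<Omega>"
  shows "gradient u (at p) = - norm (gradient u (at p)) *\<^sub>R \<nu> p"
proof -
  have du: "u differentiable at p" by (rule Cinf_differentiable[OF u frontier_V(1)[OF p]])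
  let ?G = "gradient u (at p)"
  have nn: "\<nu> p \<bullet> \<nu> p = 1" using norm_normal[OF p] by (simp add: norm_eq_1)
  have pdG: "pd v u p = ?G \<bullet> v" for v by (rule gradient_inner[OF du, symmetric])
  have tang: "0 \<le> ?G \<bullet> v" if v: "v \<bullet> \<nu> p = 0" for v
  proof (rule field_le_epsilon)
    fix e :: real assume e: "e > 0"
    define t where "t = e / (\<bar>?G \<bullet> \<nu> p\<bar> + 1)"
    have t: "t > 0" using e by (simp add: t_def add_nonneg_pos)
    have "0 \<le> pd (v - t *\<^sub>R \<nu> p) u p"
      by (rule inward_derivative[OF p]) (use v t nn in \<open>simp add: inner_diff_left\<close>)
    then have "t * (?G \<bullet> \<nu> p) \<le> ?G \<bullet> v" by (simp add: pdG inner_diff_right)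
    moreover have "t * (\<bar>?G \<bullet> \<nu> p\<bar> + 1) = e"
      unfolding t_def by (simp add: add_nonneg_eq_0_iff)
    then have "\<bar>t * (?G \<bullet> \<nu> p)\<bar> \<le> e" using t by (simp add: abs_mult distrib_left)
    ultimately show "0 \<le> ?G \<bullet> v + e" by linarith
  qed
  define T where "T = ?G - (?G \<bullet> \<nu> p) *\<^sub>R \<nu> p"
  have Tn: "T \<bullet> \<nu> p = 0" using nn by (simp add: T_def inner_diff_left)
  have "0 \<le> ?G \<bullet> (- T)" by (rule tang) (simp add: Tn)
  moreover have "?G \<bullet> T = T \<bullet> T"
    using Tn by (simp add: T_def inner_diff_right inner_diff_left inner_commute)
  ultimately have "T \<bullet> T \<le> 0" by simp
  then have "T = 0" by (metis inner_gt_zero_iff not_le)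
  then have G: "?G = (?G \<bullet> \<nu> p) *\<^sub>R \<nu> p" by (simp add: T_def)
  have "0 \<le> pd (- \<nu> p) u p" by (rule inward_derivative[OF p]) (simp add: nn)
  then have "?G \<bullet> \<nu> p \<le> 0" by (simp add: pdG)
  moreover have "norm ?G = \<bar>?G \<bullet> \<nu> p\<bar>"
    using arg_cong[OF G, of norm] norm_normal[OF p] by simp
  ultimately have "?G \<bullet> \<nu> p = - norm ?G" by simp
  then show ?thesis using G by simp
qed

end

section \<open>Mean curvature of a level set\<close>

text \<open>The first-variation argument: a linear term dominated by a quadratic one vanishes. It is
  tested at \<open>t = a / s\<close> with a positive \<open>s\<close> at least
  \<open>b\<close>.\<close>

lemma quadratic_bound_imp_zero:
  fixes a b :: real
  assumes "\<And>t. 2 * t * a \<le> t\<^sup>2 * b"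
  shows "a = 0"
proof (rule ccontr)
  assume "a \<noteq> 0"
  define s where "s = \<bar>b\<bar> + 1"
  have s: "s > 0" "b \<le> s" by (auto simp: s_def)
  have "2 * (a / s) * a \<le> (a / s)\<^sup>2 * b" by (rule assms)
  also have "\<dots> \<le> (a / s)\<^sup>2 * s" using s by (intro mult_left_mono) auto
  finally have "a * a \<le> 0" using s by (simp add: power2_eq_square field_simps)
  then show False using \<open>a \<noteq> 0\<close> by (metis mult_eq_0_iff not_square_less_zero order_less_le)
qed

text \<open>A unit vector maximising \<open>S x \<bullet> x\<close> on \<open>T\<close> is an
  eigenvector, and the induction continues on its orthogonal complement in \<open>T\<close>.
  Symmetry is asked on \<open>T\<close> only, since the shape operator is determined only on the
  tangent space.\<close>

lemma spectral_basis:
  fixes S :: "'a::euclidean_space \<Rightarrow> 'a"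
  assumes S: "linear S" and "subspace T" "\<And>x. x \<in> T \<Longrightarrow> S x \<in> T"
    "\<And>x y. x \<in> T \<Longrightarrow> y \<in> T \<Longrightarrow> S x \<bullet> y = x \<bullet> S y"
  shows "\<exists>B \<kappa>. pairwise orthogonal B \<and> (\<forall>e\<in>B. norm e = 1) \<and> span B = T \<and> (\<forall>e\<in>B. S e = \<kappa> e *\<^sub>R e)"
  using assms(2-4)
proof (induction "dim T" arbitrary: T rule: less_induct)
  case less
  note T = less.prems(1) and inv = less.prems(2) and sym = less.prems(3)
  show ?case
  proof (cases "T = {0}")
    case True
    then show ?thesis by (intro exI[of _ "{}"]) auto
  next
    case False
    then obtain y where y: "y \<in> T" "y \<noteq> 0" using subspace_0[OF T] by blast
    let ?K = "T \<inter> sphere 0 1"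
    have K: "compact ?K" using closed_subspace[OF T] by (simp add: closed_Int_compact)
    have "y /\<^sub>R norm y \<in> ?K" using y T by (simp add: subspace_scale)
    then have ne: "?K \<noteq> {}" by blast
    have cont: "continuous_on ?K (\<lambda>x. S x \<bullet> x)"
      by (intro continuous_intros linear_continuous_on S[unfolded linear_conv_bounded_linear])
    obtain e where e: "e \<in> ?K" "\<And>x. x \<in> ?K \<Longrightarrow> S x \<bullet> x \<le> S e \<bullet> e"
      using continuous_attains_sup[OF K ne cont] by blast
    define l where "l = S e \<bullet> e"
    have eT: "e \<in> T" and ee: "e \<bullet> e = 1" using e(1) by (auto simp: norm_eq_1)
    have le: "S x \<bullet> x \<le> l * (x \<bullet> x)" if x: "x \<in> T" for x
    proof (cases "x = 0")
      case True
      then show ?thesis by (simp add: linear_0[OF S])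
    next
      case False
      have "x /\<^sub>R norm x \<in> ?K" using x False T by (simp add: subspace_scale)
      then have "S (x /\<^sub>R norm x) \<bullet> (x /\<^sub>R norm x) \<le> l" unfolding l_def by (rule e(2))
      then have "(S x \<bullet> x) / (norm x)\<^sup>2 \<le> l"
        by (simp add: linear_scale[OF S] power2_eq_square divide_inverse mult_ac)
      then show ?thesis using False by (simp add: pos_divide_le_eq power2_norm_eq_inner)
    qed
    have orth0: "S e \<bullet> v = 0" if v: "v \<in> T" "v \<bullet> e = 0" for v
    proof (rule quadratic_bound_imp_zero)
      fix t
      have ev: "e \<bullet> v = 0" "S v \<bullet> e = S e \<bullet> v" using v sym[OF v(1) eT] by (simp_all add: inner_commute)
      have "S (e + t *\<^sub>R v) \<bullet> (e + t *\<^sub>R v) \<le> l * ((e + t *\<^sub>R v) \<bullet> (e + t *\<^sub>R v))"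
        by (rule le) (intro subspace_add subspace_scale T eT v)
      then have "l + 2 * t * (S e \<bullet> v) + t\<^sup>2 * (S v \<bullet> v) \<le> l * (1 + t\<^sup>2 * (v \<bullet> v))"
        by (simp add: linear_add[OF S] linear_scale[OF S] inner_add_left inner_add_right ev v(2) ee
            l_def[symmetric] power2_eq_square algebra_simps)
      then show "2 * t * (S e \<bullet> v) \<le> t\<^sup>2 * (l * (v \<bullet> v) - S v \<bullet> v)" by (simp add: algebra_simps)
    qed
    have Se: "S e = l *\<^sub>R e"
    proof -
      let ?d = "S e - l *\<^sub>R e"
      have d: "?d \<in> T" "?d \<bullet> e = 0"
        using inv eT T ee by (simp_all add: subspace_diff subspace_scale inner_diff_left l_def)
      have "?d \<bullet> ?d = S e \<bullet> ?d - l * (e \<bullet> ?d)" by (simp only: inner_diff_left inner_scaleR_left)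
      also have "\<dots> = 0" using orth0[OF d] d(2) by (simp only: inner_commute[of e])
      finally show ?thesis by simp
    qed
    define T' where "T' = {v\<in>T. v \<bullet> e = 0}"
    have T': "subspace T'" unfolding T'_def subspace_def
      using T by (simp add: subspace_0 subspace_add subspace_scale inner_add_left)
    have "e \<notin> T'" using ee by (simp add: T'_def)
    then have "T' \<subset> T" using eT unfolding T'_def by blast
    then have dim: "dim T' < dim T" by (intro dim_psubset) (simp add: span_eq_iff[THEN iffD2, OF T] span_eq_iff[THEN iffD2, OF T'])
    have inv': "S x \<in> T'" if "x \<in> T'" for x
      using that sym[of x e] eT inv by (simp add: T'_def Se)
    obtain B \<kappa> where B: "pairwise orthogonal B" "\<forall>e\<in>B. norm e = 1" "span B = T'" "\<forall>e\<in>B. S e = \<kappa> e *\<^sub>R e"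
      using less.hyps[OF dim T' inv'] sym by (auto simp: T'_def)
    have BT: "b \<in> T" "b \<bullet> e = 0" if "b \<in> B" for b using span_base[OF that] B(3) by (auto simp: T'_def)
    have eB: "e \<notin> B" using BT(2)[of e] ee by auto
    have "x \<in> span (insert e B) \<longleftrightarrow> x \<in> T" for x
    proof
      assume "x \<in> span (insert e B)"
      then obtain k where "x - k *\<^sub>R e \<in> T'" by (auto simp: span_insert B(3))
      then have "(x - k *\<^sub>R e) + k *\<^sub>R e \<in> T" using eT T by (intro subspace_add subspace_scale) (auto simp: T'_def)
      then show "x \<in> T" by simp
    next
      assume "x \<in> T"
      then have "x - (x \<bullet> e) *\<^sub>R e \<in> T'"
        using eT T ee by (simp add: T'_def subspace_diff subspace_scale inner_diff_left)
      then show "x \<in> span (insert e B)" by (auto simp: span_insert B(3))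
    qed
    then have "span (insert e B) = T" by blast
    moreover have "pairwise orthogonal (insert e B)"
      using B(1) BT(2) by (intro pairwise_orthogonal_insert) (auto simp: orthogonal_def inner_commute)
    moreover have "\<forall>b\<in>insert e B. norm b = 1" using B(2) ee by (simp add: norm_eq_1)
    moreover have "\<forall>b\<in>insert e B. S b = (\<kappa>(e := l)) b *\<^sub>R b" using B(4) eB Se by auto
    ultimately show ?thesis by blast
  qed
qed

lemma trace_orthonormal:
  fixes L :: "'a::euclidean_space \<Rightarrow> 'a"
  assumes L: "linear L" and E: "pairwise orthogonal E" "\<And>e. e \<in> E \<Longrightarrow> norm e = 1" "span E = UNIV"
  shows "(\<Sum>e\<in>E. L e \<bullet> e) = (\<Sum>b\<in>Basis. L b \<bullet> b)"
proof -
  have fin: "finite E" by (rule pairwise_orthogonal_imp_finite[OF E(1)])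
  have ex: "(\<Sum>e\<in>E. (x \<bullet> e) *\<^sub>R e) = x" for x
    by (rule orthonormal_basis_expand[OF E(1) _ _ fin]) (auto simp: E(2,3))
  have "L b \<bullet> b = (\<Sum>e\<in>E. (b \<bullet> e) * (L e \<bullet> b))" for b
  proof -
    have "L b = L (\<Sum>e\<in>E. (b \<bullet> e) *\<^sub>R e)" by (simp only: ex)
    also have "\<dots> = (\<Sum>e\<in>E. (b \<bullet> e) *\<^sub>R L e)" by (simp add: linear_sum[OF L] linear_scale[OF L])
    finally show ?thesis by (simp add: inner_sum_left)
  qed
  then have "(\<Sum>b\<in>Basis. L b \<bullet> b) = (\<Sum>b\<in>Basis. \<Sum>e\<in>E. (b \<bullet> e) * (L e \<bullet> b))" by simp
  also have "\<dots> = (\<Sum>e\<in>E. \<Sum>b\<in>Basis. (b \<bullet> e) * (L e \<bullet> b))" by (rule sum.swap)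
  also have "\<dots> = (\<Sum>e\<in>E. L e \<bullet> e)"
  proof (rule sum.cong[OF refl])
    fix e
    show "(\<Sum>b\<in>Basis. (b \<bullet> e) * (L e \<bullet> b)) = L e \<bullet> e"
      unfolding euclidean_inner[of "L e" e] by (rule sum.cong[OF refl]) (simp only: inner_commute mult.commute)
  qed
  finally show ?thesis by simp
qed

section \<open>Uniqueness of the shape operator on tangent vectors and its trace\<close>

context smooth_domain
begin

text \<open>For small \<open>t\<close> the points \<open>p + t (e - \<eta> \<nu>)\<close> and
  \<open>p + t (e + \<eta> \<nu>)\<close> lie on opposite sides of the boundary, and the
  intermediate value theorem finds a boundary point between them. So every tangent direction is
  approached from within the frontier.\<close>

lemma frontier_tangent_point:
  assumes p: "p \<in> frontier \<Omega>" and e: "e \<bullet> \<nu> p = 0" and \<eta>: "\<eta> > 0"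
  shows "\<forall>\<^sub>F t in at_right 0. \<exists>s. \<bar>s\<bar> \<le> \<eta> \<and> p + t *\<^sub>R (e + s *\<^sub>R \<nu> p) \<in> frontier \<Omega>"
proof -
  obtain U \<phi> where U: "p \<in> U" "local_defining_function \<Omega> U \<phi>" using chart_at[OF p] .
  note l = local_defining_functionD[OF U(2)]
  have np: "\<nu> p \<bullet> \<nu> p = 1" using norm_normal[OF p] by (simp add: norm_eq_1)
  have g: "gradient \<phi> (at p) = norm (gradient \<phi> (at p)) *\<^sub>R \<nu> p"
    using outer_unit_normal_eq[OF U(2,1) p] l(3)[OF U(1)] by simp
  have pd: "pd v \<phi> p = norm (gradient \<phi> (at p)) * (v \<bullet> \<nu> p)" for v
    unfolding gradient_inner[OF l(6)[OF U(1)], symmetric] by (subst g) (simp add: inner_commute)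
  have g0: "norm (gradient \<phi> (at p)) > 0" using l(3)[OF U(1)] by simp
  have \<phi>0: "\<phi> p = 0" using l(5)[OF U(1)] p by blast
  let ?w = "\<lambda>s. e + s *\<^sub>R \<nu> p"
  have e1: "\<forall>\<^sub>F t in at_right 0. p + t *\<^sub>R ?w (- \<eta>) \<in> U \<and> \<phi> (p + t *\<^sub>R ?w (- \<eta>)) < 0"
    by (rule descent_direction[OF l(1) U(1) l(6)[OF U(1)] \<phi>0])
      (simp only: pd inner_add_left inner_scaleR_left e np, use g0 \<eta> in simp)
  have "pd v (\<lambda>x. - \<phi> x) p = - pd v \<phi> p" for v
    using pd_cmult[OF l(6)[OF U(1)], of "- 1" v] by simp
  then have e2: "\<forall>\<^sub>F t in at_right 0. p + t *\<^sub>R ?w \<eta> \<in> U \<and> - \<phi> (p + t *\<^sub>R ?w \<eta>) < 0"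
    by (intro descent_direction[OF l(1) U(1)] differentiable_minus l(6)[OF U(1)])
      (simp_all only: pd inner_add_left inner_scaleR_left e np \<phi>0, use g0 \<eta> in simp_all)
  obtain r where r: "r > 0" "ball p r \<subseteq> U" using l(1) U(1) openE by blast
  have "((\<lambda>t. t * (norm e + \<eta>)) \<longlongrightarrow> 0 * (norm e + \<eta>)) (at_right 0)" by (intro tendsto_intros)
  then have e3: "\<forall>\<^sub>F t in at_right 0. t * (norm e + \<eta>) < r" using r(1) by (intro order_tendstoD) auto
  show ?thesis using e1 e2 e3 eventually_at_right_less[of "0::real"]
  proof eventually_elim
    case (elim t)
    have inU: "p + t *\<^sub>R ?w s \<in> U" if s: "s \<in> {- \<eta>..\<eta>}" for s
    proof -
      have "norm (?w s) \<le> norm e + \<eta>"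
        using norm_triangle_ineq[of e "s *\<^sub>R \<nu> p"] s norm_normal[OF p] by (auto simp: abs_le_iff)
      then have "t * norm (?w s) \<le> t * (norm e + \<eta>)" using elim(4) by (intro mult_left_mono) auto
      moreover have "norm (t *\<^sub>R ?w s) = t * norm (?w s)" using elim(4) by simp
      ultimately have "norm (t *\<^sub>R ?w s) < r" using elim(3) by linarith
      then show ?thesis using r(2) by (auto simp: dist_norm)
    qed
    have "continuous_on {- \<eta>..\<eta>} (\<lambda>s. \<phi> (p + t *\<^sub>R ?w s))"
      by (rule continuous_on_compose2[OF Cinf_continuous_on[OF l(2)]]) (use inU in \<open>auto intro!: continuous_intros\<close>)
    then obtain s where s: "- \<eta> \<le> s" "s \<le> \<eta>" "\<phi> (p + t *\<^sub>R ?w s) = 0"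
      using IVT'[of "\<lambda>s. \<phi> (p + t *\<^sub>R ?w s)" "- \<eta>" 0 \<eta>] elim \<eta> by auto
    then have "p + t *\<^sub>R ?w s \<in> frontier \<Omega>" using inU[of s] l(5) by auto
    then show ?case using s by (intro exI[of _ s]) auto
  qed
qed

text \<open>A derivative within the frontier is tested along boundary points only. Tangent vectors
  are directions of such points up to an error \<open>\<eta>\<close>, so two derivatives agree on
  them. This is what makes the principal curvatures unambiguous.\<close>

lemma tangential_derivative_unique:
  fixes g :: "'a \<Rightarrow> 'b::real_normed_vector"
  assumes p: "p \<in> frontier \<Omega>" and e: "e \<bullet> \<nu> p = 0"
    and D1: "(g has_derivative D1) (at p within frontier \<Omega>)"
    and D2: "(g has_derivative D2) (at p within frontier \<Omega>)"
  shows "D1 e = D2 e"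
proof -
  define D where "D v = D1 v - D2 v" for v
  have D: "((\<lambda>x. 0) has_derivative D) (at p within frontier \<Omega>)"
    using has_derivative_diff[OF D1 D2] by (simp add: D_def[abs_def])
  then have bl: "bounded_linear D" by (rule has_derivative_bounded_linear)
  interpret D: bounded_linear D by (rule bl)
  obtain K where K: "\<And>x. norm (D x) \<le> norm x * K" "K > 0" using D.pos_bounded by blast
  define C where "C = K + norm e + 1"
  have C: "C > 0" using K(2) by (simp add: C_def add_pos_nonneg)
  have bound: "norm (D e) \<le> \<eta> * C" if \<eta>: "0 < \<eta>" "\<eta> < 1" for \<eta>
  proof -
    obtain d where d: "d > 0" "\<And>y. y \<in> frontier \<Omega> \<Longrightarrow> norm (y - p) < d \<Longrightarrow> norm (D (y - p)) \<le> \<eta> * norm (y - p)"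
      using D \<eta>(1) unfolding has_derivative_within_alt by auto
    have "((\<lambda>t. t * (norm e + \<eta>)) \<longlongrightarrow> 0 * (norm e + \<eta>)) (at_right 0)" by (intro tendsto_intros)
    then have e3: "\<forall>\<^sub>F t in at_right 0. t * (norm e + \<eta>) < d" using d(1) by (intro order_tendstoD) auto
    have "\<forall>\<^sub>F t in at_right (0::real). norm (D e) \<le> \<eta> * C"
      using e3 frontier_tangent_point[OF p e \<eta>(1)] eventually_at_right_less[of "0::real"]
    proof eventually_elim
      case (elim t)
      obtain s where s: "\<bar>s\<bar> \<le> \<eta>" "p + t *\<^sub>R (e + s *\<^sub>R \<nu> p) \<in> frontier \<Omega>" using elim(2) by blast
      let ?w = "e + s *\<^sub>R \<nu> p"
      have nw: "norm ?w \<le> norm e + \<eta>"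
        using norm_triangle_ineq[of e "s *\<^sub>R \<nu> p"] s norm_normal[OF p] by simp
      then have "t * norm ?w \<le> t * (norm e + \<eta>)" using elim(3) by (intro mult_left_mono) auto
      moreover have "norm (t *\<^sub>R ?w) = t * norm ?w" using elim(3) by simp
      ultimately have "norm (t *\<^sub>R ?w) < d" using elim(1) by linarith
      then have "norm (D (t *\<^sub>R ?w)) \<le> \<eta> * norm (t *\<^sub>R ?w)"
        using d(2)[OF s(2)] by simp
      then have "norm (D ?w) \<le> \<eta> * norm ?w" using elim(3) by (simp add: D.scaleR)
      also have "\<dots> \<le> \<eta> * (norm e + 1)" using nw \<eta> by (intro mult_left_mono) auto
      finally have 1: "norm (D ?w) \<le> \<eta> * (norm e + 1)" .
      have "norm (s *\<^sub>R D (\<nu> p)) \<le> \<eta> * K"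
        using K(1)[of "\<nu> p"] norm_normal[OF p] s(1) by (simp add: mult_mono)
      then have "norm (D ?w - s *\<^sub>R D (\<nu> p)) \<le> \<eta> * (norm e + 1) + \<eta> * K"
        using 1 norm_triangle_ineq4[of "D ?w" "s *\<^sub>R D (\<nu> p)"] by linarith
      also have "D ?w - s *\<^sub>R D (\<nu> p) = D e" by (simp add: D.add D.scaleR)
      finally show "norm (D e) \<le> \<eta> * C" by (simp add: C_def distrib_left)
    qed
    then show ?thesis by simp
  qed
  have "norm (D e) \<le> 0 + \<epsilon>" if \<epsilon>: "\<epsilon> > 0" for \<epsilon>
  proof -
    define \<eta> where "\<eta> = min (1 / 2) (\<epsilon> / C)"
    have "0 < \<eta>" "\<eta> < 1" "\<eta> \<le> \<epsilon> / C" using \<epsilon> C by (auto simp: \<eta>_def min_def)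
    then show ?thesis using bound[of \<eta>] C by (simp add: pos_le_divide_eq)
  qed
  then have "norm (D e) \<le> 0" by (rule field_le_epsilon)
  then show ?thesis by (simp add: D_def)
qed

text \<open>Tangentially the shape operator is \<open>q L\<close> with \<open>L\<close> symmetric of
  trace zero, so its trace over the tangent space is minus the normal entry of \<open>q L\<close>. A
  frame exists by the spectral theorem, and its sum is unique because every frame diagonalises the
  same operator on tangent vectors.\<close>

lemma principal_frame_trace:
  assumes p: "p \<in> frontier \<Omega>" and D: "(\<nu> has_derivative D) (at p within frontier \<Omega>)"
    and inv: "\<And>v. D v \<bullet> \<nu> p = 0"
    and L: "linear L" and q: "\<And>v w. w \<bullet> \<nu> p = 0 \<Longrightarrow> D v \<bullet> w = q * (L v \<bullet> w)"
    and sym: "\<And>v w. L v \<bullet> w = v \<bullet> L w" and tr: "(\<Sum>b\<in>Basis. L b \<bullet> b) = 0"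
  shows "mean_curvature \<Omega> p = - q * (L (\<nu> p) \<bullet> \<nu> p)"
proof -
  let ?T = "{v. v \<bullet> \<nu> p = 0}"
  have np: "\<nu> p \<bullet> \<nu> p = 1" using norm_normal[OF p] by (simp add: norm_eq_1)
  have T: "subspace ?T" by (simp add: subspace_def inner_add_left)
  have lD: "linear D" using has_derivative_bounded_linear[OF D] by (simp add: linear_conv_bounded_linear)
  obtain B \<kappa> where "pairwise orthogonal B" "\<forall>e\<in>B. norm e = 1" "span B = ?T" "\<forall>e\<in>B. D e = \<kappa> e *\<^sub>R e"
    using spectral_basis[OF lD T] inv q sym by (auto simp: inner_commute)
  then have ex: "principal_frame \<Omega> p B \<kappa>" using D by (auto simp: principal_frame_def)
  have un: "(\<Sum>e\<in>B. \<kappa> e) = - q * (L (\<nu> p) \<bullet> \<nu> p)" if pf: "principal_frame \<Omega> p B \<kappa>" for B \<kappa>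
  proof -
    have B: "pairwise orthogonal B" "\<And>e. e \<in> B \<Longrightarrow> norm e = 1" "span B = ?T"
      using pf unfolding principal_frame_def by blast+
    obtain S where S: "(\<nu> has_derivative S) (at p within frontier \<Omega>)" "\<forall>e\<in>B. S e = \<kappa> e *\<^sub>R e"
      using pf unfolding principal_frame_def by blast
    have fin: "finite B" by (rule pairwise_orthogonal_imp_finite[OF B(1)])
    have BT: "e \<bullet> \<nu> p = 0" if "e \<in> B" for e using span_base[OF that] B(3) by auto
    have "\<kappa> e = q * (L e \<bullet> e)" if e: "e \<in> B" for e
    proof -
      have "D e = \<kappa> e *\<^sub>R e" using tangential_derivative_unique[OF p BT[OF e] D S(1)] S(2) e by simp
      then have "D e \<bullet> e = \<kappa> e" using B(2)[OF e] by (simp add: norm_eq_1)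
      then show ?thesis using q[OF BT[OF e]] by simp
    qed
    then have \<kappa>: "(\<Sum>e\<in>B. \<kappa> e) = q * (\<Sum>e\<in>B. L e \<bullet> e)" by (simp add: sum_distrib_left)
    have "(\<Sum>e\<in>insert (\<nu> p) B. L e \<bullet> e) = (\<Sum>b\<in>Basis. L b \<bullet> b)"
    proof (rule trace_orthonormal[OF L])
      show "pairwise orthogonal (insert (\<nu> p) B)"
        using B(1) BT by (intro pairwise_orthogonal_insert) (auto simp: orthogonal_def inner_commute)
      show "norm e = 1" if "e \<in> insert (\<nu> p) B" for e using that B(2) norm_normal[OF p] by auto
      have "x - (x \<bullet> \<nu> p) *\<^sub>R \<nu> p \<in> span B" for x using np by (simp add: B(3) inner_diff_left)
      then show "span (insert (\<nu> p) B) = UNIV" by (auto simp: span_insert)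
    qed
    moreover have "\<nu> p \<notin> B" using BT[of "\<nu> p"] np by auto
    ultimately have "(\<Sum>e\<in>B. L e \<bullet> e) = - (L (\<nu> p) \<bullet> \<nu> p)" using tr fin by simp
    with \<kappa> show ?thesis by simp
  qed
  show ?thesis unfolding mean_curvature_def
    by (rule the_equality) (use ex un[OF ex] in metis, use un in metis)
qed

end


section \<open>One-sided derivatives at the boundary\<close>

lemma directional_derivative_unique:
  fixes g :: "'a::real_normed_vector \<Rightarrow> 'b::real_normed_vector"
  assumes D1: "(g has_derivative D1) (at p within S)" and D2: "(g has_derivative D2) (at p within S)"
    and v: "\<forall>\<^sub>F t in at_right 0. p + t *\<^sub>R v \<in> S"
  shows "D1 v = D2 v"
proof -
  define D where "D v = D1 v - D2 v" for v
  have D: "((\<lambda>x. 0) has_derivative D) (at p within S)"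
    using has_derivative_diff[OF D1 D2] by (simp add: D_def[abs_def])
  interpret D: bounded_linear D by (rule has_derivative_bounded_linear[OF D])
  have "norm (D v) \<le> 0 + \<epsilon>" if \<epsilon>: "\<epsilon> > 0" for \<epsilon>
  proof -
    define \<eta> where "\<eta> = \<epsilon> / (norm v + 1)"
    have \<eta>: "\<eta> > 0" using \<epsilon> by (simp add: \<eta>_def add_nonneg_pos)
    obtain d where d: "d > 0" "\<And>y. y \<in> S \<Longrightarrow> norm (y - p) < d \<Longrightarrow> norm (D (y - p)) \<le> \<eta> * norm (y - p)"
      using D \<eta> unfolding has_derivative_within_alt by auto
    have "((\<lambda>t. t * norm v) \<longlongrightarrow> 0 * norm v) (at_right 0)" by (intro tendsto_intros)
    then have "\<forall>\<^sub>F t in at_right 0. t * norm v < d" using d(1) by (intro order_tendstoD) auto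
    then have "\<forall>\<^sub>F t in at_right (0::real). norm (D v) \<le> \<eta> * norm v"
      using v eventually_at_right_less[of "0::real"]
    proof eventually_elim
      case (elim t)
      then have "norm (D (t *\<^sub>R v)) \<le> \<eta> * norm (t *\<^sub>R v)" using d(2)[OF elim(2)] by simp
      then show ?case using elim(3) by (simp add: D.scaleR)
    qed
    then have "norm (D v) \<le> \<eta> * norm v" by simp
    also have "\<dots> \<le> \<eta> * (norm v + 1)" using \<eta> by (intro mult_left_mono) auto
    also have "\<dots> = \<epsilon>" by (simp add: \<eta>_def add_nonneg_eq_0_iff)
    finally show ?thesis by simp
  qed
  then have "norm (D v) \<le> 0" by (rule field_le_epsilon)
  then show ?thesis by (simp add: D_def)
qed

text \<open>The hypothesis of the theorem differentiates \<open>u\<close> within the closure, while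
  the analysis uses a smooth extension \<open>g\<close>. Inward directions determine a derivative
  within the closure, and every vector is a difference of two inward ones.\<close>

lemma (in smooth_domain) gradient_within_closure:
  assumes p: "p \<in> frontier \<Omega>" and g: "g differentiable at p" and gu: "\<And>x. x \<in> closure \<Omega> \<Longrightarrow> g x = u x"
  shows "gradient u (at p within closure \<Omega>) = gradient g (at p)"
proof -
  let ?S = "closure \<Omega>"
  have pS: "p \<in> ?S" using p by (simp add: frontier_def)
  have D: "(u has_derivative (\<lambda>v. pd v g p)) (at p within ?S)"
    by (rule has_derivative_transform_within[OF has_derivative_at_withinI[OF pd_has[OF g]] zero_less_one pS gu])
  then have "u differentiable (at p within ?S)" unfolding differentiable_def by blast
  then have D': "(u has_derivative frechet_derivative u (at p within ?S)) (at p within ?S)"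
    by (simp add: frechet_derivative_works)
  let ?D = "frechet_derivative u (at p within ?S)"
  have lin: "linear ?D" "linear (\<lambda>v. pd v g p)"
    using has_derivative_bounded_linear[OF D] has_derivative_bounded_linear[OF D']
    by (simp_all add: linear_conv_bounded_linear)
  have eq: "?D v = pd v g p" if v: "v \<bullet> \<nu> p < 0" for v
  proof (rule directional_derivative_unique[OF D' D])
    show "\<forall>\<^sub>F t in at_right 0. p + t *\<^sub>R v \<in> ?S"
      using inward_normal_direction[OF p v] by (rule eventually_mono) (use closure_subset in blast)
  qed
  have np: "\<nu> p \<bullet> \<nu> p = 1" using norm_normal[OF p] by (simp add: norm_eq_1)
  have "?D v = pd v g p" for v
  proof -
    \<comment> \<open>Large enough that \<open>v - k \<nu>\<close> points inward, as
      \<open>- k \<nu>\<close> does.\<close>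
    define k where "k = \<bar>v \<bullet> \<nu> p\<bar> + 1"
    have k: "k > 0" "(v - k *\<^sub>R \<nu> p) \<bullet> \<nu> p < 0" "(- k *\<^sub>R \<nu> p) \<bullet> \<nu> p < 0"
      using np by (auto simp: k_def inner_diff_left)
    have "?D (v - k *\<^sub>R \<nu> p) - ?D (- k *\<^sub>R \<nu> p) = pd (v - k *\<^sub>R \<nu> p) g p - pd (- k *\<^sub>R \<nu> p) g p"
      by (simp only: eq[OF k(2)] eq[OF k(3)])
    then show ?thesis by (simp only: linear_diff[OF lin(1), symmetric] linear_diff[OF lin(2), symmetric]) simp
  qed
  then show ?thesis by (simp add: gradient_def)
qed

definition hess :: "('a::euclidean_space \<Rightarrow> real) \<Rightarrow> 'a \<Rightarrow> 'a \<Rightarrow> 'a" where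
  "hess u p v = (\<Sum>b\<in>Basis. pd v (pd b u) p *\<^sub>R b)"

lemma
  assumes U: "open U" "p \<in> U" and u: "Cinf U u"
  shows hess_inner: "hess u p v \<bullet> w = pd v (pd w u) p"
    and hess_sym: "hess u p v \<bullet> w = v \<bullet> hess u p w"
    and gradient_has_derivative: "((\<lambda>x. gradient u (at x)) has_derivative hess u p) (at p)"
    and trace_hess: "(\<Sum>b\<in>Basis. hess u p b \<bullet> b) = laplacian u p"
proof -
  note d = Cinf_differentiable[OF Cinf_pd[OF u] U(2)]
  show i: "hess u p v \<bullet> w = pd v (pd w u) p" for v w
  proof -
    have "pd v (pd w u) p = pd v (\<lambda>x. \<Sum>b\<in>Basis. (b \<bullet> w) * pd b u x) p"
      by (rule pd_cong[OF U]) (rule pd_sum_Basis[OF Cinf_differentiable[OF u], symmetric])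
    also have "\<dots> = (\<Sum>b\<in>Basis. pd v (\<lambda>x. (b \<bullet> w) * pd b u x) p)"
      by (rule pd_sum) (intro differentiable_mult d differentiable_const)
    also have "\<dots> = (\<Sum>b\<in>Basis. (b \<bullet> w) * pd v (pd b u) p)"
      by (intro sum.cong refl pd_cmult d)
    finally show ?thesis by (simp add: hess_def inner_sum_left mult.commute)
  qed
  show "hess u p v \<bullet> w = v \<bullet> hess u p w"
    unfolding inner_commute[of v] i by (rule pd_commute[OF u U])
  show "((\<lambda>x. gradient u (at x)) has_derivative hess u p) (at p)"
    unfolding gradient_def hess_def[abs_def]
    by (intro has_derivative_sum has_derivative_scaleR_left Cinf_has_derivative[OF Cinf_pd[OF u] U(2)])
  show "(\<Sum>b\<in>Basis. hess u p b \<bullet> b) = laplacian u p" by (simp add: i laplacian_def)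
qed

text \<open>Here \<open>\<sigma>\<close> stands for the area of the unit sphere, \<open>a\<close>
  for that of the boundary, the \<open>M\<close>'s for the integrals of the powers of
  \<open>f\<close>, and \<open>M\<^sub>1 / ((n - 2) * \<sigma>)\<close> for the leading coefficient
  at the pole. The last equation says that \<open>c\<^sub>0\<close> is the stationary point of the
  flux bound as a function of the boundary value of \<open>w\<close>; the powers of \<open>a\<close>
  cancel in it. Logarithms make it a linear identity.\<close>

lemma exponent_identity:
  fixes n \<sigma> a M\<^sub>1 M\<^sub>2 M\<^sub>3 :: real
  assumes pos: "n > 2" "\<sigma> > 0" "a > 0" "M\<^sub>1 > 0" "M\<^sub>2 > 0" "M\<^sub>3 > 0"
  defines "P \<equiv> (n - 2)\<^sup>2 * (M\<^sub>1 / ((n - 2) * \<sigma>)) powr (1 - n / (n - 2))"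
  defines "c\<^sub>0 \<equiv> (M\<^sub>3 / (P * M\<^sub>1)) powr ((n - 2) / (2 * (n - 1)))"
  shows "P > 0" and "c\<^sub>0 > 0" and "c\<^sub>0 powr (n / (n - 2) + 1) = M\<^sub>3 / (P * M\<^sub>1)"
    and "(n - 2) * c\<^sub>0 * ((\<sigma> / a) powr (1 / (n - 1)) * ((M\<^sub>1 / a)\<^sup>2 / (M\<^sub>2 / a))
      * ((M\<^sub>3 / a) / (M\<^sub>1 / a) ^ 3) powr (n / (2 * (n - 1)))) * M\<^sub>2 = M\<^sub>3"
proof -
  define q where "q = n - 2"
  have q: "q > 0" "n = q + 2" using pos(1) by (auto simp: q_def)
  show P: "P > 0" using pos by (simp add: P_def)
  then have Q: "M\<^sub>3 / (P * M\<^sub>1) > 0" using pos by simp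
  then show c: "c\<^sub>0 > 0" by (simp only: c\<^sub>0_def powr_gt_zero)
  show "c\<^sub>0 powr (n / (n - 2) + 1) = M\<^sub>3 / (P * M\<^sub>1)"
  proof -
    have "(n - 2) / (2 * (n - 1)) * (n / (n - 2) + 1) = 1"
    proof -
      have "q + 1 > 0" using q(1) by simp
      moreover have "n / (n - 2) + 1 = 2 * (q + 1) / q" using q by (simp add: field_simps)
      ultimately show ?thesis using q by (simp add: q_def[symmetric])
    qed
    then show ?thesis unfolding c\<^sub>0_def powr_powr using Q by (simp only: powr_one less_imp_le)
  qed
  let ?K = "(\<sigma> / a) powr (1 / (n - 1)) * ((M\<^sub>1 / a)\<^sup>2 / (M\<^sub>2 / a)) * ((M\<^sub>3 / a) / (M\<^sub>1 / a) ^ 3) powr (n / (2 * (n - 1)))"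
  have A0: "M\<^sub>1 / (q * \<sigma>) > 0" using pos q by simp
  have lP: "ln P = 2 * ln q + (1 - (q + 2) / q) * (ln M\<^sub>1 - (ln q + ln \<sigma>))"
    using pos q A0 by (simp add: P_def ln_mult ln_div ln_realpow ln_powr)
  have lc: "ln c\<^sub>0 = q / (2 * (q + 1)) * (ln M\<^sub>3 - (ln P + ln M\<^sub>1))"
    using pos q P Q by (simp add: c\<^sub>0_def ln_mult ln_div ln_powr)
  have lK: "ln ?K = 1 / (q + 1) * (ln \<sigma> - ln a) + (2 * (ln M\<^sub>1 - ln a) - (ln M\<^sub>2 - ln a))
      + (q + 2) / (2 * (q + 1)) * ((ln M\<^sub>3 - ln a) - 3 * (ln M\<^sub>1 - ln a))"
  proof -
    have "\<sigma> / a > 0" "(M\<^sub>1 / a)\<^sup>2 / (M\<^sub>2 / a) > 0" "(M\<^sub>3 / a) / (M\<^sub>1 / a) ^ 3 > 0" "M\<^sub>1 / a > 0" "M\<^sub>2 / a > 0" "M\<^sub>3 / a > 0"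
      "(M\<^sub>1 / a)\<^sup>2 > 0" "(M\<^sub>1 / a) ^ 3 > 0"
      using pos by simp_all
    then show ?thesis using pos q
      by (simp only: ln_mult ln_div ln_powr ln_realpow powr_gt_zero mult_pos_pos) (simp add: algebra_simps)
  qed
  have K: "?K > 0" using pos by (auto intro!: mult_pos_pos divide_pos_pos)
  define k where "k = ?K"
  have k: "k > 0" "ln k = ln ?K" using K by (simp_all only: k_def)
  have "ln (q * c\<^sub>0 * k * M\<^sub>2) = ln q + ln c\<^sub>0 + ln k + ln M\<^sub>2"
    using q(1) c k(1) pos(5) by (simp add: ln_mult)
  also have "\<dots> = ln M\<^sub>3"
  proof -
    \<comment> \<open>In terms of \<open>T\<close> and \<open>y\<close> the exponents become
      polynomial, and \<open>Ty\<close> eliminates \<open>y\<close>, which occurs only in that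
      product.\<close>
    define T where "T = 1 / (q + 1)"
    define y where "y = 1 - (q + 2) / q"
    have q1: "q + 1 > 0" using q(1) by simp
    have T: "q / (2 * (q + 1)) = (1 - T) / 2" "(q + 2) / (2 * (q + 1)) = (1 + T) / 2"
      using q1 by (simp_all add: T_def divide_simps algebra_simps)
    have y: "y = - 2 / q" using q(1) by (simp add: y_def field_simps)
    have Ty: "(1 - T) / 2 * y = - T"
      unfolding T(1)[symmetric] y using q(1) q1 by (simp add: T_def divide_simps)
    have "ln c\<^sub>0 = (1 - T) / 2 * (ln M\<^sub>3 - 2 * ln q - ln M\<^sub>1) - ((1 - T) / 2 * y) * (ln M\<^sub>1 - (ln q + ln \<sigma>))"
      unfolding lc lP T(1) y_def[symmetric] by (simp add: field_simps)
    then show ?thesis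
      unfolding k(2) lK T Ty T_def[symmetric] by (simp add: field_simps)
  qed
  finally have "q * c\<^sub>0 * k * M\<^sub>2 = M\<^sub>3"
    using ln_inj_iff[of "q * c\<^sub>0 * k * M\<^sub>2" "M\<^sub>3"] q(1) c k(1) pos by simp
  then show "(n - 2) * c\<^sub>0 * ?K * M\<^sub>2 = M\<^sub>3" by (simp only: q_def k_def)
qed

section \<open>Boundary identities and moments of the gradient\<close>

context green_function
begin

abbreviation f :: "'a \<Rightarrow> real" where "f x \<equiv> norm (gradient u (at x))"

text \<open>Identities valid in the punctured domain pass to the boundary by continuity; a ball
  around the pole is cut out because \<open>g\<close> is continuous only away from it.\<close>

lemma closure_constant:
  fixes g :: "'a \<Rightarrow> real"
  assumes g: "continuous_on (closure \<Omega> - {0}) g" and const: "\<And>x. x \<in> \<Omega> \<Longrightarrow> x \<noteq> 0 \<Longrightarrow> g x = a"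
    and p: "p \<in> closure \<Omega>" "p \<noteq> 0"
  shows "g p = a"
proof -
  have np: "0 < norm p" using p by simp
  define S where "S = \<Omega> - cball 0 (norm p / 2)"
  have "p \<in> (- cball 0 (norm p / 2)) \<inter> closure \<Omega>" using p by simp
  then have "p \<in> closure (- cball 0 (norm p / 2) \<inter> \<Omega>)"
    using open_Int_closure_subset[OF open_Compl[OF closed_cball[of 0 "norm p / 2"]], of \<Omega>] by blast
  moreover have "- cball 0 (norm p / 2) \<inter> \<Omega> = S" by (auto simp: S_def)
  ultimately have pS: "p \<in> closure S" by simp
  have "closure S \<subseteq> closure \<Omega> - ball 0 (norm p / 2)"
    by (rule closure_minimal) (use closure_subset[of \<Omega>] in \<open>auto simp: S_def intro!: closed_Diff\<close>)
  then have sub: "closure S \<subseteq> closure \<Omega> - {0}" using np by fastforce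
  show ?thesis
    by (rule continuous_constant_on_closure[OF continuous_on_subset[OF g sub] _ pS]) (auto simp: S_def intro!: const)
qed

lemma closure_V: "closure \<Omega> - {0} \<subseteq> V - {0}"
  using V(2) by blast

lemma laplacian_closure: "p \<in> closure \<Omega> \<Longrightarrow> p \<noteq> 0 \<Longrightarrow> laplacian u p = 0"
  by (rule closure_constant[OF continuous_on_subset[OF Cinf_continuous_on[OF Cinf_laplacian[OF oV u]] closure_V] harmonic])

text \<open>Where \<open>f > 0\<close> the normal extends off the boundary as
  \<open>- Du / |Du|\<close>. Its derivative is \<open>- hess / f\<close> plus a multiple of
  \<open>Du\<close>, hence tangentially \<open>- hess / f\<close>; as
  \<open>laplacian u = 0\<close>, also at the boundary, the trace is the normal entry of the Hessian
  divided by \<open>f\<close>.\<close>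

lemma mean_curvature_eq:
  assumes p: "p \<in> frontier \<Omega>" and f0: "f p > 0"
  shows "mean_curvature \<Omega> p * f p = pd (\<nu> p) (pd (\<nu> p) u) p"
proof -
  have pV: "p \<in> V - {0}" by (rule frontier_V(1)[OF p])
  note h = hess_inner[OF oV pV u] hess_sym[OF oV pV u] gradient_has_derivative[OF oV pV u] trace_hess[OF oV pV u]
  let ?G = "\<lambda>x. gradient u (at x)"
  let ?q = "\<lambda>x. - inverse (norm (?G x))"
  have G0: "?G p \<noteq> 0" using f0 by simp
  have norm': "((\<lambda>x. norm (?G x)) has_derivative (\<lambda>v. hess u p v \<bullet> sgn (?G p))) (at p)"
    using has_derivative_compose[OF h(3) has_derivative_norm[OF G0]] .
  obtain q' where q': "(?q has_derivative q') (at p)"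
    using has_derivative_minus[OF Deriv.has_derivative_inverse[OF _ norm']] G0 by auto
  define D where "D v = ?q p *\<^sub>R hess u p v + q' v *\<^sub>R ?G p" for v
  let ?N = "\<lambda>x. ?q x *\<^sub>R ?G x"
  have D: "(?N has_derivative D) (at p)"
    unfolding D_def[abs_def] by (rule has_derivative_scaleR[OF q' h(3)])
  have "continuous_on (V - {0}) f"
    unfolding gradient_def by (intro continuous_intros Cinf_continuous_on Cinf_pd u)
  then have "continuous (at p) f" using oV pV continuous_on_eq_continuous_at by blast
  then have "\<forall>\<^sub>F x in at p. 0 < f x"
    unfolding continuous_at by (rule order_tendstoD(1)[OF _ f0])
  then obtain r where r: "r > 0" "\<And>x. dist x p < r \<Longrightarrow> 0 < f x"
    using f0 unfolding eventually_at by (metis UNIV_I)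
  have N\<nu>: "?N x = \<nu> x" if "x \<in> frontier \<Omega>" "dist x p < r" for x
    using gradient_frontier[OF that(1)] r(2)[OF that(2)]
    by (metis (no_types, opaque_lifting) inverse_eq_divide left_inverse less_irrefl minus_mult_minus scaleR_one scaleR_scaleR)
  have \<nu>D: "(\<nu> has_derivative D) (at p within frontier \<Omega>)"
    by (rule has_derivative_transform_within[OF has_derivative_at_withinI[OF D] r(1) p N\<nu>])
  \<comment> \<open>Differentiating \<open>?N x \<bullet> ?N x = 1\<close> shows that
    \<open>D\<close> has no normal component.\<close>
  have "((\<lambda>x. ?N x \<bullet> ?N x) has_derivative (\<lambda>v. ?N p \<bullet> D v + D v \<bullet> ?N p)) (at p)"
    by (rule has_derivative_inner[OF D D])
  moreover have "((\<lambda>x. ?N x \<bullet> ?N x) has_derivative (\<lambda>v. 0)) (at p)"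
  proof (rule has_derivative_transform_within[OF has_derivative_const r(1)])
    fix x assume "dist x p < r"
    then show "1 = ?N x \<bullet> ?N x" using r(2)[of x] by (simp add: power2_norm_eq_inner[symmetric] power2_eq_square)
  qed simp
  ultimately have "(\<lambda>v. ?N p \<bullet> D v + D v \<bullet> ?N p) = (\<lambda>v. 0)" by (rule has_derivative_unique)
  then have N0: "?N p \<bullet> D v + D v \<bullet> ?N p = 0" for v by (rule fun_cong)
  have "D v \<bullet> ?N p = 0" for v using N0[of v] inner_commute[of "?N p" "D v"] by linarith
  moreover have "?N p = \<nu> p" by (rule N\<nu>[OF p]) (simp add: r(1))
  ultimately have inv: "D v \<bullet> \<nu> p = 0" for v by (simp only:)
  have lin: "linear (hess u p)"
    using has_derivative_bounded_linear[OF h(3)] by (simp add: linear_conv_bounded_linear)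
  have "mean_curvature \<Omega> p = - ?q p * (hess u p (\<nu> p) \<bullet> \<nu> p)"
  proof (rule principal_frame_trace[OF p \<nu>D inv lin _ h(2)])
    fix v w assume "w \<bullet> \<nu> p = 0"
    then have "?G p \<bullet> w = 0" by (subst gradient_frontier[OF p]) (simp add: inner_commute)
    then show "D v \<bullet> w = ?q p * (hess u p v \<bullet> w)" by (simp add: D_def inner_add_left inner_diff_left)
  next
    show "(\<Sum>b\<in>Basis. hess u p b \<bullet> b) = 0"
      using h(4) laplacian_closure[of p] p frontier_V(2)[OF p] by (simp add: frontier_def)
  qed
  then show ?thesis using f0 by (simp add: h(1) field_simps)
qed


lemma continuous_f: "continuous_on (frontier \<Omega>) f"
proof -
  have "continuous_on (V - {0}) f"
    unfolding gradient_def by (intro continuous_intros Cinf_continuous_on Cinf_pd u)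
  then show ?thesis by (rule continuous_on_subset) (use frontier_V in blast)
qed

lemma normal_derivative: "p \<in> frontier \<Omega> \<Longrightarrow> pd (\<nu> p) u p = - f p"
proof -
  assume p: "p \<in> frontier \<Omega>"
  have "\<nu> p \<bullet> \<nu> p = 1" using norm_normal[OF p] by (simp add: norm_eq_1)
  then have "(- f p *\<^sub>R \<nu> p) \<bullet> \<nu> p = - f p" by (simp only: inner_scaleR_left mult_1_right)
  then have "gradient u (at p) \<bullet> \<nu> p = - f p"
    using arg_cong[OF gradient_frontier[OF p], of "\<lambda>v. v \<bullet> \<nu> p"] by (rule trans[rotated])
  then show ?thesis using gradient_inner[OF Cinf_differentiable[OF u frontier_V(1)[OF p]]] by simp
qed

lemma SI_f: "SI f = surface_const TYPE('a) * m"
proof -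
  have "SI (\<lambda>x. pd (\<nu> x) u x) = SI (\<lambda>x. - f x)" by (rule SI_cong) (rule normal_derivative)
  also have "\<dots> = - SI f" by (simp add: set_lebesgue_integral_def)
  finally show ?thesis using flux by simp
qed

text \<open>The factor \<open>surface_const\<close> enters through \<open>kap\<close> and through
  the flux of \<open>u\<close> and cancels, leaving a quotient of surface integrals.\<close>

lemma A_eq: "A = SI f / ((real DIM('a) - 2) * area (sphere (0::'a) 1))"
  using surface_const_pos[OF dim] by (simp add: A_def SI_f kap_def)

lemma SI_f_pos: "SI f > 0"
  using surface_const_pos[OF dim] m_pos by (simp add: SI_f)

text \<open>As \<open>f\<close> may vanish on part of the boundary, positivity of the higher moments
  is derived from that of the first, through \<open>f \<le> h + f^(k + 1) / h^k\<close> for every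
  \<open>h > 0\<close>.\<close>

lemma SI_power_pos: "SI (\<lambda>x. f x ^ Suc k) > 0"
proof (rule ccontr)
  assume neg: "\<not> ?thesis"
  let ?a = "SI (\<lambda>x. 1)"
  have "SI f \<le> 0 + e" if e: "e > 0" for e
  proof -
    define h where "h = e / (\<bar>?a\<bar> + 1)"
    have h: "h > 0" using e by (simp add: h_def add_nonneg_pos)
    have "f x \<le> h * 1 + (1 / h ^ k) * f x ^ Suc k" for x
    proof (cases "f x \<le> h")
      case True
      then show ?thesis using h by (simp add: add_increasing2)
    next
      case False
      then have "h ^ k \<le> f x ^ k" using h by (intro power_mono) auto
      then have "f x * h ^ k \<le> f x * f x ^ k" by (intro mult_left_mono) auto
      then have "f x \<le> (1 / h ^ k) * f x ^ Suc k" using h by (simp add: pos_le_divide_eq)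
      then show ?thesis using h by linarith
    qed
    then have "SI f \<le> SI (\<lambda>x. h * 1 + (1 / h ^ k) * f x ^ Suc k)"
      by (intro SI_mono continuous_intros continuous_f)
    also have "\<dots> = SI (\<lambda>x. h * 1) + SI (\<lambda>x. (1 / h ^ k) * f x ^ Suc k)"
      by (intro SI_add continuous_intros continuous_f)
    also have "\<dots> = h * ?a + (1 / h ^ k) * SI (\<lambda>x. f x ^ Suc k)" by (simp only: set_integral_mult_right)
    also have "\<dots> \<le> h * ?a + 0" using neg h by (intro add_left_mono mult_nonneg_nonpos) auto
    also have "h * ?a \<le> h * (\<bar>?a\<bar> + 1)" using h by (intro mult_left_mono) auto
    also have "\<dots> = e" by (simp add: h_def add_nonneg_eq_0_iff)
    finally show ?thesis by simp
  qed
  then have "SI f \<le> 0" by (rule field_le_epsilon)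
  then show False using SI_f_pos by simp
qed


section \<open>The function \<open>W\<close> for a fixed shift \<open>s\<close>\<close>

context
  fixes s P :: real
  assumes s: "c + s > 0"
begin

definition "w x = u x + s"
text \<open>The power \<open>w^(-\<alpha>)\<close> is smooth only where \<open>w > 0\<close>; this
  open set still contains the closure of \<open>\<Omega>\<close> apart from the pole.\<close>

definition "Vs = {x \<in> V - {0}. w x > 0}"
definition "W x = pot_energy w x - P * w x"

lemma Cinf_w: "Cinf (V - {0}) w"
  unfolding w_def[abs_def] by (intro Cinf_add oV u Cinf_const)

lemma open_Vs: "open Vs"
proof -
  have "open ((V - {0}) \<inter> w -` {0<..})"
    by (rule continuous_open_preimage[OF Cinf_continuous_on[OF Cinf_w] oV]) simp
  then show ?thesis by (simp add: Vs_def vimage_def Int_def)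
qed

lemma Vs: "x \<in> Vs \<Longrightarrow> x \<in> V - {0}" "x \<in> Vs \<Longrightarrow> w x > 0"
  by (auto simp: Vs_def)

lemma closure_Vs: "x \<in> closure \<Omega> \<Longrightarrow> x \<noteq> 0 \<Longrightarrow> x \<in> Vs"
proof -
  assume x: "x \<in> closure \<Omega>" "x \<noteq> 0"
  have "c \<le> u x"
  proof (cases "x \<in> \<Omega>")
    case True
    then show ?thesis using x by (intro lower_bound)
  next
    case False
    then have "x \<in> frontier \<Omega>" using x open_\<Omega> by (simp add: frontier_def interior_open)
    then show ?thesis using bc by simp
  qed
  then show ?thesis using s \<Omega>V(1)[OF x] by (simp add: Vs_def w_def)
qed

lemma Cinf_w_Vs: "Cinf Vs w"
  by (rule Cinf_subset[OF Cinf_w]) (use Vs(1) in blast)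

lemma Cinf_W: "Cinf Vs W"
  unfolding W_def[abs_def] using Vs(2)
  by (intro Cinf_diff open_Vs Cinf_pot_energy Cinf_mult Cinf_const Cinf_w_Vs)

lemma pd_w: "x \<in> V - {0} \<Longrightarrow> pd v w x = pd v u x"
  unfolding w_def[abs_def] by (simp add: pd_add Cinf_differentiable[OF u])

lemma grad2_w: "x \<in> V - {0} \<Longrightarrow> grad2 w x = (f x)\<^sup>2"
proof -
  assume x: "x \<in> V - {0}"
  have "grad2 w x = grad2 u x" by (simp add: grad2_def pd_w[OF x])
  then show ?thesis by (simp add: grad2_norm[OF Cinf_differentiable[OF u x]])
qed

lemma laplacian_w: "x \<in> V - {0} \<Longrightarrow> laplacian w x = laplacian u x"
  unfolding laplacian_def by (intro sum.cong refl pd_cong[OF oV] pd_w)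

text \<open>On the boundary \<open>Du = - f \<nu>\<close>, so the normal derivative of
  \<open>|Dw|^2\<close> is \<open>- 2 f\<close> times the second normal derivative of
  \<open>u\<close>, and the curvature identity makes it \<open>- 2 H f^2\<close>.\<close>

lemma normal_derivative_W:
  assumes p: "p \<in> frontier \<Omega>"
  defines "\<alpha> \<equiv> alpha TYPE('a)"
  shows "pd (\<nu> p) W p = \<alpha> * (c + s) powr (- \<alpha> - 1) * f p ^ 3
    - 2 * (c + s) powr (- \<alpha>) * mean_curvature \<Omega> p * (f p)\<^sup>2 + P * f p"
proof -
  let ?n = "\<nu> p"
  have pV: "p \<in> V - {0}" by (rule frontier_V(1)[OF p])
  have pVs: "p \<in> Vs" using p frontier_V(2)[OF p] by (intro closure_Vs) (simp add: frontier_def)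
  have wp: "w p = c + s" using bc[OF p] by (simp add: w_def)
  note dw = Cinf_differentiable[OF Cinf_w pV]
  have pw: "pd ?n w p = - f p" using pd_w[OF pV] normal_derivative[OF p] by simp
  have cp: "Cinf Vs (\<lambda>x. w x powr (- \<alpha>))" by (rule Cinf_comp_powr[OF open_Vs Cinf_w_Vs Vs(2)])
  have "pd ?n (grad2 w) p = 2 * (\<Sum>b\<in>Basis. pd b w p * pd ?n (pd b w) p)"
    by (rule pd_grad2[OF oV pV Cinf_w])
  also have "(\<Sum>b\<in>Basis. pd b w p * pd ?n (pd b w) p) = (\<Sum>b\<in>Basis. pd ?n (pd b u) p * pd b u p)"
  proof (rule sum.cong[OF refl])
    fix b
    have "pd ?n (pd b w) p = pd ?n (pd b u) p" by (rule pd_cong[OF oV pV pd_w])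
    then show "pd b w p * pd ?n (pd b w) p = pd ?n (pd b u) p * pd b u p"
      by (simp only: pd_w[OF pV] mult.commute)
  qed
  also have "\<dots> = hess u p ?n \<bullet> gradient u (at p)"
    unfolding hess_def inner_sum_left inner_scaleR_left
    by (intro sum.cong refl) (simp only: inner_commute[of _ "gradient u (at p)"] gradient_inner[OF Cinf_differentiable[OF u pV]])
  also have "\<dots> = hess u p ?n \<bullet> (- f p *\<^sub>R ?n)" using gradient_frontier[OF p] by simp
  also have "\<dots> = - f p * pd ?n (pd ?n u) p" by (simp only: inner_scaleR_right hess_inner[OF oV pV u])
  \<comment> \<open>Where \<open>f p = 0\<close> the curvature identity does not apply, but both
    sides vanish.\<close>
  also have "\<dots> = - (mean_curvature \<Omega> p * (f p)\<^sup>2)"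
    using mean_curvature_eq[OF p] by (cases "f p = 0") (auto simp: power2_eq_square)
  finally have pg: "pd ?n (grad2 w) p = - 2 * (mean_curvature \<Omega> p * (f p)\<^sup>2)" by simp
  have wp0: "w p > 0" by (rule Vs(2)[OF pVs])
  have "pd ?n W p = pd ?n (pot_energy w) p - pd ?n (\<lambda>x. P * w x) p"
    unfolding W_def[abs_def]
    by (rule pd_diff[OF Cinf_differentiable[OF Cinf_pot_energy[OF open_Vs Cinf_w_Vs Vs(2)] pVs]])
      (auto intro!: differentiable_mult dw)
  also have "pd ?n (\<lambda>x. P * w x) p = P * pd ?n w p" by (rule pd_cmult[OF dw])
  also have "pd ?n (pot_energy w) p = w p powr (- \<alpha>) * pd ?n (grad2 w) p
      + (- \<alpha> * w p powr (- \<alpha> - 1) * pd ?n w p) * grad2 w p"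
    unfolding pot_energy_def[abs_def] \<alpha>_def[symmetric]
    by (simp only: pd_mult[OF Cinf_differentiable[OF cp pVs] Cinf_differentiable[OF Cinf_grad2[OF oV Cinf_w] pV]]
        pd_powr[OF dw wp0])
  finally show ?thesis
    unfolding pg pw wp grad2_w[OF pV] by (simp add: power2_eq_square power3_eq_cube algebra_simps)
qed

text \<open>After scaling by \<open>|x|^(n - 2)\<close> the energy tends to
  \<open>A^(-\<alpha>) ((n - 2) A)^2\<close>, because \<open>\<alpha> (n - 2) = n\<close>; the given
  \<open>P\<close> makes this equal to \<open>P A\<close>, the limit of the scaled second
  term.\<close>

lemma W_pole:
  assumes P: "P = (real DIM('a) - 2)\<^sup>2 * A powr (1 - alpha TYPE('a))"
  shows "((\<lambda>x. W x * norm x powr (real DIM('a) - 2)) \<longlongrightarrow> 0) (at 0)"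
proof -
  let ?n = "real DIM('a)"
  define \<alpha> where "\<alpha> = alpha TYPE('a)"
  have \<alpha>n: "\<alpha> * (?n - 2) = ?n" using n3 by (simp add: \<alpha>_def alpha_def)
  have w1: "((\<lambda>x. w x * norm x powr (?n - 2)) \<longlongrightarrow> A) (at 0)"
    using shift_asymptotics unfolding w_def .
  have "((\<lambda>x. (w x * norm x powr (?n - 2)) powr (- \<alpha>) * (f x * norm x powr (?n - 1))\<^sup>2 - P * (w x * norm x powr (?n - 2)))
      \<longlongrightarrow> A powr (- \<alpha>) * ((?n - 2) * A)\<^sup>2 - P * A) (at 0)"
    using A_pos by (intro tendsto_intros w1 u_asymptotics) auto
  moreover have "A powr (- \<alpha>) * ((?n - 2) * A)\<^sup>2 - P * A = 0"
  proof -
    have "A powr (1 - \<alpha>) = A * A powr (- \<alpha>)" using A_pos powr_add[of A 1 "- \<alpha>"] by simp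
    then show ?thesis unfolding P \<alpha>_def[symmetric] by (simp add: power2_eq_square)
  qed
  ultimately have lim: "((\<lambda>x. (w x * norm x powr (?n - 2)) powr (- \<alpha>) * (f x * norm x powr (?n - 1))\<^sup>2
      - P * (w x * norm x powr (?n - 2))) \<longlongrightarrow> 0) (at 0)" by simp
  have "\<forall>\<^sub>F x in at 0. x \<in> \<Omega> \<and> x \<noteq> 0"
    using zero open_\<Omega> by (auto simp: eventually_at_topological)
  then have "\<forall>\<^sub>F x in at 0. (w x * norm x powr (?n - 2)) powr (- \<alpha>) * (f x * norm x powr (?n - 1))\<^sup>2
      - P * (w x * norm x powr (?n - 2)) = W x * norm x powr (?n - 2)"
  proof eventually_elim
    fix x assume x: "x \<in> \<Omega> \<and> x \<noteq> 0"
    then have xV: "x \<in> V - {0}" "w x > 0"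
      using \<Omega>V(2) closure_Vs[of x] Vs(2) closure_subset[of \<Omega>] by blast+
    have r: "norm x > 0" using x by simp
    have "(w x * norm x powr (?n - 2)) powr (- \<alpha>) = w x powr (- \<alpha>) * norm x powr (- ?n)"
      using \<alpha>n xV r by (simp add: powr_mult powr_powr algebra_simps)
    moreover have "(norm x powr (?n - 1))\<^sup>2 = norm x powr (2 * ?n - 2)"
      using r by (simp add: power2_eq_square powr_add[symmetric])
    moreover have "norm x powr (- ?n) * norm x powr (2 * ?n - 2) = norm x powr (?n - 2)"
      by (simp add: powr_add[symmetric])
    ultimately have "(w x * norm x powr (?n - 2)) powr (- \<alpha>) * (f x * norm x powr (?n - 1))\<^sup>2
        = w x powr (- \<alpha>) * (f x)\<^sup>2 * norm x powr (?n - 2)"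
      by (simp add: power_mult_distrib mult_ac)
    then show "(w x * norm x powr (?n - 2)) powr (- \<alpha>) * (f x * norm x powr (?n - 1))\<^sup>2
      - P * (w x * norm x powr (?n - 2)) = W x * norm x powr (?n - 2)"
      using grad2_w[OF xV(1)] by (simp add: W_def pot_energy_def \<alpha>_def left_diff_distrib)
  qed
  then show ?thesis by (rule Lim_transform_eventually[OF lim])
qed

text \<open>Rigidity gives \<open>w^(1 - \<alpha>) = K |x|^2\<close>, first in the punctured domain
  and then up to the boundary. There \<open>w\<close> has the constant value \<open>c + s\<close>,
  so the frontier lies on a sphere centred at the pole.\<close>

lemma ball_of_flux:
  assumes P: "P = (real DIM('a) - 2)\<^sup>2 * A powr (1 - alpha TYPE('a))" and flux: "SI (\<lambda>x. pd (\<nu> x) W x) \<le> 0"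
  shows "\<exists>r>0. \<Omega> = ball 0 r \<and> (\<forall>x\<in>closure \<Omega> - {0}. \<forall>y\<in>closure \<Omega> - {0}. norm x = norm y \<longrightarrow> u x = u y)"
proof -
  define \<alpha> where "\<alpha> = alpha TYPE('a)"
  have \<alpha>1: "\<alpha> > 1" unfolding \<alpha>_def by (rule alpha_identity(2)[OF dim3])
  have \<Omega>Vs: "x \<in> Vs" if "x \<in> \<Omega> - {0}" for x using that closure_subset[of \<Omega>] by (intro closure_Vs) auto
  have harm: "laplacian w x = 0" if "x \<in> \<Omega> - {0}" for x
    using that laplacian_w[OF \<Omega>V(2)] harmonic by auto
  have oO: "open (\<Omega> - {0})" using open_\<Omega> by (simp add: open_delete)
  have cw: "Cinf (\<Omega> - {0}) w" by (rule Cinf_subset[OF Cinf_w]) (use \<Omega>V(2) in blast)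
  have wpos: "w x > 0" if "x \<in> \<Omega> - {0}" for x using Vs(2)[OF \<Omega>Vs[OF that]] .
  have lapW: "laplacian W x = 2 * w x powr (- \<alpha>) * (\<Sum>i\<in>Basis. \<Sum>j\<in>Basis. (tensor w x i j)\<^sup>2)"
    if x: "x \<in> \<Omega> - {0}" for x
  proof -
    have "laplacian W x = laplacian (pot_energy w) x - laplacian (\<lambda>x. P * w x) x"
      unfolding W_def[abs_def]
      by (rule laplacian_diff[OF oO Cinf_pot_energy[OF oO cw wpos] Cinf_mult[OF oO Cinf_const cw] x])
    also have "laplacian (\<lambda>x. P * w x) x = P * laplacian w x" by (rule laplacian_cmult[OF oO cw x])
    finally show ?thesis
      using laplacian_pot_energy[OF dim3 oO x cw wpos harm] harm[OF x] by (simp add: \<alpha>_def)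
  qed
  have ev: "\<forall>\<^sub>F x in at 0. x \<in> Vs"
    using zero open_\<Omega> \<Omega>Vs by (auto simp: eventually_at_topological intro!: exI[of _ \<Omega>])
  \<comment> \<open>\<open>subharmonic_flux\<close> wants a neighbourhood of the whole closure, so
    the pole is put back; the result is open since \<open>Vs\<close> contains a punctured
    neighbourhood of it.\<close>
  have V': "open (insert 0 Vs)"
  proof -
    obtain S where S: "open S" "0 \<in> S" "\<And>x. x \<in> S \<Longrightarrow> x \<noteq> 0 \<Longrightarrow> x \<in> Vs"
      using ev unfolding eventually_at_topological by blast
    have "insert 0 Vs = S \<union> Vs" using S by blast
    then show ?thesis using open_Un[OF S(1) open_Vs] by simp
  qed
  have "0 \<notin> Vs" using Vs(1) by blast
  then have V'0: "insert 0 Vs - {0} = Vs" by blast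
  have "laplacian W x = 0" if x: "x \<in> \<Omega>" "x \<noteq> 0" for x
  proof (rule subharmonic_flux[OF V' _ _ zero _ W_pole[OF P] flux x])
    show "closure \<Omega> \<subseteq> insert 0 Vs" using closure_Vs by blast
    show "Cinf (insert 0 Vs - {0}) W" unfolding V'0 by (rule Cinf_W)
    show "0 \<le> laplacian W x" if "x \<in> \<Omega>" "x \<noteq> 0" for x
      using lapW[of x] that by (simp add: sum_nonneg)
  qed
  then have T: "tensor w x i j = 0" if x: "x \<in> \<Omega> - {0}" "i \<in> Basis" "j \<in> Basis" for x i j
  proof -
    have "(\<Sum>i\<in>Basis. \<Sum>j\<in>Basis. (tensor w x i j)\<^sup>2) = 0"
      using lapW[OF x(1)] wpos[OF x(1)] \<open>\<And>x. x \<in> \<Omega> \<Longrightarrow> x \<noteq> 0 \<Longrightarrow> laplacian W x = 0\<close>[of x] x(1) by simp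
    then have "(\<Sum>j\<in>Basis. (tensor w x i j)\<^sup>2) = 0"
      using x(2) by (subst (asm) sum_nonneg_eq_0_iff) (auto intro: sum_nonneg)
    then show ?thesis using x(3) by (subst (asm) sum_nonneg_eq_0_iff) auto
  qed
  have "filterlim w at_top (at 0)" unfolding w_def[abs_def] by (rule u_at_top)
  then obtain K where K: "K > 0" "\<And>x. x \<in> \<Omega> - {0} \<Longrightarrow> w x powr (1 - \<alpha>) = K * (norm x)\<^sup>2"
    using radial_rigidity[OF dim3 open_\<Omega> conn zero cw wpos T] unfolding \<alpha>_def by blast
  have cl: "w x powr (1 - \<alpha>) - K * (norm x)\<^sup>2 = 0" if x: "x \<in> closure \<Omega>" "x \<noteq> 0" for x
  proof (rule closure_constant[OF _ _ x])
    have sub: "closure \<Omega> - {0} \<subseteq> Vs" using closure_Vs by blast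
    have "continuous_on Vs (\<lambda>x. w x powr (1 - \<alpha>) - K * (norm x)\<^sup>2)"
      by (intro continuous_intros Cinf_continuous_on[OF Cinf_comp_powr[OF open_Vs Cinf_w_Vs Vs(2)]])
    then show "continuous_on (closure \<Omega> - {0}) (\<lambda>x. w x powr (1 - \<alpha>) - K * (norm x)\<^sup>2)"
      using sub by (rule continuous_on_subset)
  qed (simp add: K(2))
  define r where "r = sqrt ((c + s) powr (1 - \<alpha>) / K)"
  have r: "r > 0" using K(1) s by (simp add: r_def)
  have fr: "frontier \<Omega> \<subseteq> sphere 0 r"
  proof
    fix p assume p: "p \<in> frontier \<Omega>"
    have "(c + s) powr (1 - \<alpha>) = K * (norm p)\<^sup>2"
      using cl[of p] p frontier_V(2)[OF p] bc[OF p] by (simp add: frontier_def w_def)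
    then show "p \<in> sphere 0 r" using K(1) by (simp add: r_def)
  qed
  have "u x = u y" if "x \<in> closure \<Omega> - {0}" "y \<in> closure \<Omega> - {0}" "norm x = norm y" for x y
  proof -
    have "w x > 0" "w y > 0" using Vs(2) closure_Vs that by auto
    moreover have "w x powr (1 - \<alpha>) = w y powr (1 - \<alpha>)" using cl[of x] cl[of y] that by auto
    then have "(w x powr (1 - \<alpha>)) powr (1 / (1 - \<alpha>)) = (w y powr (1 - \<alpha>)) powr (1 / (1 - \<alpha>))" by simp
    ultimately have "w x = w y" using \<alpha>1 by (simp add: powr_powr)
    then show ?thesis by (simp add: w_def)
  qed
  then show ?thesis
    using r ball_of_frontier_sphere[OF open_\<Omega> conn bounded_\<Omega> zero dim r fr] by blast
qed

end

theorem rigidity: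
  defines "n \<equiv> real DIM('a)" and "F \<equiv> frontier \<Omega>"
  assumes H: "\<And>p. p \<in> F \<Longrightarrow> mean_curvature \<Omega> p / (n - 1) \<ge>
      (area (sphere (0::'a) 1) / area F) powr (1 / (n - 1))
      * ((surface_mean F f)\<^sup>2 / surface_mean F (\<lambda>x. f x ^ 2))
      * (surface_mean F (\<lambda>x. f x ^ 3) / (surface_mean F f) ^ 3) powr (n / (2 * (n - 1)))"
  shows "\<exists>r>0. \<Omega> = ball 0 r \<and> (\<forall>x\<in>closure \<Omega> - {0}. \<forall>y\<in>closure \<Omega> - {0}. norm x = norm y \<longrightarrow> u x = u y)"
proof -
  define M\<^sub>1 where "M\<^sub>1 = SI f"
  define M\<^sub>2 where "M\<^sub>2 = SI (\<lambda>x. f x ^ 2)"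
  define M\<^sub>3 where "M\<^sub>3 = SI (\<lambda>x. f x ^ 3)"
  define \<sigma> where "\<sigma> = area (sphere (0::'a) 1)"
  define a where "a = area F"
  define K where "K = (\<sigma> / a) powr (1 / (n - 1)) * ((M\<^sub>1 / a)\<^sup>2 / (M\<^sub>2 / a))
      * ((M\<^sub>3 / a) / (M\<^sub>1 / a) ^ 3) powr (n / (2 * (n - 1)))"
  define \<alpha> where "\<alpha> = alpha TYPE('a)"
  define P where "P = (n - 2)\<^sup>2 * (M\<^sub>1 / ((n - 2) * \<sigma>)) powr (1 - n / (n - 2))"
  \<comment> \<open>For this boundary value of \<open>w = u + s\<close> the hypothesis makes the bound for the flux of \<open>W\<close> vanish.\<close>
  define c\<^sub>0 where "c\<^sub>0 = (M\<^sub>3 / (P * M\<^sub>1)) powr ((n - 2) / (2 * (n - 1)))"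
  have n: "n > 2" using n3 by (simp add: n_def)
  have \<alpha>n: "\<alpha> = n / (n - 2)" by (simp add: \<alpha>_def alpha_def n_def)
  have pos: "\<sigma> > 0" "a > 0" "M\<^sub>1 > 0" "M\<^sub>2 > 0" "M\<^sub>3 > 0"
    using area_sphere_pos[OF dim] area_pos zero SI_f_pos SI_power_pos[of 1] SI_power_pos[of 2]
    by (auto simp: \<sigma>_def a_def F_def M\<^sub>1_def M\<^sub>2_def M\<^sub>3_def numeral_2_eq_2 numeral_3_eq_3)
  note e = exponent_identity[OF n pos, folded P_def, folded c\<^sub>0_def, folded K_def, folded \<alpha>n]
  have K: "mean_curvature \<Omega> p \<ge> (n - 1) * K" if "p \<in> F" for p
    using H[OF that] n
    by (simp add: K_def M\<^sub>1_def M\<^sub>2_def M\<^sub>3_def \<sigma>_def a_def F_def surface_mean_def pos_le_divide_eq mult.commute)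
  define s where "s = c\<^sub>0 - c"
  have cs: "c + s = c\<^sub>0" by (simp add: s_def)
  then have s: "c + s > 0" using e(2) by simp
  have PA: "P = (real DIM('a) - 2)\<^sup>2 * A powr (1 - alpha TYPE('a))"
    by (simp add: P_def A_eq alpha_def n_def M\<^sub>1_def \<sigma>_def)
  define C\<^sub>3 where "C\<^sub>3 = \<alpha> * c\<^sub>0 powr (- \<alpha> - 1)"
  define C\<^sub>2 where "C\<^sub>2 = - (2 * c\<^sub>0 powr (- \<alpha>) * ((n - 1) * K))"
  have cont: "continuous_on (frontier \<Omega>) (\<lambda>x. pd (\<nu> x) (W s P) x)"
  proof -
    have "continuous_on (Vs s) (\<lambda>x. gradient (W s P) (at x))"
      unfolding gradient_def by (intro continuous_intros Cinf_continuous_on Cinf_pd Cinf_W s)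
    moreover have FV: "x \<in> Vs s" if "x \<in> frontier \<Omega>" for x
      using that frontier_V(2)[OF that] by (intro closure_Vs s) (simp_all add: frontier_def)
    ultimately have "continuous_on (frontier \<Omega>) (\<lambda>x. gradient (W s P) (at x) \<bullet> \<nu> x)"
      by (intro continuous_intros continuous_normal) (auto elim: continuous_on_subset)
    then show ?thesis
      by (rule continuous_on_eq) (rule gradient_inner[OF Cinf_differentiable[OF Cinf_W[OF s] FV]])
  qed
  have cp: "continuous_on (frontier \<Omega>) (\<lambda>x. k * f x ^ j)" for k j
    by (intro continuous_intros continuous_f)
  have "pd (\<nu> x) (W s P) x \<le> C\<^sub>3 * f x ^ 3 + (C\<^sub>2 * f x ^ 2 + P * f x ^ 1)" if x: "x \<in> frontier \<Omega>" for x
  proof -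
    \<comment> \<open>The curvature enters \<open>normal_derivative_W\<close> with a negative
      factor, so its lower bound limits the flux from above.\<close>
    have "2 * c\<^sub>0 powr (- \<alpha>) * ((n - 1) * K) * (f x)\<^sup>2 \<le> 2 * c\<^sub>0 powr (- \<alpha>) * mean_curvature \<Omega> x * (f x)\<^sup>2"
      using K x by (intro mult_right_mono mult_left_mono) (auto simp: F_def)
    then show ?thesis
      unfolding normal_derivative_W[OF s x] cs C\<^sub>3_def C\<^sub>2_def \<alpha>_def[symmetric] by simp
  qed
  then have "SI (\<lambda>x. pd (\<nu> x) (W s P) x) \<le> SI (\<lambda>x. C\<^sub>3 * f x ^ 3 + (C\<^sub>2 * f x ^ 2 + P * f x ^ 1))"
    by (intro SI_mono cont continuous_on_add cp)
  also have "\<dots> = SI (\<lambda>x. C\<^sub>3 * f x ^ 3) + (SI (\<lambda>x. C\<^sub>2 * f x ^ 2) + SI (\<lambda>x. P * f x ^ 1))"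
    by (subst SI_add[OF cp continuous_on_add[OF cp cp]]) (subst SI_add[OF cp cp], rule refl)
  also have "\<dots> = C\<^sub>3 * M\<^sub>3 + (C\<^sub>2 * M\<^sub>2 + P * M\<^sub>1)"
    by (simp add: M\<^sub>1_def M\<^sub>2_def M\<^sub>3_def)
  also have "\<dots> = 0"
  proof -
    \<comment> \<open>After multiplication by \<open>n - 2\<close> the choice of
      \<open>c\<^sub>0\<close> reduces the three terms to multiples of \<open>E * M\<^sub>3\<close>
      with factors \<open>n\<close>, \<open>- 2 * (n - 1)\<close> and \<open>n - 2\<close>, whose
      sum is zero.\<close>
    define E where "E = c\<^sub>0 powr (- \<alpha> - 1)"
    have "E * c\<^sub>0 powr (\<alpha> + 1) = 1" using e(2) by (simp add: E_def powr_add[symmetric])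
    then have "E * (M\<^sub>3 / (P * M\<^sub>1)) = 1" by (simp only: e(3))
    then have E3: "E * M\<^sub>3 = P * M\<^sub>1" using e(1) pos(3) by (simp add: field_simps)
    have E2: "c\<^sub>0 powr (- \<alpha>) = c\<^sub>0 * E" using e(2) powr_add[of c\<^sub>0 1 "- \<alpha> - 1"] by (simp add: E_def)
    have "C\<^sub>3 * M\<^sub>3 = \<alpha> * (E * M\<^sub>3)" by (simp add: C\<^sub>3_def E_def)
    moreover have "(n - 2) * (C\<^sub>2 * M\<^sub>2) = - 2 * (n - 1) * (E * ((n - 2) * c\<^sub>0 * K * M\<^sub>2))"
      by (simp add: C\<^sub>2_def E2 algebra_simps)
    moreover have "(n - 2) * \<alpha> = n" using n by (simp add: \<alpha>n)
    ultimately have "(n - 2) * (C\<^sub>3 * M\<^sub>3 + (C\<^sub>2 * M\<^sub>2 + P * M\<^sub>1))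
        = n * (E * M\<^sub>3) - 2 * (n - 1) * (E * M\<^sub>3) + (n - 2) * (E * M\<^sub>3)"
      unfolding e(4) E3[symmetric] by (simp only: distrib_left mult.assoc[symmetric])
    also have "\<dots> = 0" by (simp add: algebra_simps)
    finally show ?thesis using n by simp
  qed
  finally show ?thesis by (rule ball_of_flux[OF s PA])
qed

end

section \<open>Reduction to a smooth extension of the solution\<close>

theorem corollary1p7:
  fixes \<Omega> :: "(real ^ 'n) set" and u :: "real ^ 'n \<Rightarrow> real" and c d :: real
  defines "n \<equiv> real CARD('n)"
    and "Du \<equiv> \<lambda>x. norm (gradient u (at x within closure \<Omega>))"
  assumes "CARD('n) \<ge> 3"
    and "open \<Omega>" and "connected \<Omega>" and "bounded \<Omega>" and "smooth_boundary \<Omega>" and "0 \<in> \<Omega>"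
    and "d > 0"
    and "smooth_on (closure \<Omega> - {0}) u"
    and "neg_laplacian_eq_dirac \<Omega> u (d * area (frontier \<Omega>))"
    and "\<forall>x\<in>frontier \<Omega>. u x = c"
    and "\<forall>p\<in>frontier \<Omega>.
      mean_curvature \<Omega> p / (n - 1) \<ge>
        (area (sphere (0 :: real ^ 'n) 1) / area (frontier \<Omega>)) powr (1 / (n - 1))
        * ((surface_mean (frontier \<Omega>) Du)\<^sup>2 / surface_mean (frontier \<Omega>) (\<lambda>x. Du x ^ 2))
        * (surface_mean (frontier \<Omega>) (\<lambda>x. Du x ^ 3) / (surface_mean (frontier \<Omega>) Du) ^ 3)
            powr (n / (2 * (n - 1)))"
  shows "\<exists>a r. r > 0 \<and> \<Omega> = ball a r \<and>
    (\<forall>x\<in>closure \<Omega> - {0}. \<forall>y\<in>closure \<Omega> - {0}. dist a x = dist a y \<longrightarrow> u x = u y)"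
proof -
  let ?F = "frontier \<Omega>"
  have dim: "DIM(real ^ 'n) = CARD('n)" by simp
  interpret smooth_domain \<Omega>
    using assms(3,4,6,7) by unfold_locales auto
  obtain V\<^sub>0 g\<^sub>0 where g0: "open V\<^sub>0" "closure \<Omega> - {0} \<subseteq> V\<^sub>0" "Cinf V\<^sub>0 g\<^sub>0" "\<And>x. x \<in> closure \<Omega> - {0} \<Longrightarrow> g\<^sub>0 x = u x"
    by (rule smooth_onE[OF assms(10)]) (rule that)
  \<comment> \<open>The extension is tied to \<open>u\<close> only away from the origin, so the
    value there is put in by hand; then \<open>g = u\<close> on the whole closure. \<open>V\<close>
    is enlarged by \<open>\<Omega>\<close> so as to contain the pole.\<close>
  define g where "g x = (if x = 0 then u 0 else g\<^sub>0 x)" for x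
  define V where "V = V\<^sub>0 \<union> \<Omega>"
  have V: "open V" "closure \<Omega> \<subseteq> V" "V - {0} \<subseteq> V\<^sub>0"
    using g0(1,2) assms(4,8) closure_subset[of \<Omega>] by (auto simp: V_def)
  have gu: "g x = u x" if "x \<in> closure \<Omega>" for x using g0(4)[of x] that by (simp add: g_def)
  have gu\<Omega>: "g x = u x" if "x \<in> \<Omega>" for x using gu[of x] closure_subset[of \<Omega>] that by blast
  have oV: "open (V - {0})" using V(1) by (simp add: open_delete)
  have area: "area ?F > 0" by (rule area_pos) (use assms(8) in blast)
  interpret G: green_function \<Omega> g V "d * area ?F" c
  proof
    show "3 \<le> DIM(real ^ 'n)" using assms(3) by simp
    show "Cinf (V - {0}) g"
      by (rule Cinf_cong[OF oV _ Cinf_subset[OF g0(3) V(3)]]) (simp add: g_def)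
    show "set_integrable lborel K g" if "compact K" "K \<subseteq> \<Omega>" for K
    proof -
      have "set_integrable lborel K u"
        using assms(11) that unfolding neg_laplacian_eq_dirac_def by blast
      moreover have "(\<lambda>x. indicator K x *\<^sub>R g x) = (\<lambda>x. indicator K x *\<^sub>R u x)"
        using gu\<Omega> that(2) by (auto simp: fun_eq_iff subset_iff indicator_def)
      ultimately show ?thesis by (simp add: set_integrable_def)
    qed
    show "- (LINT x:\<Omega>|lborel. g x * laplacian \<phi> x) = d * area ?F * \<phi> 0" if "test_function \<Omega> \<phi>" for \<phi>
    proof -
      have "(\<lambda>x. indicator \<Omega> x *\<^sub>R (g x * laplacian \<phi> x)) = (\<lambda>x. indicator \<Omega> x *\<^sub>R (u x * laplacian \<phi> x))"
        using gu\<Omega> by (auto simp: fun_eq_iff subset_iff indicator_def)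
      then show ?thesis
        using assms(11) that by (simp add: neg_laplacian_eq_dirac_def set_lebesgue_integral_def)
    qed
    show "0 < d * area ?F" using assms(9) area by simp
    show "g x = c" if "x \<in> ?F" for x using gu[of x] that assms(12) by (simp add: frontier_def)
  qed (use assms(4,5,8) V in auto)
  \<comment> \<open>The one-sided gradient of \<open>u\<close> in the hypothesis becomes the
    ordinary gradient of the extension.\<close>
  have Du: "Du x = norm (gradient g (at x))" if x: "x \<in> ?F" for x
    unfolding Du_def
    by (simp only: gradient_within_closure[OF x Cinf_differentiable[OF G.u G.frontier_V(1)[OF x]] gu])
  have mean: "surface_mean ?F (\<lambda>x. Du x ^ k) = surface_mean ?F (\<lambda>x. norm (gradient g (at x)) ^ k)" for k
    unfolding surface_mean_def by (intro arg_cong2[of _ _ _ _ "(*)"] refl SI_cong) (simp only: Du)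
  have "\<exists>r>0. \<Omega> = ball 0 r \<and> (\<forall>x\<in>closure \<Omega> - {0}. \<forall>y\<in>closure \<Omega> - {0}. norm x = norm y \<longrightarrow> g x = g y)"
  proof (rule G.rigidity)
    fix p assume "p \<in> ?F"
    with assms(13) show "(area (sphere (0::real ^ 'n) 1) / area ?F) powr (1 / (real DIM(real ^ 'n) - 1))
      * ((surface_mean ?F (\<lambda>x. norm (gradient g (at x))))\<^sup>2 / surface_mean ?F (\<lambda>x. norm (gradient g (at x)) ^ 2))
      * (surface_mean ?F (\<lambda>x. norm (gradient g (at x)) ^ 3) / (surface_mean ?F (\<lambda>x. norm (gradient g (at x)))) ^ 3) powr (real DIM(real ^ 'n) / (2 * (real DIM(real ^ 'n) - 1)))
      \<le> mean_curvature \<Omega> p / (real DIM(real ^ 'n) - 1)"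
      unfolding dim n_def using mean[of 1] mean[of 2] mean[of 3] by simp
  qed
  then obtain r where r: "r > 0" "\<Omega> = ball 0 r"
    "\<And>x y. x \<in> closure \<Omega> - {0} \<Longrightarrow> y \<in> closure \<Omega> - {0} \<Longrightarrow> norm x = norm y \<Longrightarrow> g x = g y" by blast
  have "u x = u y" if "x \<in> closure \<Omega> - {0}" "y \<in> closure \<Omega> - {0}" "dist 0 x = dist 0 y" for x y
    using r(3)[OF that(1,2)] that gu[of x] gu[of y] by simp
  then show ?thesis using r(1,2) by blast
qed

end
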